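(* Let $v>0$ and $B_0\in\mathbb{R}$ be fixed, and consider the system with moving right boundary, whose location at time $t$ is $B=B_0+vt$. Let $\{f^n(0)\}$ be a deterministic sequence with $f^n(0)\in\mathcal{M}^{(n)}\cap\mathcal{M}^{B_0}$, let $f(0)\in\mathcal{M}^{B_0}$, and suppose $f^n(0)\to f(0)$ weakly as $n\to\infty$. Let $f^n(\cdot)$ be the corresponding empirical-distribution process. Then $f^n(\cdot)\Rightarrow f(\cdot)$ (convergence in distribution) in $D([0,\infty),\mathcal{M})$, where $f(\cdot)\in D([0,\infty),\mathcal{M})$ is deterministic and uniquely determined by $f(0)$; and $f^n(t)\in\mathcal{M}^{(n)}\cap\mathcal{M}^{B_0+vt}$ and $f(t)\in\mathcal{M}^{B_0+vt}$ for all $t$. Moreover, $f(\cdot)$ is a continuous element of $D([0,\infty),\mathcal{M})$ which satisfies $$f(t)h-f(0)h-\int_0^tL^{\{r\}}[f(s)h]\,ds=0,\qquad\forall h\in\mathcal{C}_b,\ \forall t\ge0 .$$ (This trajectory is called the mean-field limit (MFL) with initial state $f(0)$.) Furthermore, $f(\cdot)$ is the unique mean-field model (for the moving right boundary system) with initial state $f(0)$.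
   Context: Model with moving right boundary. Fix $\lambda\ge0$ and a random variable $Z>0$ with CDF $J$ and $\mathbb{E}Z=1$. The boundary at time $t$ is at $B=B_0+vt$. There are $n$ particles, located at all times in $(-\infty,B]$. Each particle makes independent forward jumps at the points of its own independent Poisson process of rate $\lambda$, with i.i.d. sizes distributed as $Z$, except that a particle that would jump over the boundary lands exactly at the current boundary location; it then stays at that point (while the boundary moves on) until its next jump. Each particle also has another independent Poisson process, of rate $1$, at whose points it chooses another particle uniformly at random and moves to the location of the chosen particle if that is to the right of its own location. $f^n_x(t)$ is the fraction of particles located in $(-\infty,x]$ at time $t$; $f^n(t)=(f^n_x(t),x\in\mathbb{R})$. Notation. $\mathcal{M}$ is the set of (proper) cumulative distribution functions on $\mathbb{R}$ with the topology of weak convergence; $\mathcal{M}^{(n)}\subset\mathcal{M}$ is the set of empirical distributions of $n$ points; $\mathcal{M}^b=\{g\in\mathcal{M}:g_b=1\}$ for $b\in\mathbb{R}$. $D([0,\infty),\mathcal{M})$ is the Skorohod space with the $J_1$ topology. $\mathcal{C}_b$ is the set of continuous bounded functions on $\mathbb{R}$ that are constant to the left of some closed bounded interval and constant (possibly with another value) to the right of it. $fh=\int_{\mathbb{R}}h(x)\,df_x$. Operator $L^{\{r\}}$: for a pair $(f,B)$ with $f\in\mathcal{M}^B$ and $h\in\mathcal{C}_b$ (with $a\wedge b=\min\{a,b\}$), $$L^{\{r\}}[fh]=\lambda\,\mathbb{E}\int_{(-\infty,B)}d_yf_y\,(h((y+Z)\wedge B)-h(y))+\int_{(-\infty,B)}d_yf_y\int_{[y,B]}d_\xi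 f_\xi\,(h(\xi)-h(y)),$$ the expectation being over $Z$; in $L^{\{r\}}[f(s)h]$ the boundary is $B=B_0+vs$. Mean-field model for this system: a function $f_x(t)$, $x\in\mathbb{R}$, $t\ge0$, such that (a) for every $t$, $f(t)=(f_x(t),x\in\mathbb{R})\in\mathcal{M}^{B_0+vt}$ (so $f_x(t)=1$ for $x\ge B_0+vt$); (b) for every $x$, $f_x(t)$ is non-increasing and $(\lambda+1)$-Lipschitz in $t$; (c) for every $x$ and every $t$ with $x<B_0+vt$ at which $\frac{\partial}{\partial t}f_x(t)$ exists, $$\frac{\partial}{\partial t}f_x(t)=-\lambda\int_{(-\infty,x]}(1-J(x-y))\,d_yf_y(t)-f_x(t)(1-f_x(t)).$$ *)

theory Defs
  imports "HOL-Probability.Probability"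
begin

section \<open>Distribution functions and weak convergence\<close>

definition cdfs :: "(real \<Rightarrow> real) set" where
  "cdfs = {F. mono F \<and> (\<forall>x. continuous (at_right x) F) \<and> (F \<longlongrightarrow> 0) at_bot \<and> (F \<longlongrightarrow> 1) at_top}"

definition cdfs_upto :: "real \<Rightarrow> (real \<Rightarrow> real) set" where
  "cdfs_upto b = {F \<in> cdfs. F b = 1}"

definition empirical_cdf :: "nat \<Rightarrow> (nat \<Rightarrow> real) \<Rightarrow> real \<Rightarrow> real" where
  "empirical_cdf n p = (\<lambda>x. real (card {i. i < n \<and> p i \<le> x}) / real n)"

definition empirical_cdfs :: "nat \<Rightarrow> (real \<Rightarrow> real) set" where
  "empirical_cdfs n = range (empirical_cdf n)"

text \<open>The topology of weak convergence on \<^const>\<open>cdfs\<close> is given by the Levy metric; see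
  \<open>limitin_levy_iff_weak_conv\<close> below.\<close>

definition levy_close :: "real \<Rightarrow> (real \<Rightarrow> real) \<Rightarrow> (real \<Rightarrow> real) \<Rightarrow> bool" where
  "levy_close e F G \<longleftrightarrow> (\<forall>x. F x \<le> G (x + e) + e \<and> G x \<le> F (x + e) + e)"

text \<open>On \<^const>\<open>cdfs\<close> the number 1 belongs to the set on the right anyway; inserting it only makes
  the infimum well-defined for arbitrary functions.\<close>

definition levy_dist :: "(real \<Rightarrow> real) \<Rightarrow> (real \<Rightarrow> real) \<Rightarrow> real" where
  "levy_dist F G = Inf (insert 1 {e. 0 < e \<and> levy_close e F G})"

definition levy_metric :: "(real \<Rightarrow> real) metric" where
  "levy_metric = metric (cdfs, levy_dist)"

lemma cdfs_bounds:
  assumes "F \<in> cdfs" shows "0 \<le> F x" "F x \<le> 1"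
proof -
  have m: "mono F" and b: "(F \<longlongrightarrow> 0) at_bot" and t: "(F \<longlongrightarrow> 1) at_top"
    using assms by (auto simp: cdfs_def)
  have "eventually (\<lambda>y. F y \<le> F x) at_bot"
    using eventually_le_at_bot[of x] by eventually_elim (use m in \<open>auto simp: mono_def\<close>)
  then show "0 \<le> F x" using tendsto_upperbound[OF b] by simp
  have "eventually (\<lambda>y. F x \<le> F y) at_top"
    using eventually_ge_at_top[of x] by eventually_elim (use m in \<open>auto simp: mono_def\<close>)
  then show "F x \<le> 1" using tendsto_lowerbound[OF t] by simp
qed

lemma levy_close_mono:
  assumes "F \<in> cdfs" "G \<in> cdfs" "levy_close e F G" "e \<le> e'"
  shows "levy_close e' F G"
proof -
  have "F (x + e) \<le> F (x + e')" "G (x + e) \<le> G (x + e')" for x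
    using assms by (auto simp: cdfs_def mono_def)
  moreover have "F x \<le> G (x + e) + e" "G x \<le> F (x + e) + e" for x
    using assms(3) by (auto simp: levy_close_def)
  ultimately show ?thesis
    using assms(4) unfolding levy_close_def by (smt (verit, best))
qed

lemma levy_close_1:
  assumes "F \<in> cdfs" "G \<in> cdfs" shows "levy_close 1 F G"
  unfolding levy_close_def using cdfs_bounds[OF assms(1)] cdfs_bounds[OF assms(2)]
  by (smt (verit, best))

lemma levy_dist_nonneg: "0 \<le> levy_dist F G"
  unfolding levy_dist_def by (rule cInf_greatest) auto

lemma levy_dist_le:
  assumes "0 < e" "levy_close e F G" shows "levy_dist F G \<le> e"
  unfolding levy_dist_def
  by (rule cInf_lower) (use assms in \<open>auto intro!: bdd_belowI[of _ 0]\<close>)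

lemma levy_dist_less:
  assumes "F \<in> cdfs" "G \<in> cdfs" "levy_dist F G < e" shows "levy_close e F G"
proof -
  obtain d where "d \<in> insert 1 {e. 0 < e \<and> levy_close e F G}" "d < e"
    using assms(3) unfolding levy_dist_def by (meson cInf_lessD insert_not_empty)
  then have "levy_close d F G" using levy_close_1[OF assms(1,2)] by auto
  then show ?thesis using levy_close_mono[OF assms(1,2)] \<open>d < e\<close> by auto
qed

lemma levy_dist_zero_imp_le:
  assumes F: "F \<in> cdfs" and G: "G \<in> cdfs" and z: "levy_dist F G = 0"
  shows "F x \<le> G x"
proof -
  have c: "levy_close e F G" if "0 < e" for e
    using levy_dist_less[OF F G] z that by auto
  have "continuous (at_right x) G" using G by (auto simp: cdfs_def)
  then have "(G \<longlongrightarrow> G x) (at_right x)" by (simp add: continuous_within)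
  then have "((\<lambda>y. G y + (y - x)) \<longlongrightarrow> G x + (x - x)) (at_right x)"
    by (intro tendsto_intros) auto
  moreover have "eventually (\<lambda>y. F x \<le> G y + (y - x)) (at_right x)"
    using eventually_at_right_less[of x]
  proof eventually_elim
    case (elim y)
    then show ?case using c[of "y - x"] unfolding levy_close_def by (auto dest: spec[of _ x])
  qed
  ultimately show ?thesis using tendsto_lowerbound[of _ _ "at_right x"] by fastforce
qed

lemma levy_close_commute: "levy_close e F G \<longleftrightarrow> levy_close e G F"
  unfolding levy_close_def by auto

lemma levy_dist_commute: "levy_dist F G = levy_dist G F"
  unfolding levy_dist_def by (subst levy_close_commute) simp

lemma Metric_space_levy: "Metric_space cdfs levy_dist"
proof
  fix F G :: "real \<Rightarrow> real"
  show "0 \<le> levy_dist F G" by (rule levy_dist_nonneg)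
  show "levy_dist F G = levy_dist G F" by (rule levy_dist_commute)
next
  fix F G assume F: "F \<in> cdfs" and G: "G \<in> cdfs"
  show "levy_dist F G = 0 \<longleftrightarrow> F = G"
  proof
    assume z: "levy_dist F G = 0"
    show "F = G"
      using levy_dist_zero_imp_le[OF F G z] levy_dist_zero_imp_le[OF G F] z
      by (intro ext order.antisym) (auto simp: levy_dist_commute)
  next
    assume "F = G"
    then have "levy_close e F G" if "0 < e" for e
      using F that unfolding levy_close_def cdfs_def mono_def
      by (smt (verit, best) mem_Collect_eq)
    then have "levy_dist F G \<le> e" if "0 < e" for e using levy_dist_le that by auto
    then show "levy_dist F G = 0"
      using levy_dist_nonneg[of F G] field_le_epsilon[of "levy_dist F G" 0] by auto
  qed
next
  fix F G H assume F: "F \<in> cdfs" and G: "G \<in> cdfs" and H: "H \<in> cdfs"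
  show "levy_dist F H \<le> levy_dist F G + levy_dist G H"
  proof (rule field_le_epsilon)
    fix e :: real assume "0 < e"
    define a where "a = levy_dist F G + e / 2"
    define b where "b = levy_dist G H + e / 2"
    have a: "levy_close a F G" and b: "levy_close b G H"
      using levy_dist_less[OF F G, of a] levy_dist_less[OF G H, of b] \<open>0 < e\<close>
      by (auto simp: a_def b_def)
    have "levy_close (a + b) F H"
      unfolding levy_close_def
    proof (intro allI conjI)
      fix x
      have "F x \<le> G (x + a) + a" "G (x + a) \<le> H (x + a + b) + b"
        using a b by (auto simp: levy_close_def)
      then show "F x \<le> H (x + (a + b)) + (a + b)" by (simp add: add.assoc)
      have "H x \<le> G (x + b) + b" "G (x + b) \<le> F (x + b + a) + a"
        using a b by (auto simp: levy_close_def)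
      then show "H x \<le> F (x + (a + b)) + (a + b)" by (simp add: ac_simps)
    qed
    moreover have "0 < a + b" using \<open>0 < e\<close> levy_dist_nonneg[of F G] levy_dist_nonneg[of G H]
      by (simp add: a_def b_def)
    ultimately show "levy_dist F H \<le> levy_dist F G + levy_dist G H + e"
      using levy_dist_le[of "a + b" F H] by (simp add: a_def b_def)
  qed
qed

lemma mspace_levy_metric [simp]: "mspace levy_metric = cdfs"
  and mdist_levy_metric [simp]: "mdist levy_metric = levy_dist"
  by (simp_all add: levy_metric_def Metric_space.mspace_metric[OF Metric_space_levy]
      Metric_space.mdist_metric[OF Metric_space_levy])

lemma levy_tendsto_imp_weak_conv:
  assumes Fn: "\<And>n. Fn n \<in> cdfs" and F: "F \<in> cdfs"
    and lim: "(\<lambda>n. levy_dist (Fn n) F) \<longlonglongrightarrow> 0"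
  shows "weak_conv Fn F"
  unfolding weak_conv_def
proof (intro allI impI)
  fix x assume "isCont F x"
  show "(\<lambda>n. Fn n x) \<longlonglongrightarrow> F x"
  proof (rule tendstoI)
    fix e :: real assume "0 < e"
    then obtain d where d: "d > 0" "\<And>y. dist y x < d \<Longrightarrow> dist (F y) (F x) < e / 2"
      using \<open>isCont F x\<close> unfolding continuous_at_eps_delta by (meson half_gt_zero)
    define c where "c = min (d / 2) (e / 2)"
    have c: "0 < c" "c < d" "c \<le> e / 2" using \<open>0 < e\<close> d(1) by (auto simp: c_def)
    have "eventually (\<lambda>n. levy_dist (Fn n) F < c) sequentially"
      using lim c(1) by (auto dest: order_tendstoD)
    then show "eventually (\<lambda>n. dist (Fn n x) (F x) < e) sequentially"
    proof eventually_elim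
      case (elim n)
      have cl: "levy_close c (Fn n) F" using levy_dist_less[OF Fn F elim] .
      have 1: "Fn n x \<le> F (x + c) + c" using cl by (simp add: levy_close_def)
      have "F (x - c) \<le> Fn n (x - c + c) + c" using cl unfolding levy_close_def by blast
      then have 2: "F (x - c) \<le> Fn n x + c" by simp
      have "dist (F (x + c)) (F x) < e / 2" "dist (F (x - c)) (F x) < e / 2"
        using c d(2)[of "x + c"] d(2)[of "x - c"] by (simp_all add: dist_real_def)
      then show ?case using 1 2 c(3) by (simp add: dist_real_def abs_if split: if_splits)
    qed
  qed
qed

lemma weak_conv_imp_levy_tendsto:
  assumes Fn: "\<And>n. Fn n \<in> cdfs" and F: "F \<in> cdfs" and w: "weak_conv Fn F"
  shows "(\<lambda>n. levy_dist (Fn n) F) \<longlonglongrightarrow> 0"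
proof (rule order_tendstoI)
  fix a :: real assume "a < 0"
  then show "eventually (\<lambda>n. a < levy_dist (Fn n) F) sequentially"
    using levy_dist_nonneg by (auto intro!: always_eventually simp: less_le_trans)
next
  fix e' :: real assume "0 < e'"
  define e where "e = e' / 2"
  have e: "0 < e" "e < e'" using \<open>0 < e'\<close> by (auto simp: e_def)
  have mF: "mono F" and mFn: "\<And>n. mono (Fn n)" using F Fn by (auto simp: cdfs_def)
  have "\<exists>c. real_of_int k * (e/2) < c \<and> c < (real_of_int k + 1) * (e/2) \<and> isCont F c" for k :: int
  proof -
    have "countable {x. \<not> isCont F x}" by (rule mono_ctble_discont[OF mF])
    then have "uncountable ({real_of_int k * (e/2)<..<(real_of_int k + 1) * (e/2)} - {x. \<not> isCont F x})"
      using e(1) by (intro uncountable_minus_countable) (auto simp: uncountable_open_interval algebra_simps)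
    then have "{real_of_int k * (e/2)<..<(real_of_int k + 1) * (e/2)} - {x. \<not> isCont F x} \<noteq> {}"
      by (metis countable_empty)
    then show ?thesis by auto
  qed
  then obtain c :: "int \<Rightarrow> real" where
    c: "\<And>k. real_of_int k * (e/2) < c k" "\<And>k. c k < (real_of_int k + 1) * (e/2)" "\<And>k. isCont F (c k)"
    by metis
  have "eventually (\<lambda>y. F y < e/2) at_bot" "eventually (\<lambda>y. 1 - e/2 < F y) at_top"
    using F e(1) order_tendstoD(2)[of F 0 at_bot "e/2"] order_tendstoD(1)[of F 1 at_top "1 - e/2"]
    by (simp_all add: cdfs_def)
  then obtain lo hi where lo: "\<And>y. y \<le> lo \<Longrightarrow> F y < e/2" and hi: "\<And>y. hi \<le> y \<Longrightarrow> 1 - e/2 < F y"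
    unfolding eventually_at_bot_linorder eventually_at_top_linorder by blast
  define a where "a = \<lfloor>lo / (e/2)\<rfloor> - 1"
  define b where "b = \<lceil>hi / (e/2)\<rceil>"
  have "(real_of_int a + 1) * (e/2) \<le> lo"
    using e(1) floor_divide_lower[of "e/2" lo] by (auto simp: a_def)
  then have ca: "F (c a) < e/2" using c(2)[of a] by (intro lo) auto
  have "hi \<le> real_of_int b * (e/2)"
    using e(1) ceiling_divide_upper[of "e/2" hi] by (auto simp: b_def)
  then have cb: "1 - e/2 < F (c b)" using c(1)[of b] by (intro hi) auto
  have "eventually (\<lambda>n. \<forall>k\<in>{a..b} \<union> {a, b}. \<bar>Fn n (c k) - F (c k)\<bar> < e/2) sequentially"
  proof (rule eventually_ball_finite, simp, intro ballI)
    fix k assume "k \<in> {a..b} \<union> {a, b}"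
    have "(\<lambda>n. Fn n (c k)) \<longlonglongrightarrow> F (c k)" using w c(3) by (auto simp: weak_conv_def)
    from tendstoD[OF this, of "e/2"] e(1)
    show "eventually (\<lambda>n. \<bar>Fn n (c k) - F (c k)\<bar> < e/2) sequentially" by (auto simp: dist_real_def)
  qed
  then show "eventually (\<lambda>n. levy_dist (Fn n) F < e') sequentially"
  proof eventually_elim
    case (elim n)
    have main: "F x \<le> Fn n (x + e) + e \<and> Fn n x \<le> F (x + e) + e" for x
    proof -
      define k where "k = \<lfloor>x / (e/2)\<rfloor> + 1"
      have "real_of_int (k - 1) * (e/2) \<le> x" "x < real_of_int k * (e/2)"
        using e(1) floor_divide_lower[of "e/2" x] floor_divide_upper[of "e/2" x]
        by (auto simp: k_def)
      moreover have "(real_of_int k + 1) * (e/2) = real_of_int (k - 1) * (e/2) + e"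
        by (simp add: field_simps)
      ultimately have xc: "x < c k" "c k < x + e" using c(1,2)[of k] by auto
      consider "k \<in> {a..b}" | "k < a" | "b < k" by fastforce
      then show ?thesis
      proof cases
        case 1
        then have "\<bar>Fn n (c k) - F (c k)\<bar> < e/2" using elim by auto
        moreover have "F x \<le> F (c k)" "F (c k) \<le> F (x + e)" "Fn n x \<le> Fn n (c k)"
          "Fn n (c k) \<le> Fn n (x + e)" using xc mF mFn[of n] by (auto simp: mono_def)
        ultimately show ?thesis using e(1) by (auto simp: abs_if split: if_splits)
      next
        case 2
        then have "(real_of_int k + 1) * (e/2) \<le> real_of_int a * (e/2)"
          using e(1) by (intro mult_right_mono) auto
        then have "x \<le> c a" using xc(1) c(2)[of k] c(1)[of a] by linarith
        then have "F x \<le> F (c a)" "Fn n x \<le> Fn n (c a)" using mF mFn[of n] by (auto simp: mono_def)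
        moreover have "\<bar>Fn n (c a) - F (c a)\<bar> < e/2" using elim by auto
        ultimately show ?thesis
          using ca e(1) cdfs_bounds(1)[OF F, of "x + e"] cdfs_bounds(1)[OF Fn[of n], of "x + e"]
          by (auto simp: abs_if split: if_splits)
      next
        case 3
        then have "(real_of_int b + 1) * (e/2) \<le> real_of_int k * (e/2)"
          using e(1) by (intro mult_right_mono) auto
        then have "c b \<le> x + e" using xc(2) c(1)[of k] c(2)[of b] by linarith
        then have "F (c b) \<le> F (x + e)" "Fn n (c b) \<le> Fn n (x + e)"
          using mF mFn[of n] by (auto simp: mono_def)
        moreover have "\<bar>Fn n (c b) - F (c b)\<bar> < e/2" using elim by auto
        ultimately show ?thesis
          using cb e(1) cdfs_bounds(2)[OF F, of x] cdfs_bounds(2)[OF Fn[of n], of x]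
          by (auto simp: abs_if split: if_splits)
      qed
    qed
    then have "levy_close e (Fn n) F" by (auto simp: levy_close_def)
    then show ?case using levy_dist_le[OF e(1)] e(2) by fastforce
  qed
qed

lemma limitin_levy_iff_weak_conv:
  assumes "\<And>n. Fn n \<in> cdfs" "F \<in> cdfs"
  shows "limitin (mtopology_of levy_metric) Fn F sequentially \<longleftrightarrow> weak_conv Fn F"
proof -
  have *: "(\<lambda>n. levy_dist (Fn n) F) \<longlonglongrightarrow> 0 \<longleftrightarrow>
      (\<forall>e>0. eventually (\<lambda>n. levy_dist (Fn n) F < e) sequentially)"
    using levy_dist_nonneg by (auto simp: tendsto_iff)
  show ?thesis
    using assms levy_tendsto_imp_weak_conv[of Fn F] weak_conv_imp_levy_tendsto[of Fn F]
    by (auto simp: mtopology_of_def Metric_space.limitin_metric[OF Metric_space_levy] *)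
qed


section \<open>The Skorohod space on the half-line\<close>

definition cadlag_paths :: "'a metric \<Rightarrow> (real \<Rightarrow> 'a) set" where
  "cadlag_paths m = {x \<in> {0..} \<rightarrow>\<^sub>E mspace m.
     (\<forall>t\<ge>0. limitin (mtopology_of m) x (x t) (at_right t)) \<and>
     (\<forall>t>0. \<exists>l. limitin (mtopology_of m) x l (at_left t))}"

definition time_change :: "(real \<Rightarrow> real) \<Rightarrow> bool" where
  "time_change s \<longleftrightarrow> strict_mono_on {0..} s \<and> s ` {0..} = {0..}"

text \<open>Only the topology of the state space matters for the \<open>J1\<close> topology, not the choice of metric.
  A sequence of paths converges to \<open>x\<close> in the \<open>J1\<close> topology iff for all \<open>T, e > 0\<close> it eventually
  stays in the following set (Ethier and Kurtz, Markov Processes, Proposition 3.5.3(c)). The \<open>J1\<close>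
  topology is metrizable and these sets have a countable cofinal subfamily at each \<open>x\<close>
  (\<open>T = k\<close>, \<open>e = 1/k\<close>), so they form a neighbourhood base at \<open>x\<close>.\<close>

definition J1_nhd :: "'a metric \<Rightarrow> (real \<Rightarrow> 'a) \<Rightarrow> real \<Rightarrow> real \<Rightarrow> (real \<Rightarrow> 'a) set" where
  "J1_nhd m x T e = {y \<in> cadlag_paths m. \<exists>s. time_change s \<and>
     (\<forall>t\<in>{0..T}. \<bar>s t - t\<bar> < e \<and> mdist m (y t) (x (s t)) < e)}"

definition J1_topology :: "'a metric \<Rightarrow> (real \<Rightarrow> 'a) topology" where
  "J1_topology m = topology (\<lambda>U. U \<subseteq> cadlag_paths m \<and>
     (\<forall>x\<in>U. \<exists>T>0. \<exists>e>0. J1_nhd m x T e \<subseteq> U))"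

lemma J1_nhd_mono: "T \<le> T' \<Longrightarrow> e' \<le> e \<Longrightarrow> J1_nhd m x T' e' \<subseteq> J1_nhd m x T e"
  unfolding J1_nhd_def
  by (intro Collect_mono impI; elim conjE exE; intro conjI exI ballI; (assumption)?; force)

lemma openin_J1_topology:
  "openin (J1_topology m) U \<longleftrightarrow>
     U \<subseteq> cadlag_paths m \<and> (\<forall>x\<in>U. \<exists>T>0. \<exists>e>0. J1_nhd m x T e \<subseteq> U)"
proof -
  have "istopology (\<lambda>U. U \<subseteq> cadlag_paths m \<and> (\<forall>x\<in>U. \<exists>T>0. \<exists>e>0. J1_nhd m x T e \<subseteq> U))"
    unfolding istopology_def
  proof (intro conjI allI impI ballI)
    fix U V x
    assume U: "U \<subseteq> cadlag_paths m \<and> (\<forall>x\<in>U. \<exists>T>0. \<exists>e>0. J1_nhd m x T e \<subseteq> U)"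
      and V: "V \<subseteq> cadlag_paths m \<and> (\<forall>x\<in>V. \<exists>T>0. \<exists>e>0. J1_nhd m x T e \<subseteq> V)"
    show "U \<inter> V \<subseteq> cadlag_paths m" using U by auto
    assume "x \<in> U \<inter> V"
    then obtain T e T' e' where "T > 0" "e > 0" "J1_nhd m x T e \<subseteq> U"
      and "T' > 0" "e' > 0" "J1_nhd m x T' e' \<subseteq> V"
      using U V by blast
    moreover have "J1_nhd m x (max T T') (min e e') \<subseteq> J1_nhd m x T e"
      "J1_nhd m x (max T T') (min e e') \<subseteq> J1_nhd m x T' e'"
      by (intro J1_nhd_mono; simp)+
    ultimately show "\<exists>T>0. \<exists>e>0. J1_nhd m x T e \<subseteq> U \<inter> V"
      by (intro exI[of _ "max T T'"] exI[of _ "min e e'"] conjI) auto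
  next
    fix K
    assume K: "\<forall>U\<in>K. U \<subseteq> cadlag_paths m \<and> (\<forall>x\<in>U. \<exists>T>0. \<exists>e>0. J1_nhd m x T e \<subseteq> U)"
    then show "\<Union>K \<subseteq> cadlag_paths m" by auto
    fix x assume "x \<in> \<Union>K"
    then obtain U where U: "U \<in> K" "x \<in> U" by auto
    with K obtain T e where "T > 0" "e > 0" "J1_nhd m x T e \<subseteq> U" by meson
    then show "\<exists>T>0. \<exists>e>0. J1_nhd m x T e \<subseteq> \<Union>K" using U by blast
  qed
  then show ?thesis unfolding J1_topology_def by (simp add: topology_inverse')
qed

lemma topspace_J1_topology [simp]: "topspace (J1_topology m) = cadlag_paths m"
proof -
  have "openin (J1_topology m) (cadlag_paths m)"
    unfolding openin_J1_topology by (auto simp: J1_nhd_def intro!: exI[of _ 1])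
  then show ?thesis
    using openin_J1_topology[of m "topspace (J1_topology m)"] openin_subset by blast
qed

definition borel_sets_of :: "'a topology \<Rightarrow> 'a measure" where
  "borel_sets_of X = sigma (topspace X) {U. openin X U}"

text \<open>Weak convergence of probability measures on the Borel sets of a topological space.\<close>

definition weakly_converges :: "'a topology \<Rightarrow> (nat \<Rightarrow> 'a measure) \<Rightarrow> 'a measure \<Rightarrow> bool" where
  "weakly_converges X Q Q' \<longleftrightarrow>
     (\<forall>\<Phi>. continuous_map X euclideanreal \<Phi> \<and> bounded (\<Phi> ` topspace X) \<longrightarrow>
        (\<lambda>n. integral\<^sup>L (Q n) \<Phi>) \<longlonglongrightarrow> integral\<^sup>L Q' \<Phi>)"


section \<open>The particle system with moving right boundary\<close>

context prob_space
begin

text \<open>Counting processes of Poisson processes; the rate may be 0.\<close>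

definition poisson_process :: "real \<Rightarrow> (real \<Rightarrow> 'a \<Rightarrow> nat) \<Rightarrow> bool" where
  "poisson_process r N \<longleftrightarrow>
     (\<forall>t\<ge>0. random_variable (count_space UNIV) (N t)) \<and>
     (\<forall>\<omega>\<in>space M. N 0 \<omega> = 0 \<and> mono_on {0..} (\<lambda>t. N t \<omega>) \<and>
        (\<forall>t\<ge>0. continuous (at_right t) (\<lambda>s. N s \<omega>))) \<and>
     (\<forall>s t k. 0 \<le> s \<and> s \<le> t \<longrightarrow>
        prob {\<omega>\<in>space M. N t \<omega> - N s \<omega> = k} = (r * (t - s)) ^ k / fact k * exp (- (r * (t - s)))) \<and>
     (\<forall>\<tau>::nat \<Rightarrow> real. 0 \<le> \<tau> 0 \<and> incseq \<tau> \<longrightarrow>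
        indep_vars (\<lambda>_. count_space UNIV) (\<lambda>j \<omega>. N (\<tau> (Suc j)) \<omega> - N (\<tau> j) \<omega>) UNIV)"

end

definition process_point :: "(real \<Rightarrow> nat) \<Rightarrow> real \<Rightarrow> bool" where
  "process_point c t \<longleftrightarrow> 0 < t \<and> (\<forall>s. 0 \<le> s \<and> s < t \<longrightarrow> c s < c t)"

definition left_lim :: "(real \<Rightarrow> real) \<Rightarrow> real \<Rightarrow> real" where
  "left_lim x t = Lim (at_left t) x"

datatype source = Jumps nat | Choices nat | Size nat nat | Target nat nat

text \<open>\<open>NJ i\<close> and \<open>NC i\<close> count the points of the two Poisson processes of particle \<open>i < n\<close>;
  \<open>S i k\<close> is the size of the jump attempted at the \<open>k\<close>-th point of \<open>NJ i\<close>, and \<open>C i k\<close> the particle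
  chosen at the \<open>k\<close>-th point of \<open>NC i\<close>; \<open>X i t\<close> is the location at time \<open>t\<close>, starting from the
  deterministic \<open>p i\<close>. The law of \<open>Z\<close> is \<open>\<mu>\<close>. Locations are constant between points for every
  \<open>\<omega>\<close>, so that all paths are cadlag; the update rules are required almost surely, because
  they may conflict on the null set where two of the processes share a point. The target law makes
  sense for \<open>n \<ge> 2\<close> only, when there is another particle to choose.\<close>

locale moving_boundary_system = prob_space M for M :: "'w measure" +
  fixes n :: nat and lam :: real and \<mu> :: "real measure" and v B0 :: real
    and p :: "nat \<Rightarrow> real"
    and NJ NC :: "nat \<Rightarrow> real \<Rightarrow> 'w \<Rightarrow> nat"
    and S :: "nat \<Rightarrow> nat \<Rightarrow> 'w \<Rightarrow> real"
    and C :: "nat \<Rightarrow> nat \<Rightarrow> 'w \<Rightarrow> nat"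
    and X :: "nat \<Rightarrow> real \<Rightarrow> 'w \<Rightarrow> real"
  assumes jump_process: "i < n \<Longrightarrow> poisson_process lam (NJ i)"
    and choice_process: "i < n \<Longrightarrow> poisson_process 1 (NC i)"
    and size_measurable: "i < n \<Longrightarrow> random_variable borel (S i k)"
    and size_distr: "i < n \<Longrightarrow> distr M borel (S i k) = \<mu>"
    and target_measurable: "i < n \<Longrightarrow> random_variable (count_space UNIV) (C i k)"
    and target_distr: "i < n \<Longrightarrow>
      distr M (count_space UNIV) (C i k) = measure_pmf (pmf_of_set ({..<n} - {i}))"
    and independence:
      "indep_sets (\<lambda>d. case d of
           Jumps i \<Rightarrow> sigma_sets (space M) {NJ i t -` A \<inter> space M | t A. 0 \<le> t}
         | Choices i \<Rightarrow> sigma_sets (space M) {NC i t -` A \<inter> space M | t A. 0 \<le> t}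
         | Size i k \<Rightarrow> {S i k -` A \<inter> space M | A. A \<in> sets borel}
         | Target i k \<Rightarrow> {C i k -` A \<inter> space M | A. True})
       {d. case d of Jumps i \<Rightarrow> i < n | Choices i \<Rightarrow> i < n | Size i k \<Rightarrow> i < n | Target i k \<Rightarrow> i < n}"
    and location_measurable: "i < n \<Longrightarrow> 0 \<le> t \<Longrightarrow> random_variable borel (X i t)"
    and initial: "i < n \<Longrightarrow> \<omega> \<in> space M \<Longrightarrow> X i 0 \<omega> = p i"
    and constant_between_points:
      "i < n \<Longrightarrow> \<omega> \<in> space M \<Longrightarrow> 0 \<le> s \<Longrightarrow> s \<le> t \<Longrightarrow>
       NJ i s \<omega> = NJ i t \<omega> \<Longrightarrow> NC i s \<omega> = NC i t \<omega> \<Longrightarrow> X i t \<omega> = X i s \<omega>"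
    and forward_jump:
      "AE \<omega> in M. \<forall>i<n. \<forall>t. process_point (\<lambda>s. NJ i s \<omega>) t \<longrightarrow>
         X i t \<omega> = min (left_lim (\<lambda>s. X i s \<omega>) t + S i (NJ i t \<omega>) \<omega>) (B0 + v * t)"
    and copy_chosen:
      "AE \<omega> in M. \<forall>i<n. \<forall>t. process_point (\<lambda>s. NC i s \<omega>) t \<longrightarrow>
         X i t \<omega> = max (left_lim (\<lambda>s. X i s \<omega>) t) (left_lim (\<lambda>s. X (C i (NC i t \<omega>) \<omega>) s \<omega>) t)"

text \<open>The random path of the empirical distribution of the \<open>n\<close>-particle system started from \<open>g\<close>.\<close>

definition empirical_process ::
    "'w measure \<Rightarrow> nat \<Rightarrow> real \<Rightarrow> real measure \<Rightarrow> real \<Rightarrow> real \<Rightarrow> (real \<Rightarrow> real) \<Rightarrow>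
     ('w \<Rightarrow> real \<Rightarrow> real \<Rightarrow> real) \<Rightarrow> bool" where
  "empirical_process M n lam \<mu> v B0 g Y \<longleftrightarrow>
     (\<exists>p NJ NC S C X. moving_boundary_system M n lam \<mu> v B0 p NJ NC S C X \<and>
        empirical_cdf n p = g \<and>
        (\<forall>\<omega>\<in>space M. Y \<omega> = (\<lambda>t\<in>{0..}. empirical_cdf n (\<lambda>i. X i t \<omega>))))"


section \<open>The generator and the mean-field model\<close>

definition test_functions :: "(real \<Rightarrow> real) set" where
  "test_functions = {h. continuous_on UNIV h \<and> bounded (range h) \<and>
     (\<exists>a b. a \<le> b \<and> (\<forall>x\<le>a. h x = h a) \<and> (\<forall>x\<ge>b. h x = h b))}"

definition cdf_integral :: "(real \<Rightarrow> real) \<Rightarrow> (real \<Rightarrow> real) \<Rightarrow> real" where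
  "cdf_integral f h = (LINT x|interval_measure f. h x)"

definition boundary_operator ::
    "real \<Rightarrow> real measure \<Rightarrow> real \<Rightarrow> (real \<Rightarrow> real) \<Rightarrow> (real \<Rightarrow> real) \<Rightarrow> real" where
  "boundary_operator lam \<mu> B f h =
     lam * (LINT z|\<mu>. (LINT y:{..<B}|interval_measure f. h (min (y + z) B) - h y)) +
     (LINT y:{..<B}|interval_measure f. (LINT \<xi>:{y..B}|interval_measure f. h \<xi> - h y))"

text \<open>A model \<open>f\<close> takes the time as its first argument; \<open>J\<close> is the distribution function of \<open>Z\<close>.
  The time derivative at 0 is one-sided.\<close>

definition mean_field_model ::
    "real \<Rightarrow> (real \<Rightarrow> real) \<Rightarrow> real \<Rightarrow> real \<Rightarrow> (real \<Rightarrow> real \<Rightarrow> real) \<Rightarrow> bool" where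
  "mean_field_model lam J v B0 f \<longleftrightarrow>
     (\<forall>t\<ge>0. f t \<in> cdfs_upto (B0 + v * t)) \<and>
     (\<forall>x. antimono_on {0..} (\<lambda>t. f t x) \<and> (lam + 1)-lipschitz_on {0..} (\<lambda>t. f t x)) \<and>
     (\<forall>x t D. 0 \<le> t \<and> x < B0 + v * t \<and>
        ((\<lambda>s. f s x) has_real_derivative D) (at t within {0..}) \<longrightarrow>
        D = - lam * (LINT y:{..x}|interval_measure (f t). 1 - J (x - y)) - f t x * (1 - f t x))"

end

(* The increments of the driving processes over the cells of a time grid, the jump sizes and the targets
   form an independent family. An Euler scheme that acts only in cells containing exactly one point is
   a function of it, agrees with the particle system at the grid times up to a small probability, and
   its next step uses fresh noise. This yields a recursion for the mean square deviation of the
   empirical distribution function from a solution of the mean-field equation. At location x the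
   recursion involves the deviations at x - Z as well; a supersolution built from a geometric series of
   averages over these shifts closes it, so the deviation tends to 0 at every time and location, and
   monotonicity in time makes the convergence uniform on bounded time intervals.
   The solution comes from a Picard iteration with an integrating factor. A mean-field model is Lipschitz
   in time, so it is the integral of its derivative and uniqueness follows from Gronwall's argument.
   The weak equation for the indicator of (-oo, x] is the equation for f_x; linearity and uniform limits
   give all test functions. *)

theory Submission
  imports Defs
begin

section \<open>An Euler scheme driven by independent noises\<close>

text \<open>Nothing is conditioned on: the system comes with independence only, so the Markov
  property is replaced by the fact that the scheme after k cells is a function of an explicit set of
  independent variables. The delicate point is that sizes and targets are numbered by the points of
  each particle, so the number of the next one is random; it is fresh only after splitting by the
  value of the count. The mesh h = T / n^3 balances the errors at time T: cells with several points
  have total probability of order n^3 (n h)^2, that is 1 / n; sampling noise adds up to order 1 / n;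
  the discretization error n h is of order 1 / n^2. Initial convergence holds only at continuity
  points, and shifts by atoms of Z spread the exceptional points. They stay countable, and Levy
  distance is controlled by finitely many points off any countable set. Borel measurability of that
  path is a separate matter and takes an argument with step paths on grids.\<close>

datatype noise = Jump_inc nat nat | Choice_inc nat nat | Mark nat nat | Pick nat nat

primrec noise_source :: "noise \<Rightarrow> source" where
  "noise_source (Jump_inc i k) = Jumps i"
| "noise_source (Choice_inc i k) = Choices i"
| "noise_source (Mark i k) = Size i k"
| "noise_source (Pick i k) = Target i k"

primrec noise_particle :: "noise \<Rightarrow> nat" where
  "noise_particle (Jump_inc i k) = i"
| "noise_particle (Choice_inc i k) = i"
| "noise_particle (Mark i k) = i"
| "noise_particle (Pick i k) = i"

lemma noise_source_dest:
  "noise_source e = Jumps i \<Longrightarrow> e \<in> range (Jump_inc i)"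
  "noise_source e = Choices i \<Longrightarrow> e \<in> range (Choice_inc i)"
  "noise_source e = Size i k \<Longrightarrow> e = Mark i k"
  "noise_source e = Target i k \<Longrightarrow> e = Pick i k"
  by (cases e; auto)+

text \<open>Within one source the chosen events intersect to an event of that source, because
  \<open>F d\<close> is intersection stable. Independence of the sources factorizes over these
  intersections, and independence inside each fibre of \<open>\<pi>\<close> splits every factor
  further.\<close>

lemma (in prob_space) indep_sets_refine:
  assumes F: "indep_sets F I"
    and Fint: "\<And>d. d \<in> I \<Longrightarrow> Int_stable (F d)"
    and NI: "\<And>e. e \<in> N \<Longrightarrow> \<pi> e \<in> I"
    and sub: "\<And>e. e \<in> N \<Longrightarrow> E e \<subseteq> F (\<pi> e)"
    and E: "\<And>d. d \<in> I \<Longrightarrow> indep_sets E {e \<in> N. \<pi> e = d}"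
  shows "indep_sets E N"
proof (rule indep_setsI)
  fix e assume "e \<in> N"
  then show "E e \<subseteq> events"
    using sub[of e] F NI[of e] unfolding indep_sets_def by auto
next
  fix A J assume J: "J \<noteq> {}" "J \<subseteq> N" "finite J" and A: "\<forall>j\<in>J. A j \<in> E j"
  define B where "B d = \<Inter> (A ` {e \<in> J. \<pi> e = d})" for d
  have BF: "B d \<in> F d" if "d \<in> \<pi> ` J" for d
  proof -
    have "d \<in> I" using that J NI by auto
    have "finite B' \<Longrightarrow> B' \<noteq> {} \<Longrightarrow> B' \<subseteq> {e \<in> J. \<pi> e = d} \<Longrightarrow> \<Inter> (A ` B') \<in> F d" for B'
    proof (induction rule: finite_ne_induct)
      case (singleton x)
      then show ?case using A sub J by auto
    next
      case (insert x C)
      then have "A x \<in> F d" using A sub J by auto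
      moreover have "\<Inter> (A ` C) \<in> F d" using insert by auto
      ultimately show ?case using Fint[OF \<open>d \<in> I\<close>] by (auto simp: Int_stable_def)
    qed
    from this[of "{e \<in> J. \<pi> e = d}"] show ?thesis using that J by (auto simp: B_def)
  qed
  have eq: "(\<Inter>j\<in>J. A j) = (\<Inter>d\<in>\<pi> ` J. B d)" by (auto simp: B_def)
  have "prob (\<Inter>d\<in>\<pi> ` J. B d) = (\<Prod>d\<in>\<pi> ` J. prob (B d))"
    by (rule indep_setsD[OF F]) (use J NI BF in auto)
  also have "\<dots> = (\<Prod>d\<in>\<pi> ` J. \<Prod>e\<in>{e \<in> J. \<pi> e = d}. prob (A e))"
  proof (intro prod.cong refl)
    fix d assume d: "d \<in> \<pi> ` J"
    then have "d \<in> I" using J NI by auto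
    show "prob (B d) = (\<Prod>e\<in>{e \<in> J. \<pi> e = d}. prob (A e))"
      unfolding B_def by (rule indep_setsD[OF E[OF \<open>d \<in> I\<close>]]) (use J A d in auto)
  qed
  also have "\<dots> = (\<Prod>e\<in>J. prob (A e))"
    by (rule prod.image_gen[symmetric]) (use J in auto)
  finally show "prob (\<Inter>j\<in>J. A j) = (\<Prod>j\<in>J. prob (A j))" by (simp add: eq)
qed

section \<open>Increments, sizes and targets as one independent family\<close>

context moving_boundary_system begin

text \<open>All kinds of noise are made real-valued so that one product space over
  \<open>noise\<close> carries them; the scheme recovers a target as \<open>nat\<close> of the
  floor.\<close>

definition noise_var :: "real \<Rightarrow> noise \<Rightarrow> 'w \<Rightarrow> real" where
  "noise_var h d \<omega> = (case d of
     Jump_inc i k \<Rightarrow> real (NJ i (real (Suc k) * h) \<omega> - NJ i (real k * h) \<omega>)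
   | Choice_inc i k \<Rightarrow> real (NC i (real (Suc k) * h) \<omega> - NC i (real k * h) \<omega>)
   | Mark i k \<Rightarrow> S i k \<omega>
   | Pick i k \<Rightarrow> real (C i k \<omega>))"

lemma grid_incseq: "0 \<le> h \<Longrightarrow> incseq (\<lambda>k. real k * h)"
  by (auto simp: incseq_def intro!: mult_right_mono)

text \<open>Increments of one Poisson process are independent as a sequence of natural numbers; an
  injective numbering carries this over to the noises that read them.\<close>

lemma indep_noise_sub:
  fixes Z :: "noise \<Rightarrow> 'w \<Rightarrow> real"
  assumes "indep_vars (\<lambda>_. count_space UNIV) (N :: nat \<Rightarrow> 'w \<Rightarrow> nat) UNIV" "inj g"
    "\<And>k \<omega>. Z (g k) \<omega> = real (N k \<omega>)"
  shows "indep_sets (\<lambda>d. {Z d -` A \<inter> space M |A. A \<in> sets borel}) (range g)"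
proof (rule indep_setsI)
  have 1: "indep_vars (\<lambda>_. borel) (\<lambda>k \<omega>. real (N k \<omega>)) UNIV"
    by (rule indep_vars_compose2[OF assms(1)]) auto
  have "Z (g k) = (\<lambda>\<omega>. real (N k \<omega>))" for k using assms(3) by auto
  then have ind: "indep_sets (\<lambda>k. {Z (g k) -` A \<inter> space M |A. A \<in> sets borel}) UNIV"
    using 1 by (auto simp: indep_vars_def2)
  fix d assume "d \<in> range g"
  then show "{Z d -` A \<inter> space M |A. A \<in> sets borel} \<subseteq> events"
    using ind by (auto simp: indep_sets_def)
next
  have 1: "indep_vars (\<lambda>_. borel) (\<lambda>k \<omega>. real (N k \<omega>)) UNIV"
    by (rule indep_vars_compose2[OF assms(1)]) auto
  have "Z (g k) = (\<lambda>\<omega>. real (N k \<omega>))" for k using assms(3) by auto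
  then have ind: "indep_sets (\<lambda>k. {Z (g k) -` A \<inter> space M |A. A \<in> sets borel}) UNIV"
    using 1 by (auto simp: indep_vars_def2)
  fix A J assume J: "J \<noteq> {}" "J \<subseteq> range g" "finite J"
    and A: "\<forall>j\<in>J. A j \<in> {Z j -` A \<inter> space M |A. A \<in> sets borel}"
  define J' where "J' = g -` J"
  have J': "J = g ` J'" "finite J'" "J' \<noteq> {}"
    using J assms(2) by (auto simp: J'_def image_vimage_eq intro!: finite_vimageI)
  have "prob (\<Inter>j\<in>J'. A (g j)) = (\<Prod>j\<in>J'. prob (A (g j)))"
    by (rule indep_setsD[OF ind]) (use J' A in auto)
  then show "prob (\<Inter>j\<in>J. A j) = (\<Prod>j\<in>J. prob (A j))"
    using assms(2) by (simp add: J' prod.reindex inj_on_subset[OF assms(2)] o_def image_image)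
qed

lemma noise_var_measurable [measurable]:
  assumes "noise_particle d < n" "0 \<le> h"
  shows "random_variable borel (noise_var h d)"
proof (cases d)
  case (Jump_inc i k)
  then have "\<And>t. t \<ge> 0 \<Longrightarrow> random_variable (count_space UNIV) (NJ i t)"
    using jump_process[of i] assms by (auto simp: poisson_process_def)
  then have [measurable]: "random_variable (count_space UNIV) (NJ i (real (Suc k) * h))"
    "random_variable (count_space UNIV) (NJ i (real k * h))" using assms by auto
  show ?thesis unfolding noise_var_def Jump_inc by (simp del: of_nat_Suc)
next
  case (Choice_inc i k)
  then have "\<And>t. t \<ge> 0 \<Longrightarrow> random_variable (count_space UNIV) (NC i t)"
    using choice_process[of i] assms by (auto simp: poisson_process_def)
  then have [measurable]: "random_variable (count_space UNIV) (NC i (real (Suc k) * h))"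
    "random_variable (count_space UNIV) (NC i (real k * h))" using assms by auto
  show ?thesis unfolding noise_var_def Choice_inc by (simp del: of_nat_Suc)
next
  case (Mark i k)
  moreover have "noise_var h d = S i k" by (auto simp: noise_var_def Mark)
  ultimately show ?thesis using size_measurable[of i k] assms by simp
next
  case (Pick i k)
  then have [measurable]: "random_variable (count_space UNIV) (C i k)"
    using target_measurable[of i k] assms by simp
  show ?thesis unfolding noise_var_def Pick by simp
qed

text \<open>Places the events of a cell increment in the sigma-algebra that
  \<open>independence\<close> attaches to the whole Poisson process.\<close>

lemma diff_in_sigma:
  fixes N :: "real \<Rightarrow> 'w \<Rightarrow> nat"
  assumes "0 \<le> s" "0 \<le> t"
  shows "{(\<lambda>\<omega>. real (N t \<omega> - N s \<omega>)) -` A \<inter> space M | A. A \<in> sets borel}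
     \<subseteq> sigma_sets (space M) {N t -` A \<inter> space M | t A. 0 \<le> t}"
proof -
  let ?S = "sigma (space M) {N t -` A \<inter> space M | t A. 0 \<le> t}"
  have N [measurable]: "N u \<in> measurable ?S (count_space UNIV)" if "0 \<le> u" for u
    by (rule measurableI) (use that in \<open>auto simp: sets_measure_of_conv space_measure_of_conv\<close>)
  note [measurable] = N[OF assms(1)] N[OF assms(2)]
  have "(\<lambda>\<omega>. real (N t \<omega> - N s \<omega>)) \<in> borel_measurable ?S" by measurable
  from measurable_sets[OF this] show ?thesis
    by (subst (asm) sets_measure_of) (auto simp: space_measure_of_conv)
qed

text \<open>Across sources this is the assumption \<open>independence\<close>. Inside the source of
  a Poisson process it is the independence of increments over the grid, and a size or target is
  alone in its source.\<close>

lemma noise_indep: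
  assumes "0 \<le> h"
  shows "indep_vars (\<lambda>_. borel) (noise_var h) {d. noise_particle d < n}"
  unfolding indep_vars_def2
proof (intro conjI ballI)
  fix d assume "d \<in> {d. noise_particle d < n}"
  then show "random_variable borel (noise_var h d)" using assms by auto
next
  let ?F = "\<lambda>d. case d of
           Jumps i \<Rightarrow> sigma_sets (space M) {NJ i t -` A \<inter> space M | t A. 0 \<le> t}
         | Choices i \<Rightarrow> sigma_sets (space M) {NC i t -` A \<inter> space M | t A. 0 \<le> t}
         | Size i k \<Rightarrow> {S i k -` A \<inter> space M | A. A \<in> sets borel}
         | Target i k \<Rightarrow> {C i k -` A \<inter> space M | A. True}"
  let ?I = "{d. case d of Jumps i \<Rightarrow> i < n | Choices i \<Rightarrow> i < n | Size i k \<Rightarrow> i < n | Target i k \<Rightarrow> i < n}"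
  let ?E = "\<lambda>i. {noise_var h i -` A \<inter> space M |A. A \<in> sets borel}"
  show "indep_sets ?E {d. noise_particle d < n}"
  proof (rule indep_sets_refine[of ?F ?I _ noise_source])
    show "indep_sets ?F ?I" by (rule independence)
    fix d assume d: "d \<in> ?I"
    have sg: "Int_stable (sigma_sets (space M) X)" if "X \<subseteq> Pow (space M)" for X
    proof -
      interpret S: sigma_algebra "space M" "sigma_sets (space M) X"
        by (rule sigma_algebra_sigma_sets[OF that])
      show ?thesis by (auto simp: Int_stable_def)
    qed
    show "Int_stable (?F d)"
    proof (cases d)
      case (Size i k)
      then show ?thesis
        by (auto simp: Int_stable_def) (metis (no_types, lifting) Int_left_commute inf.idem inf_commute sets.Int vimage_Int inf_assoc)
    next
      case (Target i k)
      then show ?thesis by (auto simp: Int_stable_def) (metis (no_types, lifting) Int_left_commute inf.idem inf_commute vimage_Int inf_assoc)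
    qed (auto intro!: sg)
    show "indep_sets ?E {e \<in> {d. noise_particle d < n}. noise_source e = d}"
    proof (cases d)
      case (Jumps i)
      then have "i < n" using d by auto
      have "{e \<in> {d. noise_particle d < n}. noise_source e = d} = range (Jump_inc i)"
        using \<open>i < n\<close> Jumps by (auto dest: noise_source_dest(1))
      moreover have "indep_sets ?E (range (Jump_inc i))"
        by (rule indep_noise_sub[where N = "\<lambda>k \<omega>. NJ i (real (Suc k) * h) \<omega> - NJ i (real k * h) \<omega>"])
          (use jump_process[OF \<open>i < n\<close>] grid_incseq[OF assms] in
            \<open>auto simp: poisson_process_def noise_var_def inj_def dest: spec[where x = "\<lambda>k. real k * h"]\<close>)
      ultimately show ?thesis by simp
    next
      case (Choices i)
      then have "i < n" using d by auto
      have "{e \<in> {d. noise_particle d < n}. noise_source e = d} = range (Choice_inc i)"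
        using \<open>i < n\<close> Choices by (auto dest: noise_source_dest(2))
      moreover have "indep_sets ?E (range (Choice_inc i))"
        by (rule indep_noise_sub[where N = "\<lambda>k \<omega>. NC i (real (Suc k) * h) \<omega> - NC i (real k * h) \<omega>"])
          (use choice_process[OF \<open>i < n\<close>] grid_incseq[OF assms] in
            \<open>auto simp: poisson_process_def noise_var_def inj_def dest: spec[where x = "\<lambda>k. real k * h"]\<close>)
      ultimately show ?thesis by simp
    next
      case (Size i k)
      then have "i < n" using d by auto
      have "{e \<in> {d. noise_particle d < n}. noise_source e = d} = {Mark i k}"
        using \<open>i < n\<close> Size by (auto dest: noise_source_dest(3))
      moreover have "?E (Mark i k) \<subseteq> events"
        using noise_var_measurable[of "Mark i k" h] assms \<open>i < n\<close> by (auto intro: measurable_sets)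
      ultimately show ?thesis by (auto simp: indep_sets_def subset_singleton_iff)
    next
      case (Target i k)
      then have "i < n" using d by auto
      have "{e \<in> {d. noise_particle d < n}. noise_source e = d} = {Pick i k}"
        using \<open>i < n\<close> Target by (auto dest: noise_source_dest(4))
      moreover have "?E (Pick i k) \<subseteq> events"
        using noise_var_measurable[of "Pick i k" h] assms \<open>i < n\<close> by (auto intro: measurable_sets)
      ultimately show ?thesis by (auto simp: indep_sets_def subset_singleton_iff)
    qed
  next
    fix e assume e: "e \<in> {d. noise_particle d < n}"
    show "noise_source e \<in> ?I" using e by (cases e) auto
    show "?E e \<subseteq> ?F (noise_source e)"
    proof (cases e)
      case (Jump_inc i k)
      have "noise_var h e = (\<lambda>\<omega>. real (NJ i (real (Suc k) * h) \<omega> - NJ i (real k * h) \<omega>))"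
        by (simp add: noise_var_def Jump_inc fun_eq_iff del: of_nat_Suc)
      then show ?thesis
        using diff_in_sigma[of "real k * h" "real (Suc k) * h" "NJ i"] assms Jump_inc
        by (simp del: of_nat_Suc)
    next
      case (Choice_inc i k)
      have "noise_var h e = (\<lambda>\<omega>. real (NC i (real (Suc k) * h) \<omega> - NC i (real k * h) \<omega>))"
        by (simp add: noise_var_def Choice_inc fun_eq_iff del: of_nat_Suc)
      then show ?thesis
        using diff_in_sigma[of "real k * h" "real (Suc k) * h" "NC i"] assms Choice_inc
        by (simp del: of_nat_Suc)
    next
      case (Mark i k)
      then show ?thesis by (auto simp: noise_var_def)
    next
      case (Pick i k)
      have "noise_var h (Pick i k) -` A \<inter> space M = C i k -` (real -` A) \<inter> space M" for A
        by (auto simp: noise_var_def)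
      then show ?thesis unfolding Pick by auto
    qed
  qed
qed

end

text \<open>The joint law of independent variables is a product, so Fubini integrates
  \<open>Y\<close> out with \<open>X\<close> frozen. This takes the place of a conditional
  expectation given \<open>X\<close>.\<close>

lemma (in prob_space) indep_var_integral:
  fixes \<psi> :: "'b \<times> 'b \<Rightarrow> real"
  assumes ind: "indep_var S X T Y" and \<psi>[measurable]: "\<psi> \<in> borel_measurable (S \<Otimes>\<^sub>M T)"
    and bd: "\<And>a. \<bar>\<psi> a\<bar> \<le> B"
  shows "expectation (\<lambda>\<omega>. \<psi> (X \<omega>, Y \<omega>)) = expectation (\<lambda>\<omega>. \<integral>y. \<psi> (X \<omega>, y) \<partial>distr M T Y)"
proof -
  have X[measurable]: "random_variable S X" and Y[measurable]: "random_variable T Y"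
    and eq: "distr M S X \<Otimes>\<^sub>M distr M T Y = distr M (S \<Otimes>\<^sub>M T) (\<lambda>x. (X x, Y x))"
    using ind unfolding indep_var_distribution_eq by auto
  interpret DX: prob_space "distr M S X" by (rule prob_space_distr[OF X])
  interpret DY: prob_space "distr M T Y" by (rule prob_space_distr[OF Y])
  interpret P: pair_prob_space "distr M S X" "distr M T Y" ..
  have "expectation (\<lambda>\<omega>. \<psi> (X \<omega>, Y \<omega>)) = (\<integral>a. \<psi> a \<partial>(distr M S X \<Otimes>\<^sub>M distr M T Y))"
    unfolding eq by (subst integral_distr) auto
  also have "\<dots> = (\<integral>x. \<integral>y. \<psi> (x, y) \<partial>distr M T Y \<partial>distr M S X)"
    by (rule P.integral_fst'[symmetric]) (rule P.integrable_const_bound[where B = B], use bd in auto)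
  also have "\<dots> = expectation (\<lambda>\<omega>. \<integral>y. \<psi> (X \<omega>, y) \<partial>distr M T Y)"
    by (subst integral_distr) auto
  finally show ?thesis .
qed

text \<open>Serves to make the random number of the next size or target deterministic: it is fixed
  on each event \<kappa> = c. The partial sums converge by dominated convergence.\<close>

lemma (in prob_space) expectation_split_nat:
  fixes f :: "'a \<Rightarrow> real" and \<kappa> :: "'a \<Rightarrow> nat"
  assumes [measurable]: "f \<in> borel_measurable M" "\<kappa> \<in> measurable M (count_space UNIV)"
    and bd: "\<And>\<omega>. \<bar>f \<omega>\<bar> \<le> B"
  shows "(\<lambda>c. expectation (\<lambda>\<omega>. of_bool (\<kappa> \<omega> = c) * f \<omega>)) sums expectation f"
  unfolding sums_def
proof -
  have eq: "(\<Sum>c<N. expectation (\<lambda>\<omega>. of_bool (\<kappa> \<omega> = c) * f \<omega>)) =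
      expectation (\<lambda>\<omega>. of_bool (\<kappa> \<omega> < N) * f \<omega>)" for N
  proof -
    have "(\<Sum>c<N. expectation (\<lambda>\<omega>. of_bool (\<kappa> \<omega> = c) * f \<omega>)) =
      expectation (\<lambda>\<omega>. \<Sum>c<N. of_bool (\<kappa> \<omega> = c) * f \<omega>)"
      by (rule Bochner_Integration.integral_sum[symmetric])
        (rule integrable_const_bound[where B = B], use bd in \<open>auto simp: abs_mult intro: order_trans[OF abs_ge_zero]\<close>)
    also have "(\<lambda>\<omega>. \<Sum>c<N. of_bool (\<kappa> \<omega> = c) * f \<omega>) = (\<lambda>\<omega>. of_bool (\<kappa> \<omega> < N) * f \<omega>)"
      by (auto simp: fun_eq_iff sum_distrib_right[symmetric] of_bool_def sum.delta)
    finally show ?thesis .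
  qed
  show "(\<lambda>N. \<Sum>c<N. expectation (\<lambda>\<omega>. of_bool (\<kappa> \<omega> = c) * f \<omega>)) \<longlonglongrightarrow> expectation f"
    unfolding eq
  proof (rule integral_dominated_convergence[where w = "\<lambda>_. B"])
    show "AE \<omega> in M. (\<lambda>N. of_bool (\<kappa> \<omega> < N) * f \<omega>) \<longlonglongrightarrow> f \<omega>"
    proof (rule AE_I2)
      fix \<omega>
      have "eventually (\<lambda>N. of_bool (\<kappa> \<omega> < N) * f \<omega> = f \<omega>) sequentially"
        using eventually_gt_at_top[of "\<kappa> \<omega>"] by eventually_elim auto
      then show "(\<lambda>N. of_bool (\<kappa> \<omega> < N) * f \<omega>) \<longlonglongrightarrow> f \<omega>" by (rule tendsto_eventually)
    qed
    show "AE x in M. norm (of_bool (\<kappa> x < i) * f x) \<le> B" for i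
      using bd order_trans[OF abs_ge_zero bd] by (auto simp: abs_mult)
  qed auto
qed

section \<open>The scheme and the noises on which it depends\<close>

context moving_boundary_system begin

definition cells :: "nat \<Rightarrow> noise set" where
  "cells k = (\<lambda>i. Jump_inc i k) ` {..<n} \<union> (\<lambda>i. Choice_inc i k) ` {..<n}"

text \<open>The scheme stands still in a cell with two or more points. It counts points from the cells, so that
  sizes and targets are numbered from 1 as in the particle system, and uses the boundary at the left end
  of the cell.\<close>

definition single :: "(noise \<Rightarrow> real) \<Rightarrow> nat \<Rightarrow> noise \<Rightarrow> bool" where
  "single z k d \<longleftrightarrow> z d = 1 \<and> (\<forall>e\<in>cells k - {d}. z e = 0)"

definition jump_count :: "(noise \<Rightarrow> real) \<Rightarrow> nat \<Rightarrow> nat \<Rightarrow> nat" where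
  "jump_count z i k = (\<Sum>l<k. nat \<lfloor>z (Jump_inc i l)\<rfloor>)"

definition choice_count :: "(noise \<Rightarrow> real) \<Rightarrow> nat \<Rightarrow> nat \<Rightarrow> nat" where
  "choice_count z i k = (\<Sum>l<k. nat \<lfloor>z (Choice_inc i l)\<rfloor>)"

primrec euler :: "real \<Rightarrow> nat \<Rightarrow> (noise \<Rightarrow> real) \<Rightarrow> nat \<Rightarrow> real" where
  "euler h 0 z i = p i"
| "euler h (Suc k) z i =
    (if i < n \<and> single z k (Jump_inc i k)
     then min (euler h k z i + z (Mark i (Suc (jump_count z i k)))) (B0 + v * (real k * h))
     else if i < n \<and> single z k (Choice_inc i k)
     then max (euler h k z i) (euler h k z (nat \<lfloor>z (Pick i (Suc (choice_count z i k)))\<rfloor>))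
     else euler h k z i)"

text \<open>The state after \<open>k\<close> cells depends on these noises only; the marks and picks among them are
  themselves determined by the counts.\<close>

definition used :: "(noise \<Rightarrow> real) \<Rightarrow> nat \<Rightarrow> noise set" where
  "used z k = {d. noise_particle d < n \<and> (case d of Jump_inc i l \<Rightarrow> l < k | Choice_inc i l \<Rightarrow> l < k
     | Mark i j \<Rightarrow> j \<le> jump_count z i k | Pick i j \<Rightarrow> j \<le> choice_count z i k)}"

lemma finite_cells [simp]: "finite (cells k)" by (simp add: cells_def)

lemma cells_particle: "d \<in> cells k \<Longrightarrow> noise_particle d < n"
  by (auto simp: cells_def)

lemma single_cong: "d \<in> cells k \<Longrightarrow> (\<And>e. e \<in> cells k \<Longrightarrow> z e = z' e) \<Longrightarrow> single z k d = single z' k d"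
  by (auto simp: single_def)

text \<open>Agreement on the cell increments already forces equal counts, so both configurations
  read sizes and targets with the same numbers.\<close>

lemma euler_cong:
  assumes "\<And>d. d \<in> used z k \<Longrightarrow> z d = z' d"
  shows "euler h k z i = euler h k z' i"
  using assms
proof (induction k arbitrary: i)
  case (Suc k)
  have mono: "jump_count z i k \<le> jump_count z i (Suc k)" "choice_count z i k \<le> choice_count z i (Suc k)" for i
    by (auto simp: jump_count_def choice_count_def)
  have "used z k \<subseteq> used z (Suc k)"
    using mono by (fastforce simp: used_def split: noise.splits intro: order_trans)
  then have IH: "euler h k z i = euler h k z' i" for i using Suc by blast
  have cell: "z e = z' e" if "e \<in> cells k" for e
    using that by (intro Suc.prems) (auto simp: cells_def used_def)
  show ?case
  proof (cases "i < n")
    case True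
    have c: "jump_count z i k = jump_count z' i k" "choice_count z i k = choice_count z' i k"
      unfolding jump_count_def choice_count_def
      by (intro sum.cong refl arg_cong[where f = "\<lambda>x. nat \<lfloor>x\<rfloor>"] Suc.prems, use True in \<open>auto simp: used_def\<close>)+
    have s: "single z k (Jump_inc i k) = single z' k (Jump_inc i k)"
      "single z k (Choice_inc i k) = single z' k (Choice_inc i k)"
      by (intro single_cong cell; use True in \<open>auto simp: cells_def\<close>)+
    \<comment> \<open>The size is read only in a cell that is \<open>single\<close> for this jump.
      There the count rises by one, so the successor of the old count is still a number within
      \<open>used z (Suc k)\<close>.\<close>
    have 1: "z (Mark i (Suc (jump_count z i k))) = z' (Mark i (Suc (jump_count z i k)))"
      if "single z k (Jump_inc i k)"
      using that True by (intro Suc.prems) (auto simp: used_def jump_count_def single_def)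
    have 2: "z (Pick i (Suc (choice_count z i k))) = z' (Pick i (Suc (choice_count z i k)))"
      if "single z k (Choice_inc i k)"
      using that True by (intro Suc.prems) (auto simp: used_def choice_count_def single_def)
    show ?thesis using 1 2 by (simp add: IH s[symmetric] c[symmetric])
  next
    case False
    then show ?thesis by (simp add: IH)
  qed
qed simp

context
  fixes N :: "'x measure" and \<zeta> :: "'x \<Rightarrow> noise \<Rightarrow> real"
  assumes \<zeta>: "\<And>d. noise_particle d < n \<Longrightarrow> (\<lambda>\<omega>. \<zeta> \<omega> d) \<in> borel_measurable N"
begin

text \<open>The measurability facts are stated over an arbitrary space because they are applied
  twice: on \<open>M\<close> to \<open>noises h\<close>, and on products of noise coordinates to the
  coordinates.\<close>

lemma count_measurable:
  assumes "i < n"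
  shows "(\<lambda>\<omega>. jump_count (\<zeta> \<omega>) i k) \<in> measurable N (count_space UNIV)"
    "(\<lambda>\<omega>. choice_count (\<zeta> \<omega>) i k) \<in> measurable N (count_space UNIV)"
proof -
  have [measurable]: "(\<lambda>\<omega>. \<zeta> \<omega> (Jump_inc i l)) \<in> borel_measurable N"
    "(\<lambda>\<omega>. \<zeta> \<omega> (Choice_inc i l)) \<in> borel_measurable N" for l
    using assms by (auto intro!: \<zeta>)
  show "(\<lambda>\<omega>. jump_count (\<zeta> \<omega>) i k) \<in> measurable N (count_space UNIV)"
    unfolding jump_count_def by measurable
  show "(\<lambda>\<omega>. choice_count (\<zeta> \<omega>) i k) \<in> measurable N (count_space UNIV)"
    unfolding choice_count_def by measurable
qed

lemma single_measurable:
  assumes "d \<in> cells k"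
  shows "Measurable.pred N (\<lambda>\<omega>. single (\<zeta> \<omega>) k d)"
proof -
  have [measurable]: "(\<lambda>\<omega>. \<zeta> \<omega> e) \<in> borel_measurable N" if "e \<in> cells k" for e
    using that by (auto intro!: \<zeta> cells_particle)
  have [simp]: "finite (cells k - {d})" by simp
  have "Measurable.pred N (\<lambda>\<omega>. \<zeta> \<omega> d = 1)" using assms by measurable
  moreover have "Measurable.pred N (\<lambda>\<omega>. \<forall>e\<in>cells k - {d}. \<zeta> \<omega> e = 0)"
    by (rule pred_intros_finite) auto
  ultimately show ?thesis unfolding single_def by measurable
qed

lemma mark_measurable:
  assumes "i < n"
  shows "(\<lambda>\<omega>. \<zeta> \<omega> (Mark i (Suc (jump_count (\<zeta> \<omega>) i k)))) \<in> borel_measurable N"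
    "(\<lambda>\<omega>. \<zeta> \<omega> (Pick i (Suc (choice_count (\<zeta> \<omega>) i k)))) \<in> borel_measurable N"
proof -
  show "(\<lambda>\<omega>. \<zeta> \<omega> (Mark i (Suc (jump_count (\<zeta> \<omega>) i k)))) \<in> borel_measurable N"
    by (rule measurable_compose_countable[where f = "\<lambda>c \<omega>. \<zeta> \<omega> (Mark i (Suc c))"])
      (use assms in \<open>auto intro!: \<zeta> count_measurable\<close>)
  show "(\<lambda>\<omega>. \<zeta> \<omega> (Pick i (Suc (choice_count (\<zeta> \<omega>) i k)))) \<in> borel_measurable N"
    by (rule measurable_compose_countable[where f = "\<lambda>c \<omega>. \<zeta> \<omega> (Pick i (Suc c))"])
      (use assms in \<open>auto intro!: \<zeta> count_measurable\<close>)
qed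

lemma euler_measurable1: "(\<lambda>\<omega>. euler h k (\<zeta> \<omega>) i) \<in> borel_measurable N"
proof (induction k arbitrary: i)
  case (Suc k)
  show ?case
  proof (cases "i < n")
    case True
    note [measurable] = Suc mark_measurable[OF True, of k]
    have [measurable]: "Measurable.pred N (\<lambda>\<omega>. single (\<zeta> \<omega>) k (Jump_inc i k))"
      "Measurable.pred N (\<lambda>\<omega>. single (\<zeta> \<omega>) k (Choice_inc i k))"
      using True by (auto intro!: single_measurable simp: cells_def)
    have [measurable]: "(\<lambda>\<omega>. euler h k (\<zeta> \<omega>) (nat \<lfloor>\<zeta> \<omega> (Pick i (Suc (choice_count (\<zeta> \<omega>) i k)))\<rfloor>)) \<in> borel_measurable N"
      by (rule measurable_compose_countable[where f = "\<lambda>j \<omega>. euler h k (\<zeta> \<omega>) j"]) measurable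
    show ?thesis by simp
  next
    case False
    then show ?thesis using Suc by simp
  qed
qed simp

lemma euler_measurable: "(\<lambda>\<omega>. euler h k (\<zeta> \<omega>)) \<in> measurable N (PiM UNIV (\<lambda>_. borel))"
  using measurable_PiM_single'[of UNIV "\<lambda>i \<omega>. euler h k (\<zeta> \<omega>) i" N "\<lambda>_. borel"] euler_measurable1 by auto

end

definition noises :: "real \<Rightarrow> 'w \<Rightarrow> noise \<Rightarrow> real" where
  "noises h \<omega> = (\<lambda>d. noise_var h d \<omega>)"

lemma noises_measurable: "0 \<le> h \<Longrightarrow> noise_particle d < n \<Longrightarrow> (\<lambda>\<omega>. noises h \<omega> d) \<in> borel_measurable M"
  unfolding noises_def by measurable

text \<open>Outside \<open>K\<close> all points of the product take the constant
  \<open>undefined\<close>. Without a side condition on \<open>d\<close> the measurability of the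
  scheme is available on products over any part of the noises.\<close>

lemma PiM_coordinate: "(\<lambda>z. z d :: real) \<in> borel_measurable (PiM K (\<lambda>_. borel :: real measure))"
proof (cases "d \<in> K")
  case False
  have "(\<lambda>z. z d :: real) \<in> borel_measurable (PiM K (\<lambda>_. borel :: real measure)) \<longleftrightarrow>
      (\<lambda>z. undefined :: real) \<in> borel_measurable (PiM K (\<lambda>_. borel :: real measure))"
    by (rule measurable_cong) (use False in \<open>auto simp: space_PiM PiE_def extensional_def\<close>)
  then show ?thesis by simp
qed simp
text \<open>On the event that the count is c, the next size or target has the fixed number c + 1,
  while count, cell and state are functions of noises that exclude it; freezing them integrates it
  out, and summing over c removes the restriction. Afterwards the event that the cell is single
  splits off, since the state reads earlier cells only.\<close>

lemma fresh_noise: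
  fixes \<phi> :: "(nat \<Rightarrow> real) \<Rightarrow> real \<Rightarrow> real"
  assumes h: "0 \<le> h" and i: "i < n" and d: "d \<in> cells k"
    and mk: "mk = Mark i \<and> cnt = (\<lambda>z. jump_count z i k) \<or> mk = Pick i \<and> cnt = (\<lambda>z. choice_count z i k)"
    and \<nu>: "\<And>c. distr M borel (noise_var h (mk c)) = \<nu>"
    and \<phi>: "(\<lambda>(w, s). \<phi> w s) \<in> borel_measurable (PiM UNIV (\<lambda>_. borel) \<Otimes>\<^sub>M borel)"
    and bd: "\<And>w s. \<bar>\<phi> w s\<bar> \<le> B"
  shows "expectation (\<lambda>\<omega>. of_bool (single (noises h \<omega>) k d) *
            \<phi> (euler h k (noises h \<omega>)) (noises h \<omega> (mk (Suc (cnt (noises h \<omega>))))))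
     = prob {\<omega>\<in>space M. single (noises h \<omega>) k d} *
       expectation (\<lambda>\<omega>. \<integral>s. \<phi> (euler h k (noises h \<omega>)) s \<partial>\<nu>)" (is "?L = ?R")
proof -
  let ?Z = "noises h" and ?W = "\<lambda>z. euler h k z"
  define \<phi>' where "\<phi>' w = (\<integral>s. \<phi> w s \<partial>\<nu>)" for w
  have B: "0 \<le> B" using bd order_trans[OF abs_ge_zero] by blast
  interpret \<nu>: prob_space \<nu>
  proof -
    have "random_variable borel (noise_var h (mk 0))" using mk i h by auto
    from prob_space_distr[OF this] show "prob_space \<nu>" using \<nu> by simp
  qed
  have s\<nu>: "sets \<nu> = sets borel" using \<nu>[of 0, symmetric] by simp
  have \<phi>\<nu>: "(\<lambda>(w, s). \<phi> w s) \<in> borel_measurable (PiM UNIV (\<lambda>_. borel) \<Otimes>\<^sub>M \<nu>)"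
    using \<phi> by (simp cong: measurable_cong_sets add: sets_pair_measure_cong[OF refl s\<nu>])
  have \<phi>'m: "\<phi>' \<in> borel_measurable (PiM UNIV (\<lambda>_. borel))"
    unfolding \<phi>'_def by (rule \<nu>.borel_measurable_lebesgue_integral) (use \<phi>\<nu> in simp)
  have \<phi>m1: "\<phi> w \<in> borel_measurable \<nu>" for w
    using measurable_compose[OF measurable_Pair1'[of w "PiM UNIV (\<lambda>_. borel)" \<nu>] \<phi>\<nu>] by (simp add: space_PiM)
  have \<phi>'b: "\<bar>\<phi>' w\<bar> \<le> B" for w
  proof -
    have "integrable \<nu> (\<phi> w)" by (rule \<nu>.integrable_const_bound[where B = B]) (use bd \<phi>m1 in auto)
    then have "\<bar>\<phi>' w\<bar> \<le> (\<integral>s. \<bar>\<phi> w s\<bar> \<partial>\<nu>)" unfolding \<phi>'_def by simp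
    also have "\<dots> \<le> (\<integral>s. B \<partial>\<nu>)"
      by (rule integral_mono) (use bd \<open>integrable \<nu> (\<phi> w)\<close> in auto)
    finally show ?thesis by (simp add: \<nu>.prob_space)
  qed
  have cntm: "(\<lambda>\<omega>. cnt (\<zeta> \<omega>)) \<in> measurable N (count_space UNIV)"
    if "\<And>d. noise_particle d < n \<Longrightarrow> (\<lambda>\<omega>. \<zeta> \<omega> d) \<in> borel_measurable N" for N :: "'y measure" and \<zeta>
    using mk count_measurable[OF that i] by auto
  have mkm: "(\<lambda>\<omega>. ?Z \<omega> (mk (Suc (cnt (?Z \<omega>))))) \<in> borel_measurable M"
    using mk mark_measurable[OF noises_measurable[OF h] i] by auto
  note Zm = noises_measurable[OF h]
  note [measurable] = cntm[OF Zm] mkm single_measurable[OF Zm d] euler_measurable[OF Zm] \<phi> \<phi>'m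
  have [measurable]: "(\<lambda>\<omega>. \<phi> (?W (?Z \<omega>)) (?Z \<omega> (mk (Suc (cnt (?Z \<omega>)))))) \<in> borel_measurable M"
    using measurable_compose[OF measurable_Pair[OF euler_measurable[OF Zm, where h = h and k = k] mkm] \<phi>] by simp
  have b1: "\<bar>of_bool b * x\<bar> \<le> B" if "\<bar>x\<bar> \<le> B" for b x using that B by auto
  have step1: "expectation (\<lambda>\<omega>. of_bool (cnt (?Z \<omega>) = c) * (of_bool (single (?Z \<omega>) k d) *
            \<phi> (?W (?Z \<omega>)) (?Z \<omega> (mk (Suc (cnt (?Z \<omega>)))))))
     = expectation (\<lambda>\<omega>. of_bool (cnt (?Z \<omega>) = c) * (of_bool (single (?Z \<omega>) k d) * \<phi>' (?W (?Z \<omega>))))" for c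
  proof -
    \<comment> \<open>All noises except the sizes (or targets) of particle \<open>i\<close> numbered
      above \<open>c\<close>. On the event that the count is \<open>c\<close> the state is
      determined by these, and they are independent of number \<open>Suc c\<close>.\<close>
    define K where "K = {d. noise_particle d < n} - {mk j |j. c < j}"
    define R where "R = (\<lambda>\<omega>. restrict (\<lambda>d. noise_var h d \<omega>) K)"
    define \<psi> where "\<psi> = (\<lambda>(z, y :: noise \<Rightarrow> real). of_bool (cnt z = c) * (of_bool (single z k d) * \<phi> (?W z) (y (mk (Suc c)))))"
    have "indep_var (PiM K (\<lambda>_. borel)) R (PiM {mk (Suc c)} (\<lambda>_. borel)) (\<lambda>\<omega>. restrict (\<lambda>d. noise_var h d \<omega>) {mk (Suc c)})"
      unfolding R_def by (rule indep_var_restrict[OF noise_indep[OF h]]) (use mk i in \<open>auto simp: K_def\<close>)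
    then have ind: "indep_var (PiM K (\<lambda>_. borel)) R (PiM {mk (Suc c)} (\<lambda>_. borel)) (\<lambda>\<omega>. restrict (\<lambda>d. noise_var h d \<omega>) {mk (Suc c)})" .
    have mkn: "noise_particle (mk (Suc c)) < n" using mk i by auto
    have Rm: "(\<lambda>z. z d :: real) \<in> borel_measurable (PiM K (\<lambda>_. borel))" for d :: noise by (rule PiM_coordinate)
    note [measurable] = cntm[OF Rm] single_measurable[OF Rm d] euler_measurable[OF Rm]
    have \<psi>m: "\<psi> \<in> borel_measurable (PiM K (\<lambda>_. borel) \<Otimes>\<^sub>M PiM {mk (Suc c)} (\<lambda>_. borel))"
    proof -
      have [measurable]: "(\<lambda>x. \<phi> (?W (fst x)) (snd x (mk (Suc c)))) \<in> borel_measurable (PiM K (\<lambda>_. borel) \<Otimes>\<^sub>M PiM {mk (Suc c)} (\<lambda>_. borel))"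
        using measurable_compose[OF measurable_Pair[OF measurable_compose[OF measurable_fst euler_measurable[OF Rm, where h = h and k = k]]
          measurable_compose[OF measurable_snd PiM_coordinate[of "mk (Suc c)"]]] \<phi>] by simp
      show ?thesis unfolding \<psi>_def by (simp add: case_prod_beta)
    qed
    have cellK: "cells k \<subseteq> K" "l < k \<Longrightarrow> Jump_inc i l \<in> K" "l < k \<Longrightarrow> Choice_inc i l \<in> K" for l
      using mk i by (auto simp: K_def cells_def)
    have cntR: "cnt (R \<omega>) = cnt (?Z \<omega>)" for \<omega>
      using mk cellK by (auto simp: jump_count_def choice_count_def R_def noises_def intro!: sum.cong)
    have singR: "single (R \<omega>) k d = single (?Z \<omega>) k d" for \<omega>
      by (rule single_cong[OF d]) (use cellK in \<open>auto simp: R_def noises_def\<close>)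
    have WR: "?W (R \<omega>) = ?W (?Z \<omega>)" if "cnt (?Z \<omega>) = c" for \<omega>
    proof
      fix j
      have "used (?Z \<omega>) k \<subseteq> K" using mk that by (fastforce simp: used_def K_def)
      then show "?W (R \<omega>) j = ?W (?Z \<omega>) j"
        by (intro euler_cong[symmetric]) (auto simp: R_def noises_def)
    qed
    have "expectation (\<lambda>\<omega>. of_bool (cnt (?Z \<omega>) = c) * (of_bool (single (?Z \<omega>) k d) *
            \<phi> (?W (?Z \<omega>)) (?Z \<omega> (mk (Suc (cnt (?Z \<omega>))))))) = expectation (\<lambda>\<omega>. \<psi> (R \<omega>, restrict (\<lambda>d. noise_var h d \<omega>) {mk (Suc c)}))"
      by (rule Bochner_Integration.integral_cong[OF refl]) (auto simp: \<psi>_def cntR singR WR noises_def)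
    also have "\<dots> = expectation (\<lambda>\<omega>. \<integral>y. \<psi> (R \<omega>, y) \<partial>distr M (PiM {mk (Suc c)} (\<lambda>_. borel))
        (\<lambda>\<omega>. restrict (\<lambda>d. noise_var h d \<omega>) {mk (Suc c)}))"
      by (rule indep_var_integral[OF ind \<psi>m, of B]) (auto simp: \<psi>_def intro: b1[OF b1[OF bd]])
    also have "\<dots> = expectation (\<lambda>\<omega>. of_bool (cnt (?Z \<omega>) = c) * (of_bool (single (?Z \<omega>) k d) * \<phi>' (?W (?Z \<omega>))))"
    proof (rule Bochner_Integration.integral_cong[OF refl])
      fix \<omega>
      have [measurable]: "(\<lambda>\<omega>. restrict (\<lambda>d. noise_var h d \<omega>) {mk (Suc c)}) \<in> measurable M (PiM {mk (Suc c)} (\<lambda>_. borel))"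
        using mkn h by (intro measurable_restrict) auto
      have [measurable]: "\<phi> w \<in> borel_measurable borel" for w
        using \<phi>m1 s\<nu> by (simp cong: measurable_cong_sets)
      have [measurable]: "noise_var h (mk (Suc c)) \<in> borel_measurable M" using mkn h by auto
      have "(\<integral>y. \<phi> w (y (mk (Suc c))) \<partial>distr M (PiM {mk (Suc c)} (\<lambda>_. borel))
        (\<lambda>\<omega>. restrict (\<lambda>d. noise_var h d \<omega>) {mk (Suc c)})) = \<phi>' w" for w
        unfolding \<phi>'_def \<nu>[of "Suc c", symmetric]
        by (subst integral_distr, measurable, subst integral_distr) auto
      then show "(\<integral>y. \<psi> (R \<omega>, y) \<partial>distr M (PiM {mk (Suc c)} (\<lambda>_. borel))
        (\<lambda>\<omega>. restrict (\<lambda>d. noise_var h d \<omega>) {mk (Suc c)})) =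
        of_bool (cnt (?Z \<omega>) = c) * (of_bool (single (?Z \<omega>) k d) * \<phi>' (?W (?Z \<omega>)))"
        by (auto simp: \<psi>_def cntR singR WR)
    qed
    finally show ?thesis .
  qed
  have "?L = expectation (\<lambda>\<omega>. of_bool (single (?Z \<omega>) k d) * \<phi>' (?W (?Z \<omega>)))"
  proof (rule sums_unique2)
    show "(\<lambda>c. expectation (\<lambda>\<omega>. of_bool (cnt (?Z \<omega>) = c) * (of_bool (single (?Z \<omega>) k d) *
            \<phi> (?W (?Z \<omega>)) (?Z \<omega> (mk (Suc (cnt (?Z \<omega>)))))))) sums ?L"
      by (rule expectation_split_nat[where B = B]) (measurable, rule b1[OF bd])
    show "(\<lambda>c. expectation (\<lambda>\<omega>. of_bool (cnt (?Z \<omega>) = c) * (of_bool (single (?Z \<omega>) k d) *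
            \<phi> (?W (?Z \<omega>)) (?Z \<omega> (mk (Suc (cnt (?Z \<omega>)))))))) sums expectation (\<lambda>\<omega>. of_bool (single (?Z \<omega>) k d) * \<phi>' (?W (?Z \<omega>)))"
      unfolding step1 by (rule expectation_split_nat[where B = B]) (measurable, rule b1[OF \<phi>'b])
  qed
  also have "\<dots> = ?R"
  proof -
    \<comment> \<open>Now cell \<open>k\<close> is separated from all other noises: the state after
      \<open>k\<close> cells reads only increments over cells \<open>l < k\<close>, so it is
      independent of what cell \<open>k\<close> contains.\<close>
    define K where "K = {d. noise_particle d < n} - cells k"
    define R where "R = (\<lambda>\<omega>. restrict (\<lambda>d. noise_var h d \<omega>) K)"
    define R' where "R' = (\<lambda>\<omega>. restrict (\<lambda>d. noise_var h d \<omega>) (cells k))"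
    have ind: "indep_var (PiM (cells k) (\<lambda>_. borel)) R' (PiM K (\<lambda>_. borel)) R"
      unfolding R_def R'_def by (rule indep_var_restrict[OF noise_indep[OF h]]) (auto simp: K_def cells_particle)
    have Rm: "(\<lambda>z. z d :: real) \<in> borel_measurable (PiM K (\<lambda>_. borel))" for d :: noise and K by (rule PiM_coordinate)
    note [measurable] = single_measurable[OF Rm d] euler_measurable[OF Rm]
    have "indep_var borel ((\<lambda>z. of_bool (single z k d) :: real) \<circ> R') borel ((\<lambda>z. \<phi>' (?W z)) \<circ> R)"
      by (rule indep_var_compose[OF ind]) measurable
    moreover have "single (R' \<omega>) k d = single (?Z \<omega>) k d" for \<omega>
      by (rule single_cong[OF d]) (auto simp: R'_def noises_def)
    moreover have "?W (R \<omega>) = ?W (?Z \<omega>)" for \<omega>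
    proof
      fix j
      have "used (?Z \<omega>) k \<subseteq> K" by (fastforce simp: used_def K_def cells_def)
      then show "?W (R \<omega>) j = ?W (?Z \<omega>) j"
        by (intro euler_cong[symmetric]) (auto simp: R_def noises_def)
    qed
    ultimately have "indep_var borel (\<lambda>\<omega>. of_bool (single (?Z \<omega>) k d) :: real) borel (\<lambda>\<omega>. \<phi>' (?W (?Z \<omega>)))"
      by (simp add: o_def)
    note prd = indep_var_lebesgue_integral[OF this]
    have "expectation (\<lambda>\<omega>. of_bool (single (?Z \<omega>) k d) * \<phi>' (?W (?Z \<omega>))) =
      expectation (\<lambda>\<omega>. of_bool (single (?Z \<omega>) k d)) * expectation (\<lambda>\<omega>. \<phi>' (?W (?Z \<omega>)))"
    proof -
      have "integrable M (\<lambda>\<omega>. of_bool (single (?Z \<omega>) k d) :: real)"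
        by (rule integrable_const_bound[where B = 1]) auto
      moreover have "integrable M (\<lambda>\<omega>. \<phi>' (?W (?Z \<omega>)))"
        by (rule integrable_const_bound[where B = B]) (use \<phi>'b in auto)
      ultimately show ?thesis
        by (rule prd)
    qed
    moreover have "expectation (\<lambda>\<omega>. of_bool (single (?Z \<omega>) k d)) = prob {\<omega>\<in>space M. single (?Z \<omega>) k d}"
    proof -
      have "expectation (\<lambda>\<omega>. of_bool (single (?Z \<omega>) k d)) = expectation (indicator {\<omega>\<in>space M. single (?Z \<omega>) k d})"
        by (rule Bochner_Integration.integral_cong) auto
      also have "\<dots> = prob ({\<omega>\<in>space M. single (?Z \<omega>) k d} \<inter> space M)"
        by (rule Bochner_Integration.integral_indicator)
      also have "{\<omega>\<in>space M. single (?Z \<omega>) k d} \<inter> space M = {\<omega>\<in>space M. single (?Z \<omega>) k d}" by auto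
      finally show ?thesis .
    qed
    ultimately show ?thesis by (simp add: \<phi>'_def)
  qed
  finally show ?thesis .
qed

end

lemma empirical_cdf_sum: "empirical_cdf n w x = (\<Sum>i<n. of_bool (w i \<le> x)) / real n"
  unfolding empirical_cdf_def by (simp add: of_bool_def sum.If_cases Int_def lessThan_def)

lemma empirical_cdf_bounds: "0 \<le> empirical_cdf n w x" "empirical_cdf n w x \<le> 1"
proof -
  show "0 \<le> empirical_cdf n w x" by (simp add: empirical_cdf_def)
  have "card {i. i < n \<and> w i \<le> x} \<le> card {..<n}" by (rule card_mono) auto
  then show "empirical_cdf n w x \<le> 1" by (simp add: empirical_cdf_def divide_le_eq)
qed

section \<open>Cells with no point, one point and several points\<close>

context moving_boundary_system begin

definition rate :: "noise \<Rightarrow> real" where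
  "rate d = (case d of Jump_inc i k \<Rightarrow> lam | _ \<Rightarrow> 1)"

lemma poisson_incr_prob:
  assumes "poisson_process r N" "0 \<le> h"
  shows "prob {\<omega>\<in>space M. real (N (real (Suc k) * h) \<omega> - N (real k * h) \<omega>) = real c}
    = (r * h) ^ c / fact c * exp (- (r * h))"
proof -
  have "prob {\<omega>\<in>space M. N (real (Suc k) * h) \<omega> - N (real k * h) \<omega> = c} =
     (r * (real (Suc k) * h - real k * h)) ^ c / fact c * exp (- (r * (real (Suc k) * h - real k * h)))"
    using assms mult_right_mono[of "real k" "real (Suc k)" h]
    unfolding poisson_process_def by (auto simp del: of_nat_Suc)
  moreover have "real (Suc k) * h - real k * h = h" by (simp add: algebra_simps)
  ultimately show ?thesis by (simp only: of_nat_eq_iff)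
qed

lemma noise_var_prob:
  assumes "0 \<le> h" "d \<in> cells k"
  shows "prob {\<omega>\<in>space M. noises h \<omega> d = real c} = (rate d * h) ^ c / fact c * exp (- (rate d * h))"
  using assms poisson_incr_prob[OF jump_process _, of _ h k c] poisson_incr_prob[OF choice_process _, of _ h k c]
  by (auto simp: cells_def rate_def noises_def noise_var_def simp del: of_nat_Suc)

lemma sum_cells: "(\<Sum>d\<in>cells k. g d) = (\<Sum>i<n. g (Jump_inc i k) + (g (Choice_inc i k) :: real))"
proof -
  have "(\<Sum>d\<in>cells k. g d) = (\<Sum>d\<in>(\<lambda>i. Jump_inc i k) ` {..<n}. g d) + (\<Sum>d\<in>(\<lambda>i. Choice_inc i k) ` {..<n}. g d)"
    unfolding cells_def by (rule sum.union_disjoint) auto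
  also have "\<dots> = (\<Sum>i<n. g (Jump_inc i k)) + (\<Sum>i<n. g (Choice_inc i k))"
    by (simp add: sum.reindex inj_on_def)
  finally show ?thesis by (simp add: sum.distrib)
qed

lemma sum_rate: "(\<Sum>d\<in>cells k. rate d) = real n * (lam + 1)"
  unfolding sum_cells by (simp add: rate_def)

lemma prob_cells:
  assumes h: "0 \<le> h" and "n > 0"
  shows "prob {\<omega>\<in>space M. \<forall>d\<in>cells k. noises h \<omega> d = real (c d)}
    = (\<Prod>d\<in>cells k. (rate d * h) ^ c d / fact (c d)) * exp (- (real n * (lam + 1) * h))"
proof -
  have "cells k \<noteq> {}" using \<open>n > 0\<close> by (auto simp: cells_def)
  have "{\<omega>\<in>space M. \<forall>d\<in>cells k. noises h \<omega> d = real (c d)} =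
     (\<Inter>d\<in>cells k. noise_var h d -` {real (c d)} \<inter> space M)"
    using \<open>cells k \<noteq> {}\<close> by (auto simp: noises_def)
  also have "prob \<dots> = (\<Prod>d\<in>cells k. prob (noise_var h d -` {real (c d)} \<inter> space M))"
    by (rule indep_varsD[OF noise_indep[OF h]]) (use \<open>cells k \<noteq> {}\<close> cells_particle in auto)
  also have "\<dots> = (\<Prod>d\<in>cells k. (rate d * h) ^ c d / fact (c d) * exp (- (rate d * h)))"
  proof (rule prod.cong[OF refl])
    fix d assume "d \<in> cells k"
    have "noise_var h d -` {real (c d)} \<inter> space M = {\<omega>\<in>space M. noises h \<omega> d = real (c d)}"
      by (auto simp: noises_def)
    then show "prob (noise_var h d -` {real (c d)} \<inter> space M) = (rate d * h) ^ c d / fact (c d) * exp (- (rate d * h))"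
      using noise_var_prob[OF h \<open>d \<in> cells k\<close>, of "c d"] by simp
  qed
  also have "\<dots> = (\<Prod>d\<in>cells k. (rate d * h) ^ c d / fact (c d)) * exp (\<Sum>d\<in>cells k. - (rate d * h))"
    by (simp only: prod.distrib exp_sum finite_cells)
  also have "(\<Sum>d\<in>cells k. - (rate d * h)) = - (real n * (lam + 1) * h)"
    by (simp add: sum_negf sum_distrib_right[symmetric] sum_rate)
  finally show ?thesis .
qed

lemma prob_zero:
  assumes h: "0 \<le> h" and "n > 0"
  shows "prob {\<omega>\<in>space M. \<forall>d\<in>cells k. noises h \<omega> d = 0} = exp (- (real n * (lam + 1) * h))"
  using prob_cells[OF assms, of k "\<lambda>_. 0"] by simp

lemma prob_single:
  assumes h: "0 \<le> h" and "n > 0" and d: "d \<in> cells k"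
  shows "prob {\<omega>\<in>space M. single (noises h \<omega>) k d} = rate d * h * exp (- (real n * (lam + 1) * h))"
proof -
  have "{\<omega>\<in>space M. single (noises h \<omega>) k d} = {\<omega>\<in>space M. \<forall>e\<in>cells k. noises h \<omega> e = real (of_bool (e = d))}"
    using d by (auto simp: single_def)
  then have "prob {\<omega>\<in>space M. single (noises h \<omega>) k d} = (\<Prod>e\<in>cells k. (rate e * h) ^ of_bool (e = d) / fact (of_bool (e = d))) * exp (- (real n * (lam + 1) * h))"
    using prob_cells[OF assms(1,2), of k "\<lambda>e. of_bool (e = d)"] by simp
  also have "(\<Prod>e\<in>cells k. (rate e * h) ^ of_bool (e = d) / fact (of_bool (e = d))) = (\<Prod>e\<in>cells k. if e = d then rate d * h else 1)"
    by (rule prod.cong) auto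
  also have "\<dots> = rate d * h" using d by simp
  finally show ?thesis .
qed

text \<open>For counts this means two or more points in the cell, the situation in which the scheme
  stands still although particles may move.\<close>

definition bad_cell :: "(noise \<Rightarrow> real) \<Rightarrow> nat \<Rightarrow> bool" where
  "bad_cell z k \<longleftrightarrow> \<not> (\<forall>d\<in>cells k. z d = 0) \<and> \<not> (\<exists>d\<in>cells k. single z k d)"

lemma single_unique: "d \<in> cells k \<Longrightarrow> e \<in> cells k \<Longrightarrow> single z k d \<Longrightarrow> single z k e \<Longrightarrow> d = e"
  by (force simp: single_def)

lemma sum_single: "(\<Sum>d\<in>cells k. of_bool (single z k d)) = (of_bool (\<exists>d\<in>cells k. single z k d) :: real)"
proof (cases "\<exists>d\<in>cells k. single z k d")
  case True
  then obtain d where d: "d \<in> cells k" "single z k d" by auto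
  have "(\<Sum>e\<in>cells k. of_bool (single z k e)) = (\<Sum>e\<in>cells k. if e = d then 1 else 0 :: real)"
    by (rule sum.cong) (use d single_unique in auto)
  then show ?thesis using d by auto
qed auto

lemma pred_zero_cell [measurable]:
  assumes "0 \<le> h" shows "Measurable.pred M (\<lambda>\<omega>. \<forall>d\<in>cells k. noises h \<omega> d = 0)"
proof (rule pred_intros_finite)
  fix d assume "d \<in> cells k"
  then have [measurable]: "(\<lambda>\<omega>. noises h \<omega> d) \<in> borel_measurable M"
    by (intro noises_measurable[OF assms] cells_particle)
  show "Measurable.pred M (\<lambda>\<omega>. noises h \<omega> d = 0)" by measurable
qed simp

lemma pred_bad_cell [measurable]:
  assumes "0 \<le> h" shows "Measurable.pred M (\<lambda>\<omega>. bad_cell (noises h \<omega>) k)"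
proof -
  have [measurable]: "Measurable.pred M (\<lambda>\<omega>. \<exists>d\<in>cells k. single (noises h \<omega>) k d)"
    by (rule pred_intros_finite) (auto intro: single_measurable noises_measurable[OF assms])
  show ?thesis unfolding bad_cell_def using assms by measurable
qed

lemma expectation_of_bool: "expectation (\<lambda>\<omega>. of_bool (P \<omega>)) = prob {\<omega>\<in>space M. P \<omega>}"
proof -
  have "expectation (\<lambda>\<omega>. of_bool (P \<omega>)) = expectation (indicator {\<omega>\<in>space M. P \<omega>})"
    by (rule Bochner_Integration.integral_cong) auto
  also have "\<dots> = prob ({\<omega>\<in>space M. P \<omega>} \<inter> space M)"
    by (rule Bochner_Integration.integral_indicator)
  also have "{\<omega>\<in>space M. P \<omega>} \<inter> space M = {\<omega>\<in>space M. P \<omega>}" by auto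
  finally show ?thesis .
qed

lemma integrable_of_bool: "Measurable.pred M P \<Longrightarrow> integrable M (\<lambda>\<omega>. of_bool (P \<omega>) :: real)"
  by (rule integrable_const_bound[where B = 1]) auto

text \<open>With y the mean number of points in the cell, the cell is empty with probability exp (-
  y) and single with probability y exp (- y). The rest is at most y^2, by 1 - y \<le> exp (- y)
  multiplied with 1 + y.\<close>

lemma prob_bad_cell:
  assumes h: "0 \<le> h" and "n > 0" and lam: "0 \<le> lam"
  shows "prob {\<omega>\<in>space M. bad_cell (noises h \<omega>) k} \<le> (real n * (lam + 1) * h)\<^sup>2"
proof -
  define y where "y = real n * (lam + 1) * h"
  have sm [measurable]: "Measurable.pred M (\<lambda>\<omega>. single (noises h \<omega>) k d)" if "d \<in> cells k" for d
    using that by (intro single_measurable noises_measurable[OF h])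
  have "of_bool (bad_cell z k) = 1 - of_bool (\<forall>d\<in>cells k. z d = 0) - (\<Sum>d\<in>cells k. of_bool (single z k d) :: real)" for z
    unfolding sum_single by (auto simp: bad_cell_def single_def)
  then have "prob {\<omega>\<in>space M. bad_cell (noises h \<omega>) k} = expectation (\<lambda>\<omega>. 1 - of_bool (\<forall>d\<in>cells k. noises h \<omega> d = 0)
      - (\<Sum>d\<in>cells k. of_bool (single (noises h \<omega>) k d)))"
    by (simp add: expectation_of_bool[symmetric])
  also have "\<dots> = 1 - prob {\<omega>\<in>space M. \<forall>d\<in>cells k. noises h \<omega> d = 0} - (\<Sum>d\<in>cells k. prob {\<omega>\<in>space M. single (noises h \<omega>) k d})"
    using integrable_of_bool[OF pred_zero_cell[OF h, of k]] integrable_of_bool[OF sm]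
    by (simp add: expectation_of_bool prob_space del: sum_of_bool_eq)
  also have "\<dots> = 1 - exp (- y) - (\<Sum>d\<in>cells k. rate d * h * exp (- y))"
    using prob_single[OF h \<open>n > 0\<close>] prob_zero[OF h \<open>n > 0\<close>] by (simp add: y_def)
  also have "(\<Sum>d\<in>cells k. rate d * h * exp (- y)) = y * exp (- y)"
    by (simp add: sum_distrib_right[symmetric] sum_rate y_def)
  also have "1 - exp (- y) - y * exp (- y) \<le> y\<^sup>2"
  proof -
    have "0 \<le> y" using h lam by (simp add: y_def)
    then have "(1 - y) * (1 + y) \<le> exp (- y) * (1 + y)"
      using exp_ge_add_one_self[of "- y"] by (intro mult_right_mono) auto
    then show ?thesis by (simp add: algebra_simps power2_eq_square)
  qed
  finally show ?thesis by (simp add: y_def)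
qed

lemma emp_le_n: "n > 0 \<Longrightarrow> (\<And>i. i < n \<Longrightarrow> w i \<le> x) \<Longrightarrow> empirical_cdf n w x = 1"
  by (simp add: empirical_cdf_sum)

abbreviation "\<FF> \<equiv> empirical_cdf n"

lemma emp_measurable: "(\<lambda>(w, x). \<FF> w x) \<in> borel_measurable (PiM UNIV (\<lambda>_. borel) \<Otimes>\<^sub>M borel)"
proof -
  have [measurable]: "(\<lambda>a. fst a i :: real) \<in> borel_measurable (PiM UNIV (\<lambda>_. borel) \<Otimes>\<^sub>M borel)" for i :: nat
    by (rule measurable_compose[OF measurable_fst measurable_component_singleton]) simp
  show ?thesis unfolding empirical_cdf_sum case_prod_beta by measurable
qed

text \<open>Strictly left of the boundary the truncation is invisible: a minimum with a number above
  \<open>x\<close> is at most \<open>x\<close> just when the other entry is. The boundary meant is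
  the one the scheme uses, at the left end of the cell.\<close>

lemma euler_step_emp:
  fixes z :: "noise \<Rightarrow> real"
  assumes x: "x < B0 + v * (real k * h)"
  defines "w \<equiv> euler h k z"
  shows "\<FF> (euler h (Suc k) z) x = \<FF> w x - (\<Sum>i<n.
     of_bool (single z k (Jump_inc i k)) *
        (of_bool (w i \<le> x) - of_bool (w i + z (Mark i (Suc (jump_count z i k))) \<le> x))
   + of_bool (single z k (Choice_inc i k)) *
        (of_bool (w i \<le> x) - of_bool (max (w i) (w (nat \<lfloor>z (Pick i (Suc (choice_count z i k)))\<rfloor>)) \<le> x))) / real n"
proof -
  have "of_bool (euler h (Suc k) z i \<le> x) = (of_bool (w i \<le> x) - (
     of_bool (single z k (Jump_inc i k)) *
        (of_bool (w i \<le> x) - of_bool (w i + z (Mark i (Suc (jump_count z i k))) \<le> x))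
   + of_bool (single z k (Choice_inc i k)) *
        (of_bool (w i \<le> x) - of_bool (max (w i) (w (nat \<lfloor>z (Pick i (Suc (choice_count z i k)))\<rfloor>)) \<le> x)) ) :: real)"
    if "i < n" for i
  proof -
    have "\<not> (single z k (Jump_inc i k) \<and> single z k (Choice_inc i k))"
      using single_unique[of "Jump_inc i k" k "Choice_inc i k" z] that by (auto simp: cells_def)
    then show ?thesis using that x by (auto simp: w_def min_le_iff_disj)
  qed
  then show ?thesis
    by (simp add: empirical_cdf_sum sum_subtractf diff_divide_distrib)
qed

text \<open>At most one particle moves in a cell, so the distribution function changes by at most 1
  / n, and only if the cell is single. In mean and over a unit of time these squares add up to
  sampling noise of order 1 / n.\<close>

lemma euler_step_change:
  "(\<FF> (euler h (Suc k) z) x - \<FF> (euler h k z) x)\<^sup>2 \<le> (\<Sum>d\<in>cells k. of_bool (single z k d)) / (real n)\<^sup>2"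
proof (cases "\<exists>d\<in>cells k. single z k d")
  case True
  then obtain d where d: "d \<in> cells k" "single z k d" by auto
  define i where "i = noise_particle d"
  have i: "i < n" using d cells_particle by (auto simp: i_def)
  have eq: "euler h (Suc k) z j = euler h k z j" if "j \<noteq> i" "j < n" for j
  proof -
    have "\<not> single z k (Jump_inc j k)" "\<not> single z k (Choice_inc j k)"
      using single_unique[OF d(1) _ d(2), of "Jump_inc j k"] single_unique[OF d(1) _ d(2), of "Choice_inc j k"] that
      by (auto simp: cells_def i_def)
    then show ?thesis by simp
  qed
  have "\<FF> (euler h (Suc k) z) x - \<FF> (euler h k z) x =
     (\<Sum>j<n. of_bool (euler h (Suc k) z j \<le> x) - of_bool (euler h k z j \<le> x)) / real n"
    by (simp add: empirical_cdf_sum sum_subtractf diff_divide_distrib del: euler.simps sum_of_bool_eq)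
  also have "(\<Sum>j<n. of_bool (euler h (Suc k) z j \<le> x) - of_bool (euler h k z j \<le> x) :: real) =
    (\<Sum>j<n. if j = i then of_bool (euler h (Suc k) z i \<le> x) - of_bool (euler h k z i \<le> x) else 0)"
    by (rule sum.cong) (use eq in \<open>auto simp del: euler.simps\<close>)
  also have "\<dots> = of_bool (euler h (Suc k) z i \<le> x) - of_bool (euler h k z i \<le> x)"
    using i by simp
  finally have "(\<FF> (euler h (Suc k) z) x - \<FF> (euler h k z) x)\<^sup>2 =
     (of_bool (euler h (Suc k) z i \<le> x) - of_bool (euler h k z i \<le> x))\<^sup>2 / (real n)\<^sup>2"
    by (simp add: power_divide del: euler.simps)
  also have "\<dots> \<le> 1 / (real n)\<^sup>2"
    by (intro divide_right_mono) (auto simp del: euler.simps)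
  finally show ?thesis using True by (simp add: sum_single del: sum_of_bool_eq)
next
  case False
  then have "euler h (Suc k) z j = euler h k z j" for j
    by (auto simp: cells_def)
  then have "euler h (Suc k) z = euler h k z" by auto
  then show ?thesis by (simp add: sum_nonneg del: euler.simps)
qed

lemma mu_eq: "i < n \<Longrightarrow> distr M borel (noise_var h (Mark i c)) = \<mu>"
proof -
  assume "i < n"
  have "noise_var h (Mark i c) = S i c" by (auto simp: noise_var_def)
  then show ?thesis using size_distr[OF \<open>i < n\<close>] by simp
qed

lemma pick_eq:
  assumes "i < n" "2 \<le> n"
  shows "distr M borel (noise_var h (Pick i c)) = distr (measure_pmf (pmf_of_set ({..<n} - {i}))) borel real"
proof -
  have [measurable]: "C i c \<in> measurable M (count_space UNIV)" using target_measurable assms by auto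
  have "noise_var h (Pick i c) = real \<circ> C i c" by (auto simp: noise_var_def)
  then have "distr M borel (noise_var h (Pick i c)) = distr (distr M (count_space UNIV) (C i c)) borel real"
    by (simp add: distr_distr)
  then show ?thesis using target_distr[OF assms(1)] by simp
qed

lemma pick_integral:
  fixes g :: "real \<Rightarrow> real"
  assumes "i < n" "2 \<le> n" "g \<in> borel_measurable borel"
  shows "(\<integral>s. g s \<partial>distr M borel (noise_var h (Pick i c))) = (\<Sum>j\<in>{..<n} - {i}. g (real j)) / real (n - 1)"
proof -
  have "{..<n} - {i} \<noteq> {}"
  proof -
    have "(if i = 0 then 1 else 0) \<in> {..<n} - {i}" using assms(2) by auto
    then show ?thesis by blast
  qed
  then show ?thesis
    using assms unfolding pick_eq[OF assms(1,2)]
    by (subst integral_distr) (auto simp: integral_pmf_of_set)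
qed

end

lemma (in prob_space) abs_expectation_le:
  fixes f :: "'a \<Rightarrow> real"
  assumes "f \<in> borel_measurable M" "\<And>x. \<bar>f x\<bar> \<le> B"
  shows "\<bar>expectation f\<bar> \<le> B"
proof -
  have "integrable M f" by (rule integrable_const_bound[where B = B]) (use assms in auto)
  have "\<bar>expectation f\<bar> \<le> expectation (\<lambda>x. \<bar>f x\<bar>)" by (rule integral_abs_bound)
  also have "\<dots> \<le> B" by (rule integral_le_const) (use assms \<open>integrable M f\<close> in auto)
  finally show ?thesis .
qed

section \<open>Mean square deviation over one cell\<close>

context moving_boundary_system begin

lemma mu_prob: "0 < n \<Longrightarrow> prob_space \<mu>" "0 < n \<Longrightarrow> sets \<mu> = sets borel"
proof -
  assume "0 < n"
  then have "random_variable borel (S 0 0)" by (rule size_measurable)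
  from prob_space_distr[OF this] show "prob_space \<mu>" using size_distr[OF \<open>0 < n\<close>] by simp
  show "sets \<mu> = sets borel" using size_distr[OF \<open>0 < n\<close>, of 0] by (metis sets_distr)
qed

text \<open>\<open>fresh_noise\<close> for the jump and the choice of each particle. The weight
  \<open>a\<close> is left free because \<open>one_step\<close> takes the deviation itself for it;
  \<epsilon> is the probability of an empty cell and enters through
  \<open>prob_single\<close>.\<close>

lemma expected_change:
  fixes a :: "(nat \<Rightarrow> real) \<Rightarrow> real"
  assumes h: "0 \<le> h" and n: "2 \<le> n" and x: "x < B0 + v * (real k * h)"
    and a[measurable]: "a \<in> borel_measurable (PiM UNIV (\<lambda>_. borel))" and a1: "\<And>w. \<bar>a w\<bar> \<le> 1"
  defines "W \<equiv> \<lambda>\<omega>. euler h k (noises h \<omega>)" and "W' \<equiv> \<lambda>\<omega>. euler h (Suc k) (noises h \<omega>)"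
    and "\<epsilon> \<equiv> exp (- (real n * (lam + 1) * h))"
  shows "expectation (\<lambda>\<omega>. a (W \<omega>) * (\<FF> (W' \<omega>) x - \<FF> (W \<omega>) x)) =
      - (lam * h * \<epsilon>) * expectation (\<lambda>\<omega>. a (W \<omega>) * (\<FF> (W \<omega>) x - (\<integral>s. \<FF> (W \<omega>) (x - s) \<partial>\<mu>)))
      - (h * \<epsilon> * (real n / real (n - 1))) * expectation (\<lambda>\<omega>. a (W \<omega>) * (\<FF> (W \<omega>) x * (1 - \<FF> (W \<omega>) x)))"
proof -
  let ?Z = "noises h"
  interpret \<mu>: prob_space \<mu> using mu_prob n by auto
  have s\<mu>[measurable_cong]: "sets \<mu> = sets borel" using mu_prob n by auto
  have Zm: "noise_particle d < n \<Longrightarrow> (\<lambda>\<omega>. ?Z \<omega> d) \<in> borel_measurable M" for d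
    by (rule noises_measurable[OF h])
  have Wm[measurable]: "W \<in> measurable M (PiM UNIV (\<lambda>_. borel))"
    unfolding W_def by (rule euler_measurable[OF Zm])
  define \<phi>J where "\<phi>J i w s = a w * (of_bool (w i \<le> x) - of_bool (w i + s \<le> x))" for i w s
  define \<phi>C where "\<phi>C i w s = a w * (of_bool (w i \<le> x) - of_bool (max (w i) (w (nat \<lfloor>s\<rfloor>)) \<le> x))" for i w and s :: real
  have wc[measurable]: "(\<lambda>b. fst b i :: real) \<in> borel_measurable (PiM UNIV (\<lambda>_. borel) \<Otimes>\<^sub>M borel)" for i :: nat
    by (rule measurable_compose[OF measurable_fst measurable_component_singleton]) simp
  have [measurable]: "(\<lambda>b. fst b (nat \<lfloor>snd b :: real\<rfloor>) :: real) \<in> borel_measurable (PiM UNIV (\<lambda>_. borel) \<Otimes>\<^sub>M borel)"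
    by (rule measurable_compose_countable[where f = "\<lambda>i b. fst b i"]) measurable
  have [measurable]: "(\<lambda>b. a (fst b)) \<in> borel_measurable (PiM UNIV (\<lambda>_. borel) \<Otimes>\<^sub>M borel)"
    by measurable
  have \<phi>Jm: "(\<lambda>(w, s). \<phi>J i w s) \<in> borel_measurable (PiM UNIV (\<lambda>_. borel) \<Otimes>\<^sub>M borel)" for i
    unfolding \<phi>J_def case_prod_beta by measurable
  have \<phi>Cm: "(\<lambda>(w, s). \<phi>C i w s) \<in> borel_measurable (PiM UNIV (\<lambda>_. borel) \<Otimes>\<^sub>M borel)" for i
    unfolding \<phi>C_def case_prod_beta by measurable
  have [measurable]: "\<phi>J i w \<in> borel_measurable borel" "\<phi>C i w \<in> borel_measurable borel" for i w
    using measurable_compose[OF measurable_Pair1'[of w "PiM UNIV (\<lambda>_. borel)" borel] \<phi>Jm[of i]]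
      measurable_compose[OF measurable_Pair1'[of w "PiM UNIV (\<lambda>_. borel)" borel] \<phi>Cm[of i]] by (simp_all add: space_PiM)
  have \<phi>J1: "\<bar>\<phi>J i w s\<bar> \<le> 1" and \<phi>C1: "\<bar>\<phi>C i w s\<bar> \<le> 1" for i w s
    using a1[of w] by (auto simp: \<phi>J_def \<phi>C_def)
  define MJ where "MJ i \<omega> = ?Z \<omega> (Mark i (Suc (jump_count (?Z \<omega>) i k)))" for i \<omega>
  define MC where "MC i \<omega> = ?Z \<omega> (Pick i (Suc (choice_count (?Z \<omega>) i k)))" for i \<omega>
  have MJm[measurable]: "MJ i \<in> borel_measurable M" and MCm[measurable]: "MC i \<in> borel_measurable M" if "i < n" for i
    unfolding MJ_def MC_def using mark_measurable[OF Zm that] by auto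
  have [measurable]: "(\<lambda>\<omega>. \<phi>J i (W \<omega>) (MJ i \<omega>)) \<in> borel_measurable M"
      "(\<lambda>\<omega>. \<phi>C i (W \<omega>) (MC i \<omega>)) \<in> borel_measurable M" if "i < n" for i
    using measurable_compose[OF measurable_Pair[OF Wm MJm[OF that]] \<phi>Jm[of i]]
      measurable_compose[OF measurable_Pair[OF Wm MCm[OF that]] \<phi>Cm[of i]] by simp_all
  have cJ: "Jump_inc i k \<in> cells k" and cC: "Choice_inc i k \<in> cells k" if "i < n" for i
    using that by (auto simp: cells_def)
  have [measurable]: "Measurable.pred M (\<lambda>\<omega>. single (?Z \<omega>) k (Jump_inc i k))"
     "Measurable.pred M (\<lambda>\<omega>. single (?Z \<omega>) k (Choice_inc i k))" if "i < n" for i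
    using single_measurable[OF Zm cJ[OF that]] single_measurable[OF Zm cC[OF that]] by auto
  have int1: "integrable M (\<lambda>\<omega>. of_bool (single (?Z \<omega>) k (Jump_inc i k)) * \<phi>J i (W \<omega>) (MJ i \<omega>))"
    "integrable M (\<lambda>\<omega>. of_bool (single (?Z \<omega>) k (Choice_inc i k)) * \<phi>C i (W \<omega>) (MC i \<omega>))" if "i < n" for i
    by (rule integrable_const_bound[where B = 1]; use that \<phi>J1 \<phi>C1 in \<open>auto simp: abs_mult\<close>)+
  have EJ: "expectation (\<lambda>\<omega>. of_bool (single (?Z \<omega>) k (Jump_inc i k)) * \<phi>J i (W \<omega>) (MJ i \<omega>)) =
     lam * h * \<epsilon> * expectation (\<lambda>\<omega>. \<integral>s. \<phi>J i (W \<omega>) s \<partial>\<mu>)" if "i < n" for i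
    using fresh_noise[OF h that cJ[OF that], where mk = "Mark i" and cnt = "\<lambda>z. jump_count z i k" and \<nu> = \<mu>
        and \<phi> = "\<phi>J i" and B = 1] mu_eq[OF that] \<phi>Jm \<phi>J1 prob_single[OF h _ cJ[OF that]] n
    by (simp add: W_def MJ_def \<epsilon>_def rate_def)
  define \<nu> where "\<nu> i = distr M borel (noise_var h (Pick i 0))" for i
  have EC: "expectation (\<lambda>\<omega>. of_bool (single (?Z \<omega>) k (Choice_inc i k)) * \<phi>C i (W \<omega>) (MC i \<omega>)) =
     h * \<epsilon> * expectation (\<lambda>\<omega>. \<integral>s. \<phi>C i (W \<omega>) s \<partial>\<nu> i)" if "i < n" for i
    using fresh_noise[OF h that cC[OF that], where mk = "Pick i" and cnt = "\<lambda>z. choice_count z i k" and \<nu> = "\<nu> i"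
        and \<phi> = "\<phi>C i" and B = 1] pick_eq[OF that n] \<phi>Cm \<phi>C1 prob_single[OF h _ cC[OF that]] n
    by (simp add: W_def MC_def \<epsilon>_def rate_def \<nu>_def)
  have sumJ: "(\<Sum>i<n. \<integral>s. \<phi>J i w s \<partial>\<mu>) = real n * (a w * (\<FF> w x - (\<integral>s. \<FF> w (x - s) \<partial>\<mu>)))" for w
  proof -
    have m[measurable]: "Measurable.pred borel (\<lambda>s. w i + s \<le> x)" for i by measurable
    have i1: "integrable \<mu> (\<lambda>s. of_bool (w i + s \<le> x) :: real)" for i
      by (rule \<mu>.integrable_const_bound[where B = 1]) auto
    have "(\<integral>s. \<phi>J i w s \<partial>\<mu>) = a w * (of_bool (w i \<le> x) - (\<integral>s. of_bool (w i + s \<le> x) \<partial>\<mu>))" for i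
      unfolding \<phi>J_def using i1[of i] by (simp add: \<mu>.prob_space)
    then have "(\<Sum>i<n. \<integral>s. \<phi>J i w s \<partial>\<mu>) = a w * ((\<Sum>i<n. of_bool (w i \<le> x)) - (\<Sum>i<n. \<integral>s. of_bool (w i + s \<le> x) \<partial>\<mu>))"
      by (simp add: sum_distrib_left[symmetric] sum_subtractf del: sum_of_bool_eq)
    also have "(\<Sum>i<n. \<integral>s. of_bool (w i + s \<le> x) \<partial>\<mu>) = (\<integral>s. (\<Sum>i<n. of_bool (w i + s \<le> x) :: real) \<partial>\<mu>)"
      by (rule Bochner_Integration.integral_sum[symmetric]) (rule i1)
    also have "(\<integral>s. (\<Sum>i<n. of_bool (w i + s \<le> x)) \<partial>\<mu>) = (\<integral>s. real n * \<FF> w (x - s) \<partial>\<mu>)"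
      using n by (intro Bochner_Integration.integral_cong) (auto simp: empirical_cdf_sum le_diff_eq simp del: sum_of_bool_eq)
    also have "(\<Sum>i<n. of_bool (w i \<le> x)) = real n * \<FF> w x"
      using n by (simp add: empirical_cdf_sum del: sum_of_bool_eq)
    finally show ?thesis by (simp add: algebra_simps)
  qed
  have sumC: "(\<Sum>i<n. \<integral>s. \<phi>C i w s \<partial>\<nu> i) = real n * (real n / real (n - 1)) * (a w * (\<FF> w x * (1 - \<FF> w x)))" for w
  proof -
    have "(\<integral>s. \<phi>C i w s \<partial>\<nu> i) = a w * of_bool (w i \<le> x) * (real n * (1 - \<FF> w x)) / real (n - 1)" if "i < n" for i
    proof -
      have "(\<integral>s. \<phi>C i w s \<partial>\<nu> i) = (\<Sum>j\<in>{..<n} - {i}. \<phi>C i w (real j)) / real (n - 1)"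
        unfolding \<nu>_def by (rule pick_integral[OF that n]) measurable
      \<comment> \<open>A particle that chose itself would not move, so the missing index can be
        added to the sum. The denominator remains n - 1, whence the factor n / (n - 1).\<close>
      also have "(\<Sum>j\<in>{..<n} - {i}. \<phi>C i w (real j)) = (\<Sum>j<n. \<phi>C i w (real j))"
        by (rule sum.mono_neutral_left) (auto simp: \<phi>C_def)
      also have "\<dots> = (\<Sum>j<n. a w * of_bool (w i \<le> x) * (1 - of_bool (w j \<le> x)))"
        by (rule sum.cong) (auto simp: \<phi>C_def)
      also have "\<dots> = a w * of_bool (w i \<le> x) * (real n - (\<Sum>j<n. of_bool (w j \<le> x)))"
        by (simp add: sum_distrib_left[symmetric] sum_subtractf del: sum_of_bool_eq)
      also have "(\<Sum>j<n. of_bool (w j \<le> x)) = real n * \<FF> w x"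
        using n by (simp add: empirical_cdf_sum del: sum_of_bool_eq)
      finally show ?thesis by (simp add: algebra_simps)
    qed
    then have "(\<Sum>i<n. \<integral>s. \<phi>C i w s \<partial>\<nu> i) = (\<Sum>i<n. of_bool (w i \<le> x) * (a w * (real n * (1 - \<FF> w x)) / real (n - 1)))"
      by (intro sum.cong) auto
    also have "\<dots> = (\<Sum>i<n. of_bool (w i \<le> x)) * (a w * (real n * (1 - \<FF> w x)) / real (n - 1))"
      by (simp only: sum_distrib_right)
    also have "(\<Sum>i<n. of_bool (w i \<le> x)) = real n * \<FF> w x"
      using n by (simp add: empirical_cdf_sum del: sum_of_bool_eq)
    finally show ?thesis by (simp add: algebra_simps diff_divide_distrib)
  qed
  have intb: "integrable M (\<lambda>\<omega>. \<integral>s. \<phi>J i (W \<omega>) s \<partial>\<mu>)" "integrable M (\<lambda>\<omega>. \<integral>s. \<phi>C i (W \<omega>) s \<partial>\<nu> i)" if "i < n" for i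
  proof -
    have P: "prob_space (\<nu> i)" unfolding \<nu>_def by (rule prob_space_distr) (use that h in auto)
    interpret \<nu>: prob_space "\<nu> i" by (rule P)
    have [measurable_cong]: "sets (\<nu> i) = sets borel" by (simp add: \<nu>_def)
    have [measurable]: "(\<lambda>w. \<integral>s. \<phi>J i w s \<partial>\<mu>) \<in> borel_measurable (PiM UNIV (\<lambda>_. borel))"
      by (rule \<mu>.borel_measurable_lebesgue_integral) (use \<phi>Jm in \<open>simp cong: measurable_cong_sets add: sets_pair_measure_cong[OF refl s\<mu>]\<close>)
    have [measurable]: "(\<lambda>w. \<integral>s. \<phi>C i w s \<partial>\<nu> i) \<in> borel_measurable (PiM UNIV (\<lambda>_. borel))"
      by (rule \<nu>.borel_measurable_lebesgue_integral) (use \<phi>Cm in \<open>simp cong: measurable_cong_sets add: sets_pair_measure_cong[OF refl \<open>sets (\<nu> i) = sets borel\<close>]\<close>)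
    have "\<bar>\<integral>s. \<phi>J i w s \<partial>\<mu>\<bar> \<le> 1" for w
      by (rule \<mu>.abs_expectation_le) (use \<phi>J1 in auto)
    then show "integrable M (\<lambda>\<omega>. \<integral>s. \<phi>J i (W \<omega>) s \<partial>\<mu>)"
      by (intro integrable_const_bound[where B = 1]) auto
    have "\<bar>\<integral>s. \<phi>C i w s \<partial>\<nu> i\<bar> \<le> 1" for w
      by (rule \<nu>.abs_expectation_le) (use \<phi>C1 in auto)
    then show "integrable M (\<lambda>\<omega>. \<integral>s. \<phi>C i (W \<omega>) s \<partial>\<nu> i)"
      by (intro integrable_const_bound[where B = 1]) auto
  qed
  have "expectation (\<lambda>\<omega>. a (W \<omega>) * (\<FF> (W' \<omega>) x - \<FF> (W \<omega>) x)) =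
    expectation (\<lambda>\<omega>. - (\<Sum>i<n. of_bool (single (?Z \<omega>) k (Jump_inc i k)) * \<phi>J i (W \<omega>) (MJ i \<omega>)
       + of_bool (single (?Z \<omega>) k (Choice_inc i k)) * \<phi>C i (W \<omega>) (MC i \<omega>)) / real n)"
    unfolding W'_def W_def
    by (subst euler_step_emp[OF x]) (simp add: \<phi>J_def \<phi>C_def MJ_def MC_def W_def sum_distrib_left algebra_simps del: sum_of_bool_eq)
  also have "\<dots> = - (\<Sum>i<n. lam * h * \<epsilon> * expectation (\<lambda>\<omega>. \<integral>s. \<phi>J i (W \<omega>) s \<partial>\<mu>)
       + h * \<epsilon> * expectation (\<lambda>\<omega>. \<integral>s. \<phi>C i (W \<omega>) s \<partial>\<nu> i)) / real n"
    using int1 by (simp add: EJ EC)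
  also have "\<dots> = - (lam * h * \<epsilon> * expectation (\<lambda>\<omega>. \<Sum>i<n. \<integral>s. \<phi>J i (W \<omega>) s \<partial>\<mu>)
       + h * \<epsilon> * expectation (\<lambda>\<omega>. \<Sum>i<n. \<integral>s. \<phi>C i (W \<omega>) s \<partial>\<nu> i)) / real n"
    using intb by (simp add: sum.distrib sum_distrib_left)
  finally have e: "expectation (\<lambda>\<omega>. a (W \<omega>) * (\<FF> (W' \<omega>) x - \<FF> (W \<omega>) x)) = \<dots>" .
  have alg: "- (p * (real n * A) + q * (real n * r * Bq)) / real n = - p * A - q * r * Bq" for p q r A Bq
    using n by (simp add: field_simps)
  show ?thesis unfolding e sumJ sumC integral_mult_right_zero alg ..
qed

lemma emp_comp_measurable:
  assumes "W \<in> measurable N (PiM UNIV (\<lambda>_. borel))" "g \<in> borel_measurable N"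
  shows "(\<lambda>\<omega>. \<FF> (W \<omega>) (g \<omega>)) \<in> borel_measurable N"
  using measurable_compose[OF measurable_Pair[OF assms] emp_measurable] by simp

definition variance_at :: "real \<Rightarrow> nat \<Rightarrow> (real \<Rightarrow> real) \<Rightarrow> real \<Rightarrow> real" where
  "variance_at h k u x = expectation (\<lambda>\<omega>. (\<FF> (euler h k (noises h \<omega>)) x - u x)\<^sup>2)"

text \<open>The square of a + (F' - F) - \<delta> is expanded, where \<open>a\<close> is the old
  deviation and \<delta> the change of \<open>u\<close>. The terms linear in the changes are known
  in mean from \<open>expected_change\<close> and leave, to first order, h times the difference of
  two drifts weighted by \<open>a\<close>. The quadratic terms are of order h / n and h^2.\<close>

lemma one_step:
  fixes u :: "real \<Rightarrow> real"
  assumes h: "0 \<le> h" and n: "2 \<le> n" and lam: "0 \<le> lam" and x: "x < B0 + v * (real k * h)"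
    and u[measurable]: "u \<in> borel_measurable borel" and u01: "\<And>y. 0 \<le> u y" "\<And>y. u y \<le> 1"
    and g: "g = lam * ((\<integral>s. u (x - s) \<partial>\<mu>) - u x) - u x * (1 - u x)"
    and d1: "\<bar>u' x - u x - h * g\<bar> \<le> K0 * h\<^sup>2" and d2: "\<bar>u' x - u x\<bar> \<le> (lam + 1) * h"
  shows "variance_at h (Suc k) u' x \<le> variance_at h k u x
     + h * (lam * (\<integral>s. variance_at h k u (x - s) \<partial>\<mu>) + 2 * variance_at h k u x)
     + (2 * lam + 6) * h / real n + (4 * real n * (lam + 1)\<^sup>2 + 2 * K0 + 2 * (lam + 1)\<^sup>2) * h\<^sup>2"
proof -
  let ?Z = "noises h"
  interpret \<mu>: prob_space \<mu> using mu_prob n by auto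
  interpret M\<mu>: pair_prob_space M \<mu> ..
  have s\<mu>[measurable_cong]: "sets \<mu> = sets borel" using mu_prob n by auto
  have Zm: "noise_particle d < n \<Longrightarrow> (\<lambda>\<omega>. ?Z \<omega> d) \<in> borel_measurable M" for d
    by (rule noises_measurable[OF h])
  define W where "W = (\<lambda>\<omega>. euler h k (?Z \<omega>))"
  define W' where "W' = (\<lambda>\<omega>. euler h (Suc k) (?Z \<omega>))"
  have Wm[measurable]: "W \<in> measurable M (PiM UNIV (\<lambda>_. borel))" "W' \<in> measurable M (PiM UNIV (\<lambda>_. borel))"
    unfolding W_def W'_def by (rule euler_measurable[OF Zm], assumption)+
  have [measurable]: "(\<lambda>\<omega>. \<FF> (W \<omega>) y) \<in> borel_measurable M" "(\<lambda>\<omega>. \<FF> (W' \<omega>) y) \<in> borel_measurable M" for y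
    by (rule emp_comp_measurable; measurable)+
  have [measurable]: "(\<lambda>b. \<FF> (W (fst b)) (x - snd b)) \<in> borel_measurable (M \<Otimes>\<^sub>M \<mu>)"
    by (rule emp_comp_measurable; measurable)
  define F where "F \<omega> y = \<FF> (W \<omega>) y" for \<omega> y
  define F' where "F' \<omega> = \<FF> (W' \<omega>) x" for \<omega>
  have [measurable]: "(\<lambda>\<omega>. F \<omega> y) \<in> borel_measurable M" "F' \<in> borel_measurable M" for y
    unfolding F_def F'_def by measurable
  have [measurable]: "(\<lambda>b. F (fst b) (x - snd b)) \<in> borel_measurable (M \<Otimes>\<^sub>M \<mu>)"
    unfolding F_def by measurable
  have F01: "0 \<le> F \<omega> y" "F \<omega> y \<le> 1" for \<omega> y
    by (auto simp: F_def empirical_cdf_bounds)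
  have F'01: "0 \<le> F' \<omega>" "F' \<omega> \<le> 1" for \<omega>
    by (auto simp: F'_def empirical_cdf_bounds)
  have [measurable]: "(\<lambda>s. F \<omega> (x - s)) \<in> borel_measurable borel" for \<omega>
    unfolding F_def empirical_cdf_sum by measurable
  define V where "V y = variance_at h k u y" for y
  have V: "V y = expectation (\<lambda>\<omega>. (F \<omega> y - u y)\<^sup>2)" for y
    by (simp add: V_def variance_at_def F_def W_def)
  define a where "a \<omega> = F \<omega> x - u x" for \<omega>
  have [measurable]: "a \<in> borel_measurable M" unfolding a_def by measurable
  have Va: "V x = expectation (\<lambda>\<omega>. (a \<omega>)\<^sup>2)" by (simp add: V a_def)
  have a1: "\<bar>a \<omega>\<bar> \<le> 1" for \<omega> using F01[of \<omega> x] u01[of x] by (auto simp: a_def)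
  define IF where "IF \<omega> = (\<integral>s. F \<omega> (x - s) \<partial>\<mu>)" for \<omega>
  have [measurable]: "IF \<in> borel_measurable M"
    unfolding IF_def by (rule \<mu>.borel_measurable_lebesgue_integral) (simp add: case_prod_beta)
  have iF: "integrable \<mu> (\<lambda>s. F \<omega> (x - s))" for \<omega>
    by (rule \<mu>.integrable_const_bound[where B = 1]) (use F01 in auto)
  have iu: "integrable \<mu> (\<lambda>s. u (x - s))"
    by (rule \<mu>.integrable_const_bound[where B = 1]) (use u01 in auto)
  have IF01: "0 \<le> IF \<omega>" "IF \<omega> \<le> 1" for \<omega>
    unfolding IF_def by (rule \<mu>.integral_ge_const \<mu>.integral_le_const; use iF F01 in auto)+
  define Iu where "Iu = (\<integral>s. u (x - s) \<partial>\<mu>)"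
  define \<epsilon> where "\<epsilon> = exp (- (real n * (lam + 1) * h))"
  have \<epsilon>: "0 \<le> \<epsilon>" "\<epsilon> \<le> 1" "1 - \<epsilon> \<le> real n * (lam + 1) * h"
    using exp_ge_add_one_self[of "- (real n * (lam + 1) * h)"] h lam by (auto simp: \<epsilon>_def)
  define \<delta> where "\<delta> = u' x - u x"
  have ib: "integrable M f" if "f \<in> borel_measurable M" "\<And>\<omega>. \<bar>f \<omega>\<bar> \<le> 100" for f :: "'w \<Rightarrow> real"
    by (rule integrable_const_bound[where B = 100]) (use that in auto)
  have dF1: "\<bar>F' \<omega> - F \<omega> x\<bar> \<le> 1" for \<omega> using F01[of \<omega> x] F'01[of \<omega>] by auto
  have m1: "\<bar>p * q\<bar> \<le> 1" if "\<bar>p\<bar> \<le> 1" "\<bar>q\<bar> \<le> 1" for p q :: real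
    using that by (simp add: abs_mult mult_le_one)
  have b1: "\<bar>a \<omega> * (F' \<omega> - F \<omega> x)\<bar> \<le> 1" "\<bar>(a \<omega>)\<^sup>2\<bar> \<le> 1" "\<bar>(F' \<omega> - F \<omega> x)\<^sup>2\<bar> \<le> 1"
    "\<bar>a \<omega> * (F \<omega> x - IF \<omega>)\<bar> \<le> 1" "\<bar>a \<omega> * (F \<omega> x * (1 - F \<omega> x))\<bar> \<le> 1" for \<omega>
    using a1[of \<omega>] dF1[of \<omega>] F01[of \<omega> x] IF01[of \<omega>]
    by (auto simp: abs_square_le_1 intro!: m1)
  have i: "integrable M (\<lambda>\<omega>. a \<omega> * (F' \<omega> - F \<omega> x))" "integrable M (\<lambda>\<omega>. (a \<omega>)\<^sup>2)"
    "integrable M (\<lambda>\<omega>. (F' \<omega> - F \<omega> x)\<^sup>2)" "integrable M (\<lambda>\<omega>. a \<omega> * (F \<omega> x - IF \<omega>))"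
    "integrable M (\<lambda>\<omega>. a \<omega> * (F \<omega> x * (1 - F \<omega> x)))" "integrable M a"
    by (rule ib, measurable, rule order_trans[OF b1(1)] order_trans[OF b1(2)] order_trans[OF b1(3)]
        order_trans[OF b1(4)] order_trans[OF b1(5)] order_trans[OF a1], simp)+
  define P where "P = expectation (\<lambda>\<omega>. a \<omega> * (F \<omega> x - IF \<omega>))"
  define Q where "Q = expectation (\<lambda>\<omega>. a \<omega> * (F \<omega> x * (1 - F \<omega> x)))"
  have bE: "\<bar>expectation f\<bar> \<le> 1" if "integrable M f" "\<And>\<omega>. \<bar>f \<omega>\<bar> \<le> 1" for f :: "'w \<Rightarrow> real"
    by (rule abs_expectation_le) (use that in auto)
  have PQ: "\<bar>P\<bar> \<le> 1" "\<bar>Q\<bar> \<le> 1" "\<bar>expectation a\<bar> \<le> 1"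
    unfolding P_def Q_def by (rule bE; use i b1 a1 in auto)+
  have am: "(\<lambda>w. \<FF> w x - u x) \<in> borel_measurable (PiM UNIV (\<lambda>_. borel))"
    by (intro borel_measurable_diff emp_comp_measurable) auto
  have w1: "\<bar>\<FF> w x - u x\<bar> \<le> 1" for w
    using empirical_cdf_bounds[of n w x] u01[of x] by (auto simp: abs_le_iff)
  have E1: "expectation (\<lambda>\<omega>. a \<omega> * (F' \<omega> - F \<omega> x)) = - (lam * h * \<epsilon>) * P - (h * \<epsilon> * (real n / real (n - 1))) * Q"
    unfolding P_def Q_def a_def F_def F'_def IF_def W_def W'_def \<epsilon>_def
    by (rule expected_change[OF h n x am w1])
  have E2: "expectation (\<lambda>\<omega>. (F' \<omega> - F \<omega> x)\<^sup>2) \<le> (lam + 1) * h / real n"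
  proof -
    have sm [measurable]: "Measurable.pred M (\<lambda>\<omega>. single (noises h \<omega>) k d)" if "d \<in> cells k" for d
      using that by (intro single_measurable noises_measurable[OF h])
    have isg: "integrable M (\<lambda>\<omega>. of_bool (single (?Z \<omega>) k d) :: real)" if "d \<in> cells k" for d
      by (rule integrable_of_bool[OF sm[OF that]])
    have "expectation (\<lambda>\<omega>. (F' \<omega> - F \<omega> x)\<^sup>2) \<le> expectation (\<lambda>\<omega>. (\<Sum>d\<in>cells k. of_bool (single (?Z \<omega>) k d)) / (real n)\<^sup>2)"
      using isg by (intro integral_mono i) (auto simp: F_def F'_def W_def W'_def simp del: sum_of_bool_eq euler.simps
          intro!: euler_step_change Bochner_Integration.integrable_sum)
    also have "\<dots> = (\<Sum>d\<in>cells k. rate d * h * \<epsilon>) / (real n)\<^sup>2"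
      using isg n prob_single[OF h, of _ k]
      by (simp add: expectation_of_bool \<epsilon>_def del: sum_of_bool_eq)
    also have "\<dots> = real n * (lam + 1) * h * \<epsilon> / (real n)\<^sup>2"
      by (simp add: sum_distrib_right[symmetric] sum_rate)
    also have "\<dots> \<le> real n * (lam + 1) * h * 1 / (real n)\<^sup>2"
      using \<epsilon> h lam by (intro divide_right_mono mult_left_mono) auto
    also have "\<dots> = (lam + 1) * h / real n"
      using n by (simp add: power2_eq_square field_simps)
    finally show ?thesis .
  qed
  \<comment> \<open>The difference of the drifts of \<open>F\<close> and \<open>u\<close>, weighted
    by the deviation. For the jumps, 2ab \<le> a^2 + b^2 separates the deviations at x and at x - s.
    For the copying, F (1 - F) - u (1 - u) = (F - u) (1 - F - u), and the last factor is at least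
    -1.\<close>
  have key: "2 * (- lam * (a \<omega> * (F \<omega> x - IF \<omega>)) - a \<omega> * (F \<omega> x * (1 - F \<omega> x)) - a \<omega> * g)
     \<le> lam * (\<integral>s. (F \<omega> (x - s) - u (x - s))\<^sup>2 \<partial>\<mu>) + 2 * (a \<omega>)\<^sup>2" for \<omega>
  proof -
    have i2: "integrable \<mu> (\<lambda>s. (F \<omega> (x - s) - u (x - s))\<^sup>2)"
    proof (rule \<mu>.integrable_const_bound[where B = 1])
      have "\<bar>F \<omega> y - u y\<bar> \<le> 1" for y using F01[of \<omega> y] u01[of y] by auto
      then show "AE s in \<mu>. norm ((F \<omega> (x - s) - u (x - s))\<^sup>2) \<le> 1" by (auto simp: abs_square_le_1)
    qed measurable
    have "2 * a \<omega> * (IF \<omega> - Iu) = (\<integral>s. 2 * a \<omega> * (F \<omega> (x - s) - u (x - s)) \<partial>\<mu>)"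
      using iF[of \<omega>] iu by (simp add: IF_def Iu_def)
    also have "\<dots> \<le> (\<integral>s. (a \<omega>)\<^sup>2 + (F \<omega> (x - s) - u (x - s))\<^sup>2 \<partial>\<mu>)"
    proof (rule integral_mono)
      show "2 * a \<omega> * (F \<omega> (x - s) - u (x - s)) \<le> (a \<omega>)\<^sup>2 + (F \<omega> (x - s) - u (x - s))\<^sup>2" for s
        by (rule sum_squares_bound)
    qed (use iF[of \<omega>] iu i2 in auto)
    also have "\<dots> = (a \<omega>)\<^sup>2 + (\<integral>s. (F \<omega> (x - s) - u (x - s))\<^sup>2 \<partial>\<mu>)"
      using i2 by (simp add: \<mu>.prob_space)
    finally have 1: "2 * a \<omega> * (IF \<omega> - Iu) \<le> (a \<omega>)\<^sup>2 + (\<integral>s. (F \<omega> (x - s) - u (x - s))\<^sup>2 \<partial>\<mu>)" .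
    have 2: "lam * (2 * a \<omega> * (IF \<omega> - Iu)) \<le> lam * ((a \<omega>)\<^sup>2 + (\<integral>s. (F \<omega> (x - s) - u (x - s))\<^sup>2 \<partial>\<mu>))"
      by (rule mult_left_mono[OF 1 lam])
    have "2 * (- lam * (a \<omega> * (F \<omega> x - IF \<omega>)) - a \<omega> * (F \<omega> x * (1 - F \<omega> x)) - a \<omega> * g) =
       lam * (2 * a \<omega> * (IF \<omega> - Iu)) - 2 * lam * (a \<omega>)\<^sup>2 - 2 * (a \<omega>)\<^sup>2 * (1 - F \<omega> x - u x)"
      unfolding g Iu_def[symmetric] a_def by (simp add: algebra_simps power2_eq_square)
    also have "\<dots> \<le> lam * ((a \<omega>)\<^sup>2 + (\<integral>s. (F \<omega> (x - s) - u (x - s))\<^sup>2 \<partial>\<mu>)) - 2 * lam * (a \<omega>)\<^sup>2 + 2 * (a \<omega>)\<^sup>2"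
    proof -
      have "(a \<omega>)\<^sup>2 * (-1) \<le> (a \<omega>)\<^sup>2 * (1 - F \<omega> x - u x)"
        using F01[of \<omega> x] u01[of x] by (intro mult_left_mono) auto
      then show ?thesis using 2 by (simp add: algebra_simps)
    qed
    also have "\<dots> \<le> lam * (\<integral>s. (F \<omega> (x - s) - u (x - s))\<^sup>2 \<partial>\<mu>) + 2 * (a \<omega>)\<^sup>2"
      using lam by (simp add: algebra_simps)
    finally show ?thesis .
  qed
  have bd2: "\<bar>(F \<omega> y - u y)\<^sup>2\<bar> \<le> 1" for \<omega> y
    using F01[of \<omega> y] u01[of y] by (auto simp: abs_square_le_1)
  have iM\<mu>: "integrable (M \<Otimes>\<^sub>M \<mu>) (\<lambda>(\<omega>, s). (F \<omega> (x - s) - u (x - s))\<^sup>2)"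
    by (rule M\<mu>.P.integrable_const_bound[where B = 1]) (use bd2 in \<open>auto simp: case_prod_beta\<close>)
  have swap: "expectation (\<lambda>\<omega>. \<integral>s. (F \<omega> (x - s) - u (x - s))\<^sup>2 \<partial>\<mu>) = (\<integral>s. V (x - s) \<partial>\<mu>)"
    unfolding V by (rule M\<mu>.Fubini_integral[symmetric]) (rule iM\<mu>)
  have iS: "integrable M (\<lambda>\<omega>. \<integral>s. (F \<omega> (x - s) - u (x - s))\<^sup>2 \<partial>\<mu>)"
    using M\<mu>.integrable_fst[OF iM\<mu>] by simp
  have E3: "2 * (- lam * P - Q - expectation a * g) \<le> lam * (\<integral>s. V (x - s) \<partial>\<mu>) + 2 * V x"
  proof -
    have "2 * (- lam * P - Q - expectation a * g) = expectation (\<lambda>\<omega>. 2 * (- lam * (a \<omega> * (F \<omega> x - IF \<omega>)) - a \<omega> * (F \<omega> x * (1 - F \<omega> x)) - a \<omega> * g))"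
      using i unfolding P_def Q_def by simp
    also have "\<dots> \<le> expectation (\<lambda>\<omega>. lam * (\<integral>s. (F \<omega> (x - s) - u (x - s))\<^sup>2 \<partial>\<mu>) + 2 * (a \<omega>)\<^sup>2)"
      by (rule integral_mono[OF _ _ key]) (use i iS in auto)
    also have "\<dots> = lam * (\<integral>s. V (x - s) \<partial>\<mu>) + 2 * V x"
      using i iS swap by (simp add: Va)
    finally show ?thesis .
  qed
  have "variance_at h (Suc k) u' x = expectation (\<lambda>\<omega>. (a \<omega> + (F' \<omega> - F \<omega> x) - \<delta>)\<^sup>2)"
    unfolding variance_at_def by (simp add: a_def F'_def W'_def \<delta>_def del: euler.simps)
  also have "\<dots> \<le> expectation (\<lambda>\<omega>. (a \<omega>)\<^sup>2 + 2 * (a \<omega> * (F' \<omega> - F \<omega> x)) - 2 * \<delta> * a \<omega> + 2 * (F' \<omega> - F \<omega> x)\<^sup>2 + 2 * \<delta>\<^sup>2)"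
  proof (rule integral_mono)
    show "integrable M (\<lambda>\<omega>. (a \<omega> + (F' \<omega> - F \<omega> x) - \<delta>)\<^sup>2)"
    proof (rule integrable_const_bound[where B = "(2 + \<bar>\<delta>\<bar>)\<^sup>2"])
      have "\<bar>a \<omega> + (F' \<omega> - F \<omega> x) - \<delta>\<bar> \<le> 2 + \<bar>\<delta>\<bar>" for \<omega> using a1[of \<omega>] dF1[of \<omega>] by linarith
      then show "AE \<omega> in M. norm ((a \<omega> + (F' \<omega> - F \<omega> x) - \<delta>)\<^sup>2) \<le> (2 + \<bar>\<delta>\<bar>)\<^sup>2"
        by (auto simp: abs_le_square_iff[symmetric])
    qed measurable
    show "(a \<omega> + (F' \<omega> - F \<omega> x) - \<delta>)\<^sup>2 \<le> (a \<omega>)\<^sup>2 + 2 * (a \<omega> * (F' \<omega> - F \<omega> x)) - 2 * \<delta> * a \<omega> + 2 * (F' \<omega> - F \<omega> x)\<^sup>2 + 2 * \<delta>\<^sup>2" for \<omega>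
      \<comment> \<open>With d = F' - F this is (d - \<delta>)^2 \<le> 2 d^2 + 2 \<delta>^2, the gap
        being (d + \<delta>)^2.\<close>
      using zero_le_power2[of "(F' \<omega> - F \<omega> x) + \<delta>"] by (simp add: power2_eq_square algebra_simps)
  qed (use i in auto)
  also have "\<dots> = V x + 2 * (- (lam * h * \<epsilon>) * P - (h * \<epsilon> * (real n / real (n - 1))) * Q)
      - 2 * \<delta> * expectation a + 2 * expectation (\<lambda>\<omega>. (F' \<omega> - F \<omega> x)\<^sup>2) + 2 * \<delta>\<^sup>2"
    using i by (simp add: E1 prob_space Va)
  also have "\<dots> \<le> V x + 2 * (- (lam * h * \<epsilon>) * P - (h * \<epsilon> * (real n / real (n - 1))) * Q)
      - 2 * \<delta> * expectation a + 2 * ((lam + 1) * h / real n) + 2 * ((lam + 1) * h)\<^sup>2"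
    using E2 d2 abs_le_square_iff[of \<delta> "(lam + 1) * h"] h lam by (simp add: \<delta>_def)
  \<comment> \<open>The ideal increment is separated from three defects: \<epsilon> is below 1, n /
    (n - 1) is above 1, and \<open>u\<close> has a remainder beyond its linear change. They multiply
    \<open>P\<close>, \<open>Q\<close> and the mean of \<open>a\<close>, all at most 1 in
    modulus.\<close>
  also have "\<dots> = V x + h * (2 * (- lam * P - Q - expectation a * g))
      + 2 * (lam * h * (1 - \<epsilon>)) * P + 2 * h * (1 - \<epsilon> * (real n / real (n - 1))) * Q
      - 2 * (\<delta> - h * g) * expectation a + 2 * (lam + 1) * h / real n + 2 * ((lam + 1) * h)\<^sup>2"
    by (simp add: algebra_simps)
  also have "\<dots> \<le> V x + h * (lam * (\<integral>s. V (x - s) \<partial>\<mu>) + 2 * V x)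
      + 2 * (lam * h * (1 - \<epsilon>)) + 2 * h * ((1 - \<epsilon>) + 2 / real n)
      + 2 * (K0 * h\<^sup>2) + 2 * (lam + 1) * h / real n + 2 * ((lam + 1) * h)\<^sup>2"
  proof -
    have up: "r * y \<le> R" if "\<bar>r\<bar> \<le> R" "\<bar>y\<bar> \<le> 1" for r y R :: real
    proof -
      have "r * y \<le> \<bar>r\<bar> * \<bar>y\<bar>" by (metis abs_ge_self abs_mult)
      also have "\<dots> \<le> \<bar>r\<bar> * 1" by (rule mult_left_mono) (use that in auto)
      finally show ?thesis using that by simp
    qed
    have 1: "h * (2 * (- lam * P - Q - expectation a * g)) \<le> h * (lam * (\<integral>s. V (x - s) \<partial>\<mu>) + 2 * V x)"
      by (rule mult_left_mono[OF E3 h])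
    have 2: "2 * (lam * h * (1 - \<epsilon>)) * P \<le> 2 * (lam * h * (1 - \<epsilon>))"
      by (rule up) (use PQ \<epsilon> lam h in auto)
    have 3: "2 * h * (1 - \<epsilon> * (real n / real (n - 1))) * Q \<le> 2 * h * ((1 - \<epsilon>) + 2 / real n)"
    proof (rule up)
      have r: "real (n - 1) = real n - 1" "real n \<ge> 2" using n by auto
      have "real n / real (n - 1) = 1 + 1 / real (n - 1)" using r by (simp add: field_simps)
      then have "\<bar>1 - \<epsilon> * (real n / real (n - 1))\<bar> \<le> (1 - \<epsilon>) + \<epsilon> * (1 / real (n - 1))"
      proof -
        have "0 \<le> \<epsilon> * (1 / real (n - 1))" using \<epsilon> by simp
        moreover have "1 - \<epsilon> * (1 + 1 / real (n - 1)) = (1 - \<epsilon>) - \<epsilon> * (1 / real (n - 1))"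
          by (simp add: algebra_simps)
        moreover have "\<bar>(1 - \<epsilon>) - q\<bar> \<le> (1 - \<epsilon>) + q" if "0 \<le> q" for q
          using \<epsilon>(1,2) that by (simp add: abs_le_iff)
        ultimately show ?thesis
          unfolding \<open>real n / real (n - 1) = 1 + 1 / real (n - 1)\<close> by metis
      qed
      also have "\<epsilon> * (1 / real (n - 1)) \<le> 1 * (2 / real n)"
        using \<epsilon> r by (intro mult_mono) (auto simp: field_simps)
      finally show "\<bar>2 * h * (1 - \<epsilon> * (real n / real (n - 1)))\<bar> \<le> 2 * h * ((1 - \<epsilon>) + 2 / real n)"
        using h by (simp add: abs_mult mult_left_mono)
    qed (use PQ in auto)
    have 4: "- (2 * (\<delta> - h * g) * expectation a) \<le> 2 * (K0 * h\<^sup>2)"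
    proof -
      have "(- 2 * (\<delta> - h * g)) * expectation a \<le> 2 * (K0 * h\<^sup>2)"
        by (rule up) (use d1 PQ in \<open>auto simp: \<delta>_def abs_mult abs_le_iff\<close>)
      then show ?thesis by (simp add: algebra_simps)
    qed
    show ?thesis using 1 2 3 4 by linarith
  qed
  also have "\<dots> \<le> V x + h * (lam * (\<integral>s. V (x - s) \<partial>\<mu>) + 2 * V x)
      + 2 * (lam * h * (real n * (lam + 1) * h)) + 2 * h * ((real n * (lam + 1) * h) + 2 / real n)
      + 2 * (K0 * h\<^sup>2) + 2 * (lam + 1) * h / real n + 2 * ((lam + 1) * h)\<^sup>2"
  proof -
    have "lam * h * (1 - \<epsilon>) \<le> lam * h * (real n * (lam + 1) * h)"
      using \<epsilon>(3) h lam by (intro mult_left_mono) auto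
    moreover have "2 * h * ((1 - \<epsilon>) + 2 / real n) \<le> 2 * h * ((real n * (lam + 1) * h) + 2 / real n)"
      using \<epsilon>(3) h lam by (intro mult_left_mono) auto
    ultimately show ?thesis by (intro add_mono order_refl) auto
  qed
  also have "\<dots> \<le> V x + h * (lam * (\<integral>s. V (x - s) \<partial>\<mu>) + 2 * V x)
      + (2 * lam + 6) * h / real n + (4 * real n * (lam + 1)\<^sup>2 + 2 * K0 + 2 * (lam + 1)\<^sup>2) * h\<^sup>2"
  proof -
    have "2 * (lam * h * (real n * (lam + 1) * h)) + 2 * h * (real n * (lam + 1) * h) = (2 * real n * (lam + 1)\<^sup>2) * h\<^sup>2"
      by (simp add: power2_eq_square algebra_simps)
    moreover have "(2 * real n * (lam + 1)\<^sup>2) * h\<^sup>2 \<le> (4 * real n * (lam + 1)\<^sup>2) * h\<^sup>2"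
      by (intro mult_right_mono) auto
    \<comment> \<open>In 2 lam + 6, the summand 4 stems from n / (n - 1) and 2 (lam + 1) from the
      squared change.\<close>
    moreover have "2 * h * (2 / real n) + 2 * (lam + 1) * h / real n = (2 * lam + 6) * h / real n"
      using n by (simp add: field_simps)
    moreover have "2 * ((lam + 1) * h)\<^sup>2 = 2 * (lam + 1)\<^sup>2 * h\<^sup>2" by (simp add: power_mult_distrib)
    moreover have "2 * h * ((real n * (lam + 1) * h) + 2 / real n) = 2 * h * (real n * (lam + 1) * h) + 2 * h * (2 / real n)"
      by (simp add: distrib_left)
    moreover have "(4 * real n * (lam + 1)\<^sup>2 + 2 * K0 + 2 * (lam + 1)\<^sup>2) * h\<^sup>2 =
        (4 * real n * (lam + 1)\<^sup>2) * h\<^sup>2 + 2 * (K0 * h\<^sup>2) + 2 * (lam + 1)\<^sup>2 * h\<^sup>2"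
      by (simp add: distrib_right)
    ultimately show ?thesis by linarith
  qed
  finally show ?thesis by (simp add: V_def)
qed

end

section \<open>Coupling of the particles with the Euler scheme\<close>

text \<open>What the pathwise arguments need of a Poisson process, in a form that is inherited by
  sums such as \<open>total\<close>.\<close>

definition counting :: "(real \<Rightarrow> nat) \<Rightarrow> bool" where
  "counting N \<longleftrightarrow> mono_on {0..} N \<and> (\<forall>t\<ge>0. continuous (at_right t) N)"

lemma counting_mono: "counting N \<Longrightarrow> 0 \<le> s \<Longrightarrow> s \<le> t \<Longrightarrow> N s \<le> N t"
  by (auto simp: counting_def mono_on_def)

lemma counting_right:
  assumes "counting N" "0 \<le> t"
  obtains u where "t < u" "\<And>r. t \<le> r \<Longrightarrow> r < u \<Longrightarrow> N r = N t"
proof -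
  have "(N \<longlongrightarrow> N t) (at_right t)" using assms by (auto simp: counting_def continuous_within)
  then have "eventually (\<lambda>r. N r = N t) (at_right t)"
    by (auto simp: tendsto_discrete)
  then obtain u where "t < u" "\<And>r. t < r \<Longrightarrow> r < u \<Longrightarrow> N r = N t"
    unfolding eventually_at_right_field by auto
  then show ?thesis by (intro that[of u]) (auto simp: le_less)
qed

text \<open>\<tau> is the infimum of the times from \<open>s\<close> on at which the value
  \<open>N t\<close> is taken. Right-continuity makes it attained, and so \<tau> is a
  \<open>process_point\<close>.\<close>

lemma last_jump:
  assumes N: "counting N" and st: "0 \<le> s" "s \<le> t" "N s < N t"
  obtains \<tau> where "s < \<tau>" "\<tau> \<le> t" "N \<tau> = N t" "\<And>r. 0 \<le> r \<Longrightarrow> r < \<tau> \<Longrightarrow> N r < N t"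
proof -
  define A where "A = {r. s \<le> r \<and> N r = N t}"
  define \<tau> where "\<tau> = Inf A"
  have A: "t \<in> A" "bdd_below A" using st by (auto simp: A_def)
  have le: "\<tau> \<le> t" "s \<le> \<tau>"
    unfolding \<tau>_def using A by (auto intro!: cInf_lower cInf_greatest simp: A_def)
  obtain u where u: "\<tau> < u" "\<And>r. \<tau> \<le> r \<Longrightarrow> r < u \<Longrightarrow> N r = N \<tau>"
    using counting_right[OF N, of \<tau>] le st by auto
  obtain r where r: "r \<in> A" "r < u"
    using cInf_lessD[of A u] A u(1) unfolding \<tau>_def by auto
  have "\<tau> \<le> r" unfolding \<tau>_def using r A by (auto intro!: cInf_lower)
  then have N\<tau>: "N \<tau> = N t" using u(2)[of r] r by (auto simp: A_def)
  then have "s < \<tau>" using le st by (cases "s = \<tau>") auto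
  moreover have "N r < N t" if "0 \<le> r" "r < \<tau>" for r
  proof -
    have "N r \<le> N t" using counting_mono[OF N that(1), of t] that le by auto
    moreover have "N r \<noteq> N t"
    proof
      assume eq: "N r = N t"
      have "s \<le> r"
      proof (rule ccontr)
        assume "\<not> s \<le> r"
        then have "N r \<le> N s" using counting_mono[OF N that(1), of s] by auto
        then show False using eq st by auto
      qed
      then have "r \<in> A" using eq by (auto simp: A_def)
      then have "\<tau> \<le> r" unfolding \<tau>_def using A by (auto intro!: cInf_lower)
      then show False using that by auto
    qed
    ultimately show ?thesis by auto
  qed
  ultimately show ?thesis using le N\<tau> that by blast
qed

text \<open>Below \<open>t\<close> the counter takes finitely many values; once the largest of them
  is reached it cannot move before \<open>t\<close>.\<close>

lemma counting_left_const:
  assumes N: "counting N" and t: "0 < t"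
  obtains q where "0 \<le> q" "q < t" "\<And>r. q \<le> r \<Longrightarrow> r < t \<Longrightarrow> N r = N q"
proof -
  have fin: "finite (N ` {0..<t})"
    by (rule finite_subset[of _ "{..N t}"]) (auto intro: counting_mono[OF N])
  have "N ` {0..<t} \<noteq> {}" using t by auto
  then obtain q where q: "q \<in> {0..<t}" "N q = Max (N ` {0..<t})"
    using Max_in[OF fin] by auto
  have "N r = N q" if "q \<le> r" "r < t" for r
  proof (rule antisym)
    show "N r \<le> N q" unfolding q(2) using that q by (intro Max_ge fin) auto
    show "N q \<le> N r" using that q by (intro counting_mono[OF N]) auto
  qed
  then show ?thesis using q that by auto
qed

lemma left_lim_const:
  assumes "q < t" "\<And>r. q \<le> r \<Longrightarrow> r < t \<Longrightarrow> x r = c"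
  shows "left_lim x t = c"
proof -
  have "eventually (\<lambda>r. x r = c) (at_left t)"
    using eventually_at_left_real[OF assms(1)] by eventually_elim (use assms in auto)
  then have "(x \<longlongrightarrow> c) (at_left t)" by (rule tendsto_eventually)
  then show ?thesis unfolding left_lim_def by (intro tendsto_Lim) auto
qed

lemma counting_sum:
  assumes "\<And>i. i \<in> I \<Longrightarrow> counting (N i)"
  shows "counting (\<lambda>t. \<Sum>i\<in>I. N i t)"
  unfolding counting_def
proof (intro conjI allI impI)
  show "mono_on {0..} (\<lambda>t. \<Sum>i\<in>I. N i t)"
    by (intro mono_onI sum_mono) (use counting_mono[OF assms] in auto)
  show "continuous (at_right t) (\<lambda>t. \<Sum>i\<in>I. N i t)" if "0 \<le> t" for t
    by (intro continuous_intros) (use assms that in \<open>auto simp: counting_def\<close>)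
qed

context moving_boundary_system begin

lemma counting_NJ: "i < n \<Longrightarrow> \<omega> \<in> space M \<Longrightarrow> counting (\<lambda>t. NJ i t \<omega>)"
  and counting_NC: "i < n \<Longrightarrow> \<omega> \<in> space M \<Longrightarrow> counting (\<lambda>t. NC i t \<omega>)"
  and NJ_0: "i < n \<Longrightarrow> \<omega> \<in> space M \<Longrightarrow> NJ i 0 \<omega> = 0"
  and NC_0: "i < n \<Longrightarrow> \<omega> \<in> space M \<Longrightarrow> NC i 0 \<omega> = 0"
  using jump_process[of i] choice_process[of i] by (auto simp: poisson_process_def counting_def)

text \<open>A discrete clock for all particles: while it stands still so does every location. Left
  limits thereby become values, and inductions can run over it.\<close>

definition total :: "'w \<Rightarrow> real \<Rightarrow> nat" where
  "total \<omega> t = (\<Sum>i<n. NJ i t \<omega> + NC i t \<omega>)"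

lemma counting_total: "\<omega> \<in> space M \<Longrightarrow> counting (total \<omega>)"
proof -
  assume \<omega>: "\<omega> \<in> space M"
  have "counting (\<lambda>t. (\<Sum>i<n. NJ i t \<omega>) + (\<Sum>i<n. NC i t \<omega>))"
    using counting_sum[of "{..<n}" "\<lambda>i t. NJ i t \<omega>"] counting_sum[of "{..<n}" "\<lambda>i t. NC i t \<omega>"]
      counting_NJ[OF _ \<omega>] counting_NC[OF _ \<omega>]
    unfolding counting_def mono_on_def by (auto intro!: continuous_intros add_mono)
  then show ?thesis unfolding total_def[abs_def] by (simp add: sum.distrib)
qed

lemma total_const:
  assumes \<omega>: "\<omega> \<in> space M" and st: "0 \<le> s" "s \<le> t" and eq: "total \<omega> s = total \<omega> t" and i: "i < n"
  shows "NJ i s \<omega> = NJ i t \<omega>" "NC i s \<omega> = NC i t \<omega>" "X i t \<omega> = X i s \<omega>"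
proof -
  have le: "NJ j s \<omega> + NC j s \<omega> \<le> NJ j t \<omega> + NC j t \<omega>" if "j < n" for j
    using counting_mono[OF counting_NJ[OF that \<omega>] st] counting_mono[OF counting_NC[OF that \<omega>] st] by simp
  have "NJ i s \<omega> + NC i s \<omega> = NJ i t \<omega> + NC i t \<omega>"
  proof (rule ccontr)
    assume "NJ i s \<omega> + NC i s \<omega> \<noteq> NJ i t \<omega> + NC i t \<omega>"
    then have "NJ i s \<omega> + NC i s \<omega> < NJ i t \<omega> + NC i t \<omega>" using le[OF i] by simp
    then have "total \<omega> s < total \<omega> t"
      unfolding total_def by (intro sum_strict_mono_ex1) (use le i in auto)
    then show False using eq by simp
  qed
  then show 1: "NJ i s \<omega> = NJ i t \<omega>" "NC i s \<omega> = NC i t \<omega>"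
    using counting_mono[OF counting_NJ[OF i \<omega>] st] counting_mono[OF counting_NC[OF i \<omega>] st] by auto
  show "X i t \<omega> = X i s \<omega>" by (rule constant_between_points[OF i \<omega> st 1])
qed

text \<open>Collects the almost sure rules, positive sizes and existing targets in one event, so
  that the arguments that follow are about single paths.\<close>

definition regular :: "'w \<Rightarrow> bool" where
  "regular \<omega> \<longleftrightarrow> (\<forall>i<n. \<forall>k. 0 < S i k \<omega> \<and> C i k \<omega> < n) \<and>
     (\<forall>i<n. \<forall>t. process_point (\<lambda>s. NJ i s \<omega>) t \<longrightarrow>
         X i t \<omega> = min (left_lim (\<lambda>s. X i s \<omega>) t + S i (NJ i t \<omega>) \<omega>) (B0 + v * t)) \<and>
     (\<forall>i<n. \<forall>t. process_point (\<lambda>s. NC i s \<omega>) t \<longrightarrow>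
         X i t \<omega> = max (left_lim (\<lambda>s. X i s \<omega>) t) (left_lim (\<lambda>s. X (C i (NC i t \<omega>) \<omega>) s \<omega>) t))"

lemma regular_AE:
  assumes n: "2 \<le> n" and pos: "AE z in \<mu>. 0 < z"
  shows "AE \<omega> in M. regular \<omega>"
proof -
  have "AE \<omega> in M. 0 < S i k \<omega>" if "i < n" for i k
  proof (rule AE_distrD[OF size_measurable[OF that, of k]])
    show "AE x in distr M borel (S i k). 0 < x" unfolding size_distr[OF that] by (rule pos)
  qed
  moreover have "AE \<omega> in M. C i k \<omega> < n" if "i < n" for i k
  proof (rule AE_distrD[OF target_measurable[OF that, of k]])
    have "(if i = 0 then 1 else 0) \<in> {..<n} - {i}" using n by auto
    then have "{..<n} - {i} \<noteq> {}" by blast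
    then show "AE x in distr M (count_space UNIV) (C i k). x < n"
      unfolding target_distr[OF that] by (auto simp: AE_measure_pmf_iff)
  qed
  ultimately have "AE \<omega> in M. \<forall>i\<in>{..<n}. \<forall>k. 0 < S i k \<omega> \<and> C i k \<omega> < n"
    by (intro AE_finite_allI) (auto simp: AE_all_countable)
  with forward_jump copy_chosen show ?thesis
    by eventually_elim (auto simp: regular_def)
qed

text \<open>Strong induction on the number of points up to \<open>t\<close>. At the last point
  \<tau> the left limits are the values at an earlier time \<open>q\<close> with fewer points, where
  the induction hypothesis covers all particles, in particular a chosen one. After \<tau> the
  location rests and the boundary moves further to the right.\<close>

lemma location_mono_bounded:
  assumes \<omega>: "\<omega> \<in> space M" and reg: "regular \<omega>" and v: "0 \<le> v" and p: "\<And>i. i < n \<Longrightarrow> p i \<le> B0"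
  assumes "0 \<le> t" "i < n"
  shows "X i t \<omega> \<le> B0 + v * t \<and> (\<forall>s. 0 \<le> s \<and> s \<le> t \<longrightarrow> X i s \<omega> \<le> X i t \<omega>)"
  using assms(5,6)
proof (induction "total \<omega> t" arbitrary: t i rule: less_induct)
  case less
  note cT = counting_total[OF \<omega>]
  show ?case
  proof (cases "total \<omega> 0 < total \<omega> t")
    case False
    then have eq: "total \<omega> 0 = total \<omega> s" if "0 \<le> s" "s \<le> t" for s
      using counting_mono[OF cT order_refl that(1)] counting_mono[OF cT that] by simp
    have "X i s \<omega> = p i" if "0 \<le> s" "s \<le> t" for s
      using total_const(3)[OF \<omega> order_refl that(1) eq[OF that] less(3)] initial[OF less(3) \<omega>] by simp
    then show ?thesis using p[OF less(3)] v less(2) by (auto intro: order_trans[of _ B0])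
  next
    case True
    obtain \<tau> where \<tau>: "0 < \<tau>" "\<tau> \<le> t" "total \<omega> \<tau> = total \<omega> t" "\<And>r. 0 \<le> r \<Longrightarrow> r < \<tau> \<Longrightarrow> total \<omega> r < total \<omega> t"
      using last_jump[OF cT order_refl less(2) True] by blast
    obtain q where q: "0 \<le> q" "q < \<tau>" "\<And>r. q \<le> r \<Longrightarrow> r < \<tau> \<Longrightarrow> total \<omega> r = total \<omega> q"
      using counting_left_const[OF cT \<tau>(1)] by blast
    have left: "NJ j r \<omega> = NJ j q \<omega>" "NC j r \<omega> = NC j q \<omega>" "X j r \<omega> = X j q \<omega>"
      if "j < n" "q \<le> r" "r < \<tau>" for j r
      using total_const[OF \<omega> q(1) that(2) q(3)[OF that(2,3), symmetric] that(1)] by auto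
    have ll: "left_lim (\<lambda>s. X j s \<omega>) \<tau> = X j q \<omega>" if "j < n" for j
      by (rule left_lim_const[OF q(2)]) (rule left(3)[OF that])
    have IH: "X j q \<omega> \<le> B0 + v * q" "\<And>s. 0 \<le> s \<Longrightarrow> s \<le> q \<Longrightarrow> X j s \<omega> \<le> X j q \<omega>" if "j < n" for j
      using less(1)[of q j] \<tau>(4)[OF q(1,2)] q(1) that by auto
    have bq: "B0 + v * q \<le> B0 + v * \<tau>" "B0 + v * \<tau> \<le> B0 + v * t"
      using q \<tau> v by (auto intro!: mult_left_mono)
    have main: "X i q \<omega> \<le> X i \<tau> \<omega> \<and> X i \<tau> \<omega> \<le> B0 + v * \<tau>"
    proof -
      have pp: "process_point N \<tau>" if "counting N" "\<And>r. q \<le> r \<Longrightarrow> r < \<tau> \<Longrightarrow> N r = N q" "N q < N \<tau>" for N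
        unfolding process_point_def
      proof (intro conjI allI impI)
        fix s assume s: "0 \<le> s \<and> s < \<tau>"
        have "N s \<le> N q"
          using counting_mono[OF that(1), of s q] that(2)[of s] s by (cases "s \<le> q") auto
        then show "N s < N \<tau>" using that by simp
      qed (rule \<tau>(1))
      \<comment> \<open>The cases may overlap; if both processes have a point at \<tau>, either
        update rule gives the claim.\<close>
      consider "NJ i q \<omega> < NJ i \<tau> \<omega>" | "NC i q \<omega> < NC i \<tau> \<omega>" | "NJ i q \<omega> = NJ i \<tau> \<omega>" "NC i q \<omega> = NC i \<tau> \<omega>"
        using counting_mono[OF counting_NJ[OF less(3) \<omega>] q(1), of \<tau>] counting_mono[OF counting_NC[OF less(3) \<omega>] q(1), of \<tau>] q
        by fastforce
      then show ?thesis
      proof cases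
        case 1
        then have "process_point (\<lambda>s. NJ i s \<omega>) \<tau>"
          using pp[OF counting_NJ[OF less(3) \<omega>] left(1)[OF less(3)]] by auto
        then have "X i \<tau> \<omega> = min (X i q \<omega> + S i (NJ i \<tau> \<omega>) \<omega>) (B0 + v * \<tau>)"
          using reg less(3) ll[OF less(3)] by (auto simp: regular_def)
        moreover have "0 < S i (NJ i \<tau> \<omega>) \<omega>" using reg less(3) by (auto simp: regular_def)
        ultimately show ?thesis using IH(1)[OF less(3)] bq by auto
      next
        case 2
        then have "process_point (\<lambda>s. NC i s \<omega>) \<tau>"
          using pp[OF counting_NC[OF less(3) \<omega>] left(2)[OF less(3)]] by auto
        moreover have c: "C i (NC i \<tau> \<omega>) \<omega> < n" using reg less(3) by (auto simp: regular_def)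
        ultimately have "X i \<tau> \<omega> = max (X i q \<omega>) (X (C i (NC i \<tau> \<omega>) \<omega>) q \<omega>)"
          using reg less(3) ll[OF less(3)] ll[OF c] by (auto simp: regular_def)
        then show ?thesis using IH(1)[OF less(3)] IH(1)[OF c] bq by auto
      next
        case 3
        then have "X i \<tau> \<omega> = X i q \<omega>"
          using constant_between_points[OF less(3) \<omega> q(1), of \<tau>] q by auto
        then show ?thesis using IH(1)[OF less(3)] bq by auto
      qed
    qed
    have right: "X i s \<omega> = X i \<tau> \<omega>" if "\<tau> \<le> s" "s \<le> t" for s
    proof -
      have "total \<omega> \<tau> = total \<omega> s"
        using counting_mono[OF cT _ that(1)] counting_mono[OF cT _ that(2)] \<tau> that by simp
      then show ?thesis using total_const(3)[OF \<omega> _ that(1) _ less(3)] \<tau>(1) by simp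
    qed
    have "X i s \<omega> \<le> X i t \<omega>" if "0 \<le> s" "s \<le> t" for s
    proof -
      consider "s \<le> q" | "q \<le> s" "s < \<tau>" | "\<tau> \<le> s" by linarith
      then show ?thesis
      proof cases
        case 1 then show ?thesis using IH(2)[OF less(3) that(1)] main right[of t] \<tau>(2) by simp
      next
        case 2 then show ?thesis using left(3)[OF less(3) 2] main right[of t] \<tau>(2) by simp
      next
        case 3 then show ?thesis using right[of s] right[of t] that \<tau>(2) by simp
      qed
    qed
    then show ?thesis using main right[of t] \<tau>(2) bq by auto
  qed
qed

text \<open>Telescoping over the cells. This aligns the numbering of sizes and targets in the scheme
  with that of the particles.\<close>

lemma count_noises:
  assumes "i < n" "\<omega> \<in> space M" "0 \<le> h"
  shows "jump_count (noises h \<omega>) i k = NJ i (real k * h) \<omega>" "choice_count (noises h \<omega>) i k = NC i (real k * h) \<omega>"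
proof -
  have t: "(\<Sum>l<k. N (real (Suc l) * h) - N (real l * h)) = N (real k * h)"
    if "counting N" "N 0 = 0" for N :: "real \<Rightarrow> nat"
  proof (induction k)
    case (Suc k)
    have "N (real k * h) \<le> N (real (Suc k) * h)"
      by (rule counting_mono[OF that(1)]) (use assms(3) in \<open>auto intro!: mult_right_mono\<close>)
    then show ?case using Suc by simp
  qed (use that in simp)
  show "jump_count (noises h \<omega>) i k = NJ i (real k * h) \<omega>"
    using t[OF counting_NJ[OF assms(1,2)] NJ_0[OF assms(1,2)]]
    by (simp add: jump_count_def noises_def noise_var_def del: of_nat_Suc of_nat_diff)
  show "choice_count (noises h \<omega>) i k = NC i (real k * h) \<omega>"
    using t[OF counting_NC[OF assms(1,2)] NC_0[OF assms(1,2)]]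
    by (simp add: choice_count_def noises_def noise_var_def del: of_nat_Suc of_nat_diff)
qed

text \<open>Errors do not add up. Minimum and maximum are non-expansive with respect to the larger
  of two errors, a jump shifts both locations by the same size, and the boundaries used by particle
  and scheme in one cell differ by at most v * h.\<close>

lemma coupling:
  assumes \<omega>: "\<omega> \<in> space M" and reg: "regular \<omega>" and v: "0 \<le> v" and h: "0 < h"
    and good: "\<And>k. k < m \<Longrightarrow> \<not> bad_cell (noises h \<omega>) k"
    and "k \<le> m" "i < n"
  shows "\<bar>X i (real k * h) \<omega> - euler h k (noises h \<omega>) i\<bar> \<le> v * h"
  using assms(6,7)
proof (induction k arbitrary: i)
  case 0
  then show ?case using initial[OF _ \<omega>] v h by simp
next
  case (Suc k)
  let ?Z = "noises h \<omega>"
  define s where "s = real k * h"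
  define t where "t = real (Suc k) * h"
  have st: "0 \<le> s" "s < t" "t = s + h" using h by (auto simp: s_def t_def algebra_simps)
  have IH: "\<bar>X j s \<omega> - euler h k ?Z j\<bar> \<le> v * h" if "j < n" for j
    using Suc that by (auto simp: s_def)
  have ZJ: "?Z (Jump_inc j k) = real (NJ j t \<omega> - NJ j s \<omega>)" and ZC: "?Z (Choice_inc j k) = real (NC j t \<omega> - NC j s \<omega>)" for j
    by (simp_all add: noises_def noise_var_def s_def t_def del: of_nat_Suc)
  note mJ = counting_mono[OF counting_NJ[OF _ \<omega>]] and mC = counting_mono[OF counting_NC[OF _ \<omega>]]
  have stay: "X j t \<omega> = X j s \<omega>" "\<And>r. s \<le> r \<Longrightarrow> r \<le> t \<Longrightarrow> NJ j r \<omega> = NJ j s \<omega> \<and> NC j r \<omega> = NC j s \<omega>"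
    if j: "j < n" and z: "?Z (Jump_inc j k) = 0" "?Z (Choice_inc j k) = 0" for j
  proof -
    have "NJ j s \<omega> = NJ j t \<omega>" "NC j s \<omega> = NC j t \<omega>"
      using z mJ[OF j st(1), of t] mC[OF j st(1), of t] st by (auto simp: ZJ ZC)
    note eqs = this
    show "X j t \<omega> = X j s \<omega>"
      by (rule constant_between_points[OF j \<omega> st(1)]) (use eqs st in auto)
    fix r assume r: "s \<le> r" "r \<le> t"
    have "0 \<le> r" using r st by simp
    show "NJ j r \<omega> = NJ j s \<omega> \<and> NC j r \<omega> = NC j s \<omega>"
      using eqs mJ[OF j st(1) r(1)] mC[OF j st(1) r(1)] mJ[OF j \<open>0 \<le> r\<close> r(2)] mC[OF j \<open>0 \<le> r\<close> r(2)] by simp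
  qed
  have "\<not> bad_cell ?Z k" using good Suc.prems by auto
  then consider "\<forall>d\<in>cells k. ?Z d = 0" | d where "d \<in> cells k" "single ?Z k d"
    by (auto simp: bad_cell_def)
  then show ?case
  proof cases
    case 1
    then have z: "?Z (Jump_inc i k) = 0" "?Z (Choice_inc i k) = 0" using Suc.prems by (auto simp: cells_def)
    then have "euler h (Suc k) ?Z i = euler h k ?Z i" by (simp add: single_def)
    then show ?thesis using stay(1)[OF Suc.prems(2) z] IH[OF Suc.prems(2)] by (simp add: t_def)
  next
    case (2 d)
    define j where "j = noise_particle d"
    have j: "j < n" using 2 cells_particle by (auto simp: j_def)
    have zero: "?Z e = 0" if "e \<in> cells k" "e \<noteq> d" for e using 2 that by (auto simp: single_def)
    show ?thesis
    proof (cases "i = j")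
      case False
      have ne: "Jump_inc i k \<noteq> d" "Choice_inc i k \<noteq> d" using False by (auto simp: j_def)
      have z: "?Z (Jump_inc i k) = 0" "?Z (Choice_inc i k) = 0"
        using ne Suc.prems by (auto intro!: zero simp: cells_def)
      then have "euler h (Suc k) ?Z i = euler h k ?Z i" by (simp add: single_def)
      then show ?thesis using stay(1)[OF Suc.prems(2) z] IH[OF Suc.prems(2)] by (simp add: t_def)
    next
      case True
      have other: "NJ l r \<omega> = NJ l s \<omega> \<and> NC l r \<omega> = NC l s \<omega>" if "l < n" "l \<noteq> i" "s \<le> r" "r \<le> t" for l r
        by (rule stay(2)) (use that True in \<open>auto intro!: zero simp: cells_def j_def\<close>)
      have d: "d = Jump_inc i k \<or> d = Choice_inc i k" using 2 True by (auto simp: cells_def j_def)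
      have err: "\<bar>min (a + c) (B0 + v * \<tau>) - min (a' + c) (B0 + v * s)\<bar> \<le> v * h"
        if "\<bar>a - a'\<bar> \<le> v * h" "s \<le> \<tau>" "\<tau> \<le> t" for a a' c \<tau>
      proof -
        have "v * s \<le> v * \<tau>" "v * \<tau> \<le> v * s + v * h"
          using that v st mult_left_mono[of \<tau> t v] mult_left_mono[of s \<tau> v] by (auto simp: algebra_simps)
        then show ?thesis using that by (auto simp: min_def abs_le_iff)
      qed
      from d show ?thesis
      proof
        assume dJ: "d = Jump_inc i k"
        have one: "NJ i t \<omega> = Suc (NJ i s \<omega>)"
          using 2 mJ[OF Suc.prems(2) st(1), of t] st by (auto simp: dJ single_def ZJ)
        have "?Z (Choice_inc i k) = 0" using Suc.prems by (intro zero) (auto simp: cells_def dJ)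
        then have "NC i t \<omega> = NC i s \<omega>" using mC[OF Suc.prems(2) st(1), of t] st by (auto simp: ZC)
        then have cC: "NC i r \<omega> = NC i s \<omega>" if "s \<le> r" "r \<le> t" for r
          using mC[OF Suc.prems(2) st(1) that(1)] mC[OF Suc.prems(2) _ that(2)] that st by auto
        obtain \<tau> where \<tau>: "s < \<tau>" "\<tau> \<le> t" "NJ i \<tau> \<omega> = NJ i t \<omega>" "\<And>r. 0 \<le> r \<Longrightarrow> r < \<tau> \<Longrightarrow> NJ i r \<omega> < NJ i t \<omega>"
          using last_jump[OF counting_NJ[OF Suc.prems(2) \<omega>] st(1), of t] one st by auto
        have "process_point (\<lambda>s. NJ i s \<omega>) \<tau>"
          unfolding process_point_def using \<tau> st by auto
        moreover have "left_lim (\<lambda>s. X i s \<omega>) \<tau> = X i s \<omega>"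
        proof (rule left_lim_const[OF \<tau>(1)])
          fix r assume r: "s \<le> r" "r < \<tau>"
          have "NJ i s \<omega> = NJ i r \<omega>" using mJ[OF Suc.prems(2) st(1) r(1)] \<tau>(4)[of r] r st one by auto
          then show "X i r \<omega> = X i s \<omega>"
            using constant_between_points[OF Suc.prems(2) \<omega> st(1) r(1)] cC[of r] r \<tau> by auto
        qed
        ultimately have "X i \<tau> \<omega> = min (X i s \<omega> + S i (Suc (NJ i s \<omega>)) \<omega>) (B0 + v * \<tau>)"
          using reg Suc.prems \<tau> one by (auto simp: regular_def)
        moreover have "X i t \<omega> = X i \<tau> \<omega>"
          using constant_between_points[OF Suc.prems(2) \<omega> _ \<tau>(2)] \<tau> st cC[of \<tau>] cC[of t] by auto
        moreover have "euler h (Suc k) ?Z i = min (euler h k ?Z i + S i (Suc (NJ i s \<omega>)) \<omega>) (B0 + v * s)"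
          using 2 Suc.prems dJ h count_noises[OF Suc.prems(2) \<omega>, of h k]
          by (simp add: s_def) (simp add: noises_def noise_var_def)
        ultimately show ?thesis
          using err[OF IH[OF Suc.prems(2)], of \<tau>] \<tau> by (simp add: t_def del: euler.simps)
      next
        assume dC: "d = Choice_inc i k"
        have one: "NC i t \<omega> = Suc (NC i s \<omega>)"
          using 2 mC[OF Suc.prems(2) st(1), of t] st by (auto simp: dC single_def ZC)
        have zJ: "?Z (Jump_inc i k) = 0" using Suc.prems by (intro zero) (auto simp: cells_def dC)
        then have "NJ i t \<omega> = NJ i s \<omega>" using mJ[OF Suc.prems(2) st(1), of t] st by (auto simp: ZJ)
        then have cJ: "NJ i r \<omega> = NJ i s \<omega>" if "s \<le> r" "r \<le> t" for r
          using mJ[OF Suc.prems(2) st(1) that(1)] mJ[OF Suc.prems(2) _ that(2)] that st by auto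
        obtain \<tau> where \<tau>: "s < \<tau>" "\<tau> \<le> t" "NC i \<tau> \<omega> = NC i t \<omega>" "\<And>r. 0 \<le> r \<Longrightarrow> r < \<tau> \<Longrightarrow> NC i r \<omega> < NC i t \<omega>"
          using last_jump[OF counting_NC[OF Suc.prems(2) \<omega>] st(1), of t] one st by auto
        have pp: "process_point (\<lambda>s. NC i s \<omega>) \<tau>"
          unfolding process_point_def using \<tau> st by auto
        \<comment> \<open>The chosen particle has to rest up to \<tau> as well: the only point in
          the cell belongs to \<open>i\<close>, so the left limits at \<tau> are the values at the
          left end of the cell.\<close>
        have ll: "left_lim (\<lambda>s. X l s \<omega>) \<tau> = X l s \<omega>" if l: "l < n" for l
        proof (rule left_lim_const[OF \<tau>(1)])
          fix r assume r: "s \<le> r" "r < \<tau>"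
          have "NJ l s \<omega> = NJ l r \<omega> \<and> NC l s \<omega> = NC l r \<omega>"
          proof (cases "l = i")
            case True
            have "0 \<le> r" using r st by simp
            have "NC i r \<omega> < NC i t \<omega>" by (rule \<tau>(4)[OF \<open>0 \<le> r\<close> r(2)])
            then show ?thesis
              using mC[OF Suc.prems(2) st(1) r(1)] one cJ[OF r(1)] r(2) \<tau>(2) True by simp
          next
            case False
            then show ?thesis using other[OF l False r(1)] r \<tau> by auto
          qed
          then show "X l r \<omega> = X l s \<omega>"
            using constant_between_points[OF l \<omega> st(1) r(1)] by auto
        qed
        define c where "c = C i (Suc (NC i s \<omega>)) \<omega>"
        have c: "c < n" using reg Suc.prems by (auto simp: regular_def c_def)
        have "X i \<tau> \<omega> = max (X i s \<omega>) (X c s \<omega>)"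
          using reg pp Suc.prems \<tau> one ll[OF c] ll[OF Suc.prems(2)] by (auto simp: regular_def c_def)
        moreover have "X i t \<omega> = X i \<tau> \<omega>"
          using constant_between_points[OF Suc.prems(2) \<omega> _ \<tau>(2)] \<tau> st cJ[of \<tau>] cJ[of t] by auto
        moreover have "\<not> single ?Z k (Jump_inc i k)" using zJ by (simp add: single_def)
        then have "euler h (Suc k) ?Z i = max (euler h k ?Z i) (euler h k ?Z c)"
          using 2 Suc.prems dC h count_noises[OF Suc.prems(2) \<omega>, of h k]
          by (simp add: s_def c_def) (simp add: noises_def noise_var_def)
        ultimately show ?thesis
          using IH[OF Suc.prems(2)] IH[OF c] by (auto simp add: t_def max_def abs_le_iff simp del: euler.simps)
      qed
    qed
  qed
qed

end

section \<open>A supersolution for the mean square deviation\<close>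

text \<open>The series is chosen so that smearing at most doubles it: a geometric factor in time then turns it
  into a supersolution of the recursion.\<close>

definition smear :: "real \<Rightarrow> real measure \<Rightarrow> (real \<Rightarrow> real) \<Rightarrow> real \<Rightarrow> real" where
  "smear lam \<mu> g x = (lam * (\<integral>s. g (x - s) \<partial>\<mu>) + 2 * g x) / (lam + 2)"

definition resolvent :: "real \<Rightarrow> real measure \<Rightarrow> (real \<Rightarrow> real) \<Rightarrow> real \<Rightarrow> real" where
  "resolvent lam \<mu> g x = (\<Sum>j. (1/2) ^ j * (smear lam \<mu> ^^ j) g x)"

locale shift_kernel = prob_space \<mu> for \<mu> :: "real measure" +
  fixes lam :: real
  assumes sets_mu [measurable_cong]: "sets \<mu> = sets borel" and lam: "0 \<le> lam"
begin

lemma shift_integral_measurable: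
  fixes g :: "real \<Rightarrow> real"
  assumes [measurable]: "g \<in> borel_measurable borel"
  shows "(\<lambda>x. \<integral>s. g (x - s) \<partial>\<mu>) \<in> borel_measurable (borel :: real measure)"
  by (rule borel_measurable_lebesgue_integral) measurable

lemma shift_integrable:
  fixes g :: "real \<Rightarrow> real"
  assumes [measurable]: "g \<in> borel_measurable borel" and "\<And>x. 0 \<le> g x" "\<And>x. g x \<le> B"
  shows "integrable \<mu> (\<lambda>s. g (x - s))"
  by (rule integrable_const_bound[where B = B]) (use assms in auto)

lemma smear_props:
  assumes g: "g \<in> borel_measurable borel" "\<And>x. 0 \<le> g x" "\<And>x. g x \<le> B"
  shows "smear lam \<mu> g \<in> borel_measurable borel" "0 \<le> smear lam \<mu> g x" "smear lam \<mu> g x \<le> B"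
proof -
  note [measurable] = g(1) shift_integral_measurable[OF g(1)]
  show "smear lam \<mu> g \<in> borel_measurable borel" unfolding smear_def[abs_def] by measurable
  have i: "0 \<le> (\<integral>s. g (x - s) \<partial>\<mu>)" "(\<integral>s. g (x - s) \<partial>\<mu>) \<le> B"
    by (rule integral_ge_const integral_le_const; use shift_integrable[OF g] g in auto)+
  show "0 \<le> smear lam \<mu> g x" using i g(2)[of x] lam by (auto simp: smear_def)
  have "lam * (\<integral>s. g (x - s) \<partial>\<mu>) + 2 * g x \<le> lam * B + 2 * B"
    using i g(3)[of x] lam by (intro add_mono mult_left_mono) auto
  then show "smear lam \<mu> g x \<le> B" using lam by (simp add: smear_def divide_le_eq algebra_simps)
qed

lemma funpow_smear_props:
  assumes g: "g \<in> borel_measurable borel" "\<And>x. 0 \<le> g x" "\<And>x. g x \<le> B"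
  shows "(smear lam \<mu> ^^ j) g \<in> borel_measurable borel \<and> (\<forall>x. 0 \<le> (smear lam \<mu> ^^ j) g x \<and> (smear lam \<mu> ^^ j) g x \<le> B)"
proof (induction j)
  case (Suc j)
  then show ?case using smear_props[of "(smear lam \<mu> ^^ j) g" B] by simp
qed (use g in simp)

text \<open>Write S for \<open>smear\<close> and R for the sum of 2^-j S^j g. An index shift gives S
  R = 2 (R - g), which is at most 2 R because g \<ge> 0; multiplied with lam + 2 this is the last
  claim. It also makes R dominate g, the first term of the series.\<close>

lemma resolvent_props:
  assumes g: "g \<in> borel_measurable borel" "\<And>x. 0 \<le> g x" "\<And>x. g x \<le> B"
  shows "resolvent lam \<mu> g \<in> borel_measurable borel" "g x \<le> resolvent lam \<mu> g x"
    "0 \<le> resolvent lam \<mu> g x" "resolvent lam \<mu> g x \<le> 2 * B"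
    "lam * (\<integral>s. resolvent lam \<mu> g (x - s) \<partial>\<mu>) + 2 * resolvent lam \<mu> g x \<le> 2 * (lam + 2) * resolvent lam \<mu> g x"
proof -
  define q where "q j = (smear lam \<mu> ^^ j) g" for j
  have q [measurable]: "q j \<in> borel_measurable borel" and q01: "0 \<le> q j x" "q j x \<le> B" for j x
    using funpow_smear_props[OF g] by (auto simp: q_def)
  have B: "0 \<le> B" using q01[of 0 0] by linarith
  have r: "resolvent lam \<mu> g x = (\<Sum>j. (1/2) ^ j * q j x)" for x by (simp add: resolvent_def q_def)
  have geo: "(\<lambda>j. (1/2) ^ j * B) sums (2 * B)"
    using sums_mult2[OF geometric_sums[of "1/2 :: real"], of B] by simp
  have sm: "summable (\<lambda>j. (1/2) ^ j * q j x)" for x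
    by (rule summable_comparison_test'[OF sums_summable[OF geo], of 0]) (use q01 in \<open>auto simp: abs_mult intro!: mult_left_mono\<close>)
  show m[measurable]: "resolvent lam \<mu> g \<in> borel_measurable borel"
    unfolding r[abs_def] by (rule borel_measurable_suminf) measurable
  have le: "(1/2) ^ j * q j x \<le> (1/2) ^ j * B" "0 \<le> (1/2) ^ j * q j x" for j x
    using q01 by (auto intro!: mult_left_mono)
  show rB: "resolvent lam \<mu> g x \<le> 2 * B" for x
    unfolding r sums_unique[OF geo] by (rule suminf_le[OF le(1) sm sums_summable[OF geo]])
  show r0: "0 \<le> resolvent lam \<mu> g x" for x unfolding r by (rule suminf_nonneg[OF sm le(2)])
  have split: "resolvent lam \<mu> g x = g x + (\<Sum>j. (1/2) ^ Suc j * q (Suc j) x)" for x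
    unfolding r using suminf_split_head[OF sm[of x]] by (simp add: q_def)
  have sm': "summable (\<lambda>j. (1/2) ^ Suc j * q (Suc j) x)" for x using sm[of x] by (subst summable_Suc_iff)
  have nn: "0 \<le> (\<Sum>j. (1/2) ^ Suc j * q (Suc j) x)" for x by (rule suminf_nonneg[OF sm' le(2)])
  show gr: "g x \<le> resolvent lam \<mu> g x" for x using split[of x] nn[of x] by linarith
  have iq: "integrable \<mu> (\<lambda>s. q j (x - s))" for j by (rule shift_integrable[OF q q01])
  have Iq: "0 \<le> (\<integral>s. q j (x - s) \<partial>\<mu>)" "(\<integral>s. q j (x - s) \<partial>\<mu>) \<le> B" for j
    by (rule integral_ge_const integral_le_const; use iq q01 in auto)+
  have smI: "summable (\<lambda>j. (1/2) ^ j * (\<integral>s. q j (x - s) \<partial>\<mu>))"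
    by (rule summable_comparison_test'[OF sums_summable[OF geo], of 0]) (use Iq in \<open>auto simp: abs_mult intro!: mult_left_mono\<close>)
  have I: "(\<integral>s. resolvent lam \<mu> g (x - s) \<partial>\<mu>) = (\<Sum>j. (1/2) ^ j * (\<integral>s. q j (x - s) \<partial>\<mu>))"
  proof -
    have "(\<integral>s. (\<Sum>j. (1/2) ^ j * q j (x - s)) \<partial>\<mu>) = (\<Sum>j. \<integral>s. (1/2) ^ j * q j (x - s) \<partial>\<mu>)"
    proof (rule integral_suminf)
      show "integrable \<mu> (\<lambda>s. (1/2) ^ j * q j (x - s))" for j using iq by simp
      show "AE s in \<mu>. summable (\<lambda>j. norm ((1/2) ^ j * q j (x - s)))"
        using sm le(2) by (auto simp: abs_of_nonneg)
      show "summable (\<lambda>j. \<integral>s. norm ((1/2) ^ j * q j (x - s)) \<partial>\<mu>)"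
        using smI q01 by (simp add: abs_mult)
    qed
    then show ?thesis unfolding r by simp
  qed
  have "lam * (\<integral>s. resolvent lam \<mu> g (x - s) \<partial>\<mu>) + 2 * resolvent lam \<mu> g x
     = (\<Sum>j. lam * ((1/2) ^ j * (\<integral>s. q j (x - s) \<partial>\<mu>)) + 2 * ((1/2) ^ j * q j x))"
    unfolding I unfolding r
    by (subst suminf_add[symmetric]) (use smI sm in \<open>auto intro: summable_mult simp: suminf_mult\<close>)
  also have "\<dots> = (\<Sum>j. 2 * (lam + 2) * ((1/2) ^ Suc j * q (Suc j) x))"
  proof (rule suminf_cong)
    fix j
    have "(lam + 2) * q (Suc j) x = lam * (\<integral>s. q j (x - s) \<partial>\<mu>) + 2 * q j x"
      using lam by (simp add: q_def smear_def)
    moreover have "2 * (lam + 2) * ((1/2) ^ Suc j * q (Suc j) x) = (1/2) ^ j * ((lam + 2) * q (Suc j) x)"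
      by (simp add: algebra_simps)
    ultimately have "2 * (lam + 2) * ((1/2) ^ Suc j * q (Suc j) x) = (1/2) ^ j * (lam * (\<integral>s. q j (x - s) \<partial>\<mu>) + 2 * q j x)"
      by simp
    then show "lam * ((1/2) ^ j * (\<integral>s. q j (x - s) \<partial>\<mu>)) + 2 * ((1/2) ^ j * q j x) = 2 * (lam + 2) * ((1/2) ^ Suc j * q (Suc j) x)"
      by (simp add: algebra_simps)
  qed
  also have "\<dots> = 2 * (lam + 2) * (\<Sum>j. (1/2) ^ Suc j * q (Suc j) x)"
    by (rule suminf_mult[OF sm'])
  also have "\<dots> \<le> 2 * (lam + 2) * resolvent lam \<mu> g x"
    using split[of x] g(2)[of x] lam by (intro mult_left_mono) auto
  finally show "lam * (\<integral>s. resolvent lam \<mu> g (x - s) \<partial>\<mu>) + 2 * resolvent lam \<mu> g x \<le> 2 * (lam + 2) * resolvent lam \<mu> g x" .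
qed

text \<open>If x - d is not an atom of \<mu> for any d in the countable set \<open>D\<close>, then x
  - s misses \<open>D\<close> for almost every s and dominated convergence applies. Besides
  \<open>D\<close>, the exceptional x are therefore sums of an atom and a point of \<open>D\<close>,
  which are again countably many.\<close>

lemma smear_tendsto_0:
  fixes g :: "nat \<Rightarrow> real \<Rightarrow> real"
  assumes g: "\<And>N. g N \<in> borel_measurable borel" "\<And>N x. 0 \<le> g N x" "\<And>N x. g N x \<le> B"
    and D: "countable D" and lim: "\<And>x. x \<notin> D \<Longrightarrow> (\<lambda>N. g N x) \<longlonglongrightarrow> 0"
  obtains D' where "countable D'" "\<And>x. x \<notin> D' \<Longrightarrow> (\<lambda>N. smear lam \<mu> (g N) x) \<longlonglongrightarrow> 0"
proof
  define At where "At = {a. prob {a} \<noteq> 0}"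
  have At: "countable At" unfolding At_def by (rule countable_support)
  show "countable (D \<union> (\<lambda>(a, d). a + d) ` (At \<times> D))" using At D by auto
  fix x assume x: "x \<notin> D \<union> (\<lambda>(a, d). a + d) ` (At \<times> D)"
  have "AE s in \<mu>. \<forall>d\<in>D. s \<noteq> x - d"
    unfolding AE_ball_countable[OF D]
  proof
    fix d assume d: "d \<in> D"
    have "x - d \<notin> At"
    proof
      assume "x - d \<in> At"
      then have "(\<lambda>(a, d). a + d) (x - d, d) \<in> (\<lambda>(a, d). a + d) ` (At \<times> D)" using d by (intro imageI) auto
      then show False using x by simp
    qed
    then have "emeasure \<mu> {x - d} = 0" by (simp add: At_def emeasure_eq_measure)
    then show "AE s in \<mu>. s \<noteq> x - d"
      by (intro AE_I[of _ _ "{x - d}"]) (auto simp: sets_mu)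
  qed
  then have "AE s in \<mu>. (\<lambda>N. g N (x - s)) \<longlonglongrightarrow> 0"
  proof eventually_elim
    case (elim s)
    have "x - s \<notin> D"
    proof
      assume "x - s \<in> D"
      from bspec[OF elim this] show False by simp
    qed
    then show ?case by (rule lim)
  qed
  then have "(\<lambda>N. \<integral>s. g N (x - s) \<partial>\<mu>) \<longlonglongrightarrow> (\<integral>s. 0 \<partial>\<mu>)"
    by (intro integral_dominated_convergence[where w = "\<lambda>_. B"]) (use g in auto)
  then have "(\<lambda>N. (lam * (\<integral>s. g N (x - s) \<partial>\<mu>) + 2 * g N x) / (lam + 2)) \<longlonglongrightarrow> (lam * 0 + 2 * 0) / (lam + 2)"
    using x lam by (intro tendsto_intros lim) auto
  then show "(\<lambda>N. smear lam \<mu> (g N) x) \<longlonglongrightarrow> 0" by (simp add: smear_def)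
qed

text \<open>Each power of \<open>smear\<close> has a countable exceptional set, and so does their
  union over all powers. Off it the limit passes through the series by Tannery's theorem.\<close>

lemma resolvent_tendsto_0:
  fixes g :: "nat \<Rightarrow> real \<Rightarrow> real"
  assumes g: "\<And>N. g N \<in> borel_measurable borel" "\<And>N x. 0 \<le> g N x" "\<And>N x. g N x \<le> B"
    and D: "countable D" and lim: "\<And>x. x \<notin> D \<Longrightarrow> (\<lambda>N. g N x) \<longlonglongrightarrow> 0"
  obtains D' where "countable D'" "\<And>x. x \<notin> D' \<Longrightarrow> (\<lambda>N. resolvent lam \<mu> (g N) x) \<longlonglongrightarrow> 0"
proof -
  have "\<exists>D'. countable D' \<and> (\<forall>x. x \<notin> D' \<longrightarrow> (\<lambda>N. (smear lam \<mu> ^^ j) (g N) x) \<longlonglongrightarrow> 0)" for j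
  proof (induction j)
    case 0
    then show ?case using D lim by auto
  next
    case (Suc j)
    then obtain D1 where D1: "countable D1" "\<And>x. x \<notin> D1 \<Longrightarrow> (\<lambda>N. (smear lam \<mu> ^^ j) (g N) x) \<longlonglongrightarrow> 0" by auto
    obtain D' where "countable D'" "\<And>x. x \<notin> D' \<Longrightarrow> (\<lambda>N. smear lam \<mu> ((smear lam \<mu> ^^ j) (g N)) x) \<longlonglongrightarrow> 0"
      using smear_tendsto_0[of "\<lambda>N. (smear lam \<mu> ^^ j) (g N)" B, OF _ _ _ D1] funpow_smear_props[OF g] by blast
    then show ?case by auto
  qed
  then obtain Df where Df: "\<And>j. countable (Df j)" "\<And>j x. x \<notin> Df j \<Longrightarrow> (\<lambda>N. (smear lam \<mu> ^^ j) (g N) x) \<longlonglongrightarrow> 0"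
    by metis
  show ?thesis
  proof
    show "countable (\<Union>j. Df j)" using Df by auto
    fix x assume x: "x \<notin> (\<Union>j. Df j)"
    have "(\<lambda>N. \<Sum>j. (1/2) ^ j * (smear lam \<mu> ^^ j) (g N) x) \<longlonglongrightarrow> (\<Sum>j. (0::real))"
    proof (rule tannerys_theorem[THEN conjunct2, THEN conjunct2])
      show "(\<lambda>N. (1/2) ^ j * (smear lam \<mu> ^^ j) (g N) x) \<longlonglongrightarrow> 0" for j
        using tendsto_mult_right_zero[OF Df(2)[of x j]] x by auto
      show "\<forall>\<^sub>F (j, N) in at_top \<times>\<^sub>F sequentially. norm ((1/2) ^ j * (smear lam \<mu> ^^ j) (g N) x) \<le> (1/2) ^ j * B"
        using funpow_smear_props[OF g] by (auto intro!: always_eventually mult_left_mono simp: abs_mult)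
      show "summable (\<lambda>j. (1/2 :: real) ^ j * B)" by (intro summable_mult2 summable_geometric) simp
    qed simp
    then show "(\<lambda>N. resolvent lam \<mu> (g N) x) \<longlonglongrightarrow> 0" by (simp add: resolvent_def)
  qed
qed

end

section \<open>Deviation of the empirical distribution from the mean-field flow\<close>

text \<open>The right-hand side of the mean-field equation, with the integral of 1 - J rewritten as
  \<open>u x\<close> minus the mean of \<open>u\<close> over shifts by Z; \<open>loss_drift\<close>
  identifies the two forms.\<close>

definition drift :: "real \<Rightarrow> real measure \<Rightarrow> (real \<Rightarrow> real) \<Rightarrow> real \<Rightarrow> real" where
  "drift lam \<mu> u x = lam * ((\<integral>s. u (x - s) \<partial>\<mu>) - u x) - u x * (1 - u x)"

text \<open>The differential equation in the form of a second-order one-sided expansion, which is all that the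
  Euler scheme is compared with.\<close>

definition mean_flow :: "real \<Rightarrow> real measure \<Rightarrow> real \<Rightarrow> real \<Rightarrow> (real \<Rightarrow> real \<Rightarrow> real) \<Rightarrow> bool" where
  "mean_flow lam \<mu> v B0 f \<longleftrightarrow> (\<forall>t\<ge>0. f t \<in> cdfs_upto (B0 + v * t)) \<and>
     (\<forall>x t h. 0 \<le> t \<and> 0 \<le> h \<longrightarrow> \<bar>f (t + h) x - f t x\<bar> \<le> (lam + 1) * h) \<and>
     (\<forall>x t h. 0 \<le> t \<and> 0 \<le> h \<and> x < B0 + v * t \<longrightarrow>
        \<bar>f (t + h) x - f t x - h * drift lam \<mu> (f t) x\<bar> \<le> (2 * lam + 3) * (lam + 1) * h\<^sup>2)"

lemma cdfs_upto_ge: "F \<in> cdfs_upto b \<Longrightarrow> b \<le> x \<Longrightarrow> F x = 1"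
  using cdfs_bounds(2)[of F x] by (force simp: cdfs_upto_def cdfs_def mono_def)

lemma cdfs_upto_cdfs: "F \<in> cdfs_upto b \<Longrightarrow> F \<in> cdfs" by (simp add: cdfs_upto_def)

lemma cdfs_measurable: "F \<in> cdfs \<Longrightarrow> F \<in> borel_measurable borel"
  by (intro borel_measurable_mono) (simp add: cdfs_def)

context moving_boundary_system begin

text \<open>The bound is one cell behind the current time, because the scheme truncates at the left
  end of the cell. \<open>variance_bound\<close> needs exactly this lag: at and beyond that earlier
  boundary \<open>one_step\<close> says nothing, but there the scheme already has the value
  1.\<close>

lemma euler_bounded:
  assumes "regular \<omega>" "\<omega> \<in> space M" and v: "0 \<le> v" and h: "0 \<le> h" and p: "\<And>i. i < n \<Longrightarrow> p i \<le> B0" and "i < n"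
  shows "euler h (Suc k) (noises h \<omega>) i \<le> B0 + v * (real k * h)"
  using \<open>i < n\<close>
proof (induction k arbitrary: i)
  have pk: "nat \<lfloor>noises h \<omega> (Pick i c)\<rfloor> < n" if "i < n" for i c
    using assms(1) that by (auto simp: noises_def noise_var_def regular_def)
  {
    case 0
    then show ?case using pk[OF 0] p by auto
  next
    case (Suc k)
    have le: "B0 + v * (real k * h) \<le> B0 + v * (real (Suc k) * h)"
      using v h by (auto intro!: mult_left_mono mult_right_mono)
    have IH: "euler h (Suc k) (noises h \<omega>) j \<le> B0 + v * (real (Suc k) * h)" if "j < n" for j
      using Suc.IH[OF that] le by linarith
    show ?case
      by (subst euler.simps(2)) (use IH[OF Suc.prems] IH[OF pk[OF Suc.prems]] in auto)
  }
qed

text \<open>The additive error of \<open>one_step\<close> per unit of time, with the remainder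
  constant of \<open>mean_flow\<close> put for \<open>K0\<close>.\<close>

definition err_rate :: "real \<Rightarrow> real" where
  "err_rate h = (2 * lam + 6) / real n +
     (4 * real n * (lam + 1)\<^sup>2 + 2 * ((2 * lam + 3) * (lam + 1)) + 2 * (lam + 1)\<^sup>2) * h"

text \<open>Induction over the cells. The rate 2 lam + 5 is 2 (lam + 2) from the supersolution
  property of \<open>G\<close>, plus 1 for the additive error, which \<open>G\<close> dominates. At
  and beyond the boundary the scheme is at 1 almost surely and \<open>f\<close> has left 1 by at
  most (lam + 1) h in one step; the square of this is also covered by h *
  \<open>err_rate h\<close>.\<close>

lemma variance_bound:
  assumes h: "0 \<le> h" and n: "2 \<le> n" and lam: "0 \<le> lam" and v: "0 \<le> v" and pos: "AE z in \<mu>. 0 < z"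
    and p: "\<And>i. i < n \<Longrightarrow> p i \<le> B0" and f: "mean_flow lam \<mu> v B0 f"
    and G: "G \<in> borel_measurable borel" "\<And>x. 0 \<le> G x" "\<And>x. G x \<le> B"
      "\<And>x. lam * (\<integral>s. G (x - s) \<partial>\<mu>) + 2 * G x \<le> 2 * (lam + 2) * G x"
    and G0: "\<And>x. (\<FF> p x - f 0 x)\<^sup>2 \<le> G x" "\<And>x. err_rate h \<le> G x"
  shows "variance_at h k (f (real k * h)) x \<le> (1 + (2 * lam + 5) * h) ^ k * G x"
proof (induction k arbitrary: x)
  case 0
  have "euler h 0 z = p" for z by (simp add: fun_eq_iff)
  then show ?case using G0(1)[of x] by (simp add: variance_at_def prob_space del: euler.simps)
next
  case (Suc k)
  interpret \<mu>: shift_kernel \<mu> lam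
    using mu_prob n lam by (auto simp: shift_kernel_def shift_kernel_axioms_def)
  define t where "t = real k * h"
  have t: "0 \<le> t" "real (Suc k) * h = t + h" using h by (auto simp: t_def algebra_simps)
  have ft: "f t \<in> cdfs_upto (B0 + v * t)" and ft': "f (t + h) \<in> cdfs_upto (B0 + v * (t + h))"
    using f t h by (auto simp: mean_flow_def)
  have lip: "\<bar>f (t + h) x - f t x\<bar> \<le> (lam + 1) * h" using f t h by (auto simp: mean_flow_def)
  define r where "r = 1 + (2 * lam + 5) * h"
  have r: "1 \<le> r" "h \<le> r" using h lam mult_right_mono[of 1 "2 * lam + 5" h] by (auto simp: r_def)
  have rk: "1 \<le> r ^ k" using r by simp
  define K where "K = 4 * real n * (lam + 1)\<^sup>2 + 2 * ((2 * lam + 3) * (lam + 1)) + 2 * (lam + 1)\<^sup>2"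
  have e: "err_rate h = (2 * lam + 6) / real n + K * h" by (simp add: err_rate_def K_def)
  have K: "(lam + 1)\<^sup>2 \<le> K" using lam by (simp add: K_def)
  have "variance_at h (Suc k) (f (t + h)) x \<le> r ^ Suc k * G x"
  proof (cases "x < B0 + v * t")
    case True
    let ?V = "variance_at h k (f t)"
    have IH: "?V y \<le> r ^ k * G y" for y using Suc.IH[of y] by (simp add: r_def t_def)
    have V0: "0 \<le> ?V y" for y by (simp add: variance_at_def)
    have "variance_at h (Suc k) (f (t + h)) x \<le> ?V x + h * (lam * (\<integral>s. ?V (x - s) \<partial>\<mu>) + 2 * ?V x)
       + (2 * lam + 6) * h / real n + (4 * real n * (lam + 1)\<^sup>2 + 2 * ((2 * lam + 3) * (lam + 1)) + 2 * (lam + 1)\<^sup>2) * h\<^sup>2"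
    proof (rule one_step[OF h n lam])
      show "x < B0 + v * (real k * h)" using True by (simp add: t_def)
      show "f t \<in> borel_measurable borel" by (rule cdfs_measurable[OF cdfs_upto_cdfs[OF ft]])
      show "0 \<le> f t y" "f t y \<le> 1" for y using cdfs_bounds[OF cdfs_upto_cdfs[OF ft]] by auto
      show "\<bar>f (t + h) x - f t x - h * drift lam \<mu> (f t) x\<bar> \<le> (2 * lam + 3) * (lam + 1) * h\<^sup>2"
        using f t h True by (auto simp: mean_flow_def)
    qed (use lip in \<open>auto simp: drift_def\<close>)
    also have "\<dots> = ?V x + h * (lam * (\<integral>s. ?V (x - s) \<partial>\<mu>) + 2 * ?V x) + h * err_rate h"
      unfolding e K_def by (simp add: algebra_simps power2_eq_square)
    also have "\<dots> \<le> r ^ k * G x + h * (r ^ k * (2 * (lam + 2) * G x)) + h * (r ^ k * G x)"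
    proof -
      have "(\<integral>s. ?V (x - s) \<partial>\<mu>) \<le> (\<integral>s. r ^ k * G (x - s) \<partial>\<mu>)"
        by (rule integral_mono') (use IH V0 G(2) rk \<mu>.shift_integrable[OF G(1,2,3)] in auto)
      then have 1: "lam * (\<integral>s. ?V (x - s) \<partial>\<mu>) + 2 * ?V x \<le> lam * (r ^ k * (\<integral>s. G (x - s) \<partial>\<mu>)) + 2 * (r ^ k * G x)"
        using IH[of x] lam by (intro add_mono mult_left_mono) auto
      also have "\<dots> = r ^ k * (lam * (\<integral>s. G (x - s) \<partial>\<mu>) + 2 * G x)" by (simp add: algebra_simps)
      also have "\<dots> \<le> r ^ k * (2 * (lam + 2) * G x)" using G(4)[of x] rk by (intro mult_left_mono) auto
      finally have 2: "lam * (\<integral>s. ?V (x - s) \<partial>\<mu>) + 2 * ?V x \<le> r ^ k * (2 * (lam + 2) * G x)" .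
      have "1 * G x \<le> r ^ k * G x" using rk G(2)[of x] by (intro mult_right_mono) auto
      then have "err_rate h \<le> r ^ k * G x" using G0(2)[of x] by linarith
      then show ?thesis using IH[of x] 2 h by (intro add_mono mult_left_mono) auto
    qed
    also have "\<dots> = r ^ Suc k * G x" by (simp add: r_def algebra_simps)
    finally show ?thesis .
  next
    case False
    have "AE \<omega> in M. (\<FF> (euler h (Suc k) (noises h \<omega>)) x - f (t + h) x)\<^sup>2 \<le> ((lam + 1) * h)\<^sup>2"
      using regular_AE[OF n pos] AE_space
    proof eventually_elim
      case (elim \<omega>)
      have "\<FF> (euler h (Suc k) (noises h \<omega>)) x = 1"
      proof (rule emp_le_n)
        fix i assume i: "i < n"
        have "euler h (Suc k) (noises h \<omega>) i \<le> B0 + v * (real k * h)"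
          by (rule euler_bounded[OF elim v h p i])
        also have "\<dots> \<le> x" using False by (simp add: t_def)
        finally show "euler h (Suc k) (noises h \<omega>) i \<le> x" .
      qed (use n in simp)
      moreover have "f t x = 1" using cdfs_upto_ge[OF ft] False by simp
      ultimately show ?case using lip h lam
        by (subst abs_le_square_iff[symmetric]) (auto simp: abs_minus_commute)
    qed
    then have "variance_at h (Suc k) (f (t + h)) x \<le> expectation (\<lambda>_. ((lam + 1) * h)\<^sup>2)"
      unfolding variance_at_def by (intro integral_mono_AE') auto
    also have "\<dots> = h * ((lam + 1)\<^sup>2 * h)" by (simp add: prob_space power2_eq_square algebra_simps)
    also have "\<dots> \<le> h * err_rate h"
      unfolding e using K h lam by (intro mult_left_mono add_increasing mult_right_mono) auto
    also have "\<dots> \<le> r ^ Suc k * G x"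
    proof (rule mult_mono)
      have "r * 1 \<le> r * r ^ k" using r rk by (intro mult_left_mono) auto
      then have "r \<le> r ^ Suc k" by (simp only: power_Suc mult_1_right)
      with r(2) show "h \<le> r ^ Suc k" by (rule order_trans)
      have "0 \<le> err_rate h" unfolding e using K h lam order_trans[OF zero_le_power2 K] by auto
      then show "0 \<le> err_rate h" .
    qed (use G0 r in auto)
    finally show ?thesis .
  qed
  then show ?case by (simp only: t(2) r_def)
qed

text \<open>Chebyshev's inequality at each point of \<open>Q\<close>, and a union bound over n^3
  cells, each of them bad with probability at most (n (lam + 1) T / n^3)^2. The total (lam + 1)^2
  T^2 / n vanishes in the limit, whereas a mesh T / n^2 would leave a constant.\<close>

lemma euler_deviation:
  fixes Q :: "real set"
  assumes n: "2 \<le> n" and lam: "0 \<le> lam" and v: "0 \<le> v" and pos: "AE z in \<mu>. 0 < z"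
    and p: "\<And>i. i < n \<Longrightarrow> p i \<le> B0" and f: "mean_flow lam \<mu> v B0 f" and T: "0 < T"
    and Q: "finite Q" and \<delta>: "0 < \<delta>"
  defines "h \<equiv> T / real (n ^ 3)"
  defines "G \<equiv> resolvent lam \<mu> (\<lambda>x. (\<FF> p x - f 0 x)\<^sup>2 + err_rate h)"
  shows "\<exists>A\<in>events. 1 - (\<Sum>q\<in>Q. exp ((2 * lam + 5) * T) * G q / \<delta>\<^sup>2) - (lam + 1)\<^sup>2 * T\<^sup>2 / real n \<le> prob A \<and>
     (\<forall>\<omega>\<in>A. regular \<omega> \<and> (\<exists>w. (\<forall>q\<in>Q. \<bar>\<FF> w q - f T q\<bar> < \<delta>) \<and> (\<forall>i<n. \<bar>X i T \<omega> - w i\<bar> \<le> v * h)))"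
proof -
  interpret \<mu>: shift_kernel \<mu> lam
    using mu_prob n lam by (auto simp: shift_kernel_def shift_kernel_axioms_def)
  define m where "m = n ^ 3"
  have m: "0 < m" using n by (simp add: m_def)
  have h: "0 < h" "real m * h = T" using T m by (auto simp: h_def m_def)
  have f0: "f 0 \<in> cdfs" using f by (auto simp: mean_flow_def cdfs_upto_def)
  have er: "0 \<le> err_rate h" using lam h by (auto simp: err_rate_def)
  define g where "g x = (\<FF> p x - f 0 x)\<^sup>2 + err_rate h" for x
  have "\<bar>\<FF> p x - f 0 x\<bar> \<le> 1" for x
    using empirical_cdf_bounds[of n p x] cdfs_bounds[OF f0, of x] by (auto simp: abs_le_iff)
  then have g01: "0 \<le> g x" "g x \<le> 1 + err_rate h" for x using er by (auto simp: g_def abs_square_le_1)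
  have gm: "g \<in> borel_measurable borel"
    using cdfs_measurable[OF f0] unfolding g_def[abs_def] empirical_cdf_sum by measurable
  note R = \<mu>.resolvent_props[OF gm g01]
  have Gg: "G = resolvent lam \<mu> g" by (simp add: G_def g_def[abs_def])
  let ?W = "\<lambda>\<omega>. euler h m (noises h \<omega>)"
  have Wm: "?W \<in> measurable M (PiM UNIV (\<lambda>_. borel))"
    by (rule euler_measurable) (use noises_measurable h in auto)
  have [measurable]: "(\<lambda>\<omega>. \<FF> (?W \<omega>) q) \<in> borel_measurable M" for q
    by (rule emp_comp_measurable[OF Wm]) simp
  have Vq: "expectation (\<lambda>\<omega>. (\<FF> (?W \<omega>) q - f T q)\<^sup>2) \<le> exp ((2 * lam + 5) * T) * G q" for q
  proof -
    have "variance_at h m (f (real m * h)) q \<le> (1 + (2 * lam + 5) * h) ^ m * G q"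
    proof (rule variance_bound[OF less_imp_le[OF h(1)] n lam v pos p f])
      show "(\<FF> p x - f 0 x)\<^sup>2 \<le> G x" "err_rate h \<le> G x" for x
      proof -
        have "g x = (\<FF> p x - f 0 x)\<^sup>2 + err_rate h" by (simp add: g_def)
        then show "(\<FF> p x - f 0 x)\<^sup>2 \<le> G x" "err_rate h \<le> G x"
          unfolding Gg using R(2)[of x] er zero_le_power2[of "\<FF> p x - f 0 x"] by linarith+
      qed
    qed (use R in \<open>auto simp: Gg\<close>)
    also have "\<dots> \<le> exp ((2 * lam + 5) * T) * G q"
    proof (rule mult_right_mono)
      have "(1 + (2 * lam + 5) * h) ^ m \<le> exp ((2 * lam + 5) * h) ^ m"
        using lam h exp_ge_add_one_self[of "(2 * lam + 5) * h"] by (intro power_mono) auto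
      also have "\<dots> = exp ((2 * lam + 5) * T)"
        unfolding h(2)[symmetric] by (simp add: exp_of_nat_mult[symmetric] algebra_simps)
      finally show "(1 + (2 * lam + 5) * h) ^ m \<le> exp ((2 * lam + 5) * T)" .
    qed (use R in \<open>auto simp: Gg\<close>)
    finally show ?thesis by (simp add: variance_at_def h(2))
  qed
  define D where "D q = {\<omega>\<in>space M. \<delta> \<le> \<bar>\<FF> (?W \<omega>) q - f T q\<bar>}" for q
  have Dm[measurable]: "D q \<in> events" for q unfolding D_def by measurable
  have PD: "prob (D q) \<le> exp ((2 * lam + 5) * T) * G q / \<delta>\<^sup>2" for q
  proof -
    have d1: "\<bar>\<FF> (?W \<omega>) q - f T q\<bar> \<le> 1" for \<omega>
    proof -
      have "f T \<in> cdfs" using f T by (auto simp: mean_flow_def cdfs_upto_def)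
      then show ?thesis
        using empirical_cdf_bounds[of n "?W \<omega>" q] cdfs_bounds[of "f T" q] by (auto simp: abs_le_iff)
    qed
    have "\<delta>\<^sup>2 * prob (D q) = expectation (\<lambda>\<omega>. \<delta>\<^sup>2 * of_bool (\<delta> \<le> \<bar>\<FF> (?W \<omega>) q - f T q\<bar>))"
      by (simp add: expectation_of_bool D_def)
    also have "\<dots> \<le> expectation (\<lambda>\<omega>. (\<FF> (?W \<omega>) q - f T q)\<^sup>2)"
    proof (rule integral_mono)
      show "integrable M (\<lambda>\<omega>. \<delta>\<^sup>2 * of_bool (\<delta> \<le> \<bar>\<FF> (?W \<omega>) q - f T q\<bar>))"
        by (intro integrable_mult_right integrable_of_bool) measurable
      show "integrable M (\<lambda>\<omega>. (\<FF> (?W \<omega>) q - f T q)\<^sup>2)"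
        by (rule integrable_const_bound[where B = 1]) (use d1 in \<open>auto simp: abs_square_le_1\<close>)
      show "\<delta>\<^sup>2 * of_bool (\<delta> \<le> \<bar>\<FF> (?W \<omega>) q - f T q\<bar>) \<le> (\<FF> (?W \<omega>) q - f T q)\<^sup>2" for \<omega>
        using \<delta> by (auto simp: of_bool_def abs_le_square_iff[symmetric])
    qed
    also note Vq
    finally show ?thesis using \<delta> by (simp add: field_simps)
  qed
  define E where "E k = {\<omega>\<in>space M. bad_cell (noises h \<omega>) k}" for k
  have Em[measurable]: "E k \<in> events" for k
    unfolding E_def using pred_bad_cell[of h k] h by (simp add: pred_def)
  have PE: "prob (E k) \<le> (real n * (lam + 1) * h)\<^sup>2" for k
    unfolding E_def by (rule prob_bad_cell) (use h n lam in auto)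
  obtain N where N: "{\<omega>\<in>space M. \<not> regular \<omega>} \<subseteq> N" "emeasure M N = 0" "N \<in> events"
    using AE_E[OF regular_AE[OF n pos]] by metis
  define U where "U = (\<Union>q\<in>Q. D q) \<union> (\<Union>k<m. E k) \<union> N"
  have Um: "U \<in> events" unfolding U_def using Q N by (intro sets.Un sets.finite_UN) auto
  have "prob U \<le> prob (\<Union>q\<in>Q. D q) + prob (\<Union>k<m. E k) + prob N"
    unfolding U_def by (intro order_trans[OF measure_Un_le] add_right_mono measure_Un_le)
      (use Q N in \<open>auto intro!: sets.finite_UN\<close>)
  also have "\<dots> \<le> (\<Sum>q\<in>Q. prob (D q)) + (\<Sum>k<m. prob (E k)) + 0"
    using N by (intro add_mono measure_UNION_le Q) (auto simp: measure_def)
  also have "\<dots> \<le> (\<Sum>q\<in>Q. exp ((2 * lam + 5) * T) * G q / \<delta>\<^sup>2) + (\<Sum>k<m. (real n * (lam + 1) * h)\<^sup>2) + 0"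
    by (intro add_mono sum_mono PD PE) auto
  also have "(\<Sum>k<m. (real n * (lam + 1) * h)\<^sup>2) = (lam + 1)\<^sup>2 * T\<^sup>2 / real n"
    using n by (simp add: h_def m_def field_simps power2_eq_square power3_eq_cube)
  finally have PU: "prob U \<le> (\<Sum>q\<in>Q. exp ((2 * lam + 5) * T) * G q / \<delta>\<^sup>2) + (lam + 1)\<^sup>2 * T\<^sup>2 / real n" by simp
  show ?thesis
  proof (intro bexI[of _ "space M - U"] conjI ballI)
    show "1 - (\<Sum>q\<in>Q. exp ((2 * lam + 5) * T) * G q / \<delta>\<^sup>2) - (lam + 1)\<^sup>2 * T\<^sup>2 / real n \<le> prob (space M - U)"
      using PU prob_compl[OF Um] by simp
    fix \<omega> assume \<omega>: "\<omega> \<in> space M - U"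
    then have \<omega>M: "\<omega> \<in> space M" by simp
    show reg: "regular \<omega>" using \<omega> N by (auto simp: U_def)
    have "\<forall>i<n. \<bar>X i T \<omega> - ?W \<omega> i\<bar> \<le> v * h"
      using coupling[OF \<omega>M reg v h(1), of m m] \<omega> h(2) by (auto simp: U_def E_def)
    moreover have "\<forall>q\<in>Q. \<bar>\<FF> (?W \<omega>) q - f T q\<bar> < \<delta>" using \<omega> by (auto simp: U_def D_def)
    ultimately show "\<exists>w. (\<forall>q\<in>Q. \<bar>\<FF> w q - f T q\<bar> < \<delta>) \<and> (\<forall>i<n. \<bar>X i T \<omega> - w i\<bar> \<le> v * h)" by blast
  qed (use Um in auto)
qed

end

section \<open>From the scheme to the particles: Levy distance and uniformity in time\<close>

lemma empirical_cdf_mono: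
  assumes "\<And>i. i < n \<Longrightarrow> w i \<le> x \<Longrightarrow> w' i \<le> x'"
  shows "empirical_cdf n w x \<le> empirical_cdf n w' x'"
  unfolding empirical_cdf_def by (intro divide_right_mono of_nat_mono card_mono) (use assms in auto)

lemma empirical_cdf_cdfs:
  assumes "0 < n" shows "empirical_cdf n w \<in> cdfs"
proof -
  have ind: "((\<lambda>x. of_bool (w i \<le> x) :: real) \<longlongrightarrow> of_bool (w i \<le> x)) (at_right x)" for i x
  proof (rule tendsto_eventually)
    show "eventually (\<lambda>y. of_bool (w i \<le> y) = (of_bool (w i \<le> x) :: real)) (at_right x)"
    proof (cases "w i \<le> x")
      case True
      from eventually_at_right_less[of x] show ?thesis by eventually_elim (use True in auto)
    next
      case False
      then have "x < w i" by simp
      from eventually_at_right_real[OF this] show ?thesis by eventually_elim auto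
    qed
  qed
  have bot: "((\<lambda>x. of_bool (w i \<le> x) :: real) \<longlongrightarrow> 0) at_bot" for i
    by (rule tendsto_eventually) (auto simp: eventually_at_bot_linorder intro!: exI[of _ "w i - 1"])
  have top: "((\<lambda>x. of_bool (w i \<le> x) :: real) \<longlongrightarrow> 1) at_top" for i
    by (rule tendsto_eventually) (use eventually_ge_at_top[of "w i"] in \<open>auto elim!: eventually_mono\<close>)
  have "(empirical_cdf n w \<longlongrightarrow> empirical_cdf n w x) (at_right x)" for x
    unfolding empirical_cdf_sum[abs_def] empirical_cdf_sum[of n w x] by (intro tendsto_intros ind) (use assms in auto)
  moreover have "(empirical_cdf n w \<longlongrightarrow> (\<Sum>i<n. 0) / real n) at_bot"
    unfolding empirical_cdf_sum[abs_def] by (intro tendsto_intros bot) (use assms in auto)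
  moreover have "(empirical_cdf n w \<longlongrightarrow> (\<Sum>i<n. 1) / real n) at_top"
    unfolding empirical_cdf_sum[abs_def] by (intro tendsto_intros top) (use assms in auto)
  ultimately show ?thesis
    using assms by (auto simp: cdfs_def mono_def continuous_within intro: empirical_cdf_mono)
qed

lemma empirical_cdf_eq_1D:
  assumes "empirical_cdf n w b = 1" "i < n" shows "w i \<le> b"
proof -
  have "real (card {i. i < n \<and> w i \<le> b}) = real n"
    using assms by (simp add: empirical_cdf_def divide_eq_1_iff)
  then have "card {i. i < n \<and> w i \<le> b} = card {..<n}" by simp
  then have "{i. i < n \<and> w i \<le> b} = {..<n}" by (intro card_subset_eq) auto
  then show ?thesis using assms by auto
qed

text \<open>By contradiction: distribution functions that violate the claim along finer and finer finite
  subsets of a countable dense set would converge weakly.\<close>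

lemma levy_close_finite:
  assumes F: "F \<in> cdfs" and e: "0 < e" and D: "countable D"
  obtains Q \<delta> where "finite Q" "Q \<inter> D = {}" "0 < \<delta>"
    "\<forall>G\<in>cdfs. (\<forall>q\<in>Q. \<bar>G q - F q\<bar> < \<delta>) \<longrightarrow> levy_dist G F < e"
proof -
  have ex: "\<exists>y. a < b \<longrightarrow> a < y \<and> y < b \<and> y \<notin> D" for a b :: real
  proof (cases "a < b")
    case True
    have "uncountable ({a<..<b} - D)"
      using True D by (intro uncountable_minus_countable) (auto simp: uncountable_open_interval)
    then have "{a<..<b} - D \<noteq> {}" by (metis countable_empty)
    then show ?thesis by auto
  qed auto
  \<comment> \<open>Intervals with rational end points are countably many and suffice for density.
    Each is represented by a point outside \<open>D\<close>, as rationals themselves may lie in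
    \<open>D\<close>.\<close>
  obtain y where y: "\<And>a b :: real. a < b \<Longrightarrow> a < y a b \<and> y a b < b \<and> y a b \<notin> D"
    using ex by metis
  define q where "q k = (case from_nat k of (a :: rat, b :: rat) \<Rightarrow>
     if a < b then y (of_rat a) (of_rat b) else y 0 1)" for k
  have qD: "q k \<notin> D" for k
    using y by (auto simp: q_def of_rat_less split: prod.split)
  have dense: "\<exists>k. a < q k \<and> q k < b" if ab: "a < b" for a b :: real
  proof -
    obtain r where r: "a < of_rat r" "of_rat r < b" using of_rat_dense[OF ab] by auto
    obtain s where s: "of_rat r < (of_rat s :: real)" "of_rat s < b" using of_rat_dense[OF r(2)] by auto
    have "q (to_nat (r, s)) = y (of_rat r) (of_rat s)" using s by (simp add: q_def of_rat_less)
    then show ?thesis using y[OF s(1)] r s by (intro exI[of _ "to_nat (r, s)"]) auto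
  qed
  \<comment> \<open>One index governs both the number of test points and the tolerance, so failure
    for every N produces a single sequence.\<close>
  have "\<exists>N. \<forall>G\<in>cdfs. (\<forall>k\<le>N. \<bar>G (q k) - F (q k)\<bar> < 1 / real (Suc N)) \<longrightarrow> levy_dist G F < e"
  proof (rule ccontr)
    assume "\<not> ?thesis"
    then obtain G where G: "\<And>N. G N \<in> cdfs" "\<And>N k. k \<le> N \<Longrightarrow> \<bar>G N (q k) - F (q k)\<bar> < 1 / real (Suc N)"
      "\<And>N. \<not> levy_dist (G N) F < e"
      by metis
    have mG: "mono (G N)" for N using G(1)[of N] by (simp add: cdfs_def)
    have "weak_conv G F"
      unfolding weak_conv_def
    proof (intro allI impI)
      fix x assume "isCont F x"
      show "(\<lambda>N. G N x) \<longlonglongrightarrow> F x"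
      proof (rule tendstoI)
        fix \<epsilon> :: real assume \<epsilon>: "0 < \<epsilon>"
        then obtain d where d: "d > 0" "\<And>z. dist z x < d \<Longrightarrow> dist (F z) (F x) < \<epsilon> / 2"
          using \<open>isCont F x\<close> unfolding continuous_at_eps_delta by (meson half_gt_zero)
        obtain k where k: "x - d < q k" "q k < x" using dense[of "x - d" x] d by auto
        obtain l where l: "x < q l" "q l < x + d" using dense[of x "x + d"] d by auto
        have kl: "\<bar>F (q k) - F x\<bar> < \<epsilon> / 2" "\<bar>F (q l) - F x\<bar> < \<epsilon> / 2"
          using d(2)[of "q k"] d(2)[of "q l"] k l by (auto simp: dist_real_def)
        have "eventually (\<lambda>N. 1 / real (Suc N) < \<epsilon> / 2) sequentially"
          using order_tendstoD(2)[OF LIMSEQ_inverse_real_of_nat, of "\<epsilon> / 2"] \<epsilon> by (simp add: inverse_eq_divide)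
        then show "eventually (\<lambda>N. dist (G N x) (F x) < \<epsilon>) sequentially"
          using eventually_ge_at_top[of "max k l"]
        proof eventually_elim
          case (elim N)
          have "G N (q k) \<le> G N x" "G N x \<le> G N (q l)" using mG k l by (auto simp: mono_def)
          moreover have "\<bar>G N (q k) - F (q k)\<bar> < \<epsilon> / 2" "\<bar>G N (q l) - F (q l)\<bar> < \<epsilon> / 2"
            using G(2)[of k N] G(2)[of l N] elim by auto
          ultimately show ?case using kl unfolding dist_real_def by linarith
        qed
      qed
    qed
    then have "(\<lambda>N. levy_dist (G N) F) \<longlonglongrightarrow> 0" by (rule weak_conv_imp_levy_tendsto[OF G(1) F])
    then have "eventually (\<lambda>N. levy_dist (G N) F < e) sequentially" using e by (rule order_tendstoD)
    then show False using G(3) by auto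
  qed
  then obtain N where N: "\<And>G. G \<in> cdfs \<Longrightarrow> (\<And>k. k \<le> N \<Longrightarrow> \<bar>G (q k) - F (q k)\<bar> < 1 / real (Suc N)) \<Longrightarrow> levy_dist G F < e"
    by auto
  show ?thesis
    by (rule that[of "q ` {..N}" "1 / real (Suc N)"]) (use qD N in auto)
qed

text \<open>\<open>err_rate\<close> freed from the locale, so that \<open>n\<close> and the
  probability space may vary in a limit.\<close>

definition one_step_error :: "real \<Rightarrow> nat \<Rightarrow> real \<Rightarrow> real" where
  "one_step_error lam n h = (2 * lam + 6) / real n +
     (4 * real n * (lam + 1)\<^sup>2 + 2 * ((2 * lam + 3) * (lam + 1)) + 2 * (lam + 1)\<^sup>2) * h"

text \<open>Eliminates the processes behind \<open>Y\<close>. Locations within v * h of those of the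
  scheme become two-sided domination of distribution functions shifted by v * h, and locations that
  increase in time become distribution functions that decrease.\<close>

lemma empirical_process_deviation:
  assumes Y: "empirical_process M n lam \<mu> v B0 g Y" and n: "2 \<le> n" and lam: "0 \<le> lam" and v: "0 \<le> v"
    and pos: "AE z in \<mu>. 0 < z" and g: "g \<in> cdfs_upto B0" and f: "mean_flow lam \<mu> v B0 f" and T: "0 < T"
    and Q: "finite Q" and \<delta>: "0 < \<delta>"
  defines "G \<equiv> resolvent lam \<mu> (\<lambda>x. (g x - f 0 x)\<^sup>2 + one_step_error lam n (T / real (n ^ 3)))"
  shows "\<exists>A\<in>sets M. 1 - (\<Sum>q\<in>Q. exp ((2 * lam + 5) * T) * G q / \<delta>\<^sup>2) - (lam + 1)\<^sup>2 * T\<^sup>2 / real n \<le> measure M A \<and>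
     (\<forall>\<omega>\<in>A. (\<forall>s t x. 0 \<le> s \<longrightarrow> s \<le> t \<longrightarrow> Y \<omega> t x \<le> Y \<omega> s x) \<and>
        (\<exists>w. (\<forall>q\<in>Q. \<bar>empirical_cdf n w q - f T q\<bar> < \<delta>) \<and>
           (\<forall>x. Y \<omega> T x \<le> empirical_cdf n w (x + v * (T / real (n ^ 3))) \<and>
                empirical_cdf n w x \<le> Y \<omega> T (x + v * (T / real (n ^ 3))))))"
proof -
  obtain p NJ NC S C X where sys: "moving_boundary_system M n lam \<mu> v B0 p NJ NC S C X"
    and pg: "empirical_cdf n p = g" and YX: "\<And>\<omega>. \<omega> \<in> space M \<Longrightarrow> Y \<omega> = (\<lambda>t\<in>{0..}. empirical_cdf n (\<lambda>i. X i t \<omega>))"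
    using Y unfolding empirical_process_def by blast
  interpret moving_boundary_system M n lam \<mu> v B0 p NJ NC S C X by (rule sys)
  have p: "p i \<le> B0" if "i < n" for i
    by (rule empirical_cdf_eq_1D[OF _ that]) (use g pg in \<open>simp add: cdfs_upto_def\<close>)
  have "err_rate (T / real (n ^ 3)) = one_step_error lam n (T / real (n ^ 3))"
    by (simp add: err_rate_def one_step_error_def)
  then have *: "G = resolvent lam \<mu> (\<lambda>x. (\<FF> p x - f 0 x)\<^sup>2 + err_rate (T / real (n ^ 3)))"
    by (simp add: G_def pg)
  obtain A where A: "A \<in> events" "1 - (\<Sum>q\<in>Q. exp ((2 * lam + 5) * T) * G q / \<delta>\<^sup>2) - (lam + 1)\<^sup>2 * T\<^sup>2 / real n \<le> prob A"
    "\<And>\<omega>. \<omega> \<in> A \<Longrightarrow> regular \<omega>"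
    "\<And>\<omega>. \<omega> \<in> A \<Longrightarrow> \<exists>w. (\<forall>q\<in>Q. \<bar>\<FF> w q - f T q\<bar> < \<delta>) \<and> (\<forall>i<n. \<bar>X i T \<omega> - w i\<bar> \<le> v * (T / real (n ^ 3)))"
    using euler_deviation[OF n lam v pos p f T Q \<delta>, folded *] by blast
  show ?thesis
  proof (intro bexI[OF _ A(1)] conjI ballI A(2))
    fix \<omega> assume \<omega>: "\<omega> \<in> A"
    then have \<omega>M: "\<omega> \<in> space M" using sets.sets_into_space[OF A(1)] by auto
    note mono = location_mono_bounded[OF \<omega>M A(3)[OF \<omega>] v p]
    show "\<forall>s t x. 0 \<le> s \<longrightarrow> s \<le> t \<longrightarrow> Y \<omega> t x \<le> Y \<omega> s x"
    proof (intro allI impI)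
      fix s t x :: real assume st: "0 \<le> s" "s \<le> t"
      have "X i s \<omega> \<le> X i t \<omega>" if "i < n" for i using mono[of t i] st that by auto
      then show "Y \<omega> t x \<le> Y \<omega> s x"
        using st by (auto simp: YX[OF \<omega>M] intro!: empirical_cdf_mono intro: order_trans)
    qed
    obtain w where w: "\<forall>q\<in>Q. \<bar>\<FF> w q - f T q\<bar> < \<delta>" "\<And>i. i < n \<Longrightarrow> \<bar>X i T \<omega> - w i\<bar> \<le> v * (T / real (n ^ 3))"
      using A(4)[OF \<omega>] by blast
    have YT: "Y \<omega> T x = \<FF> (\<lambda>i. X i T \<omega>) x" for x using T by (simp add: YX[OF \<omega>M])
    have "Y \<omega> T x \<le> empirical_cdf n w (x + v * (T / real (n ^ 3)))"
      "empirical_cdf n w x \<le> Y \<omega> T (x + v * (T / real (n ^ 3)))" for x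
    proof -
      have *: "X i T \<omega> \<le> w i + v * (T / real (n ^ 3))" "w i \<le> X i T \<omega> + v * (T / real (n ^ 3))" if "i < n" for i
        using w(2)[OF that] unfolding abs_le_iff by linarith+
      show "Y \<omega> T x \<le> empirical_cdf n w (x + v * (T / real (n ^ 3)))"
        unfolding YT by (rule empirical_cdf_mono) (use * in fastforce)
      show "empirical_cdf n w x \<le> Y \<omega> T (x + v * (T / real (n ^ 3)))"
        unfolding YT by (rule empirical_cdf_mono) (use * in fastforce)
    qed
    then show "\<exists>w. (\<forall>q\<in>Q. \<bar>empirical_cdf n w q - f T q\<bar> < \<delta>) \<and>
           (\<forall>x. Y \<omega> T x \<le> empirical_cdf n w (x + v * (T / real (n ^ 3))) \<and>
                empirical_cdf n w x \<le> Y \<omega> T (x + v * (T / real (n ^ 3))))"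
      using w(1) by blast
  qed
qed

lemma one_step_error_tendsto: "(\<lambda>n. one_step_error lam (n + 2) (T / real ((n + 2) ^ 3))) \<longlonglongrightarrow> 0"
proof -
  have 1: "(\<lambda>n. c / real (n + 2)) \<longlonglongrightarrow> 0" for c :: real
    using LIMSEQ_ignore_initial_segment[OF lim_const_over_n[of c], of 2] by simp
  have "(\<lambda>n. (2 * lam + 6) / real (n + 2) + (4 * T * (lam + 1)\<^sup>2) / real (n + 2) * (1 / real (n + 2)) +
     (2 * ((2 * lam + 3) * (lam + 1)) + 2 * (lam + 1)\<^sup>2) * (T / real (n + 2) * (1 / real (n + 2) * (1 / real (n + 2)))))
     \<longlonglongrightarrow> 0 + 0 * 0 + (2 * ((2 * lam + 3) * (lam + 1)) + 2 * (lam + 1)\<^sup>2) * (0 * (0 * 0))"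
    by (intro tendsto_intros 1)
  moreover have "one_step_error lam N (T / real (N ^ 3)) = (2 * lam + 6) / real N + (4 * T * (lam + 1)\<^sup>2) / real N * (1 / real N) +
     (2 * ((2 * lam + 3) * (lam + 1)) + 2 * (lam + 1)\<^sup>2) * (T / real N * (1 / real N * (1 / real N)))" if "0 < N" for N
  proof -
    have "4 * real N * (lam + 1)\<^sup>2 * (T / real (N ^ 3)) = (4 * T * (lam + 1)\<^sup>2) / real N * (1 / real N)"
      using that by (simp add: power3_eq_cube)
    moreover have "T / real (N ^ 3) = T / real N * (1 / real N * (1 / real N))" by (simp add: power3_eq_cube)
    ultimately show ?thesis unfolding one_step_error_def distrib_right by (simp add: power3_eq_cube)
  qed
  ultimately show ?thesis by (simp del: power_Suc of_nat_Suc)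
qed

text \<open>The bound on the deviation tends to 0 only off a countable set \<open>D\<close>. This is
  enough, since the finitely many points that control the Levy distance to \<open>f T\<close> can be
  chosen off \<open>D\<close>.\<close>

lemma one_time_convergence:
  assumes lam: "0 \<le> lam" and v: "0 \<le> v" and \<mu>: "real_distribution \<mu>" and pos: "AE z in \<mu>. 0 < z"
    and f: "mean_flow lam \<mu> v B0 f" and T: "0 < T" and e: "0 < e"
    and fn0: "\<And>n. 2 \<le> n \<Longrightarrow> fn0 n \<in> cdfs_upto B0" and w: "weak_conv fn0 (f 0)"
    and Y: "\<And>n. 2 \<le> n \<Longrightarrow> empirical_process (M n) n lam \<mu> v B0 (fn0 n) (Y n)"
  shows "eventually (\<lambda>n. \<exists>A\<in>sets (M n). 1 - e \<le> measure (M n) A \<and> (\<forall>\<omega>\<in>A.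
     (\<forall>s t x. 0 \<le> s \<longrightarrow> s \<le> t \<longrightarrow> Y n \<omega> t x \<le> Y n \<omega> s x) \<and> levy_close e (Y n \<omega> T) (f T))) sequentially"
proof -
  interpret \<mu>: shift_kernel \<mu> lam
    using \<mu> lam by (auto simp: shift_kernel_def shift_kernel_axioms_def real_distribution_def real_distribution_axioms_def)
  have f0: "f 0 \<in> cdfs" and fT: "f T \<in> cdfs" using f T by (auto simp: mean_flow_def cdfs_upto_def)
  \<comment> \<open>Sequences are shifted by 2: the limit lemmas want their hypotheses at every
    index, and the data are given from n = 2 on.\<close>
  define \<eta> where "\<eta> n = one_step_error lam (n + 2) (T / real ((n + 2) ^ 3))" for n
  have \<eta>: "\<eta> \<longlonglongrightarrow> 0" unfolding \<eta>_def by (rule one_step_error_tendsto)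
  have \<eta>0: "0 \<le> \<eta> n" for n unfolding \<eta>_def one_step_error_def using lam T by auto
  obtain B where B: "\<And>n. \<bar>\<eta> n\<bar> \<le> B" using convergent_imp_Bseq[of \<eta>] \<eta> by (auto simp: convergent_def Bseq_def)
  define g where "g n x = (fn0 (n + 2) x - f 0 x)\<^sup>2 + \<eta> n" for n x
  have fnc: "fn0 (n + 2) \<in> cdfs" for n using fn0[of "n + 2"] by (simp add: cdfs_upto_def)
  have gm: "g n \<in> borel_measurable borel" for n
    using cdfs_measurable[OF f0] cdfs_measurable[OF fnc[of n]] unfolding g_def[abs_def] by measurable
  have g01: "0 \<le> g n x" "g n x \<le> 1 + B" for n x
  proof -
    have "\<bar>fn0 (n + 2) x - f 0 x\<bar> \<le> 1"
      using cdfs_bounds[OF fnc, of n x] cdfs_bounds[OF f0, of x] by (auto simp: abs_le_iff)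
    then have "(fn0 (n + 2) x - f 0 x)\<^sup>2 \<le> 1" by (simp add: abs_square_le_1)
    then show "0 \<le> g n x" "g n x \<le> 1 + B" using \<eta>0[of n] B[of n] by (auto simp: g_def)
  qed
  have cnt: "countable {x. \<not> isCont (f 0) x}" by (rule mono_ctble_discont) (use f0 in \<open>simp add: cdfs_def\<close>)
  have lim: "(\<lambda>n. g n x) \<longlonglongrightarrow> 0" if "x \<notin> {x. \<not> isCont (f 0) x}" for x
  proof -
    have "(\<lambda>n. fn0 n x) \<longlonglongrightarrow> f 0 x" using w that by (auto simp: weak_conv_def)
    then have "(\<lambda>n. fn0 (n + 2) x) \<longlonglongrightarrow> f 0 x" by (rule LIMSEQ_ignore_initial_segment)
    then have "(\<lambda>n. (fn0 (n + 2) x - f 0 x)\<^sup>2 + \<eta> n) \<longlonglongrightarrow> (f 0 x - f 0 x)\<^sup>2 + 0" by (intro tendsto_intros \<eta>)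
    then show ?thesis by (simp add: g_def)
  qed
  obtain D where D: "countable D" "\<And>x. x \<notin> D \<Longrightarrow> (\<lambda>n. resolvent lam \<mu> (g n) x) \<longlonglongrightarrow> 0"
    by (rule \<mu>.resolvent_tendsto_0[OF gm g01 cnt lim]) (assumption, rule that)
  obtain Q \<delta> where Q: "finite Q" "Q \<inter> D = {}" "0 < \<delta>"
    "\<forall>G\<in>cdfs. (\<forall>q\<in>Q. \<bar>G q - f T q\<bar> < \<delta>) \<longrightarrow> levy_dist G (f T) < e / 2"
    by (rule levy_close_finite[OF fT half_gt_zero[OF e] D(1)]) (rule that)
  have 1: "(\<lambda>n. c / real (n + 2)) \<longlonglongrightarrow> 0" for c :: real
    using LIMSEQ_ignore_initial_segment[OF lim_const_over_n[of c], of 2] by simp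
  have "(\<lambda>n. (\<Sum>q\<in>Q. exp ((2 * lam + 5) * T) * resolvent lam \<mu> (g n) q / \<delta>\<^sup>2) + (lam + 1)\<^sup>2 * T\<^sup>2 / real (n + 2))
     \<longlonglongrightarrow> (\<Sum>q\<in>Q. exp ((2 * lam + 5) * T) * 0 / \<delta>\<^sup>2) + 0"
    by (intro tendsto_intros 1 D(2)) (use Q in auto)
  then have ev1: "eventually (\<lambda>n. (\<Sum>q\<in>Q. exp ((2 * lam + 5) * T) * resolvent lam \<mu> (g n) q / \<delta>\<^sup>2) + (lam + 1)\<^sup>2 * T\<^sup>2 / real (n + 2) < e) sequentially"
    using e by (intro order_tendstoD(2)) auto
  have ev2: "eventually (\<lambda>n. v * T / real (n + 2) < e / 2) sequentially"
    using 1[of "v * T"] e by (intro order_tendstoD(2)) auto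
  have "eventually (\<lambda>n. \<exists>A\<in>sets (M (n + 2)). 1 - e \<le> measure (M (n + 2)) A \<and> (\<forall>\<omega>\<in>A.
     (\<forall>s t x. 0 \<le> s \<longrightarrow> s \<le> t \<longrightarrow> Y (n + 2) \<omega> t x \<le> Y (n + 2) \<omega> s x) \<and> levy_close e (Y (n + 2) \<omega> T) (f T))) sequentially"
    using ev1 ev2
  proof eventually_elim
    case (elim n)
    let ?n = "n + 2"
    obtain A where A: "A \<in> sets (M ?n)"
      "1 - (\<Sum>q\<in>Q. exp ((2 * lam + 5) * T) * resolvent lam \<mu> (g n) q / \<delta>\<^sup>2) - (lam + 1)\<^sup>2 * T\<^sup>2 / real ?n \<le> measure (M ?n) A"
      "\<And>\<omega>. \<omega> \<in> A \<Longrightarrow> (\<forall>s t x. 0 \<le> s \<longrightarrow> s \<le> t \<longrightarrow> Y ?n \<omega> t x \<le> Y ?n \<omega> s x)"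
      "\<And>\<omega>. \<omega> \<in> A \<Longrightarrow> (\<exists>w. (\<forall>q\<in>Q. \<bar>empirical_cdf ?n w q - f T q\<bar> < \<delta>) \<and>
           (\<forall>x. Y ?n \<omega> T x \<le> empirical_cdf ?n w (x + v * (T / real (?n ^ 3))) \<and>
                empirical_cdf ?n w x \<le> Y ?n \<omega> T (x + v * (T / real (?n ^ 3)))))"
      using empirical_process_deviation[OF Y[of ?n] _ lam v pos fn0[of ?n] f T Q(1,3)]
      unfolding g_def[abs_def] \<eta>_def by auto
    show ?case
    proof (intro bexI[OF _ A(1)] conjI ballI)
      show "1 - e \<le> measure (M ?n) A" using A(2) elim(1) by linarith
      fix \<omega> assume \<omega>: "\<omega> \<in> A"
      show "\<forall>s t x. 0 \<le> s \<longrightarrow> s \<le> t \<longrightarrow> Y ?n \<omega> t x \<le> Y ?n \<omega> s x" by (rule A(3)[OF \<omega>])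
      \<comment> \<open>The distance between particles and scheme. It takes one half of
        \<open>e\<close>; the Levy distance between scheme and limit takes the other.\<close>
      define \<kappa> where "\<kappa> = v * (T / real (?n ^ 3))"
      obtain w where w: "\<And>q. q \<in> Q \<Longrightarrow> \<bar>empirical_cdf ?n w q - f T q\<bar> < \<delta>"
        "\<And>x. Y ?n \<omega> T x \<le> empirical_cdf ?n w (x + \<kappa>)" "\<And>x. empirical_cdf ?n w x \<le> Y ?n \<omega> T (x + \<kappa>)"
        using A(4)[OF \<omega>] unfolding \<kappa>_def by blast
      have "\<kappa> \<le> v * T / real ?n"
      proof -
        have "real ?n ^ 1 \<le> real ?n ^ 3" by (rule power_increasing) auto
        then show ?thesis unfolding \<kappa>_def using v T
          by (auto simp: intro!: mult_left_mono divide_left_mono simp del: power_Suc)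
      qed
      then have \<kappa>: "\<kappa> \<le> e / 2" using elim(2) by linarith
      have wc: "empirical_cdf ?n w \<in> cdfs" by (rule empirical_cdf_cdfs) simp
      have "levy_dist (empirical_cdf ?n w) (f T) < e / 2" using Q(4) wc w(1) by blast
      then have lc: "empirical_cdf ?n w x \<le> f T (x + e / 2) + e / 2" "f T x \<le> empirical_cdf ?n w (x + e / 2) + e / 2" for x
        using levy_dist_less[OF wc fT] by (auto simp: levy_close_def)
      have mf: "f T x \<le> f T y" "empirical_cdf ?n w x \<le> empirical_cdf ?n w y" if "x \<le> y" for x y
        using fT wc that by (auto simp: cdfs_def mono_def)
      show "levy_close e (Y ?n \<omega> T) (f T)"
        unfolding levy_close_def
      proof (intro allI conjI)
        fix x
        have "Y ?n \<omega> T x \<le> f T (x + \<kappa> + e / 2) + e / 2" using w(2)[of x] lc(1)[of "x + \<kappa>"] by linarith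
        also have "\<dots> \<le> f T (x + e) + e" using mf(1)[of "x + \<kappa> + e / 2" "x + e"] \<kappa> e by linarith
        finally show "Y ?n \<omega> T x \<le> f T (x + e) + e" .
        have "f T x \<le> empirical_cdf ?n w (x + e / 2) + e / 2" by (rule lc)
        also have "\<dots> \<le> empirical_cdf ?n w (x + e - \<kappa>) + e" using mf(2)[of "x + e / 2" "x + e - \<kappa>"] \<kappa> e by linarith
        also have "\<dots> \<le> Y ?n \<omega> T (x + e) + e" using w(3)[of "x + e - \<kappa>"] by simp
        finally show "f T x \<le> Y ?n \<omega> T (x + e) + e" .
      qed
    qed
  qed
  then show ?thesis by (rule eventually_sequentially_seg[THEN iffD1])
qed

lemma (in prob_space) prob_INT_ge:
  assumes "finite K" "K \<noteq> {}" "\<And>k. k \<in> K \<Longrightarrow> A k \<in> events" "\<And>k. k \<in> K \<Longrightarrow> 1 - c \<le> prob (A k)"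
  shows "1 - real (card K) * c \<le> prob (\<Inter>k\<in>K. A k)"
proof -
  have I: "(\<Inter>k\<in>K. A k) \<in> events" using assms by (intro sets.finite_INT) auto
  have "space M - (\<Inter>k\<in>K. A k) = (\<Union>k\<in>K. space M - A k)" by auto
  then have "1 - prob (\<Inter>k\<in>K. A k) = prob (\<Union>k\<in>K. space M - A k)"
    using prob_compl[OF I] by simp
  also have "\<dots> \<le> (\<Sum>k\<in>K. prob (space M - A k))"
    by (rule measure_UNION_le) (use assms in auto)
  also have "\<dots> \<le> (\<Sum>k\<in>K. c)"
    by (rule sum_mono) (use assms(3,4) prob_compl in fastforce)
  finally show ?thesis by simp
qed

lemma grid_cell:
  assumes "0 \<le> t" "t \<le> T" "0 < T" "0 < K"
  obtains k :: nat where "k < K" "real k * (T / real K) \<le> t" "t \<le> real (Suc k) * (T / real K)"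
\<comment> \<open>At the right end the floor would give the index \<open>K\<close>, one too
  many.\<close>
proof (cases "t = T")
  case True
  show ?thesis
  proof
    show "K - 1 < K" using assms by simp
    show "real (K - 1) * (T / real K) \<le> t"
      using True assms by (simp add: field_simps)
    show "t \<le> real (Suc (K - 1)) * (T / real K)" using True assms by (simp add: field_simps)
  qed
next
  case False
  define x where "x = t * real K / T"
  have x: "0 \<le> x" "x < real K" using assms False by (auto simp: x_def field_simps)
  have t: "t = x * (T / real K)" using assms by (simp add: x_def)
  show ?thesis
  proof
    show "nat \<lfloor>x\<rfloor> < K" using x by linarith
    show "real (nat \<lfloor>x\<rfloor>) * (T / real K) \<le> t"
      unfolding t using x assms divide_nonneg_nonneg[of T "real K"] by (intro mult_right_mono) auto
    show "t \<le> real (Suc (nat \<lfloor>x\<rfloor>)) * (T / real K)"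
      unfolding t using x assms divide_nonneg_nonneg[of T "real K"] by (intro mult_right_mono) linarith+
  qed
qed

text \<open>\<open>Y\<close> decreases in time and \<open>f\<close> is Lipschitz in time, so
  closeness at the two ends of a time cell spreads over the cell at the cost of the change of
  \<open>f\<close> in it. Finitely many grid times therefore suffice.\<close>

lemma uniform_convergence:
  assumes lam: "0 \<le> lam" and v: "0 \<le> v" and \<mu>: "real_distribution \<mu>" and pos: "AE z in \<mu>. 0 < z"
    and f: "mean_flow lam \<mu> v B0 f" and T: "0 < T" and e: "0 < e"
    and fn0: "\<And>n. 2 \<le> n \<Longrightarrow> fn0 n \<in> cdfs_upto B0" and w: "weak_conv fn0 (f 0)"
    and Y: "\<And>n. 2 \<le> n \<Longrightarrow> empirical_process (M n) n lam \<mu> v B0 (fn0 n) (Y n)"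
  shows "eventually (\<lambda>n. \<exists>A\<in>sets (M n). 1 - e \<le> measure (M n) A \<and> (\<forall>\<omega>\<in>A. \<forall>t\<in>{0..T}.
     levy_dist (Y n \<omega> t) (f t) < e)) sequentially"
proof -
  obtain K :: nat where K: "4 * (lam + 1) * T / e < real K" using reals_Archimedean2 by blast
  have K0: "0 < K" using K lam T e by (cases K) (auto simp: divide_less_0_iff mult_less_0_iff dest: less_trans)
  define h where "h = T / real K"
  have h: "0 < h" "(lam + 1) * h < e / 4" using K K0 T e by (auto simp: h_def field_simps)
  \<comment> \<open>Intersecting the events at the K positive grid times loses at most K * e' in
    probability. Time 0 is not among them: there the state is the deterministic initial one.\<close>
  define e' where "e' = min (e / 4) (e / real K)"
  have e': "0 < e'" "e' \<le> e / 4" "real K * e' \<le> e" using e K0 by (auto simp: e'_def min_def field_simps)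
  have "eventually (\<lambda>n. \<forall>k\<in>{1..K}. \<exists>A\<in>sets (M n). 1 - e' \<le> measure (M n) A \<and> (\<forall>\<omega>\<in>A.
     (\<forall>s t x. 0 \<le> s \<longrightarrow> s \<le> t \<longrightarrow> Y n \<omega> t x \<le> Y n \<omega> s x) \<and> levy_close e' (Y n \<omega> (real k * h)) (f (real k * h)))) sequentially"
    by (intro eventually_ball_finite ballI one_time_convergence[OF lam v \<mu> pos f _ e'(1) fn0 w Y]) (use h in auto)
  moreover have "eventually (\<lambda>n. levy_close (e / 4) (fn0 n) (f 0)) sequentially"
  proof -
    have fnc: "fn0 (n + 2) \<in> cdfs" for n using fn0[of "n + 2"] by (simp add: cdfs_upto_def)
    have f0: "f 0 \<in> cdfs" using f by (auto simp: mean_flow_def cdfs_upto_def)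
    have "weak_conv (\<lambda>n. fn0 (n + 2)) (f 0)"
      unfolding weak_conv_def
    proof (intro allI impI)
      fix x assume "isCont (f 0) x"
      then have "(\<lambda>n. fn0 n x) \<longlonglongrightarrow> f 0 x" using w by (simp add: weak_conv_def)
      then show "(\<lambda>n. fn0 (n + 2) x) \<longlonglongrightarrow> f 0 x" by (rule LIMSEQ_ignore_initial_segment)
    qed
    from weak_conv_imp_levy_tendsto[OF fnc f0 this]
    have "eventually (\<lambda>n. levy_dist (fn0 (n + 2)) (f 0) < e / 4) sequentially"
      using e by (intro order_tendstoD) auto
    then have "eventually (\<lambda>n. levy_close (e / 4) (fn0 (n + 2)) (f 0)) sequentially"
      by eventually_elim (rule levy_dist_less[OF fnc f0])
    then show ?thesis by (rule eventually_sequentially_seg[THEN iffD1])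
  qed
  ultimately show ?thesis using eventually_ge_at_top[of 2]
  proof eventually_elim
    case (elim n)
    obtain p NJ NC S C X where sys: "moving_boundary_system (M n) n lam \<mu> v B0 p NJ NC S C X"
      and pg: "empirical_cdf n p = fn0 n" and YX: "\<And>\<omega>. \<omega> \<in> space (M n) \<Longrightarrow> Y n \<omega> = (\<lambda>t\<in>{0..}. empirical_cdf n (\<lambda>i. X i t \<omega>))"
      using Y[OF elim(3)] unfolding empirical_process_def by blast
    interpret moving_boundary_system "M n" n lam \<mu> v B0 p NJ NC S C X by (rule sys)
    obtain A where A: "\<And>k. k \<in> {1..K} \<Longrightarrow> A k \<in> events" "\<And>k. k \<in> {1..K} \<Longrightarrow> 1 - e' \<le> prob (A k)"
      "\<And>k \<omega>. k \<in> {1..K} \<Longrightarrow> \<omega> \<in> A k \<Longrightarrow>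
     (\<forall>s t x. 0 \<le> s \<longrightarrow> s \<le> t \<longrightarrow> Y n \<omega> t x \<le> Y n \<omega> s x) \<and> levy_close e' (Y n \<omega> (real k * h)) (f (real k * h))"
      using elim(1) by metis
    let ?A = "\<Inter>k\<in>{1..K}. A k"
    show ?case
    proof (intro bexI[of _ ?A] conjI ballI)
      show "?A \<in> events" using A(1) K0 by (intro sets.finite_INT) auto
      have "1 - real (card {1..K}) * e' \<le> prob ?A" by (rule prob_INT_ge) (use A K0 in auto)
      then show "1 - e \<le> prob ?A" using e'(3) by simp
      fix \<omega> t assume \<omega>: "\<omega> \<in> ?A" and t: "t \<in> {0..T}"
      have \<omega>M: "\<omega> \<in> space (M n)" using \<omega> K0 sets.sets_into_space[OF A(1)[of 1]] by auto
      have mono: "Y n \<omega> t x \<le> Y n \<omega> s x" if "0 \<le> s" "s \<le> t" for s t x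
        using A(3)[of 1 \<omega>] \<omega> K0 that by auto
      have cl: "levy_close (e / 4) (Y n \<omega> (real k * h)) (f (real k * h))" if "k \<le> K" for k
      proof (cases "k = 0")
        case True
        have "empirical_cdf n (\<lambda>i. X i 0 \<omega>) = empirical_cdf n p"
          using initial[OF _ \<omega>M] by (auto simp: empirical_cdf_def fun_eq_iff intro!: arg_cong[where f = card])
        then show ?thesis using True elim(2) pg by (simp add: YX[OF \<omega>M])
      next
        case False
        then have "k \<in> {1..K}" using that by simp
        then have c: "levy_close e' (Y n \<omega> (real k * h)) (f (real k * h))" using A(3)[of k \<omega>] \<omega> by auto
        have "Y n \<omega> (real k * h) \<in> cdfs" using \<omega>M h elim(3) by (simp add: YX empirical_cdf_cdfs)
        moreover have "f (real k * h) \<in> cdfs" using f h by (auto simp: mean_flow_def cdfs_upto_def)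
        ultimately show ?thesis using levy_close_mono c e'(2) by blast
      qed
      obtain k where k: "k < K" "real k * h \<le> t" "t \<le> real (Suc k) * h"
        using grid_cell[of t T K] t T K0 unfolding h_def by auto
      have lip: "\<bar>f b x - f a x\<bar> \<le> (lam + 1) * (b - a)" if "0 \<le> a" "a \<le> b" for a b x
      proof -
        have "\<forall>x t h. 0 \<le> t \<and> 0 \<le> h \<longrightarrow> \<bar>f (t + h) x - f t x\<bar> \<le> (lam + 1) * h"
          using f by (simp add: mean_flow_def)
        from this[rule_format, of a "b - a" x] that show ?thesis by simp
      qed
      have len: "(lam + 1) * (t - real k * h) \<le> e / 4" "(lam + 1) * (real (Suc k) * h - t) \<le> e / 4"
      proof -
        have "t - real k * h \<le> h" "real (Suc k) * h - t \<le> h" using k by (auto simp: algebra_simps)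
        then have "(lam + 1) * (t - real k * h) \<le> (lam + 1) * h" "(lam + 1) * (real (Suc k) * h - t) \<le> (lam + 1) * h"
          using lam by (auto intro!: mult_left_mono)
        then show "(lam + 1) * (t - real k * h) \<le> e / 4" "(lam + 1) * (real (Suc k) * h - t) \<le> e / 4"
          using h by linarith+
      qed
      have kh: "0 \<le> real k * h" using h by simp
      have ft: "mono (f t)" using f t by (auto simp: mean_flow_def cdfs_upto_def cdfs_def)
      have Yt: "mono (Y n \<omega> t)" using empirical_cdf_cdfs[of n] elim(3) t by (auto simp: YX[OF \<omega>M] cdfs_def)
      have "levy_close (e / 2) (Y n \<omega> t) (f t)"
        unfolding levy_close_def
      proof (intro allI conjI)
        fix x
        have "Y n \<omega> t x \<le> Y n \<omega> (real k * h) x" by (rule mono[OF kh k(2)])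
        also have "\<dots> \<le> f (real k * h) (x + e / 4) + e / 4" using cl[of k] k by (auto simp: levy_close_def)
        also have "\<dots> \<le> f t (x + e / 4) + e / 2" using lip[OF kh k(2), of "x + e / 4"] len(1) by linarith
        also have "\<dots> \<le> f t (x + e / 2) + e / 2" using monoD[OF ft, of "x + e / 4" "x + e / 2"] e by simp
        finally show "Y n \<omega> t x \<le> f t (x + e / 2) + e / 2" .
        have "f t x \<le> f (real (Suc k) * h) x + e / 4" using lip[OF _ k(3), of x] t len(2) by auto
        also have "\<dots> \<le> Y n \<omega> (real (Suc k) * h) (x + e / 4) + e / 2"
        proof -
          have "levy_close (e / 4) (Y n \<omega> (real (Suc k) * h)) (f (real (Suc k) * h))"
            by (rule cl) (use k in simp)
          then have "f (real (Suc k) * h) x \<le> Y n \<omega> (real (Suc k) * h) (x + e / 4) + e / 4"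
            unfolding levy_close_def by blast
          then show ?thesis by linarith
        qed
        also have "\<dots> \<le> Y n \<omega> t (x + e / 4) + e / 2" using mono[OF _ k(3), of "x + e / 4"] t by simp
        also have "\<dots> \<le> Y n \<omega> t (x + e / 2) + e / 2" using monoD[OF Yt, of "x + e / 4" "x + e / 2"] e by simp
        finally show "f t x \<le> Y n \<omega> t (x + e / 2) + e / 2" .
      qed
      then show "levy_dist (Y n \<omega> t) (f t) < e" using levy_dist_le[of "e / 2"] e by force
    qed
  qed
qed

section \<open>Measurability of step paths in the Skorohod space\<close>

lemma time_change_comp:
  assumes "time_change s" "time_change s'" shows "time_change (s \<circ> s')"
proof -
  have "0 \<le> s' t" if "0 \<le> t" for t using assms(2) that by (auto simp: time_change_def)
  then have "strict_mono_on {0..} (s \<circ> s')"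
    using assms by (auto simp: time_change_def strict_mono_on_def)
  moreover have "(s \<circ> s') ` {0..} = {0..}"
    using assms unfolding time_change_def by (metis image_comp)
  ultimately show ?thesis by (simp add: time_change_def)
qed

lemma time_change_inverse:
  assumes "time_change s"
  obtains s' where "time_change s'" "\<And>t. 0 \<le> t \<Longrightarrow> 0 \<le> s' t \<and> s (s' t) = t"
proof -
  have s: "strict_mono_on {0..} s" "s ` {0..} = {0..}" using assms by (auto simp: time_change_def)
  have inj: "inj_on s {0..}" by (rule strict_mono_on_imp_inj_on[OF s(1)])
  define s' where "s' = inv_into {0..} s"
  have s': "0 \<le> s' t \<and> s (s' t) = t" if "0 \<le> t" for t
    using that s(2) inv_into_into[of t s "{0..}"] f_inv_into_f[of t s "{0..}"] by (auto simp: s'_def)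
  have inv: "s' (s t) = t" if "0 \<le> t" for t using inj that by (simp add: s'_def)
  have "strict_mono_on {0..} s'"
  proof (rule strict_mono_onI)
    fix a b :: real assume ab: "a \<in> {0..}" "b \<in> {0..}" "a < b"
    show "s' a < s' b"
    proof (rule ccontr)
      assume "\<not> s' a < s' b"
      then have "s (s' b) \<le> s (s' a)"
        using strict_mono_on_leD[OF s(1), of "s' b" "s' a"] s'[of a] s'[of b] ab by auto
      then show False using s'[of a] s'[of b] ab by auto
    qed
  qed
  moreover have "s' ` {0..} = {0..}"
  proof (intro equalityI subsetI)
    fix t :: real assume "t \<in> {0..}"
    moreover have "0 \<le> s t" using s(2) \<open>t \<in> {0..}\<close> by auto
    ultimately show "t \<in> s' ` {0..}" using inv[of t] by (intro image_eqI[of _ _ "s t"]) auto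
  qed (use s' in auto)
  ultimately show ?thesis using s' that by (auto simp: time_change_def)
qed

text \<open>Piecewise affine interpolation between the two partitions. It will move the instants at
  which a path changes to grid points.\<close>

lemma time_change_interpolate:
  fixes a b :: "nat \<Rightarrow> real"
  assumes a: "strict_mono a" "a 0 = 0" "\<And>x. \<exists>k. x < a k"
    and b: "strict_mono b" "b 0 = 0" "\<And>x. \<exists>k. x < b k"
  obtains s where "time_change s"
    "\<And>k t. a k \<le> t \<Longrightarrow> t < a (Suc k) \<Longrightarrow> b k \<le> s t \<and> s t < b (Suc k)"
proof -
  have cell: "\<exists>!k. c k \<le> t \<and> t < c (Suc k)" if c: "strict_mono c" "c 0 = 0" "\<And>x. \<exists>k. x < c k" and "0 \<le> t"
    for c :: "nat \<Rightarrow> real" and t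
  proof (rule ex_ex1I)
    define k where "k = (LEAST k. t < c k)"
    have k: "t < c k" unfolding k_def using c(3)[of t] by (rule LeastI_ex)
    then have "k \<noteq> 0" using c(2) \<open>0 \<le> t\<close> by (cases k) auto
    then obtain l where l: "k = Suc l" by (cases k) auto
    have "\<not> t < c l" using not_less_Least[of l "\<lambda>k. t < c k"] l by (auto simp: k_def)
    then show "\<exists>k. c k \<le> t \<and> t < c (Suc k)" using k l by (intro exI[of _ l]) auto
    fix k l assume kl: "c k \<le> t \<and> t < c (Suc k)" "c l \<le> t \<and> t < c (Suc l)"
    have "\<not> Suc k \<le> l" "\<not> Suc l \<le> k"
      using strict_mono_leD[OF c(1), of "Suc k" l] strict_mono_leD[OF c(1), of "Suc l" k] kl by auto
    then show "k = l" by simp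
  qed
  define idx where "idx t = (THE k. a k \<le> t \<and> t < a (Suc k))" for t
  have idx: "a (idx t) \<le> t" "t < a (Suc (idx t))" if "0 \<le> t" for t
    using theI'[OF cell[OF a that]] by (auto simp: idx_def)
  have idxI: "idx t = k" if "0 \<le> t" "a k \<le> t" "t < a (Suc k)" for t k
    using cell[OF a that(1)] idx[OF that(1)] that by auto
  have da: "0 < a (Suc k) - a k" and db: "0 < b (Suc k) - b k" for k
    using strict_monoD[OF a(1), of k "Suc k"] strict_monoD[OF b(1), of k "Suc k"] by auto
  define L where "L k t = b k + (t - a k) / (a (Suc k) - a k) * (b (Suc k) - b k)" for k t
  have L1: "b k \<le> L k t \<and> L k t < b (Suc k)" if "a k \<le> t" "t < a (Suc k)" for k t
  proof -
    have "0 \<le> (t - a k) / (a (Suc k) - a k)" "(t - a k) / (a (Suc k) - a k) < 1"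
      using that da[of k] by (auto simp: field_simps)
    then have "0 \<le> (t - a k) / (a (Suc k) - a k) * (b (Suc k) - b k)"
      "(t - a k) / (a (Suc k) - a k) * (b (Suc k) - b k) < 1 * (b (Suc k) - b k)"
      using db[of k] by (intro mult_nonneg_nonneg mult_strict_right_mono; simp)+
    moreover have "L k t = b k + (t - a k) / (a (Suc k) - a k) * (b (Suc k) - b k)" by (simp add: L_def)
    ultimately show ?thesis by argo
  qed
  have Lmono: "L k t < L k t'" if "t < t'" for k t t'
    unfolding L_def using that da[of k] db[of k] by (intro add_strict_left_mono mult_strict_right_mono divide_strict_right_mono) auto
  define s where "s t = L (idx t) t" for t
  have a0: "0 \<le> a k" and b0: "0 \<le> b k" for k
    using strict_mono_leD[OF a(1), of 0 k] strict_mono_leD[OF b(1), of 0 k] a(2) b(2) by auto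
  have s1: "b k \<le> s t \<and> s t < b (Suc k)" if "a k \<le> t" "t < a (Suc k)" for k t
    using L1[OF that] idxI[of t k] that a0[of k] by (auto simp: s_def)
  have "strict_mono_on {0..} s"
  proof (rule strict_mono_onI)
    fix t t' :: real assume t: "t \<in> {0..}" "t' \<in> {0..}" "t < t'"
    have "idx t \<le> idx t'"
    proof (rule ccontr)
      assume "\<not> idx t \<le> idx t'"
      then have "a (Suc (idx t')) \<le> a (idx t)" using strict_mono_leD[OF a(1)] by auto
      then show False using idx[of t] idx[of t'] t by auto
    qed
    then consider "idx t = idx t'" | "Suc (idx t) \<le> idx t'" by linarith
    then show "s t < s t'"
    proof cases
      case 1 then show ?thesis using Lmono[OF t(3)] by (simp add: s_def)
    next
      case 2
      have "s t < b (Suc (idx t))" using s1 idx[of t] t by auto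
      also have "\<dots> \<le> b (idx t')" using strict_mono_leD[OF b(1) 2] .
      also have "\<dots> \<le> s t'" using s1 idx[of t'] t by auto
      finally show ?thesis .
    qed
  qed
  moreover have "s ` {0..} = {0..}"
  proof (intro equalityI subsetI)
    fix y assume "y \<in> s ` {0..}"
    then obtain t where t: "0 \<le> t" "y = s t" by auto
    then show "y \<in> {0..}" using s1[OF idx[OF t(1)]] b0[of "idx t"] by auto
  next
    fix y :: real assume y: "y \<in> {0..}"
    then obtain k where k: "b k \<le> y" "y < b (Suc k)" using cell[OF b, of y] by auto
    define t where "t = a k + (y - b k) / (b (Suc k) - b k) * (a (Suc k) - a k)"
    have q: "0 \<le> (y - b k) / (b (Suc k) - b k)" "(y - b k) / (b (Suc k) - b k) < 1"
      using k db[of k] by (auto simp: field_simps)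
    have t: "a k \<le> t" "t < a (Suc k)"
    proof -
      have "0 \<le> (y - b k) / (b (Suc k) - b k) * (a (Suc k) - a k)"
        "(y - b k) / (b (Suc k) - b k) * (a (Suc k) - a k) < 1 * (a (Suc k) - a k)"
        using da[of k] q by (intro mult_nonneg_nonneg mult_strict_right_mono; simp)+
      then show "a k \<le> t" "t < a (Suc k)" using t_def by argo+
    qed
    have "L k t = y" using da[of k] db[of k] by (simp add: L_def t_def)
    then have "s t = y" using idxI[OF _ t] t a0[of k] by (simp add: s_def)
    then show "y \<in> s ` {0..}" using t a0[of k] by (auto intro!: image_eqI[of _ _ t])
  qed
  ultimately show ?thesis using s1 that by (auto simp: time_change_def)
qed

text \<open>Every time has a neighbourhood in which \<open>N\<close> changes at most at that time;
  \<delta> is a Lebesgue number of this cover of [0, H]. That an interval holds at most one change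
  is expressed through the values at three times, a condition that is easy to make
  measurable.\<close>

lemma counting_fine_grid:
  assumes N: "counting N" and H: "0 \<le> H"
  obtains \<delta> where "0 < \<delta>" "\<And>a c b. 0 \<le> a \<Longrightarrow> a \<le> c \<Longrightarrow> c \<le> b \<Longrightarrow> b \<le> H \<Longrightarrow> b - a < \<delta> \<Longrightarrow> N c = N a \<or> N c = N b"
proof -
  define ok where "ok U \<longleftrightarrow> open U \<and> (\<forall>a c b. 0 \<le> a \<longrightarrow> a \<le> c \<longrightarrow> c \<le> b \<longrightarrow> a \<in> U \<longrightarrow> c \<in> U \<longrightarrow> b \<in> U \<longrightarrow> N c = N a \<or> N c = N b)" for U
  have "\<exists>U. ok U \<and> x \<in> U" if x: "0 \<le> x" for x
  proof -
    obtain u where u: "x < u" "\<And>r. x \<le> r \<Longrightarrow> r < u \<Longrightarrow> N r = N x" using counting_right[OF N x] by blast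
    obtain l where l: "l < x" "\<And>a c. 0 \<le> a \<Longrightarrow> l < a \<Longrightarrow> a \<le> c \<Longrightarrow> c < x \<Longrightarrow> N c = N a"
    proof (cases "x = 0")
      case True
      then show ?thesis by (intro that[of "- 1"]) auto
    next
      case False
      then obtain q where "0 \<le> q" "q < x" "\<And>r. q \<le> r \<Longrightarrow> r < x \<Longrightarrow> N r = N q"
        using counting_left_const[OF N, of x] x by auto
      note q = this
      show ?thesis
      proof (rule that[OF q(2)])
        fix a c :: real assume "0 \<le> a" "q < a" "a \<le> c" "c < x"
        then show "N c = N a" using q(3)[of a] q(3)[of c] by simp
      qed
    qed
    have "N c = N a \<or> N c = N b" if "0 \<le> a" "a \<le> c" "c \<le> b" "a \<in> {l<..<u}" "c \<in> {l<..<u}" "b \<in> {l<..<u}" for a c b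
    proof (cases "c < x")
      case True then show ?thesis using l(2)[of a c] that by auto
    next
      case False then show ?thesis using u(2)[of c] u(2)[of b] that by auto
    qed
    then have "ok {l<..<u}" by (simp add: ok_def)
    then show ?thesis using l u by (intro exI[of _ "{l<..<u}"]) auto
  qed
  then have cover: "{0..H} \<subseteq> \<Union>{U. ok U}" by auto
  obtain \<delta> where \<delta>: "0 < \<delta>" "\<And>T. T \<subseteq> {0..H} \<Longrightarrow> diameter T < \<delta> \<Longrightarrow> \<exists>U\<in>{U. ok U}. T \<subseteq> U"
  proof (rule Lebesgue_number_lemma[of "{0..H}" "{U. ok U}"])
    show "{U. ok U} \<noteq> {}" using cover H by auto
  qed (use cover in \<open>auto simp: ok_def\<close>)
  show ?thesis
  proof (rule that[OF \<delta>(1)])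
    fix a c b :: real assume *: "0 \<le> a" "a \<le> c" "c \<le> b" "b \<le> H" "b - a < \<delta>"
    have "diameter {a..b} < \<delta>" using * by (simp add: diameter_closed_interval)
    then obtain U where "ok U" "{a..b} \<subseteq> U" using \<delta>(2)[of "{a..b}"] * by auto
    then show "N c = N a \<or> N c = N b" using * unfolding ok_def by (meson atLeastAtMost_iff order.trans order_refl subsetD)
  qed
qed

locale step_paths =
  fixes M :: "'w measure" and m :: "'a metric" and N :: "'w \<Rightarrow> real \<Rightarrow> nat" and Y :: "'w \<Rightarrow> real \<Rightarrow> 'a"
    and d :: "'j :: countable \<Rightarrow> 'a" and near :: "'j \<Rightarrow> real \<Rightarrow> real \<Rightarrow> 'w \<Rightarrow> bool"
  assumes counting: "\<omega> \<in> space M \<Longrightarrow> counting (N \<omega>)"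
    and N_measurable: "0 \<le> t \<Longrightarrow> (\<lambda>\<omega>. N \<omega> t) \<in> measurable M (count_space UNIV)"
    and ext: "\<omega> \<in> space M \<Longrightarrow> Y \<omega> \<in> {0..} \<rightarrow>\<^sub>E mspace m"
    and const: "\<omega> \<in> space M \<Longrightarrow> 0 \<le> s \<Longrightarrow> s \<le> t \<Longrightarrow> N \<omega> s = N \<omega> t \<Longrightarrow> Y \<omega> t = Y \<omega> s"
    and d: "d j \<in> mspace m"
    and near_measurable: "0 \<le> t \<Longrightarrow> Measurable.pred M (near j e t)"
    and nearD: "\<omega> \<in> space M \<Longrightarrow> 0 \<le> t \<Longrightarrow> 0 < e \<Longrightarrow> near j e t \<omega> \<Longrightarrow> mdist m (Y \<omega> t) (d j) \<le> e"
    and near_ex: "\<omega> \<in> space M \<Longrightarrow> 0 \<le> t \<Longrightarrow> 0 < e \<Longrightarrow> \<exists>j. near j e t \<omega>"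
begin

lemma limitin_eventually_const:
  assumes "c \<in> mspace m" "eventually (\<lambda>t. x t = c) F"
  shows "limitin (mtopology_of m) x c F"
  unfolding limitin_def
proof (intro conjI allI impI)
  show "c \<in> topspace (mtopology_of m)" using assms by simp
  fix U assume "openin (mtopology_of m) U \<and> c \<in> U"
  then show "eventually (\<lambda>t. x t \<in> U) F" using assms(2) by (auto elim: eventually_mono)
qed

lemma cadlag:
  assumes \<omega>: "\<omega> \<in> space M" shows "Y \<omega> \<in> cadlag_paths m"
  unfolding cadlag_paths_def
proof (intro CollectI conjI allI impI ext[OF \<omega>])
  fix t :: real assume t: "0 \<le> t"
  obtain u where u: "t < u" "\<And>r. t \<le> r \<Longrightarrow> r < u \<Longrightarrow> N \<omega> r = N \<omega> t"
    using counting_right[OF counting[OF \<omega>] t] by blast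
  have "eventually (\<lambda>r. Y \<omega> r = Y \<omega> t) (at_right t)"
    using eventually_at_right_real[OF u(1)]
  proof eventually_elim
    case (elim r)
    then show ?case using t u(2)[of r] by (intro const[OF \<omega>]) auto
  qed
  then show "limitin (mtopology_of m) (Y \<omega>) (Y \<omega> t) (at_right t)"
    using ext[OF \<omega>] t by (intro limitin_eventually_const) auto
next
  fix t :: real assume t: "0 < t"
  obtain q where q: "0 \<le> q" "q < t" "\<And>r. q \<le> r \<Longrightarrow> r < t \<Longrightarrow> N \<omega> r = N \<omega> q"
    using counting_left_const[OF counting[OF \<omega>] t] by blast
  have "eventually (\<lambda>r. Y \<omega> r = Y \<omega> q) (at_left t)"
    using eventually_at_left_real[OF q(2)]
  proof eventually_elim
    case (elim r)
    then show ?case using q(1) q(3)[of r] by (intro const[OF \<omega>]) auto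
  qed
  then show "\<exists>l. limitin (mtopology_of m) (Y \<omega>) l (at_left t)"
    using ext[OF \<omega>] q by (intro exI[of _ "Y \<omega> q"] limitin_eventually_const) auto
qed

text \<open>At most one change of \<open>N\<close> per grid cell: by right-continuity rational times suffice to express this.
  The path is then a time change of a grid path, and countably many grid paths are dense.\<close>

definition grid_path :: "nat \<Rightarrow> 'j list \<Rightarrow> real \<Rightarrow> 'a" where
  "grid_path L js t = d (js ! nat \<lfloor>t * real L\<rfloor>)"

definition grid_event :: "nat \<Rightarrow> nat \<Rightarrow> 'j list \<Rightarrow> 'w set" where
  "grid_event K L js = {\<omega>\<in>space M.
     (\<forall>k\<in>{..<length js}. near (js ! k) (1 / real K) (real k / real L) \<omega>) \<and>
     (\<forall>k\<in>{..<length js - 1}. \<forall>r::rat. real k / real L \<le> of_rat r \<longrightarrow> of_rat r \<le> real (Suc k) / real L \<longrightarrow>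
        N \<omega> (of_rat r) = N \<omega> (real k / real L) \<or> N \<omega> (of_rat r) = N \<omega> (real (Suc k) / real L))}"

lemma grid_event_sets: "grid_event K L js \<in> sets M"
proof -
  have [measurable]: "Measurable.pred M (near j e (real k / real L))" for j e k
    by (rule near_measurable) simp
  have [measurable]: "(\<lambda>\<omega>. N \<omega> (real k / real L)) \<in> measurable M (count_space UNIV)" for k
    by (rule N_measurable) simp
  have [measurable]: "(\<lambda>\<omega>. N \<omega> (real (Suc k) / real L)) \<in> measurable M (count_space UNIV)" for k
    by (rule N_measurable) simp
  have cellm: "Measurable.pred M (\<lambda>\<omega>. real k / real L \<le> of_rat r \<longrightarrow> of_rat r \<le> real (Suc k) / real L \<longrightarrow>
        N \<omega> (of_rat r) = N \<omega> (real k / real L) \<or> N \<omega> (of_rat r) = N \<omega> (real (Suc k) / real L))" for k and r :: rat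
  proof (cases "real k / real L \<le> of_rat r")
    case True
    then have "0 \<le> (of_rat r :: real)" by (rule order_trans[rotated]) simp
    then have [measurable]: "(\<lambda>\<omega>. N \<omega> (of_rat r)) \<in> measurable M (count_space UNIV)" by (rule N_measurable)
    have D: "Measurable.pred M (\<lambda>\<omega>. N \<omega> (of_rat r) = N \<omega> (real k / real L) \<or> N \<omega> (of_rat r) = N \<omega> (real (Suc k) / real L))"
    proof -
      have eq: "Measurable.pred M (\<lambda>\<omega>. f \<omega> = g \<omega>)"
        if "f \<in> measurable M (count_space UNIV)" "g \<in> measurable M (count_space UNIV)" for f g :: "'w \<Rightarrow> nat"
      proof -
        have "(\<lambda>\<omega>. real (f \<omega>)) \<in> borel_measurable M" "(\<lambda>\<omega>. real (g \<omega>)) \<in> borel_measurable M"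
          using measurable_compose[OF that(1), of real borel] measurable_compose[OF that(2), of real borel] by auto
        then have "Measurable.pred M (\<lambda>\<omega>. real (f \<omega>) = real (g \<omega>))" by measurable
        then show ?thesis by simp
      qed
      have "Measurable.pred M (\<lambda>\<omega>. N \<omega> (of_rat r) = N \<omega> (real k / real L))"
        "Measurable.pred M (\<lambda>\<omega>. N \<omega> (of_rat r) = N \<omega> (real (Suc k) / real L))"
        by (rule eq[OF N_measurable N_measurable]; use \<open>0 \<le> (of_rat r :: real)\<close> in simp)+
      then show ?thesis unfolding pred_def by (simp add: conj_disj_distribL Collect_disj_eq sets.Un)
    qed
    show ?thesis using True D by (cases "of_rat r \<le> real (Suc k) / real L") (simp_all del: of_nat_Suc)
  qed simp
  define A B where "A \<omega> \<longleftrightarrow> (\<forall>k\<in>{..<length js}. near (js ! k) (1 / real K) (real k / real L) \<omega>)"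
    and "B \<omega> \<longleftrightarrow> (\<forall>k\<in>{..<length js - 1}. \<forall>r::rat.
      real k / real L \<le> of_rat r \<longrightarrow> of_rat r \<le> real (Suc k) / real L \<longrightarrow>
        N \<omega> (of_rat r) = N \<omega> (real k / real L) \<or> N \<omega> (of_rat r) = N \<omega> (real (Suc k) / real L))" for \<omega>
  have "Measurable.pred M A"
    unfolding A_def by (intro pred_intros_finite) (auto intro: near_measurable)
  moreover have "Measurable.pred M B"
    unfolding B_def by (intro pred_intros_finite(3) pred_intros_countable(1) cellm finite_lessThan)
  moreover have "grid_event K L js = {\<omega>\<in>space M. A \<omega>} \<inter> {\<omega>\<in>space M. B \<omega>}"
    unfolding grid_event_def A_def B_def by blast
  ultimately show ?thesis by (simp add: pred_def sets.Int)
qed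

text \<open>The clock changes at most once in each cell, at an instant \<sigma> k in (b k, b (k +
  1)]. A time change that carries these instants to the grid points makes the path equal to its own
  values at grid times, which the labels approximate.\<close>

lemma grid_event_match:
  assumes \<omega>: "\<omega> \<in> grid_event K L js" and K: "0 < K" and L: "0 < L" and len: "K * L + 1 < length js"
  obtains s where "time_change s"
    "\<And>t. 0 \<le> t \<Longrightarrow> t \<le> real K \<Longrightarrow> \<bar>s t - t\<bar> \<le> 2 / real L \<and> mdist m (Y \<omega> t) (grid_path L js (s t)) \<le> 1 / real K"
proof -
  have \<omega>M: "\<omega> \<in> space M" using \<omega> by (simp add: grid_event_def)
  note cN = counting[OF \<omega>M]
  define b where "b k = real k / real L" for k
  have b0: "0 \<le> b k" and bS: "b (Suc k) = b k + 1 / real L" for k by (auto simp: b_def add_divide_distrib)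
  have b: "strict_mono b" "b 0 = 0" "\<exists>k. x < b k" for x
    using L reals_Archimedean2[of "x * real L"] by (auto simp: b_def strict_mono_def divide_strict_right_mono field_simps)
  have bless: "b k < b (Suc k)" for k using strict_monoD[OF b(1)] by simp
  \<comment> \<open>Passage from rational to all times: by right-continuity \<open>N\<close> has the
    same value at r and at a rational slightly to the right of it.\<close>
  have two: "N \<omega> r = N \<omega> (b k) \<or> N \<omega> r = N \<omega> (b (Suc k))" if k: "k < length js - 1" and r: "b k \<le> r" "r \<le> b (Suc k)" for k r
  proof (cases "r = b (Suc k)")
    case False
    then have "r < b (Suc k)" using r by simp
    obtain u where u: "r < u" "\<And>q. r \<le> q \<Longrightarrow> q < u \<Longrightarrow> N \<omega> q = N \<omega> r"
      using counting_right[OF cN, of r] b0[of k] r by auto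
    obtain q where q: "r < of_rat q" "of_rat q < min u (b (Suc k))"
      using of_rat_dense[of r "min u (b (Suc k))"] u(1) \<open>r < b (Suc k)\<close> by auto
    have "N \<omega> (of_rat q) = N \<omega> (b k) \<or> N \<omega> (of_rat q) = N \<omega> (b (Suc k))"
      using \<omega> k q r unfolding grid_event_def b_def by auto
    moreover have "N \<omega> (of_rat q) = N \<omega> r" using u(2)[of "of_rat q"] q by auto
    ultimately show ?thesis by simp
  qed simp
  \<comment> \<open>The instant of change in the cell; where there is none, the right end serves.
    Beyond the list nothing is known about the clock and nothing is claimed.\<close>
  have "\<exists>\<sigma>. b k < \<sigma> \<and> \<sigma> \<le> b (Suc k) \<and> (k < length js - 1 \<longrightarrow>
      (\<forall>r. b k \<le> r \<and> r < \<sigma> \<longrightarrow> N \<omega> r = N \<omega> (b k)) \<and> (\<forall>r. \<sigma> \<le> r \<and> r \<le> b (Suc k) \<longrightarrow> N \<omega> r = N \<omega> (b (Suc k))))" for k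
  proof (cases "N \<omega> (b k) < N \<omega> (b (Suc k)) \<and> k < length js - 1")
    case False
    have left: "N \<omega> r = N \<omega> (b k)" if "k < length js - 1" "b k \<le> r" "r < b (Suc k)" for r
    proof -
      have "N \<omega> (b k) = N \<omega> (b (Suc k))"
        using False that(1) counting_mono[OF cN b0[of k], of "b (Suc k)"] bless[of k] by auto
      then show ?thesis using two[of k r] that by auto
    qed
    show ?thesis
    proof (intro exI[of _ "b (Suc k)"] conjI impI allI)
      fix r assume "k < length js - 1" "b k \<le> r \<and> r < b (Suc k)"
      then show "N \<omega> r = N \<omega> (b k)" using left by blast
    next
      fix r assume "b (Suc k) \<le> r \<and> r \<le> b (Suc k)"
      then have "r = b (Suc k)" by simp
      then show "N \<omega> r = N \<omega> (b (Suc k))" by simp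
    qed (use bless[of k] in simp_all)
  next
    case True
    obtain \<tau> where \<tau>: "b k < \<tau>" "\<tau> \<le> b (Suc k)" "N \<omega> \<tau> = N \<omega> (b (Suc k))" "\<And>r. 0 \<le> r \<Longrightarrow> r < \<tau> \<Longrightarrow> N \<omega> r < N \<omega> (b (Suc k))"
      using last_jump[OF cN b0[of k], of "b (Suc k)"] True bless[of k] by auto
    have "N \<omega> r = N \<omega> (b k)" if "b k \<le> r" "r < \<tau>" for r
    proof -
      have "N \<omega> r < N \<omega> (b (Suc k))" by (rule \<tau>(4)) (use that b0[of k] in auto)
      moreover have "N \<omega> r = N \<omega> (b k) \<or> N \<omega> r = N \<omega> (b (Suc k))"
        by (rule two) (use True that \<tau> in auto)
      ultimately show ?thesis by auto
    qed
    moreover have right: "N \<omega> r = N \<omega> (b (Suc k))" if "\<tau> \<le> r" "r \<le> b (Suc k)" for r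
    proof (rule antisym)
      have "0 \<le> \<tau>" using \<tau>(1) b0[of k] by simp
      then show "N \<omega> r \<le> N \<omega> (b (Suc k))" "N \<omega> (b (Suc k)) \<le> N \<omega> r"
        using counting_mono[OF cN _ that(2)] counting_mono[OF cN _ that(1)] \<tau>(3) that by auto
    qed
    ultimately show ?thesis using \<tau>(1,2) by (intro exI[of _ \<tau>]) blast
  qed
  then obtain \<sigma> where \<sigma>: "\<And>k. b k < \<sigma> k" "\<And>k. \<sigma> k \<le> b (Suc k)"
    "\<And>k r. k < length js - 1 \<Longrightarrow> b k \<le> r \<Longrightarrow> r < \<sigma> k \<Longrightarrow> N \<omega> r = N \<omega> (b k)"
    "\<And>k r. k < length js - 1 \<Longrightarrow> \<sigma> k \<le> r \<Longrightarrow> r \<le> b (Suc k) \<Longrightarrow> N \<omega> r = N \<omega> (b (Suc k))"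
    by metis
  \<comment> \<open>Shifted by one, so that [a k, a (k + 1)) runs from the change in the previous
    cell to the change in cell k. It contains b k and is mapped onto [b k, b (k + 1)).\<close>
  define a where "a k = (case k of 0 \<Rightarrow> 0 | Suc k \<Rightarrow> \<sigma> k)" for k
  have aS: "a (Suc k) = \<sigma> k" and a0: "a 0 = 0" for k by (simp_all add: a_def)
  have a_le: "a k \<le> b k" for k using \<sigma>(2) b by (cases k) (auto simp: aS a0)
  have a_ge: "b k - 1 / real L \<le> a k" for k
  proof (cases k)
    case (Suc l)
    then show ?thesis using \<sigma>(1)[of l] bS[of l] by (simp add: aS)
  qed (use b a0 in simp)
  have a: "strict_mono a" "\<exists>k. x < a k" for x
  proof -
    show "strict_mono a"
      unfolding strict_mono_Suc_iff using \<sigma>(1) a_le by (auto simp: aS intro: le_less_trans)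
    obtain k where "x < b k" using b(3) by blast
    then have "x < a (Suc k)" using \<sigma>(1)[of k] by (simp add: aS)
    then show "\<exists>k. x < a k" by blast
  qed
  obtain s where s: "time_change s" "\<And>k t. a k \<le> t \<Longrightarrow> t < a (Suc k) \<Longrightarrow> b k \<le> s t \<and> s t < b (Suc k)"
    using time_change_interpolate[OF a(1) a0 a(2) b] by blast
  show ?thesis
  proof (rule that[OF s(1)])
    fix t assume t: "0 \<le> t" "t \<le> real K"
    obtain k where k: "a k \<le> t" "t < a (Suc k)"
    proof -
      define k where "k = (LEAST k. t < a k)"
      have "t < a k" unfolding k_def using a(2)[of t] by (rule LeastI_ex)
      then obtain l where l: "k = Suc l" using t a0 by (cases k) auto
      have "\<not> t < a l" using not_less_Least[of l "\<lambda>k. t < a k"] l by (auto simp: k_def)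
      then show ?thesis using that[of l] \<open>t < a k\<close> l by auto
    qed
    have sk: "b k \<le> s t" "s t < b (Suc k)" using s(2)[OF k] by auto
    \<comment> \<open>An interval may begin up to one cell before its grid point, so times up to K
      reach the index K * L + 1. This is why lists of length K * L + 2 are used.\<close>
    have "k \<le> K * L + 1"
    proof (rule ccontr)
      assume "\<not> k \<le> K * L + 1"
      then have "K * L + 2 \<le> k" by simp
      then have "real (K * L + 2) \<le> real k" by (simp only: of_nat_le_iff)
      then have "real (K * L + 2) / real L \<le> b k" unfolding b_def by (rule divide_right_mono) simp
      moreover have "real (K * L + 2) / real L = real K + 2 / real L" using L by (simp add: field_simps)
      moreover have "2 / real L = 2 * (1 / real L)" "0 < 1 / real L" using L by simp_all
      ultimately show False using a_ge[of k] k(1) t by linarith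
    qed
    then have kl: "k < length js" using len by simp
    have "nat \<lfloor>s t * real L\<rfloor> = k"
    proof -
      have "real k \<le> s t * real L" "s t * real L < real k + 1"
        using sk L by (auto simp: b_def field_simps)
      then show ?thesis by linarith
    qed
    then have gp: "grid_path L js (s t) = d (js ! k)" by (simp add: grid_path_def)
    \<comment> \<open>Up to b k the change in the previous cell is already over; after b k the
      change in the current cell is still to come.\<close>
    have "Y \<omega> t = Y \<omega> (b k)"
    proof (cases "t \<le> b k")
      case True
      show ?thesis
      proof (cases k)
        case 0
        then show ?thesis using True t b(2) by simp
      next
        case (Suc l)
        have "N \<omega> t = N \<omega> (b k)" using \<sigma>(4)[of l t] Suc kl k(1) True by (simp add: aS)
        then show ?thesis using const[OF \<omega>M t(1) True] by simp
      qed
    next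
      case False
      have "b k < real K" using False t by simp
      then have "k < K * L" using L by (simp add: b_def field_simps flip: of_nat_mult)
      then have "N \<omega> t = N \<omega> (b k)" using \<sigma>(3)[of k t] len k(2) False by (simp add: aS)
      then show ?thesis using const[OF \<omega>M b0, of k t] False by simp
    qed
    moreover have "near (js ! k) (1 / real K) (b k) \<omega>" using \<omega> kl by (auto simp: grid_event_def b_def)
    ultimately have "mdist m (Y \<omega> t) (grid_path L js (s t)) \<le> 1 / real K"
      using nearD[OF \<omega>M b0[of k], of "1 / real K" "js ! k"] K gp by simp
    moreover have "\<bar>s t - t\<bar> \<le> 2 / real L"
      using sk k a_ge[of k] a_le[of "Suc k"] bS[of k] by (simp add: abs_le_iff)
    ultimately show "\<bar>s t - t\<bar> \<le> 2 / real L \<and> mdist m (Y \<omega> t) (grid_path L js (s t)) \<le> 1 / real K" by simp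
  qed
qed

text \<open>The mesh comes from \<open>counting_fine_grid\<close> and the labels from
  \<open>near_ex\<close>. The condition K \<le> L keeps the time distortion 2 / L of
  \<open>grid_event_match\<close> below 2 / K.\<close>

lemma grid_event_ex:
  assumes \<omega>: "\<omega> \<in> space M" and K: "0 < K"
  obtains L js where "K \<le> L" "length js = K * L + 2" "\<omega> \<in> grid_event K L js"
proof -
  obtain \<delta> where \<delta>: "0 < \<delta>" "\<And>a c b. 0 \<le> a \<Longrightarrow> a \<le> c \<Longrightarrow> c \<le> b \<Longrightarrow> b \<le> real K + 2 \<Longrightarrow> b - a < \<delta> \<Longrightarrow> N \<omega> c = N \<omega> a \<or> N \<omega> c = N \<omega> b"
    using counting_fine_grid[OF counting[OF \<omega>], of "real K + 2"] by auto
  obtain L0 :: nat where L0: "1 / \<delta> < real L0" using reals_Archimedean2 by blast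
  define L where "L = max K L0"
  have L: "K \<le> L" "0 < L" "1 / real L < \<delta>"
  proof -
    show "K \<le> L" "0 < L" using K by (auto simp: L_def)
    have "1 / \<delta> < real L" using L0 by (auto simp: L_def)
    then show "1 / real L < \<delta>" using \<delta>(1) \<open>0 < L\<close> by (simp add: field_simps)
  qed
  have "\<exists>j. near j (1 / real K) (real k / real L) \<omega>" for k by (rule near_ex[OF \<omega>]) (use K in auto)
  then obtain j where j: "\<And>k. near (j k) (1 / real K) (real k / real L) \<omega>" by metis
  define js where "js = map j [0..<K * L + 2]"
  have len: "length js = K * L + 2" by (simp add: js_def)
  have "\<omega> \<in> grid_event K L js"
    unfolding grid_event_def
  proof (intro CollectI conjI ballI allI impI \<omega>)
    fix k assume "k \<in> {..<length js}"
    then show "near (js ! k) (1 / real K) (real k / real L) \<omega>" using j len by (simp add: js_def del: upt_Suc)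
  next
    fix k and r :: rat
    assume k: "k \<in> {..<length js - 1}" and r: "real k / real L \<le> of_rat r" "of_rat r \<le> real (Suc k) / real L"
    show "N \<omega> (of_rat r) = N \<omega> (real k / real L) \<or> N \<omega> (of_rat r) = N \<omega> (real (Suc k) / real L)"
    proof (rule \<delta>(2)[OF _ r])
      have "real (Suc k) \<le> real K * real L + 1" using k len by (simp flip: of_nat_mult of_nat_Suc)
      then have "real (Suc k) / real L \<le> (real K * real L + 1) / real L" by (rule divide_right_mono) simp
      also have "\<dots> \<le> real K + 2" using L by (simp add: field_simps)
      finally show "real (Suc k) / real L \<le> real K + 2" .
      show "real (Suc k) / real L - real k / real L < \<delta>" using L by (simp add: add_divide_distrib)
    qed simp
  qed
  then show ?thesis using L len that by blast
qed

text \<open>The preimage of an open set is the union of those grid events whose grid path has a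
  suitable J1 neighbourhood inside the set, and there are countably many grid events.\<close>

theorem measurable_J1: "Y \<in> measurable M (borel_sets_of (J1_topology m))"
  unfolding borel_sets_of_def
proof (rule measurable_measure_of)
  show "{U. openin (J1_topology m) U} \<subseteq> Pow (topspace (J1_topology m))"
    by (auto simp del: topspace_J1_topology dest: openin_subset)
  show "Y \<in> space M \<rightarrow> topspace (J1_topology m)" using cadlag by auto
  fix U assume "U \<in> {U. openin (J1_topology m) U}"
  then have U: "U \<subseteq> cadlag_paths m" "\<And>x. x \<in> U \<Longrightarrow> \<exists>T>0. \<exists>e>0. J1_nhd m x T e \<subseteq> U"
    by (auto simp: openin_J1_topology)
  \<comment> \<open>The grid path need not belong to the path space, as \<open>J1_nhd\<close>
    requires only its members to be cadlag. The radius 4 / K exceeds the errors 2 / L and 1 / K of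
    \<open>grid_event_match\<close>.\<close>
  define P where "P = {(K, L, js). 0 < K \<and> K \<le> L \<and> length js = K * L + 2 \<and>
     J1_nhd m (grid_path L js) (real K) (4 / real K) \<subseteq> U}"
  have "Y -` U \<inter> space M = (\<Union>(K, L, js)\<in>P. grid_event K L js)"
  proof (intro equalityI subsetI)
    fix \<omega> assume "\<omega> \<in> (\<Union>(K, L, js)\<in>P. grid_event K L js)"
    then obtain K L js where KL: "0 < K" "K \<le> L" "length js = K * L + 2"
      and sub: "J1_nhd m (grid_path L js) (real K) (4 / real K) \<subseteq> U" and \<omega>: "\<omega> \<in> grid_event K L js"
      by (auto simp: P_def)
    have \<omega>M: "\<omega> \<in> space M" using \<omega> by (simp add: grid_event_def)
    obtain s where s: "time_change s" "\<And>t. 0 \<le> t \<Longrightarrow> t \<le> real K \<Longrightarrow> \<bar>s t - t\<bar> \<le> 2 / real L \<and> mdist m (Y \<omega> t) (grid_path L js (s t)) \<le> 1 / real K"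
      using grid_event_match[OF \<omega>] KL by auto
    have "2 / real L < 4 / real K" "1 / real K < 4 / real K" using KL by (auto simp: field_simps)
    then have "Y \<omega> \<in> J1_nhd m (grid_path L js) (real K) (4 / real K)"
      unfolding J1_nhd_def using cadlag[OF \<omega>M] s(1)
    proof (intro CollectI conjI exI[of _ s] ballI)
      fix t assume "t \<in> {0..real K}"
      then have "\<bar>s t - t\<bar> \<le> 2 / real L" "mdist m (Y \<omega> t) (grid_path L js (s t)) \<le> 1 / real K" using s(2) by auto
      then show "\<bar>s t - t\<bar> < 4 / real K" "mdist m (Y \<omega> t) (grid_path L js (s t)) < 4 / real K"
        using \<open>2 / real L < 4 / real K\<close> \<open>1 / real K < 4 / real K\<close> by linarith+
    qed
    then show "\<omega> \<in> Y -` U \<inter> space M" using sub \<omega>M by auto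
  next
    fix \<omega> assume "\<omega> \<in> Y -` U \<inter> space M"
    then have \<omega>: "\<omega> \<in> space M" "Y \<omega> \<in> U" by auto
    obtain T e where Te: "0 < T" "0 < e" "J1_nhd m (Y \<omega>) T e \<subseteq> U" using U(2)[OF \<omega>(2)] by auto
    \<comment> \<open>In time, 6 / K is the radius 4 / K plus the error 2 / K; in space, 4 / K plus
      1 / K stays below it. The margin of 6 over \<open>T\<close> keeps the inverse time change
      inside [0, K]: r t is below T + 4, and s maps K to at least K - 2.\<close>
    obtain K :: nat where K: "max (T + 6) (7 / e) < real K" using reals_Archimedean2 by blast
    have K0: "0 < K" "T + 6 < real K" "6 / real K < e" "1 \<le> real K"
    proof -
      show "T + 6 < real K" using K by simp
      then show "0 < K" "1 \<le> real K" using Te by auto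
      have "7 / e < real K" using K by simp
      then show "6 / real K < e" using Te \<open>0 < K\<close> by (simp add: field_simps)
    qed
    obtain L js where L: "K \<le> L" "length js = K * L + 2" "\<omega> \<in> grid_event K L js"
      using grid_event_ex[OF \<omega>(1) K0(1)] by blast
    obtain s where s: "time_change s" "\<And>t. 0 \<le> t \<Longrightarrow> t \<le> real K \<Longrightarrow> \<bar>s t - t\<bar> \<le> 2 / real L \<and> mdist m (Y \<omega> t) (grid_path L js (s t)) \<le> 1 / real K"
      using grid_event_match[OF L(3)] K0 L by auto
    obtain s' where s': "time_change s'" "\<And>t. 0 \<le> t \<Longrightarrow> 0 \<le> s' t \<and> s (s' t) = t"
      using time_change_inverse[OF s(1)] by blast
    have LK: "2 / real L \<le> 2 / real K" using L K0 by (simp add: field_simps)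
    have "J1_nhd m (grid_path L js) (real K) (4 / real K) \<subseteq> J1_nhd m (Y \<omega>) T e"
    proof
      fix z assume "z \<in> J1_nhd m (grid_path L js) (real K) (4 / real K)"
      then obtain r where z: "z \<in> cadlag_paths m" "time_change r"
        "\<And>t. 0 \<le> t \<Longrightarrow> t \<le> real K \<Longrightarrow> \<bar>r t - t\<bar> < 4 / real K \<and> mdist m (z t) (grid_path L js (r t)) < 4 / real K"
        by (auto simp: J1_nhd_def)
      have "\<bar>(s' \<circ> r) t - t\<bar> < e \<and> mdist m (z t) (Y \<omega> ((s' \<circ> r) t)) < e" if t: "t \<in> {0..T}" for t
      proof -
        have r: "\<bar>r t - t\<bar> < 4 / real K" "mdist m (z t) (grid_path L js (r t)) < 4 / real K" "0 \<le> r t"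
          using z(3)[of t] t K0 z(2) by (auto simp: time_change_def)
        define u where "u = s' (r t)"
        have u: "0 \<le> u" "s u = r t" using s'(2)[OF r(3)] by (auto simp: u_def)
        have "4 / real K \<le> 4" using K0 by (simp add: field_simps)
        have uK: "u \<le> real K"
        proof (rule ccontr)
          assume "\<not> u \<le> real K"
          then have "real K < u" by simp
          moreover have "strict_mono_on {0..} s" using s(1) by (simp add: time_change_def)
          ultimately have "s (real K) < s u" using u(1) by (auto simp: strict_mono_on_def)
          moreover have "real K - 2 / real L \<le> s (real K)" using s(2)[of "real K"] by (auto simp: abs_le_iff)
          moreover have "2 / real L \<le> 2"
          proof -
            have "1 \<le> real L" using L(1) K0(1) by linarith
            then show ?thesis by (simp add: field_simps)
          qed
          ultimately show False using u r(1) t K0 \<open>4 / real K \<le> 4\<close> by auto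
        qed
        have su: "\<bar>r t - u\<bar> \<le> 2 / real K" "mdist m (Y \<omega> u) (grid_path L js (r t)) \<le> 1 / real K"
          using s(2)[OF u(1) uK] u LK by auto
        have "\<bar>u - t\<bar> < 6 / real K" using su(1) r(1) by (auto simp: abs_le_iff abs_less_iff add_divide_distrib[symmetric])
        moreover have "mdist m (z t) (Y \<omega> u) \<le> mdist m (z t) (grid_path L js (r t)) + mdist m (grid_path L js (r t)) (Y \<omega> u)"
          by (rule mdist_triangle) (use z(1) t ext[OF \<omega>(1)] u d in \<open>auto simp: cadlag_paths_def grid_path_def\<close>)
        moreover have "4 / real K + 1 / real K < 6 / real K" using K0 by (simp add: field_simps)
        ultimately show ?thesis
          using su(2) r(2) K0(3) by (auto simp: u_def[symmetric] mdist_commute[of m "grid_path L js (r t)"])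
      qed
      then show "z \<in> J1_nhd m (Y \<omega>) T e"
        unfolding J1_nhd_def using z(1) time_change_comp[OF s'(1) z(2)] by blast
    qed
    then have "(K, L, js) \<in> P" using K0 L Te by (auto simp: P_def)
    then show "\<omega> \<in> (\<Union>(K, L, js)\<in>P. grid_event K L js)" using L(3) by auto
  qed
  also have "\<dots> \<in> sets M" by (rule sets.countable_UN'') (auto intro: grid_event_sets)
  finally show "Y -` U \<inter> space M \<in> sets M" .
qed

end

section \<open>Existence of the mean-field flow\<close>

lemma cdfs_uptoI:
  assumes "mono F" "\<And>x. continuous (at_right x) F" "(F \<longlongrightarrow> 0) at_bot" "F b = 1" "\<And>x. F x \<le> 1"
  shows "F \<in> cdfs_upto b"
proof -
  have "eventually (\<lambda>x. F x = 1) at_top"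
    using eventually_ge_at_top[of b] by eventually_elim (metis assms(1,4,5) monoD order_antisym)
  then have "(F \<longlongrightarrow> 1) at_top" by (rule tendsto_eventually)
  then show ?thesis using assms by (auto simp: cdfs_upto_def cdfs_def)
qed

lemma continuous_at_rightI_seq:
  fixes F :: "real \<Rightarrow> real"
  assumes "\<And>S. (\<And>n. x < S n) \<Longrightarrow> S \<longlonglongrightarrow> x \<Longrightarrow> (\<lambda>n. F (S n)) \<longlonglongrightarrow> F x"
  shows "continuous (at_right x) F"
  unfolding continuous_within
  by (rule tendsto_at_right_sequentially[of x "x + 1"]) (use assms in auto)

lemma continuous_at_right_seqD:
  fixes F :: "real \<Rightarrow> real"
  assumes "continuous (at_right x) F" "\<And>n. x < S n" "S \<longlonglongrightarrow> x"
  shows "(\<lambda>n. F (S n)) \<longlonglongrightarrow> F x"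
proof -
  have "filterlim S (at_right x) sequentially"
    using assms(2,3) by (auto simp: filterlim_at intro!: always_eventually)
  then show ?thesis using assms(1) by (auto simp: continuous_within intro: filterlim_compose)
qed

lemma tendsto_of_uniform:
  fixes F :: "'a \<Rightarrow> real"
  assumes "\<And>k. (Fk k \<longlongrightarrow> l k) G" "\<And>k y. \<bar>Fk k y - F y\<bar> \<le> \<epsilon> k" "\<And>k. \<bar>l k - L\<bar> \<le> \<epsilon> k" "\<epsilon> \<longlonglongrightarrow> 0"
  shows "(F \<longlongrightarrow> L) G"
proof (rule tendstoI)
  fix e :: real assume "0 < e"
  then have "eventually (\<lambda>k. \<epsilon> k < e / 3) sequentially"
    using assms(4) by (intro order_tendstoD(2)) auto
  then obtain k where k: "\<epsilon> k < e / 3" by (auto simp: eventually_sequentially)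
  have "eventually (\<lambda>y. dist (Fk k y) (l k) < e / 3) G"
    using assms(1) \<open>0 < e\<close> by (intro tendstoD) auto
  then show "eventually (\<lambda>y. dist (F y) L < e) G"
  proof eventually_elim
    case (elim y)
    then show ?case using assms(2)[of k y] assms(3)[of k] k unfolding dist_real_def by linarith
  qed
qed

lemma tendsto_at_bot_mirror: "(F \<longlongrightarrow> (l :: real)) (at_bot :: real filter) \<longleftrightarrow> ((\<lambda>x. F (- x)) \<longlongrightarrow> l) at_top"
  by (simp add: filterlim_at_bot_mirror)

locale mean_field_data = shift_kernel \<mu> lam for \<mu> :: "real measure" and lam :: real +
  fixes v B0 :: real and f0 :: "real \<Rightarrow> real"
  assumes v: "0 \<le> v" and f0: "f0 \<in> cdfs_upto B0" and pos: "AE z in \<mu>. 0 < z"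
begin

definition shift :: "(real \<Rightarrow> real) \<Rightarrow> real \<Rightarrow> real" where "shift u x = (\<integral>z. u (x - z) \<partial>\<mu>)"

lemma shift_integrable_cdf: "u \<in> cdfs \<Longrightarrow> integrable \<mu> (\<lambda>z. u (x - z))"
  by (rule shift_integrable[OF cdfs_measurable cdfs_bounds])

lemma shift_bounds:
  assumes "u \<in> cdfs" shows "0 \<le> shift u x" "shift u x \<le> 1"
  unfolding shift_def
  by (rule integral_ge_const integral_le_const; use shift_integrable_cdf[OF assms] cdfs_bounds[OF assms] in auto)+

lemma shift_le:
  assumes "u \<in> cdfs" shows "shift u x \<le> u x"
  unfolding shift_def
proof (rule integral_le_const[OF shift_integrable_cdf[OF assms]])
  show "AE z in \<mu>. u (x - z) \<le> u x"
    using pos by eventually_elim (use assms in \<open>auto simp: cdfs_def mono_def\<close>)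
qed

lemma shift_mono: "u \<in> cdfs \<Longrightarrow> x \<le> y \<Longrightarrow> shift u x \<le> shift u y"
  unfolding shift_def
  by (intro integral_mono shift_integrable_cdf) (auto simp: cdfs_def mono_def)

lemma shift_right_continuous:
  assumes "u \<in> cdfs" shows "continuous (at_right x) (shift u)"
proof (rule continuous_at_rightI_seq)
  fix S assume S: "\<And>n. x < S n" "S \<longlonglongrightarrow> x"
  note [measurable] = cdfs_measurable[OF assms]
  have "(\<lambda>n. u (S n - z)) \<longlonglongrightarrow> u (x - z)" for z
    by (rule continuous_at_right_seqD) (use assms S in \<open>auto simp: cdfs_def intro!: tendsto_intros\<close>)
  then show "(\<lambda>n. shift u (S n)) \<longlonglongrightarrow> shift u x"
    unfolding shift_def
    by (intro integral_dominated_convergence[where w = "\<lambda>_. 1"]) (use cdfs_bounds[OF assms] in auto)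
qed

lemma shift_at_bot:
  assumes "u \<in> cdfs" shows "(shift u \<longlongrightarrow> 0) at_bot"
proof -
  note [measurable] = cdfs_measurable[OF assms]
  have "((\<lambda>x. u (- x - z)) \<longlongrightarrow> 0) at_top" for z
  proof -
    have "filterlim (\<lambda>x. - x - z) at_bot at_top" by real_asymp
    then show ?thesis using assms by (auto simp: cdfs_def intro: filterlim_compose)
  qed
  then have "((\<lambda>x. \<integral>z. u (- x - z) \<partial>\<mu>) \<longlongrightarrow> (\<integral>z. 0 \<partial>\<mu>)) at_top"
    by (intro integral_dominated_convergence_at_top[where w = "\<lambda>_. 1"]) (use cdfs_bounds[OF assms] in \<open>auto intro!: always_eventually\<close>)
  then show ?thesis by (simp add: tendsto_at_bot_mirror shift_def)
qed

lemma shift_diff: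
  assumes "u \<in> cdfs" "w \<in> cdfs" "\<And>y. \<bar>u y - w y\<bar> \<le> D"
  shows "\<bar>shift u x - shift w x\<bar> \<le> D"
proof -
  note [measurable] = cdfs_measurable[OF assms(1)] cdfs_measurable[OF assms(2)]
  have "shift u x - shift w x = (\<integral>z. u (x - z) - w (x - z) \<partial>\<mu>)"
    unfolding shift_def using shift_integrable_cdf assms by simp
  also have "\<bar>\<dots>\<bar> \<le> D" by (rule abs_expectation_le) (use assms in auto)
  finally show ?thesis .
qed

text \<open>With the integrating factor exp ((lam + 1) t) the source term is monotone in the state; the value
  beyond the boundary keeps the state at 1 there.\<close>

definition gain :: "real \<Rightarrow> (real \<Rightarrow> real) \<Rightarrow> real \<Rightarrow> real" where
  "gain s u x = (if x < B0 + v * s then lam * shift u x + (u x)\<^sup>2 else lam + 1)"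

lemma gain_bounds:
  assumes "u \<in> cdfs" shows "0 \<le> gain s u x" "gain s u x \<le> lam + 1"
proof -
  have "lam * shift u x \<le> lam * 1" "(u x)\<^sup>2 \<le> 1"
    using mult_left_mono[OF shift_bounds(2)[OF assms, of x] lam] cdfs_bounds[OF assms, of x] by (auto intro!: power_le_one)
  then show "0 \<le> gain s u x" "gain s u x \<le> lam + 1"
    using shift_bounds[OF assms] lam by (auto simp: gain_def)
qed

text \<open>The value lam + 1 beyond the boundary is the largest that the other branch can take, so
  monotonicity survives the switch.\<close>

lemma gain_mono:
  assumes "u \<in> cdfs" "x \<le> y" shows "gain s u x \<le> gain s u y"
proof (cases "y < B0 + v * s")
  case True
  have "lam * shift u x \<le> lam * shift u y" using shift_mono[OF assms] lam by (rule mult_left_mono)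
  moreover have "(u x)\<^sup>2 \<le> (u y)\<^sup>2"
    using assms cdfs_bounds[OF assms(1)] by (intro power_mono) (auto simp: cdfs_def mono_def)
  ultimately show ?thesis using True assms(2) by (auto simp: gain_def)
next
  case False
  then show ?thesis using gain_bounds(2)[OF assms(1), of s x] by (simp add: gain_def)
qed

text \<open>The constant is lam from the averaged term and 2 from squaring values in [0, 1].\<close>

lemma gain_diff:
  assumes "u \<in> cdfs" "w \<in> cdfs" "\<And>y. \<bar>u y - w y\<bar> \<le> D"
  shows "\<bar>gain s u x - gain s w x\<bar> \<le> (lam + 2) * D"
proof -
  have D: "0 \<le> D" using assms(3)[of 0] by simp
  have "\<bar>lam * shift u x - lam * shift w x\<bar> \<le> lam * D"
    using shift_diff[OF assms] lam by (simp add: right_diff_distrib[symmetric] abs_mult mult_left_mono)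
  moreover have "\<bar>(u x)\<^sup>2 - (w x)\<^sup>2\<bar> \<le> 2 * D"
  proof -
    have "(u x)\<^sup>2 - (w x)\<^sup>2 = (u x + w x) * (u x - w x)" by (simp add: power2_eq_square algebra_simps)
    moreover have "\<bar>u x + w x\<bar> * \<bar>u x - w x\<bar> \<le> 2 * D"
      using cdfs_bounds[OF assms(1), of x] cdfs_bounds[OF assms(2), of x] assms(3)[of x] by (intro mult_mono) auto
    ultimately show ?thesis by (simp add: abs_mult)
  qed
  ultimately show ?thesis using D lam by (auto simp: gain_def algebra_simps abs_le_iff)
qed

lemma gain_tendsto_at_right:
  assumes "u \<in> cdfs" "\<And>n. x < S n" "S \<longlonglongrightarrow> x"
  shows "(\<lambda>n. gain s u (S n)) \<longlonglongrightarrow> gain s u x"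
proof (cases "x < B0 + v * s")
  case True
  have "(\<lambda>n. lam * shift u (S n) + (u (S n))\<^sup>2) \<longlonglongrightarrow> lam * shift u x + (u x)\<^sup>2"
    by (intro tendsto_intros continuous_at_right_seqD[OF shift_right_continuous] continuous_at_right_seqD[of x u] assms)
      (use assms in \<open>simp add: cdfs_def\<close>)
  moreover have "eventually (\<lambda>n. S n < B0 + v * s) sequentially"
    using order_tendstoD(2)[OF assms(3) True] .
  then have "eventually (\<lambda>n. lam * shift u (S n) + (u (S n))\<^sup>2 = gain s u (S n)) sequentially"
    by eventually_elim (simp add: gain_def)
  ultimately show ?thesis using True by (simp add: gain_def tendsto_cong)
next
  case False
  then have "gain s u (S n) = gain s u x" for n using assms(2)[of n] by (simp add: gain_def)
  then show ?thesis by simp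
qed

lemma gain_at_bot:
  assumes "u \<in> cdfs" shows "((\<lambda>x. gain s u (- x)) \<longlongrightarrow> 0) at_top"
proof -
  have "((\<lambda>x. shift u (- x)) \<longlongrightarrow> 0) at_top" "((\<lambda>x. u (- x)) \<longlongrightarrow> 0) at_top"
    using shift_at_bot[OF assms] assms by (auto simp: tendsto_at_bot_mirror cdfs_def)
  then have "((\<lambda>x. lam * shift u (- x) + (u (- x))\<^sup>2) \<longlongrightarrow> lam * 0 + 0\<^sup>2) at_top" by (intro tendsto_intros)
  moreover have "eventually (\<lambda>x. lam * shift u (- x) + (u (- x))\<^sup>2 = gain s u (- x)) at_top"
    using eventually_gt_at_top[of "- (B0 + v * s)"] by eventually_elim (auto simp: gain_def)
  ultimately show ?thesis by (simp add: tendsto_cong)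
qed

end

lemma lipschitz_borel:
  fixes g :: "real \<Rightarrow> real"
  assumes "\<And>s t. \<bar>g t - g s\<bar> \<le> L * \<bar>t - s\<bar>"
  shows "continuous_on UNIV g" "g \<in> borel_measurable borel"
proof -
  have "0 \<le> L" using assms[of 1 0] by simp
  then have "L-lipschitz_on UNIV g" using assms by (intro lipschitz_onI) (auto simp: dist_real_def)
  then show "continuous_on UNIV g" by (rule lipschitz_on_continuous_on)
  then show "g \<in> borel_measurable borel" by (rule borel_measurable_continuous_onI)
qed

lemma set_integrable_bounded:
  fixes k :: "real \<Rightarrow> real"
  assumes [measurable]: "k \<in> borel_measurable borel" and "\<And>s. a \<le> s \<Longrightarrow> s \<le> b \<Longrightarrow> \<bar>k s\<bar> \<le> D"
  shows "set_integrable lborel {a..b} k"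
  unfolding set_integrable_def
proof (rule Bochner_Integration.integrable_bound)
  show "integrable lborel (\<lambda>s. indicator {a..b} s *\<^sub>R D)"
    by (rule integrable_real_indicator[THEN integrable_scaleR_left]) (auto simp: emeasure_lborel_Icc_eq)
  show "AE s in lborel. norm (indicator {a..b} s *\<^sub>R k s) \<le> norm (indicator {a..b} s *\<^sub>R D)"
    using assms(2) by (intro always_eventually) (auto simp: indicator_def intro: order_trans[OF _ abs_ge_self])
qed simp

lemma LINT_split:
  fixes k :: "real \<Rightarrow> real"
  assumes ab: "a \<le> b" "b \<le> c" and k: "set_integrable lborel {a..c} k"
  shows "(LINT s:{a..c}|lborel. k s) = (LINT s:{a..b}|lborel. k s) + (LINT s:{b..c}|lborel. k s)"
proof -
  have i: "set_integrable lborel {a..b} k" "set_integrable lborel {b..c} k"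
    by (rule set_integrable_subset[OF k]; use ab in auto)+
  have "(LINT s:{a..c}|lborel. k s) = (\<integral>s. indicator {a..b} s *\<^sub>R k s + indicator {b..c} s *\<^sub>R k s \<partial>lborel)"
    unfolding set_lebesgue_integral_def
  proof (rule integral_cong_AE)
    show "(\<lambda>s. indicator {a..c} s *\<^sub>R k s) \<in> borel_measurable lborel"
      "(\<lambda>s. indicator {a..b} s *\<^sub>R k s + indicator {b..c} s *\<^sub>R k s) \<in> borel_measurable lborel"
      using k i unfolding set_integrable_def by (auto dest: borel_measurable_integrable intro!: borel_measurable_add)
    show "AE s in lborel. indicator {a..c} s *\<^sub>R k s = indicator {a..b} s *\<^sub>R k s + indicator {b..c} s *\<^sub>R k s"
      using AE_lborel_singleton[of b] by eventually_elim (use ab in \<open>auto simp: indicator_def\<close>)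
  qed
  also have "\<dots> = (LINT s:{a..b}|lborel. k s) + (LINT s:{b..c}|lborel. k s)"
    using i unfolding set_lebesgue_integral_def set_integrable_def by simp
  finally show ?thesis .
qed

lemma LINT_exp:
  assumes "a \<le> b" "c \<noteq> 0"
  shows "(LINT s:{a..b}|lborel. A * exp (c * s)) = A * (exp (c * b) - exp (c * a)) / c"
    "set_integrable lborel {a..b} (\<lambda>s. A * exp (c * s :: real))"
proof -
  have d: "((\<lambda>s. A * exp (c * s) / c) has_vector_derivative A * exp (c * s)) (at s within {a..b})" for s
    using assms(2) by (auto intro!: derivative_eq_intros simp: has_real_derivative_iff_has_vector_derivative[symmetric])
  have c: "continuous_on {a..b} (\<lambda>s. A * exp (c * s))" by (intro continuous_intros)
  show "(LINT s:{a..b}|lborel. A * exp (c * s)) = A * (exp (c * b) - exp (c * a)) / c"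
    unfolding set_lebesgue_integral_def
    using integral_FTC_atLeastAtMost[OF assms(1) d c] by (simp add: right_diff_distrib diff_divide_distrib)
  show "set_integrable lborel {a..b} (\<lambda>s. A * exp (c * s :: real))"
    by (rule borel_integrable_atLeastAtMost') (rule c)
qed

lemma LINT_exp_bounds:
  fixes g :: "real \<Rightarrow> real"
  assumes "a \<le> b" "0 < c" and i: "set_integrable lborel {a..b} (\<lambda>s. exp (c * s) * g s)"
    and g: "\<And>s. a \<le> s \<Longrightarrow> s \<le> b \<Longrightarrow> A \<le> g s" "\<And>s. a \<le> s \<Longrightarrow> s \<le> b \<Longrightarrow> g s \<le> B"
  shows "A * (exp (c * b) - exp (c * a)) / c \<le> (LINT s:{a..b}|lborel. exp (c * s) * g s)"
    "(LINT s:{a..b}|lborel. exp (c * s) * g s) \<le> B * (exp (c * b) - exp (c * a)) / c"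
proof -
  have c: "c \<noteq> 0" using assms(2) by simp
  show "A * (exp (c * b) - exp (c * a)) / c \<le> (LINT s:{a..b}|lborel. exp (c * s) * g s)"
    unfolding LINT_exp(1)[OF assms(1) c, symmetric]
    by (rule set_integral_mono[OF LINT_exp(2)[OF assms(1) c] i]) (use g in \<open>auto simp: mult.commute intro!: mult_left_mono\<close>)
  show "(LINT s:{a..b}|lborel. exp (c * s) * g s) \<le> B * (exp (c * b) - exp (c * a)) / c"
    unfolding LINT_exp(1)[OF assms(1) c, symmetric]
    by (rule set_integral_mono[OF i LINT_exp(2)[OF assms(1) c]]) (use g in \<open>auto simp: mult.commute intro!: mult_left_mono\<close>)
qed

section \<open>The Picard map\<close>

context mean_field_data begin

text \<open>Paths are frozen at negative times, so that they are Lipschitz on the whole line.\<close>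

definition flows :: "(real \<Rightarrow> real \<Rightarrow> real) set" where
  "flows = {\<phi>. (\<forall>t. \<phi> t \<in> cdfs_upto (B0 + v * max 0 t)) \<and> (\<forall>s t x. \<bar>\<phi> t x - \<phi> s x\<bar> \<le> (lam + 1) * \<bar>t - s\<bar>)}"

lemma flowsD: "\<phi> \<in> flows \<Longrightarrow> \<phi> t \<in> cdfs" "\<phi> \<in> flows \<Longrightarrow> \<bar>\<phi> t x - \<phi> s x\<bar> \<le> (lam + 1) * \<bar>t - s\<bar>"
  "\<phi> \<in> flows \<Longrightarrow> 0 \<le> t \<Longrightarrow> \<phi> t \<in> cdfs_upto (B0 + v * t)"
proof -
  show "\<phi> \<in> flows \<Longrightarrow> \<phi> t \<in> cdfs" "\<phi> \<in> flows \<Longrightarrow> \<bar>\<phi> t x - \<phi> s x\<bar> \<le> (lam + 1) * \<bar>t - s\<bar>"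
    by (auto simp: flows_def cdfs_upto_def)
  assume "\<phi> \<in> flows" "0 \<le> t"
  moreover have "max 0 t = t" using \<open>0 \<le> t\<close> by simp
  ultimately show "\<phi> t \<in> cdfs_upto (B0 + v * t)" unfolding flows_def by (metis (mono_tags, lifting) mem_Collect_eq)
qed

lemma gain_measurable:
  assumes "\<phi> \<in> flows" shows "(\<lambda>s. gain s (\<phi> s) x) \<in> borel_measurable borel"
proof -
  have [measurable]: "(\<lambda>s. shift (\<phi> s) x) \<in> borel_measurable borel"
    by (rule lipschitz_borel(2)[of _ "lam + 1"]) (use shift_diff flowsD[OF assms] in blast)
  have [measurable]: "(\<lambda>s. \<phi> s x) \<in> borel_measurable borel"
    by (rule lipschitz_borel(2)[of _ "lam + 1"]) (use flowsD[OF assms] in blast)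
  show ?thesis unfolding gain_def by measurable
qed

lemma exp_gain_integrable:
  assumes "\<phi> \<in> flows"
  shows "set_integrable lborel {a..b} (\<lambda>s. exp ((lam + 1) * s) * gain s (\<phi> s) x)"
proof (rule set_integrable_bounded)
  show "(\<lambda>s. exp ((lam + 1) * s) * gain s (\<phi> s) x) \<in> borel_measurable borel"
    using gain_measurable[OF assms] by measurable
  fix s assume "a \<le> s" "s \<le> b"
  have "exp ((lam + 1) * s) * gain s (\<phi> s) x \<le> exp ((lam + 1) * b) * (lam + 1)"
    using gain_bounds[OF flowsD(1)[OF assms], of s s x] lam \<open>s \<le> b\<close>
    by (intro mult_mono) (auto intro: mult_left_mono)
  then show "\<bar>exp ((lam + 1) * s) * gain s (\<phi> s) x\<bar> \<le> exp ((lam + 1) * b) * (lam + 1)"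
    using gain_bounds[OF flowsD(1)[OF assms], of s s x] by (simp add: abs_mult)
qed

text \<open>Variation of constants for the equation u' = gain - (lam + 1) u with initial value
  \<open>f0\<close>.\<close>

definition picard :: "(real \<Rightarrow> real \<Rightarrow> real) \<Rightarrow> real \<Rightarrow> real \<Rightarrow> real" where
  "picard \<phi> t x = exp (- (lam + 1) * max 0 t) *
     (f0 x + (LINT s:{0..max 0 t}|lborel. exp ((lam + 1) * s) * gain s (\<phi> s) x))"

text \<open>Over a step of length h the value relaxes towards gain / (lam + 1), with weight exp (-
  (lam + 1) h) on the old value. The range [0, 1], the Lipschitz bound in time and the second-order
  expansion are all read off from these two inequalities.\<close>

lemma picard_step:
  assumes \<phi>: "\<phi> \<in> flows" and t: "0 \<le> t" and h: "0 \<le> h"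
    and g: "\<And>s. t \<le> s \<Longrightarrow> s \<le> t + h \<Longrightarrow> A \<le> gain s (\<phi> s) x" "\<And>s. t \<le> s \<Longrightarrow> s \<le> t + h \<Longrightarrow> gain s (\<phi> s) x \<le> B"
  shows "exp (- (lam + 1) * h) * picard \<phi> t x + (1 - exp (- (lam + 1) * h)) * A / (lam + 1) \<le> picard \<phi> (t + h) x"
    "picard \<phi> (t + h) x \<le> exp (- (lam + 1) * h) * picard \<phi> t x + (1 - exp (- (lam + 1) * h)) * B / (lam + 1)"
proof -
  let ?c = "lam + 1"
  define I where "I = (LINT s:{t..t + h}|lborel. exp (?c * s) * gain s (\<phi> s) x)"
  have c: "0 < ?c" using lam by simp
  have "(LINT s:{0..t + h}|lborel. exp (?c * s) * gain s (\<phi> s) x) =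
     (LINT s:{0..t}|lborel. exp (?c * s) * gain s (\<phi> s) x) + I"
    unfolding I_def by (rule LINT_split) (use t h exp_gain_integrable[OF \<phi>] in auto)
  then have "picard \<phi> (t + h) x = exp (- ?c * (t + h)) * (f0 x + (LINT s:{0..t}|lborel. exp (?c * s) * gain s (\<phi> s) x)) + exp (- ?c * (t + h)) * I"
    using t h by (simp add: picard_def algebra_simps)
  also have "exp (- ?c * (t + h)) = exp (- ?c * h) * exp (- ?c * t)"
    by (simp add: exp_add[symmetric] algebra_simps)
  finally have eq: "picard \<phi> (t + h) x = exp (- ?c * h) * picard \<phi> t x + exp (- ?c * (t + h)) * I"
    using t by (simp add: picard_def exp_add[symmetric] algebra_simps)
  have e: "exp (- ?c * (t + h)) * (y * (exp (?c * (t + h)) - exp (?c * t)) / ?c) = (1 - exp (- ?c * h)) * y / ?c" for y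
  proof -
    have "exp (- ?c * (t + h)) * (exp (?c * (t + h)) - exp (?c * t)) = 1 - exp (- ?c * h)"
      by (simp add: right_diff_distrib exp_add[symmetric] algebra_simps)
    then show ?thesis by (metis (no_types, opaque_lifting) mult.commute mult.left_commute times_divide_eq_right)
  qed
  note b = LINT_exp_bounds[OF _ c exp_gain_integrable[OF \<phi>] g, of t "t + h", folded I_def]
  have "exp (- ?c * (t + h)) * (A * (exp (?c * (t + h)) - exp (?c * t)) / ?c) \<le> exp (- ?c * (t + h)) * I"
    using b(1) h by (intro mult_left_mono) auto
  then show "exp (- ?c * h) * picard \<phi> t x + (1 - exp (- ?c * h)) * A / ?c \<le> picard \<phi> (t + h) x"
    unfolding e eq by simp
  have "exp (- ?c * (t + h)) * I \<le> exp (- ?c * (t + h)) * (B * (exp (?c * (t + h)) - exp (?c * t)) / ?c)"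
    using b(2) h by (intro mult_left_mono) auto
  then show "picard \<phi> (t + h) x \<le> exp (- ?c * h) * picard \<phi> t x + (1 - exp (- ?c * h)) * B / ?c"
    unfolding e eq by simp
qed

lemma picard_0: "picard \<phi> 0 x = f0 x"
proof -
  have "(LINT s:{0..0::real}|lborel. g s) = (0 :: real)" for g :: "real \<Rightarrow> real"
  proof -
    have "(LINT s:{0..0::real}|lborel. g s) = (\<integral>s. 0 \<partial>(lborel :: real measure))"
      unfolding set_lebesgue_integral_def
    proof (rule integral_cong_AE)
      show "(\<lambda>s. indicator {0..0} s *\<^sub>R g s) \<in> borel_measurable lborel"
      proof -
        have "(\<lambda>s. indicator {0..0} s *\<^sub>R g s) = (\<lambda>s. indicator {0::real} s * g 0)" by (auto simp: indicator_def fun_eq_iff)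
        then show ?thesis by simp
      qed
      show "AE s in lborel. indicator {0..0} s *\<^sub>R g s = 0"
        using AE_lborel_singleton[of 0] by eventually_elim auto
    qed simp
    then show ?thesis by simp
  qed
  then show ?thesis by (simp add: picard_def)
qed

lemma picard_range:
  assumes \<phi>: "\<phi> \<in> flows" shows "0 \<le> picard \<phi> t x" "picard \<phi> t x \<le> 1"
proof -
  have g: "0 \<le> gain s (\<phi> s) x" "gain s (\<phi> s) x \<le> lam + 1" for s using gain_bounds[OF flowsD(1)[OF \<phi>]] by auto
  have "0 \<le> picard \<phi> (max 0 t) x \<and> picard \<phi> (max 0 t) x \<le> 1"
  proof -
    define e where "e = exp (- (lam + 1) * max 0 t)"
    note b = picard_step[OF \<phi> order_refl, of "max 0 t" 0 x "lam + 1", unfolded picard_0, OF _ g, folded e_def]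
    have f: "0 \<le> f0 x" "f0 x \<le> 1" using cdfs_bounds[OF cdfs_upto_cdfs[OF f0]] by auto
    have e: "0 \<le> e" by (simp add: e_def)
    have "e * f0 x \<le> e * 1" using e f by (intro mult_left_mono) auto
    moreover have "0 \<le> e * f0 x" using e f by simp
    ultimately show ?thesis using b lam by simp
  qed
  then show "0 \<le> picard \<phi> t x" "picard \<phi> t x \<le> 1" by (simp_all add: picard_def)
qed

text \<open>Right-continuity and the limit at minus infinity pass through the time integral by
  dominated convergence, monotonicity by comparing integrands.\<close>

lemma picard_flows:
  assumes \<phi>: "\<phi> \<in> flows" shows "picard \<phi> \<in> flows"
proof -
  let ?c = "lam + 1"
  have c: "0 < ?c" using lam by simp
  note fc = flowsD(1)[OF \<phi>] and f0c = cdfs_upto_cdfs[OF f0]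
  note i = exp_gain_integrable[OF \<phi>]
  have [measurable]: "(\<lambda>s. gain s (\<phi> s) x) \<in> borel_measurable borel" for x by (rule gain_measurable[OF \<phi>])
  have g: "0 \<le> gain s (\<phi> s) x" "gain s (\<phi> s) x \<le> ?c" for s x using gain_bounds[OF fc] by auto
  have "picard \<phi> t \<in> cdfs_upto (B0 + v * max 0 t)" for t
  proof (rule cdfs_uptoI)
    define T where "T = max 0 t"
    have T: "0 \<le> T" by (simp add: T_def)
    have pic: "picard \<phi> t x = exp (- ?c * T) * (f0 x + (\<integral>s. indicator {0..T} s *\<^sub>R (exp (?c * s) * gain s (\<phi> s) x) \<partial>lborel))" for x
      by (simp add: picard_def T_def set_lebesgue_integral_def)
    have dom: "integrable lborel (\<lambda>s. indicator {0..T} s *\<^sub>R (?c * exp (?c * s)))"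
      using LINT_exp(2)[of 0 T ?c ?c] c T by (simp add: set_integrable_def)
    have bd: "norm (indicator {0..T} s *\<^sub>R (exp (?c * s) * gain s (\<phi> s) x)) \<le> indicator {0..T} s *\<^sub>R (?c * exp (?c * s))" for s x
      using g by (auto simp: indicator_def abs_mult mult.commute[of ?c] intro!: mult_left_mono)
    show "mono (picard \<phi> t)"
    proof (rule monoI)
      fix x y :: real assume xy: "x \<le> y"
      have "f0 x \<le> f0 y" using f0c xy by (auto simp: cdfs_def mono_def)
      moreover have "(LINT s:{0..T}|lborel. exp (?c * s) * gain s (\<phi> s) x) \<le> (LINT s:{0..T}|lborel. exp (?c * s) * gain s (\<phi> s) y)"
        by (rule set_integral_mono[OF i i]) (use gain_mono[OF fc xy] in \<open>auto intro: mult_left_mono\<close>)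
      ultimately show "picard \<phi> t x \<le> picard \<phi> t y"
        unfolding picard_def T_def[symmetric] by (intro mult_left_mono add_mono) auto
    qed
    show "continuous (at_right x) (picard \<phi> t)" for x
    proof (rule continuous_at_rightI_seq)
      fix S assume S: "\<And>n. x < S n" "S \<longlonglongrightarrow> x"
      have "(\<lambda>n. f0 (S n)) \<longlonglongrightarrow> f0 x" by (rule continuous_at_right_seqD[OF _ S]) (use f0c in \<open>simp add: cdfs_def\<close>)
      moreover have "(\<lambda>n. \<integral>s. indicator {0..T} s *\<^sub>R (exp (?c * s) * gain s (\<phi> s) (S n)) \<partial>lborel)
         \<longlonglongrightarrow> (\<integral>s. indicator {0..T} s *\<^sub>R (exp (?c * s) * gain s (\<phi> s) x) \<partial>lborel)"
      proof (rule integral_dominated_convergence[OF _ _ dom])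
        show "AE s in lborel. (\<lambda>n. indicator {0..T} s *\<^sub>R (exp (?c * s) * gain s (\<phi> s) (S n)))
            \<longlonglongrightarrow> indicator {0..T} s *\<^sub>R (exp (?c * s) * gain s (\<phi> s) x)"
          by (intro AE_I2 tendsto_intros gain_tendsto_at_right[OF fc S])
        show "AE s in lborel. norm (indicator {0..T} s *\<^sub>R (exp (?c * s) * gain s (\<phi> s) (S n)))
            \<le> indicator {0..T} s *\<^sub>R (?c * exp (?c * s))" for n
          by (rule AE_I2) (rule bd)
      qed measurable
      ultimately show "(\<lambda>n. picard \<phi> t (S n)) \<longlonglongrightarrow> picard \<phi> t x" unfolding pic by (intro tendsto_intros)
    qed
    show "(picard \<phi> t \<longlongrightarrow> 0) at_bot"
    proof -
      have "((\<lambda>x. f0 (- x)) \<longlongrightarrow> 0) at_top" using f0c by (simp add: cdfs_def tendsto_at_bot_mirror)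
      moreover have "((\<lambda>x. \<integral>s. indicator {0..T} s *\<^sub>R (exp (?c * s) * gain s (\<phi> s) (- x)) \<partial>lborel) \<longlongrightarrow> (\<integral>s. 0 \<partial>(lborel :: real measure))) at_top"
      proof (rule integral_dominated_convergence_at_top[OF _ _ dom])
        show "AE s in lborel. ((\<lambda>x. indicator {0..T} s *\<^sub>R (exp (?c * s) * gain s (\<phi> s) (- x))) \<longlongrightarrow> 0) at_top"
        proof (rule AE_I2)
          fix s
          have "((\<lambda>x. indicator {0..T} s *\<^sub>R (exp (?c * s) * gain s (\<phi> s) (- x))) \<longlongrightarrow> indicator {0..T} s *\<^sub>R (exp (?c * s) * 0)) at_top"
            by (intro tendsto_intros gain_at_bot[OF fc])
          then show "((\<lambda>x. indicator {0..T} s *\<^sub>R (exp (?c * s) * gain s (\<phi> s) (- x))) \<longlongrightarrow> 0) at_top" by simp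
        qed
        show "\<forall>\<^sub>F y in at_top. AE s in lborel. norm (indicator {0..T} s *\<^sub>R (exp (?c * s) * gain s (\<phi> s) (- y)))
            \<le> indicator {0..T} s *\<^sub>R (?c * exp (?c * s))"
          by (intro always_eventually allI AE_I2) (rule bd)
      qed measurable
      ultimately have "((\<lambda>x. picard \<phi> t (- x)) \<longlongrightarrow> exp (- ?c * T) * (0 + 0)) at_top"
        unfolding pic by (intro tendsto_intros) simp_all
      then show ?thesis by (simp add: tendsto_at_bot_mirror)
    qed
    \<comment> \<open>This location is not passed by the boundary before \<open>T\<close>, so gain
      is lam + 1 at all times up to \<open>T\<close> and the integral is exp ((lam + 1) T) - 1. The
      initial value 1 is thus reproduced exactly.\<close>
    show "picard \<phi> t (B0 + v * max 0 t) = 1"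
    proof -
      let ?x = "B0 + v * T"
      have "gain s (\<phi> s) ?x = ?c" if "s \<in> {0..T}" for s
        using that mult_left_mono[of s T v] v by (auto simp: gain_def)
      then have "(LINT s:{0..T}|lborel. exp (?c * s) * gain s (\<phi> s) ?x) = (LINT s:{0..T}|lborel. ?c * exp (?c * s))"
        by (intro set_lebesgue_integral_cong) auto
      also have "\<dots> = exp (?c * T) - 1" using LINT_exp(1)[of 0 T ?c ?c] c T by simp
      finally have I: "(LINT s:{0..T}|lborel. exp (?c * s) * gain s (\<phi> s) ?x) = exp (?c * T) - 1" .
      have "f0 ?x = 1" by (rule cdfs_upto_ge[OF f0]) (use v T in simp)
      moreover have "exp (- ?c * T) * exp (?c * T) = 1"
        by (simp only: exp_add[symmetric] mult_minus_left add.left_inverse exp_zero)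
      ultimately show ?thesis unfolding picard_def T_def[symmetric] I by simp
    qed
    show "picard \<phi> t x \<le> 1" for x by (rule picard_range[OF \<phi>])
  qed
  moreover have "\<bar>picard \<phi> t x - picard \<phi> s x\<bar> \<le> ?c * \<bar>t - s\<bar>" for s t x
  proof -
    have main: "\<bar>picard \<phi> (t + h) x - picard \<phi> t x\<bar> \<le> ?c * h" if "0 \<le> t" "0 \<le> h" for t h
    proof -
      define e where "e = exp (- ?c * h)"
      have e: "0 < e" "e \<le> 1" "1 - e \<le> ?c * h" 
      proof -
        have y: "0 \<le> ?c * h" using that c by simp
        then show "0 < e" "e \<le> 1" unfolding e_def
          by (simp_all only: mult_minus_left exp_le_one_iff neg_le_0_iff_le exp_gt_zero)
        show "1 - e \<le> ?c * h"
          using exp_ge_add_one_self[of "- ?c * h"] unfolding e_def mult_minus_left by linarith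
      qed
      note b = picard_step[OF \<phi> that g, of x, folded e_def]
      have p: "0 \<le> (1 - e) * picard \<phi> t x" "(1 - e) * picard \<phi> t x \<le> (1 - e) * 1"
        using picard_range[OF \<phi>, of t x] e by (intro mult_nonneg_nonneg mult_left_mono; simp)+
      have "e * picard \<phi> t x \<le> picard \<phi> (t + h) x" "picard \<phi> (t + h) x \<le> e * picard \<phi> t x + (1 - e)" using b c by auto
      then have "picard \<phi> (t + h) x - picard \<phi> t x \<le> 1 - e" "picard \<phi> t x - picard \<phi> (t + h) x \<le> 1 - e"
        using p by (auto simp: algebra_simps)
      then show ?thesis using e(3) by linarith
    qed
    have "\<bar>picard \<phi> p x - picard \<phi> q x\<bar> \<le> ?c * \<bar>p - q\<bar>" if "0 \<le> p" "0 \<le> q" for p q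
    proof (cases "q \<le> p")
      case True
      then show ?thesis using main[of q "p - q"] that by simp
    next
      case False
      then show ?thesis using main[of p "q - p"] that by (simp add: abs_minus_commute)
    qed
    then have "\<bar>picard \<phi> (max 0 t) x - picard \<phi> (max 0 s) x\<bar> \<le> ?c * \<bar>max 0 t - max 0 s\<bar>" by simp
    also have "\<dots> \<le> ?c * \<bar>t - s\<bar>" using c by (intro mult_left_mono) auto
    finally show ?thesis by (simp add: picard_def)
  qed
  ultimately show ?thesis by (auto simp: flows_def)
qed

end

text \<open>Increments of quadratic order add up to nothing on finer and finer partitions.\<close>

lemma quadratic_increments_le:
  fixes \<phi> :: "real \<Rightarrow> real"
  assumes "a \<le> b" and inc: "\<And>t h. a \<le> t \<Longrightarrow> 0 \<le> h \<Longrightarrow> t + h \<le> b \<Longrightarrow> \<phi> (t + h) - \<phi> t \<le> K * h\<^sup>2"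
  shows "\<phi> b \<le> \<phi> a"
proof -
  have "\<phi> b - \<phi> a \<le> K * (b - a)\<^sup>2 / real (Suc N)" for N
  proof -
    define h where "h = (b - a) / real (Suc N)"
    have h: "0 \<le> h" "real (Suc N) * h = b - a" using assms(1) by (auto simp: h_def)
    have "k \<le> Suc N \<Longrightarrow> \<phi> (a + real k * h) - \<phi> a \<le> real k * (K * h\<^sup>2)" for k
    proof (induction k)
      case (Suc k)
      have "real (Suc k) * h \<le> real (Suc N) * h" using Suc h by (intro mult_right_mono) auto
      then have "a + real k * h + h \<le> b" using h(2) by (simp add: algebra_simps)
      then have "\<phi> (a + real k * h + h) - \<phi> (a + real k * h) \<le> K * h\<^sup>2" using h(1) by (intro inc) auto
      moreover have "a + real (Suc k) * h = a + real k * h + h" by (simp add: algebra_simps)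
      ultimately show ?case using Suc by (simp add: algebra_simps)
    qed simp
    from this[of "Suc N"] have "\<phi> b - \<phi> a \<le> real (Suc N) * (K * h\<^sup>2)" using h(2) by simp
    also have "real (Suc N) * (K * h\<^sup>2) = K * h * (real (Suc N) * h)" by (simp add: power2_eq_square)
    also have "\<dots> = K * (b - a)\<^sup>2 / real (Suc N)" unfolding h(2) by (simp add: h_def power2_eq_square)
    finally show ?thesis .
  qed
  moreover have "(\<lambda>N. K * (b - a)\<^sup>2 / real (Suc N)) \<longlonglongrightarrow> 0"
    using LIMSEQ_Suc[OF lim_const_over_n[of "K * (b - a)\<^sup>2"]] by simp
  ultimately have "\<phi> b - \<phi> a \<le> 0" by (intro LIMSEQ_le_const) auto
  then show ?thesis by simp
qed

lemma set_integral_abs_le: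
  fixes k w :: "real \<Rightarrow> real"
  assumes "set_integrable lborel A k" "set_integrable lborel A w" "\<And>s. s \<in> A \<Longrightarrow> \<bar>k s\<bar> \<le> w s"
  shows "\<bar>LINT s:A|lborel. k s\<bar> \<le> (LINT s:A|lborel. w s)"
proof -
  have "(LINT s:A|lborel. k s) \<le> (LINT s:A|lborel. w s)"
    by (rule set_integral_mono[OF assms(1,2)]) (use assms(3) in \<open>auto simp: abs_le_iff\<close>)
  moreover have "(LINT s:A|lborel. - w s) \<le> (LINT s:A|lborel. k s)"
    by (rule set_integral_mono[OF _ assms(1)]) (use assms(2,3) in \<open>auto simp: abs_le_iff set_integrable_def minus_le_iff\<close>)
  moreover have "(LINT s:A|lborel. - w s) = - (LINT s:A|lborel. w s)"
    by (simp add: set_lebesgue_integral_def)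
  ultimately show ?thesis by (simp add: abs_le_iff)
qed

lemma LINT_const: "a \<le> b \<Longrightarrow> (LINT s:{a..b}|lborel. D) = (b - a) * (D :: real)"
  "set_integrable lborel {a..b} (\<lambda>s :: real. D :: real)"
proof -
  show "(LINT s:{a..b}|lborel. D) = (b - a) * D" if "a \<le> b"
    using that by (simp add: set_lebesgue_integral_def)
  show "set_integrable lborel {a..b} (\<lambda>s. D)"
    by (rule borel_integrable_atLeastAtMost') (rule continuous_on_const)
qed

section \<open>The fixed point and its expansion in time\<close>

context mean_field_data begin

text \<open>Exponent of a weighted supremum norm in time. It is twice the Lipschitz constant lam + 2
  of \<open>gain\<close>, so that integrating against exp (growth * s) makes \<open>picard\<close>
  contract by the factor 1/2.\<close>

definition growth :: real where "growth = 2 * (lam + 2)"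

lemma picard_contraction:
  assumes \<phi>: "\<phi> \<in> flows" and \<psi>: "\<psi> \<in> flows"
    and D: "\<And>s x. 0 \<le> s \<Longrightarrow> \<bar>\<phi> s x - \<psi> s x\<bar> \<le> D * exp (growth * s)" and t: "0 \<le> t"
  shows "\<bar>picard \<phi> t x - picard \<psi> t x\<bar> \<le> D / 2 * exp (growth * t)"
proof -
  let ?c = "lam + 1" and ?k = "\<lambda>\<phi> s. exp ((lam + 1) * s) * gain s (\<phi> s) x"
  have D0: "0 \<le> D" using D[of 0 0] by simp
  have gr: "0 < growth" using lam by (simp add: growth_def)
  have diff: "picard \<phi> t x - picard \<psi> t x = exp (- ?c * t) * (LINT s:{0..t}|lborel. ?k \<phi> s - ?k \<psi> s)"
    using t exp_gain_integrable[OF \<phi>] exp_gain_integrable[OF \<psi>]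
    by (simp add: picard_def set_integral_diff algebra_simps)
  have "\<bar>LINT s:{0..t}|lborel. ?k \<phi> s - ?k \<psi> s\<bar> \<le> (LINT s:{0..t}|lborel. (exp (?c * t) * (lam + 2) * D) * exp (growth * s))"
  proof (rule set_integral_abs_le)
    show "set_integrable lborel {0..t} (\<lambda>s. ?k \<phi> s - ?k \<psi> s)"
      by (intro set_integral_diff exp_gain_integrable \<phi> \<psi>)
    show "set_integrable lborel {0..t} (\<lambda>s. (exp (?c * t) * (lam + 2) * D) * exp (growth * s))"
      by (rule LINT_exp(2)) (use t gr in auto)
    fix s assume s: "s \<in> {0..t}"
    have "\<bar>?k \<phi> s - ?k \<psi> s\<bar> = exp (?c * s) * \<bar>gain s (\<phi> s) x - gain s (\<psi> s) x\<bar>"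
      by (simp add: right_diff_distrib[symmetric] abs_mult)
    also have "\<dots> \<le> exp (?c * t) * ((lam + 2) * (D * exp (growth * s)))"
      using s lam by (intro mult_mono gain_diff flowsD \<phi> \<psi> D) (auto intro: mult_left_mono)
    finally show "\<bar>?k \<phi> s - ?k \<psi> s\<bar> \<le> (exp (?c * t) * (lam + 2) * D) * exp (growth * s)" by (simp add: mult_ac)
  qed
  also have "\<dots> = (exp (?c * t) * (lam + 2) * D) * (exp (growth * t) - 1) / growth"
    using LINT_exp(1)[OF t, of growth] gr by simp
  also have "\<dots> = exp (?c * t) * (D / 2 * (exp (growth * t) - 1))"
  proof -
    have "E * (lam + 2) * D * (X - 1) / growth = E * (D / 2 * (X - 1))" for E X
      using lam by (simp add: growth_def field_simps)
    then show ?thesis .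
  qed
  also have "\<dots> \<le> exp (?c * t) * (D / 2 * exp (growth * t))"
    using D0 by (intro mult_left_mono) auto
  finally have "exp (- ?c * t) * \<bar>LINT s:{0..t}|lborel. ?k \<phi> s - ?k \<psi> s\<bar> \<le> exp (- ?c * t) * (exp (?c * t) * (D / 2 * exp (growth * t)))"
    by (intro mult_left_mono) auto
  also have "\<dots> = (exp (- ?c * t) * exp (?c * t)) * (D / 2 * exp (growth * t))" by (simp only: mult.assoc)
  also have "exp (- ?c * t) * exp (?c * t) = 1"
    by (simp only: exp_add[symmetric] mult_minus_left add.left_inverse exp_zero)
  finally show ?thesis unfolding diff by (simp add: abs_mult)
qed

definition iterate :: "nat \<Rightarrow> real \<Rightarrow> real \<Rightarrow> real" where "iterate k = (picard ^^ k) (\<lambda>_. f0)"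

lemma iterate_flows: "iterate k \<in> flows"
proof (induction k)
  case 0
  have "f0 \<in> cdfs_upto (B0 + v * max 0 t)" for t
    using cdfs_upto_ge[OF f0, of "B0 + v * max 0 t"] v f0 by (auto simp: cdfs_upto_def)
  then show ?case using lam by (simp add: iterate_def flows_def)
next
  case (Suc k)
  then show ?case using picard_flows by (simp add: iterate_def)
qed

lemma iterate_max: "iterate k (max 0 t) x = iterate k t x"
  by (cases k) (simp_all add: iterate_def picard_def)

lemma iterate_Suc: "iterate (Suc k) = picard (iterate k)" by (simp add: iterate_def)

lemma iterate_diff:
  assumes "0 \<le> t"
  shows "\<bar>iterate (Suc k) t x - iterate k t x\<bar> \<le> (1/2) ^ k * exp (growth * t)"
  using assms
proof (induction k arbitrary: t x)
  case 0
  have "\<bar>iterate (Suc 0) t x - iterate 0 t x\<bar> \<le> 1"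
    using cdfs_bounds[OF flowsD(1)[OF iterate_flows[of "Suc 0"]], of t x] cdfs_bounds[OF flowsD(1)[OF iterate_flows[of 0]], of t x]
    by (auto simp: abs_le_iff)
  also have "1 \<le> exp (growth * t)" using 0 lam by (simp add: growth_def)
  finally show ?case by simp
next
  case (Suc k)
  show ?case
    using picard_contraction[OF iterate_flows[of "Suc k"] iterate_flows[of k] Suc.IH Suc.prems]
    by (simp add: iterate_Suc)
qed

lemma iterate_diff_add:
  assumes "0 \<le> t"
  shows "\<bar>iterate (k + j) t x - iterate k t x\<bar> \<le> (2 - 2 * (1/2) ^ j) * ((1/2) ^ k * exp (growth * t))"
proof (induction j)
  case (Suc j)
  have "\<bar>iterate (k + Suc j) t x - iterate k t x\<bar> \<le> \<bar>iterate (Suc (k + j)) t x - iterate (k + j) t x\<bar> + \<bar>iterate (k + j) t x - iterate k t x\<bar>"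
    by simp
  also have "\<dots> \<le> (1/2) ^ (k + j) * exp (growth * t) + (2 - 2 * (1/2) ^ j) * ((1/2) ^ k * exp (growth * t))"
    by (intro add_mono iterate_diff assms Suc)
  also have "\<dots> = (2 - 2 * (1/2) ^ Suc j) * ((1/2) ^ k * exp (growth * t))"
    by (simp add: power_add algebra_simps)
  finally show ?case .
qed simp

definition flow :: "real \<Rightarrow> real \<Rightarrow> real" where "flow t x = lim (\<lambda>k. iterate k t x)"

definition rate_bound :: "real \<Rightarrow> nat \<Rightarrow> real" where "rate_bound t k = 2 * (1/2) ^ k * exp (growth * max 0 t)"

lemma rate_bound_tendsto: "rate_bound t \<longlonglongrightarrow> 0"
proof -
  have "(\<lambda>k. 2 * (1/2) ^ k * exp (growth * max 0 t)) \<longlonglongrightarrow> 2 * 0 * exp (growth * max 0 t)"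
    by (intro tendsto_intros LIMSEQ_power_zero) simp
  then show ?thesis by (simp add: rate_bound_def[abs_def])
qed

lemma iterate_close: "k \<le> m \<Longrightarrow> \<bar>iterate m t x - iterate k t x\<bar> \<le> rate_bound t k"
proof -
  assume "k \<le> m"
  then obtain j where j: "m = k + j" using le_Suc_ex by blast
  have "\<bar>iterate (k + j) (max 0 t) x - iterate k (max 0 t) x\<bar> \<le> (2 - 2 * (1/2) ^ j) * ((1/2) ^ k * exp (growth * max 0 t))"
    by (rule iterate_diff_add) simp
  also have "\<dots> \<le> 2 * ((1/2) ^ k * exp (growth * max 0 t))" by (intro mult_right_mono) auto
  finally show ?thesis by (simp add: j iterate_max rate_bound_def)
qed

lemma iterate_tendsto: "(\<lambda>k. iterate k t x) \<longlonglongrightarrow> flow t x"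
proof -
  have "Cauchy (\<lambda>k. iterate k t x)"
  proof (rule metric_CauchyI)
    fix e :: real assume "0 < e"
    then obtain k where k: "rate_bound t k < e / 2"
      using order_tendstoD(2)[OF rate_bound_tendsto, of "e / 2" t] by (auto simp: eventually_sequentially)
    show "\<exists>M. \<forall>m\<ge>M. \<forall>n\<ge>M. dist (iterate m t x) (iterate n t x) < e"
    proof (intro exI allI impI)
      fix m n assume "k \<le> m" "k \<le> n"
      then show "dist (iterate m t x) (iterate n t x) < e"
        using iterate_close[of k m t x] iterate_close[of k n t x] k unfolding dist_real_def by linarith
    qed
  qed
  then show ?thesis by (simp add: flow_def Cauchy_convergent_iff convergent_LIMSEQ_iff)
qed

lemma iterate_flow: "\<bar>iterate k t x - flow t x\<bar> \<le> rate_bound t k"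
proof -
  have "\<bar>flow t x - iterate k t x\<bar> \<le> rate_bound t k"
  proof (rule LIMSEQ_le_const2)
    show "(\<lambda>m. \<bar>iterate m t x - iterate k t x\<bar>) \<longlonglongrightarrow> \<bar>flow t x - iterate k t x\<bar>"
      by (intro tendsto_intros iterate_tendsto)
    show "\<exists>N. \<forall>m\<ge>N. \<bar>iterate m t x - iterate k t x\<bar> \<le> rate_bound t k" using iterate_close by blast
  qed
  then show ?thesis by (simp add: abs_minus_commute)
qed

text \<open>For fixed t the iterates converge uniformly in the location, which preserves
  right-continuity and the limit at minus infinity; the Lipschitz bound in time passes to the limit
  pointwise.\<close>

lemma flow_flows: "flow \<in> flows"
  unfolding flows_def
proof (intro CollectI conjI allI)
  fix t
  have it: "iterate k t \<in> cdfs_upto (B0 + v * max 0 t)" for k using iterate_flows[of k] by (simp add: flows_def)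
  then have itc: "iterate k t \<in> cdfs" for k by (rule cdfs_upto_cdfs)
  note close = iterate_flow rate_bound_tendsto[of t]
  show "flow t \<in> cdfs_upto (B0 + v * max 0 t)"
  proof (rule cdfs_uptoI)
    show "mono (flow t)"
    proof (rule monoI)
      fix x y :: real assume "x \<le> y"
      then have "iterate k t x \<le> iterate k t y" for k using itc[of k] by (auto simp: cdfs_def mono_def)
      then show "flow t x \<le> flow t y" by (intro LIMSEQ_le[OF iterate_tendsto iterate_tendsto]) auto
    qed
    show "continuous (at_right x) (flow t)" for x
      unfolding continuous_within
      by (rule tendsto_of_uniform[OF _ close(1) close(1) close(2)]) (use itc in \<open>auto simp: cdfs_def continuous_within\<close>)
    show "(flow t \<longlongrightarrow> 0) at_bot"
      by (rule tendsto_of_uniform[where l = "\<lambda>_. 0", OF _ close(1) _ close(2)])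
        (use itc in \<open>auto simp: cdfs_def rate_bound_def\<close>)
    show "flow t (B0 + v * max 0 t) = 1"
      using iterate_tendsto[of t "B0 + v * max 0 t"] it by (simp add: cdfs_upto_def LIMSEQ_const_iff)
    show "flow t x \<le> 1" for x
      by (rule LIMSEQ_le_const2[OF iterate_tendsto]) (use cdfs_bounds[OF itc] in auto)
  qed
next
  fix s t x
  show "\<bar>flow t x - flow s x\<bar> \<le> (lam + 1) * \<bar>t - s\<bar>"
  proof (rule LIMSEQ_le_const2)
    show "(\<lambda>k. \<bar>iterate k t x - iterate k s x\<bar>) \<longlonglongrightarrow> \<bar>flow t x - flow s x\<bar>"
      by (intro tendsto_intros iterate_tendsto)
  qed (use flowsD(2)[OF iterate_flows] in blast)
qed

lemma picard_flow:
  assumes "0 \<le> t" shows "picard flow t x = flow t x"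
proof -
  have "\<bar>picard flow t x - flow t x\<bar> \<le> 2 * rate_bound t k" for k
  proof -
    have "\<bar>flow s y - iterate k s y\<bar> \<le> (2 * (1/2) ^ k) * exp (growth * s)" if "0 \<le> s" for s y
      using iterate_flow[of k s y] that by (simp add: rate_bound_def abs_minus_commute)
    note pc = picard_contraction[OF flow_flows iterate_flows this assms, of x]
    have "\<bar>picard flow t x - iterate (Suc k) t x\<bar> \<le> rate_bound t k"
    proof -
      have "2 * (1/2) ^ k / 2 * exp (growth * t) \<le> rate_bound t k"
        using assms by (simp add: rate_bound_def)
      with pc show ?thesis unfolding iterate_Suc by (rule order_trans)
    qed
    moreover have "\<bar>iterate (Suc k) t x - flow t x\<bar> \<le> rate_bound t (Suc k)" by (rule iterate_flow)
    moreover have "rate_bound t (Suc k) \<le> rate_bound t k" by (simp add: rate_bound_def)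
    ultimately show ?thesis by linarith
  qed
  note bd = this
  have lim: "(\<lambda>k. 2 * rate_bound t k) \<longlonglongrightarrow> 0" by (rule tendsto_mult_right_zero[OF rate_bound_tendsto])
  have "\<bar>picard flow t x - flow t x\<bar> \<le> 0" by (rule LIMSEQ_le_const[OF lim]) (use bd in blast)
  then show ?thesis by simp
qed

lemma flow_0: "flow 0 x = f0 x" using picard_flow[of 0 x] by (simp add: picard_0)

lemma drift_gain: "x < B0 + v * s \<Longrightarrow> drift lam \<mu> u x = gain s u x - (lam + 1) * u x"
  by (simp add: drift_def gain_def shift_def algebra_simps power2_eq_square)

text \<open>The sign rests on the positivity of Z, through \<open>shift_le\<close>.\<close>

lemma drift_nonpos:
  assumes "u \<in> cdfs" shows "drift lam \<mu> u x \<le> 0" "- (lam + 1) \<le> drift lam \<mu> u x"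
proof -
  have "lam * (shift u x - u x) \<le> 0" using shift_le[OF assms, of x] lam by (intro mult_nonneg_nonpos) auto
  moreover have "lam * (- 1) \<le> lam * (shift u x - u x)"
    using shift_bounds[OF assms, of x] cdfs_bounds[OF assms, of x] lam by (intro mult_left_mono) auto
  moreover have "0 \<le> u x * (1 - u x)" "u x * (1 - u x) \<le> 1 * 1"
    using cdfs_bounds[OF assms, of x] by (intro mult_nonneg_nonneg mult_mono; simp)+
  ultimately show "drift lam \<mu> u x \<le> 0" "- (lam + 1) \<le> drift lam \<mu> u x" by (auto simp: drift_def shift_def)
qed

lemma drift_diff:
  assumes "u \<in> cdfs" "w \<in> cdfs" "\<And>y. \<bar>u y - w y\<bar> \<le> D"
  shows "\<bar>drift lam \<mu> u x - drift lam \<mu> w x\<bar> \<le> (2 * lam + 1) * D"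
proof -
  have D: "0 \<le> D" using assms(3)[of 0] by simp
  have "\<bar>lam * ((shift u x - shift w x) - (u x - w x))\<bar> \<le> lam * (2 * D)"
    unfolding abs_mult using shift_diff[OF assms, of x] assms(3)[of x] lam by (intro mult_mono) auto
  moreover have "\<bar>(u x - w x) * (1 - u x - w x)\<bar> \<le> D * 1"
    unfolding abs_mult using assms(3)[of x] D cdfs_bounds[OF assms(1), of x] cdfs_bounds[OF assms(2), of x]
    by (intro mult_mono) auto
  moreover have "drift lam \<mu> u x - drift lam \<mu> w x = lam * ((shift u x - shift w x) - (u x - w x)) - (u x - w x) * (1 - u x - w x)"
    by (simp add: drift_def shift_def algebra_simps)
  ultimately show ?thesis by (simp add: algebra_simps abs_le_iff)
qed

text \<open>\<open>flow\<close> is a fixed point of \<open>picard\<close>, so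
  \<open>picard_step\<close> applies with bounds \<sigma> - \<delta> and \<sigma> + \<delta> on the
  gain, \<sigma> being its value at time t. A location left of the boundary stays there during the
  step, hence the gain varies only through the Lipschitz dependence on the state.\<close>

lemma flow_step:
  assumes t: "0 \<le> t" and h: "0 \<le> h" and x: "x < B0 + v * t"
  shows "\<bar>flow (t + h) x - flow t x - h * drift lam \<mu> (flow t) x\<bar> \<le> (2 * lam + 3) * (lam + 1) * h\<^sup>2"
proof -
  let ?c = "lam + 1"
  have c: "0 < ?c" using lam by simp
  define \<sigma> where "\<sigma> = gain t (flow t) x"
  define \<delta> where "\<delta> = (lam + 2) * (?c * h)"
  have \<delta>: "0 \<le> \<delta>" using h c lam by (simp add: \<delta>_def)
  have "\<bar>gain s (flow s) x - \<sigma>\<bar> \<le> \<delta>" if "t \<le> s" "s \<le> t + h" for s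
  proof -
    have "x < B0 + v * s" using x mult_left_mono[OF that(1) v] by simp
    then have "gain s (flow s) x = gain t (flow s) x" using x by (simp add: gain_def)
    moreover have "\<bar>flow s y - flow t y\<bar> \<le> ?c * h" for y
    proof -
      have "\<bar>flow s y - flow t y\<bar> \<le> ?c * \<bar>s - t\<bar>" by (rule flowsD(2)[OF flow_flows])
      also have "\<dots> \<le> ?c * h" using that c by (intro mult_left_mono) auto
      finally show ?thesis .
    qed
    ultimately show ?thesis unfolding \<sigma>_def \<delta>_def by (simp add: gain_diff flowsD(1)[OF flow_flows])
  qed
  then have g: "\<sigma> - \<delta> \<le> gain s (flow s) x" "gain s (flow s) x \<le> \<sigma> + \<delta>" if "t \<le> s" "s \<le> t + h" for s
    using that by (auto simp: abs_le_iff algebra_simps)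
  define e where "e = exp (- ?c * h)"
  define F where "F = flow t x"
  define F' where "F' = flow (t + h) x"
  define y where "y = ?c * h"
  have y: "0 \<le> y" using c h by (simp add: y_def)
  have e: "1 - e \<le> y" "0 \<le> 1 - e" "y - (1 - e) \<le> y\<^sup>2"
  proof -
    have ey: "e = exp (- y)" by (simp only: e_def y_def mult_minus_left)
    show "1 - e \<le> y" using exp_ge_add_one_self[of "- y"] by (simp add: ey)
    show "0 \<le> 1 - e" using y by (simp add: ey)
    have "(1 + y) * e \<le> exp y * e" using exp_ge_add_one_self[of y] by (intro mult_right_mono) (auto simp: e_def)
    also have "\<dots> = 1" unfolding ey by (simp only: exp_add[symmetric] add.right_inverse exp_zero)
    finally have "e + y * e \<le> 1" by (simp add: algebra_simps)
    moreover have "y * (1 - y) \<le> y * e" using \<open>1 - e \<le> y\<close> y by (intro mult_left_mono) auto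
    ultimately show "y - (1 - e) \<le> y\<^sup>2" by (simp add: power2_eq_square algebra_simps)
  qed
  have b: "e * F + (1 - e) * (\<sigma> - \<delta>) / ?c \<le> F'" "F' \<le> e * F + (1 - e) * (\<sigma> + \<delta>) / ?c"
    using picard_step[OF flow_flows t h g] t h by (simp_all add: picard_flow F_def F'_def e_def)
  \<comment> \<open>Gap between the value towards which the flow relaxes and the current one; the
    drift is lam + 1 times \<open>q\<close>. As q is at most 1 in modulus, replacing 1 - exp (- y)
    by y costs at most y^2.\<close>
  define q where "q = \<sigma> / ?c - F"
  have \<sigma>: "\<sigma> = ?c * (q + F)" using c by (simp add: q_def)
  have q: "\<bar>q\<bar> \<le> 1"
  proof -
    have "0 \<le> \<sigma> / ?c" "\<sigma> / ?c \<le> 1"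
      using gain_bounds[OF flowsD(1)[OF flow_flows, of t], of t x] c by (auto simp: \<sigma>_def divide_le_eq)
    then show ?thesis using cdfs_bounds[OF flowsD(1)[OF flow_flows, of t], of x] by (auto simp: q_def F_def abs_le_iff)
  qed
  have dr: "h * drift lam \<mu> (flow t) x = y * q"
    using drift_gain[OF x, of "flow t"] \<sigma> by (simp add: \<sigma>_def[symmetric] F_def[symmetric] y_def algebra_simps)
  have "(1 - e) * (\<sigma> - \<delta>) / ?c = (1 - e) * (q + F) - (1 - e) * \<delta> / ?c" "(1 - e) * (\<sigma> + \<delta>) / ?c = (1 - e) * (q + F) + (1 - e) * \<delta> / ?c"
    unfolding \<sigma> using c by (simp_all add: field_simps)
  note b = b[unfolded this]
  have "F + (1 - e) * q = e * F + (1 - e) * (q + F)" by (simp add: algebra_simps)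
  then have "\<bar>F' - F - (1 - e) * q\<bar> \<le> (1 - e) * \<delta> / ?c"
    using b unfolding abs_le_iff by linarith
  moreover have "\<bar>(1 - e) * q - y * q\<bar> \<le> y\<^sup>2"
  proof -
    have "\<bar>(1 - e) * q - y * q\<bar> = (y - (1 - e)) * \<bar>q\<bar>"
      using e by (simp add: left_diff_distrib[symmetric] abs_mult abs_minus_commute)
    also have "\<dots> \<le> y\<^sup>2 * 1" using e q by (intro mult_mono) auto
    finally show ?thesis by simp
  qed
  moreover have "(1 - e) * \<delta> / ?c \<le> y * \<delta> / ?c" using e \<delta> c by (intro divide_right_mono mult_right_mono) auto
  \<comment> \<open>Here (lam + 2) (lam + 1) h^2 is due to the variation of the gain and (lam + 1)^2
    h^2 to the exponential; this is the origin of the constant in \<open>mean_flow\<close>.\<close>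
  moreover have "y * \<delta> / ?c + y\<^sup>2 = (2 * lam + 3) * ?c * h\<^sup>2"
    using c by (simp add: y_def \<delta>_def power2_eq_square field_simps)
  ultimately show ?thesis unfolding dr F_def[symmetric] F'_def[symmetric] by linarith
qed

lemma flow_mean_flow: "mean_flow lam \<mu> v B0 flow"
  unfolding mean_flow_def
proof (intro conjI allI impI; (elim conjE)?)
  show "flow t \<in> cdfs_upto (B0 + v * t)" if "0 \<le> t" for t using flowsD(3)[OF flow_flows that] .
  show "\<bar>flow (t + h) x - flow t x\<bar> \<le> (lam + 1) * h" if "0 \<le> h" for x t h
    using flowsD(2)[OF flow_flows, of "t + h" x t] that by simp
  show "\<bar>flow (t + h) x - flow t x - h * drift lam \<mu> (flow t) x\<bar> \<le> (2 * lam + 3) * (lam + 1) * h\<^sup>2"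
    if "0 \<le> t" "0 \<le> h" "x < B0 + v * t" for x t h by (rule flow_step[OF that])
qed

text \<open>Left of the boundary the drift is non-positive, so increments are bounded above by a
  multiple of h^2. At and beyond it the starting value is 1, the largest possible.\<close>

lemma flow_antimono:
  assumes "0 \<le> s" "s \<le> t" shows "flow t x \<le> flow s x"
proof (cases "x < B0 + v * s")
  case True
  show ?thesis
  proof (rule quadratic_increments_le[OF assms(2)])
    fix r h assume r: "s \<le> r" "0 \<le> h" "r + h \<le> t"
    have "x < B0 + v * r" using True mult_left_mono[OF r(1) v] by simp
    then have "\<bar>flow (r + h) x - flow r x - h * drift lam \<mu> (flow r) x\<bar> \<le> (2 * lam + 3) * (lam + 1) * h\<^sup>2"
      using r assms by (intro flow_step) auto
    moreover have "h * drift lam \<mu> (flow r) x \<le> 0"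
      using drift_nonpos(1)[OF flowsD(1)[OF flow_flows]] r by (intro mult_nonneg_nonpos) auto
    ultimately show "flow (r + h) x - flow r x \<le> (2 * lam + 3) * (lam + 1) * h\<^sup>2" by linarith
  qed
next
  case False
  then have "flow s x = 1" using cdfs_upto_ge[OF flowsD(3)[OF flow_flows assms(1)], of x] by simp
  then show ?thesis using cdfs_bounds(2)[OF flowsD(1)[OF flow_flows], of t x] by simp
qed

end

section \<open>Lipschitz functions and their derivatives\<close>

lemma LINT_Ioc_Icc:
  fixes g :: "real \<Rightarrow> real"
  assumes "g \<in> borel_measurable borel"
  shows "(LINT s:{a<..b}|lborel. g s) = (LINT s:{a..b}|lborel. g s)"
  unfolding set_lebesgue_integral_def
proof (rule integral_cong_AE)
  show "(\<lambda>s. indicator {a<..b} s *\<^sub>R g s) \<in> borel_measurable lborel" "(\<lambda>s. indicator {a..b} s *\<^sub>R g s) \<in> borel_measurable lborel"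
    using assms by measurable
  show "AE s in lborel. indicator {a<..b} s *\<^sub>R g s = indicator {a..b} s *\<^sub>R g s"
    using AE_lborel_singleton[of a] by eventually_elim (auto simp: indicator_def)
qed

text \<open>Both sides are measures that agree on half-open intervals. With a monotone
  \<open>F\<close> and L x - F in the two places, it bounds the measure of \<open>F\<close> by L
  times Lebesgue measure.\<close>

lemma interval_measure_sum:
  fixes F1 F2 :: "real \<Rightarrow> real"
  assumes F: "mono F1" "\<And>x. continuous (at_right x) F1" "mono F2" "\<And>x. continuous (at_right x) F2"
    and sum: "\<And>x. F1 x + F2 x = L * x" and L: "0 \<le> L" and A: "A \<in> sets borel"
  shows "emeasure (interval_measure F1) A + emeasure (interval_measure F2) A = ennreal L * emeasure lborel A"
proof -
  let ?m1 = "interval_measure F1" and ?m2 = "interval_measure F2"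
  define \<sigma> where "\<sigma> A = emeasure ?m1 A + emeasure ?m2 A" for A
  define S where "S = measure_of UNIV (sets borel) \<sigma>"
  have sS: "sets S = sets borel" unfolding S_def
    using sets.sigma_algebra_axioms[of "borel :: real measure"] by (simp add: sets_measure_of sigma_algebra.sigma_sets_eq)
  have S: "emeasure S A = \<sigma> A" if "A \<in> sets borel" for A
  proof (rule emeasure_measure_of[OF S_def])
    show "sets borel \<subseteq> Pow (UNIV :: real set)" by simp
    show "A \<in> sets S" using that sS by simp
    show "positive (sets S) \<sigma>" by (simp add: positive_def \<sigma>_def)
    show "countably_additive (sets S) \<sigma>"
    proof (rule countably_additiveI)
      fix B :: "nat \<Rightarrow> real set" assume B: "range B \<subseteq> sets S" "disjoint_family B" "\<Union> (range B) \<in> sets S"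
      have "(\<Sum>i. \<sigma> (B i)) = (\<Sum>i. emeasure ?m1 (B i)) + (\<Sum>i. emeasure ?m2 (B i))"
        unfolding \<sigma>_def by (rule suminf_add[symmetric]) auto
      then show "(\<Sum>i. \<sigma> (B i)) = \<sigma> (\<Union> (range B))"
        unfolding \<sigma>_def using B sS by (simp add: suminf_emeasure)
    qed
  qed
  have Ioc: "\<sigma> {a<..b} = ennreal L * emeasure lborel {a<..b}" for a b :: real
  proof (cases "a \<le> b")
    case True
    have m: "F1 a \<le> F1 b" "F2 a \<le> F2 b" using F True by (auto simp: mono_def)
    have "\<sigma> {a<..b} = ennreal (F1 b - F1 a) + ennreal (F2 b - F2 a)"
      unfolding \<sigma>_def using F True by (subst (1 2) emeasure_interval_measure_Ioc) (auto simp: mono_def)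
    also have "\<dots> = ennreal (L * (b - a))"
      using m sum[of a] sum[of b] by (simp add: ennreal_plus[symmetric] algebra_simps del: ennreal_plus)
    finally show ?thesis using L True by (simp add: ennreal_mult)
  next
    case False
    then show ?thesis by (simp add: \<sigma>_def)
  qed
  have "S = density lborel (\<lambda>_. ennreal L)"
  proof (rule measure_eqI_generator_eq[where \<Omega> = UNIV])
    fix X assume "X \<in> range (\<lambda>(a, b). {a<..b :: real})"
    then obtain a b where X: "X = {a<..b :: real}" by auto
    show "emeasure S X = emeasure (density lborel (\<lambda>_. ennreal L)) X"
      unfolding X by (subst S) (simp_all add: Ioc emeasure_density nn_integral_cmult)
  next
    show "(\<Union>i. {- real (i::nat)<..real i}) = UNIV" by (rule UN_Ioc_eq_UNIV)
    show "emeasure S {- real i<..real i} \<noteq> \<infinity>" for i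
      by (subst S) (auto simp: Ioc ennreal_mult_eq_top_iff)
  qed (auto simp: sS borel_sigma_sets_Ioc Int_stable_def)
  then have "\<sigma> A = emeasure (density lborel (\<lambda>_. ennreal L)) A" using S[OF A] by simp
  also have "\<dots> = ennreal L * emeasure lborel A" using A by (simp add: emeasure_density nn_integral_cmult)
  finally show ?thesis by (simp add: \<sigma>_def)
qed

text \<open>The measure of \<open>F\<close> is dominated by L times Lebesgue measure, because L x -
  F is monotone as well. Hence it is absolutely continuous and has a Radon-Nikodym density.\<close>

lemma lipschitz_density:
  fixes F :: "real \<Rightarrow> real"
  assumes F: "mono F" and lip: "\<And>s t. \<bar>F t - F s\<bar> \<le> L * \<bar>t - s\<bar>" and ab: "a \<le> b"
  obtains g where "g \<in> borel_measurable borel" "integrable lborel g"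
    "\<And>s t. a \<le> s \<Longrightarrow> s \<le> t \<Longrightarrow> t \<le> b \<Longrightarrow> (LINT x:{s..t}|lborel. g x) = F t - F s"
proof -
  have L: "0 \<le> L" using lip[of 1 0] by simp
  have rc: "continuous (at_right x) F" for x
  proof -
    have "L-lipschitz_on UNIV F" using lip L by (intro lipschitz_onI) (auto simp: dist_real_def)
    then have "continuous_on UNIV F" by (rule lipschitz_on_continuous_on)
    then show ?thesis by (auto simp: continuous_on_eq_continuous_at intro: continuous_within_subset)
  qed
  define m where "m = interval_measure F"
  have Ioc: "emeasure m {s<..t} = ennreal (F t - F s)" if "s \<le> t" for s t
    unfolding m_def using that F rc by (intro emeasure_interval_measure_Ioc) (auto simp: mono_def)
  have ac: "absolutely_continuous lborel m"
    unfolding absolutely_continuous_def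
  proof
    fix N :: "real set" assume N: "N \<in> null_sets lborel"
    have "mono (\<lambda>x. L * x - F x)"
    proof (rule monoI)
      fix x y :: real assume "x \<le> y"
      then show "L * x - F x \<le> L * y - F y" using lip[of y x] by (auto simp: abs_le_iff algebra_simps)
    qed
    then have "emeasure m N + emeasure (interval_measure (\<lambda>x. L * x - F x)) N = ennreal L * emeasure lborel N"
      unfolding m_def using N L
      by (intro interval_measure_sum F rc) (auto intro!: continuous_intros rc simp: null_setsD2)
    then have "emeasure m N = 0" using N by auto
    then show "N \<in> null_sets m" using N by (auto simp: null_sets_def m_def)
  qed
  then obtain f where f[measurable]: "f \<in> borel_measurable lborel" "density lborel f = m"
    using sigma_finite_measure.Radon_Nikodym[OF sigma_finite_lborel, of m] by (auto simp: m_def)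
  \<comment> \<open>Cut off outside the interval, so that the density is integrable and therefore
    finite almost everywhere.\<close>
  define f' where "f' x = f x * indicator {a<..b} x" for x
  have f'm[measurable]: "f' \<in> borel_measurable borel" unfolding f'_def using f by measurable
  have nn: "(\<integral>\<^sup>+x. f' x * indicator {s<..t} x \<partial>lborel) = ennreal (F t - F s)" if "a \<le> s" "s \<le> t" "t \<le> b" for s t
  proof -
    have "(\<integral>\<^sup>+x. f' x * indicator {s<..t} x \<partial>lborel) = (\<integral>\<^sup>+x. f x * indicator {s<..t} x \<partial>lborel)"
      using that by (intro nn_integral_cong) (auto simp: f'_def indicator_def)
    also have "\<dots> = emeasure (density lborel f) {s<..t}" by (subst emeasure_density) auto
    finally show ?thesis using f(2) Ioc[OF that(2)] by simp
  qed
  have "(\<integral>\<^sup>+x. f' x \<partial>lborel) = (\<integral>\<^sup>+x. f' x * indicator {a<..b} x \<partial>lborel)"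
    by (intro nn_integral_cong) (auto simp: f'_def indicator_def)
  also have "\<dots> = ennreal (F b - F a)" by (rule nn) (use ab in auto)
  finally have fin: "(\<integral>\<^sup>+x. f' x \<partial>lborel) = ennreal (F b - F a)" .
  then have AEfin: "AE x in lborel. f' x \<noteq> \<infinity>" by (intro nn_integral_PInf_AE) auto
  define g where "g x = enn2real (f' x)" for x
  have gm[measurable]: "g \<in> borel_measurable borel" unfolding g_def by measurable
  have ge: "AE x in lborel. ennreal (g x) = f' x" using AEfin by eventually_elim (simp add: g_def less_top)
  have gi: "integrable lborel g"
  proof (rule integrableI_nonneg)
    have "(\<integral>\<^sup>+x. ennreal (g x) \<partial>lborel) = (\<integral>\<^sup>+x. f' x \<partial>lborel)" using ge by (rule nn_integral_cong_AE)
    then show "(\<integral>\<^sup>+x. ennreal (g x) \<partial>lborel) < \<infinity>" using fin by simp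
  qed (auto simp: g_def)
  have "(LINT x:{s..t}|lborel. g x) = F t - F s" if "a \<le> s" "s \<le> t" "t \<le> b" for s t
  proof -
    have "(LINT x:{s<..t}|lborel. g x) = enn2real (\<integral>\<^sup>+x. ennreal (indicator {s<..t} x *\<^sub>R g x) \<partial>lborel)"
      unfolding set_lebesgue_integral_def by (rule integral_eq_nn_integral) (auto simp: g_def indicator_def)
    also have "(\<integral>\<^sup>+x. ennreal (indicator {s<..t} x *\<^sub>R g x) \<partial>lborel) = (\<integral>\<^sup>+x. f' x * indicator {s<..t} x \<partial>lborel)"
      by (rule nn_integral_cong_AE) (use ge in eventually_elim, auto simp: indicator_def)
    also have "\<dots> = ennreal (F t - F s)" by (rule nn[OF that])
    finally show ?thesis using F that(2) by (simp add: LINT_Ioc_Icc mono_def)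
  qed
  then show ?thesis using that[OF gm gi] by blast
qed

text \<open>Lebesgue's differentiation theorem in the version with cubes that have \<open>x\<close>
  as their lower corner.\<close>

lemma right_average:
  fixes g :: "real \<Rightarrow> real"
  assumes "g \<in> borel_measurable borel" "integrable lborel g"
  shows "AE x in lborel. \<forall>e>0. \<exists>d>0. \<forall>h. 0 < h \<and> h < d \<longrightarrow> \<bar>(LINT s:{x..x + h}|lborel. g s) / h - g x\<bar> < e"
proof -
  have si: "set_integrable lborel {a..b} g" for a b
    unfolding set_integrable_def by (rule integrable_mult_indicator) (use assms in auto)
  have "g integrable_on cbox a b" for a b using set_borel_integral_eq_integral(1)[OF si[of a b]] by simp
  then obtain N where N: "negligible N" "\<And>x e. x \<notin> N \<Longrightarrow> 0 < e \<Longrightarrow>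
     \<exists>d>0. \<forall>h. 0 < h \<and> h < d \<longrightarrow> norm (integral (cbox x (x + h *\<^sub>R One)) g /\<^sub>R h ^ DIM(real) - g x) < e"
    using integrable_ccontinuous_explicit[of g] by metis
  have "AE x in lborel. x \<notin> N"
    using N(1) AE_not_in[of N lebesgue] by (simp add: negligible_iff_null_sets AE_completion_iff)
  then show ?thesis
  proof eventually_elim
    case (elim x)
    show ?case
    proof (intro allI impI)
      fix e :: real assume "0 < e"
      obtain d where d: "0 < d" "\<And>h. 0 < h \<and> h < d \<Longrightarrow> norm (integral (cbox x (x + h *\<^sub>R One)) g /\<^sub>R h ^ DIM(real) - g x) < e"
        using N(2)[OF elim \<open>0 < e\<close>] by blast
      have "\<bar>(LINT s:{x..x + h}|lborel. g s) / h - g x\<bar> < e" if "0 < h \<and> h < d" for h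
        using d(2)[OF that] set_borel_integral_eq_integral(2)[OF si[of x "x + h"]] by (simp add: divide_inverse mult.commute)
      then show "\<exists>d>0. \<forall>h. 0 < h \<and> h < d \<longrightarrow> \<bar>(LINT s:{x..x + h}|lborel. g s) / h - g x\<bar> < e" using d(1) by blast
    qed
  qed
qed

text \<open>\<open>right_average\<close> for the reflected function; the exceptional null set is
  reflected back, as Lebesgue measure is invariant under reflection.\<close>

lemma left_average:
  fixes g :: "real \<Rightarrow> real"
  assumes [measurable]: "g \<in> borel_measurable borel" and i: "integrable lborel g"
  shows "AE x in lborel. \<forall>e>0. \<exists>d>0. \<forall>h. 0 < h \<and> h < d \<longrightarrow> \<bar>(LINT s:{x - h..x}|lborel. g s) / h - g x\<bar> < e"
proof -
  define P where "P x \<longleftrightarrow> (\<forall>e>0. \<exists>d>0. \<forall>h. 0 < h \<and> h < d \<longrightarrow> \<bar>(LINT s:{x - h..x}|lborel. g s) / h - g x\<bar> < e)" for x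
  have "integrable lborel (\<lambda>x. g (- x))" using lborel_integrable_real_affine[OF i, of "- 1" 0] by simp
  from right_average[OF _ this]
  have "AE x in lborel. \<forall>e>0. \<exists>d>0. \<forall>h. 0 < h \<and> h < d \<longrightarrow> \<bar>(LINT s:{x..x + h}|lborel. g (- s)) / h - g (- x)\<bar> < e"
    by simp
  moreover have "(LINT s:{x..x + h}|lborel. g (- s)) = (LINT s:{- x - h..- x}|lborel. g s)" for x h
    unfolding set_lebesgue_integral_def
    by (subst lborel_integral_real_affine[where c = "- 1" and t = 0])
      (auto intro!: Bochner_Integration.integral_cong simp: indicator_def)
  ultimately have "AE x in lborel. P (- x)" unfolding P_def by simp
  then have "AE x in distr lborel borel uminus. P x"
  proof -
    assume *: "AE x in lborel. P (- x)"
    have m: "uminus \<in> measurable lborel (borel :: real measure)" by measurable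
    obtain N where N: "{x \<in> space lborel. \<not> P (- x)} \<subseteq> N" "emeasure lborel N = 0" "N \<in> sets lborel"
      using AE_E[OF *] by metis
    have [measurable]: "N \<in> sets borel" using N by simp
    have N': "uminus -` N \<in> sets borel" using measurable_sets[OF m, of N] N by simp
    show ?thesis
    proof (rule AE_I[where N = "uminus -` N"])
      show "{x \<in> space (distr lborel borel uminus). \<not> P x} \<subseteq> uminus -` N" using N(1) by auto (metis add.inverse_inverse mem_Collect_eq subsetD)
      have "uminus -` (uminus -` N) = N" by auto
      then show "emeasure (distr lborel borel uminus) (uminus -` N) = 0"
        using N N' by (subst emeasure_distr) auto
      show "uminus -` N \<in> sets (distr lborel borel uminus)" using N' by simp
    qed
  qed
  then show ?thesis unfolding lborel_distr_uminus P_def .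
qed

text \<open>Differentiability is not assumed anywhere. Averages from both sides show that almost
  everywhere \<open>F\<close> is differentiable with its density as derivative, and there the
  hypothesis forces the density to be \<open>k\<close>. The form fits a mean-field model, which is
  constrained only where the derivative exists.\<close>

lemma lipschitz_mono_FTC:
  fixes F k :: "real \<Rightarrow> real"
  assumes F: "mono F" and lip: "\<And>s t. \<bar>F t - F s\<bar> \<le> L * \<bar>t - s\<bar>" and ab: "a \<le> b"
    and k: "k \<in> borel_measurable borel"
    and D: "\<And>t D. a < t \<Longrightarrow> t < b \<Longrightarrow> (F has_real_derivative D) (at t) \<Longrightarrow> D = k t"
  shows "F b - F a = (LINT s:{a..b}|lborel. k s)"
proof -
  obtain g where g: "g \<in> borel_measurable borel" "integrable lborel g"
    "\<And>s t. a \<le> s \<Longrightarrow> s \<le> t \<Longrightarrow> t \<le> b \<Longrightarrow> (LINT x:{s..t}|lborel. g x) = F t - F s"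
    by (rule lipschitz_density[OF F lip ab]) blast
  have "AE x in lborel. a < x \<longrightarrow> x < b \<longrightarrow> g x = k x"
    using right_average[OF g(1,2)] left_average[OF g(1,2)]
  proof eventually_elim
    case (elim x)
    show ?case
    proof (intro impI)
      assume x: "a < x" "x < b"
      have "((\<lambda>h. (F (x + h) - F x) / h) \<longlongrightarrow> g x) (at 0)"
      proof (rule LIM_I)
        fix e :: real assume "0 < e"
        obtain d1 where d1: "0 < d1" "\<And>h. 0 < h \<Longrightarrow> h < d1 \<Longrightarrow> \<bar>(LINT s:{x..x + h}|lborel. g s) / h - g x\<bar> < e"
          using elim(1) \<open>0 < e\<close> by blast
        obtain d2 where d2: "0 < d2" "\<And>h. 0 < h \<Longrightarrow> h < d2 \<Longrightarrow> \<bar>(LINT s:{x - h..x}|lborel. g s) / h - g x\<bar> < e"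
          using elim(2) \<open>0 < e\<close> by blast
        define d where "d = Min {d1, d2, b - x, x - a}"
        have d: "0 < d" "d \<le> d1" "d \<le> d2" "d \<le> b - x" "d \<le> x - a" using d1 d2 x by (auto simp: d_def)
        have "norm ((F (x + h) - F x) / h - g x) < e" if h: "h \<noteq> 0 \<and> norm (h - 0) < d" for h
        proof (cases "0 < h")
          case True
          then show ?thesis using d1(2)[of h] g(3)[of x "x + h"] h d x by simp
        next
          case False
          define h' where "h' = - h"
          have h': "0 < h'" "h' < d" using h False by (auto simp: h'_def)
          have "(F (x + h) - F x) / h = (F x - F (x - h')) / h'" using h by (simp add: h'_def minus_divide_right[symmetric] field_simps)
          then show ?thesis using d2(2)[of h'] g(3)[of "x - h'" x] h' d x by simp
        qed
        then show "\<exists>s>0. \<forall>h. h \<noteq> 0 \<and> norm (h - 0) < s \<longrightarrow> norm ((F (x + h) - F x) / h - g x) < e"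
          using d(1) by blast
      qed
      then have "(F has_real_derivative g x) (at x)" by (simp add: DERIV_def)
      then show "g x = k x" by (rule D[OF x])
    qed
  qed
  then have "AE x in lborel. indicator {a..b} x *\<^sub>R g x = indicator {a..b} x *\<^sub>R k x"
    using AE_lborel_singleton[of a] AE_lborel_singleton[of b] by eventually_elim (auto simp: indicator_def)
  then have "(LINT s:{a..b}|lborel. g s) = (LINT s:{a..b}|lborel. k s)"
    unfolding set_lebesgue_integral_def using g(1) k by (intro integral_cong_AE) auto
  then show ?thesis using g(3)[OF order_refl ab order_refl] by simp
qed

context mean_field_data begin

section \<open>Uniqueness of the mean-field model\<close>

text \<open>The rate of change at every location; beyond the boundary the value is 1 and
  rests.\<close>

definition net :: "real \<Rightarrow> (real \<Rightarrow> real) \<Rightarrow> real \<Rightarrow> real" where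
  "net s u x = (if x < B0 + v * s then drift lam \<mu> u x else 0)"

lemma net_bound: "u \<in> cdfs \<Longrightarrow> \<bar>net s u x\<bar> \<le> lam + 1"
  using drift_nonpos[of u x] lam by (auto simp: net_def abs_le_iff)

lemma net_diff:
  assumes "u \<in> cdfs" "w \<in> cdfs" "\<And>y. \<bar>u y - w y\<bar> \<le> D"
  shows "\<bar>net s u x - net s w x\<bar> \<le> (2 * lam + 1) * D"
  using drift_diff[OF assms, of x] lam assms(3)[of 0] by (auto simp: net_def)

lemma drift_lipschitz:
  assumes "\<phi> \<in> flows"
  shows "\<bar>drift lam \<mu> (\<phi> t) x - drift lam \<mu> (\<phi> s) x\<bar> \<le> (2 * lam + 1) * ((lam + 1) * \<bar>t - s\<bar>)"
  by (rule drift_diff) (use flowsD[OF assms] in auto)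

lemma drift_measurable:
  assumes "\<phi> \<in> flows" shows "(\<lambda>s. drift lam \<mu> (\<phi> s) x) \<in> borel_measurable borel"
  by (rule lipschitz_borel(2)[of _ "(2 * lam + 1) * (lam + 1)"]) (use drift_lipschitz[OF assms] in \<open>simp add: mult.assoc\<close>)

lemma net_measurable:
  assumes "\<phi> \<in> flows" shows "(\<lambda>s. net s (\<phi> s) x) \<in> borel_measurable borel"
  using drift_measurable[OF assms, of x] unfolding net_def by measurable

lemma net_integrable:
  assumes "\<phi> \<in> flows" shows "set_integrable lborel {a..b} (\<lambda>s. net s (\<phi> s) x)"
  by (rule set_integrable_bounded[OF net_measurable[OF assms]]) (use net_bound flowsD[OF assms] in blast)

lemma LINT_net_bound:
  assumes "\<phi> \<in> flows" "a \<le> b" shows "\<bar>LINT s:{a..b}|lborel. net s (\<phi> s) x\<bar> \<le> (lam + 1) * (b - a)"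
proof -
  have "\<bar>LINT s:{a..b}|lborel. net s (\<phi> s) x\<bar> \<le> (LINT s:{a..b}|lborel. lam + 1)"
    by (rule set_integral_abs_le[OF net_integrable[OF assms(1)] LINT_const(2)]) (use net_bound flowsD[OF assms(1)] in blast)
  also have "\<dots> = (lam + 1) * (b - a)" using LINT_const(1)[OF assms(2)] by simp
  finally show ?thesis .
qed

definition solution :: "(real \<Rightarrow> real \<Rightarrow> real) \<Rightarrow> bool" where
  "solution \<phi> \<longleftrightarrow> \<phi> \<in> flows \<and> (\<forall>x t. 0 \<le> t \<longrightarrow> \<phi> t x = \<phi> 0 x + (LINT s:{0..t}|lborel. net s (\<phi> s) x))"

text \<open>At a fixed location nothing happens before the boundary has passed; the time of passage itself
  is approached from the right.\<close>

lemma solutionI: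
  assumes \<phi>: "\<phi> \<in> flows"
    and inc: "\<And>x a b. 0 \<le> a \<Longrightarrow> a < b \<Longrightarrow> x < B0 + v * a \<Longrightarrow> \<phi> b x - \<phi> a x = (LINT s:{a..b}|lborel. net s (\<phi> s) x)"
  shows "solution \<phi>"
  unfolding solution_def
proof (intro conjI \<phi> allI impI)
  fix x t :: real assume t: "0 \<le> t"
  have one: "\<phi> s x = 1" if "0 \<le> s" "B0 + v * s \<le> x" for s using cdfs_upto_ge[OF flowsD(3)[OF \<phi> that(1)] that(2)] .
  have zero: "(LINT s:{0..a}|lborel. net s (\<phi> s) x) = 0" if "0 \<le> a" "B0 + v * a \<le> x" for a
  proof -
    have "net s (\<phi> s) x = 0" if "s \<in> {0..a}" for s
      using that \<open>B0 + v * a \<le> x\<close> mult_left_mono[of s a v] v by (auto simp: net_def)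
    then have "(LINT s:{0..a}|lborel. net s (\<phi> s) x) = (LINT s:{0..a}|lborel. 0)"
      by (intro set_lebesgue_integral_cong) auto
    then show ?thesis by (simp add: set_lebesgue_integral_def)
  qed
  show "\<phi> t x = \<phi> 0 x + (LINT s:{0..t}|lborel. net s (\<phi> s) x)"
  proof (cases "t = 0 \<or> B0 + v * t \<le> x")
    case True
    then show ?thesis
    proof
      assume "t = 0"
      then show ?thesis using LINT_net_bound[OF \<phi> order_refl, of 0 x] by simp
    next
      assume *: "B0 + v * t \<le> x"
      have "B0 + v * 0 \<le> x" using * mult_left_mono[OF t v] by simp
      then show ?thesis using one[OF t *] one[of 0] zero[OF t *] by simp
    qed
  next
    case False
    show ?thesis
    proof (cases "x < B0")
      case True
      then show ?thesis using inc[of 0 t x] False t by simp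
    next
      case x: False
      have vt: "0 < v"
      proof (rule ccontr)
        assume "\<not> 0 < v"
        then have "v = 0" using v by simp
        then show False using False x by simp
      qed
      define \<tau> where "\<tau> = (x - B0) / v"
      have \<tau>: "0 \<le> \<tau>" "\<tau> < t" "B0 + v * \<tau> = x" using x False vt by (auto simp: \<tau>_def field_simps)
      \<comment> \<open>Starting the integral equation slightly after the passage time \<tau> costs
        at most (lam + 1) e in the value and as much in the integral; e is arbitrarily
        small.\<close>
      have "\<bar>\<phi> t x - (\<phi> 0 x + (LINT s:{0..t}|lborel. net s (\<phi> s) x))\<bar> \<le> 2 * (lam + 1) * e" if e: "0 < e" "e \<le> t - \<tau>" for e
      proof -
        define a where "a = \<tau> + e / 2"
        have a: "\<tau> < a" "a < t" "a - \<tau> \<le> e" using e by (auto simp: a_def)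
        have "x < B0 + v * a" using mult_strict_left_mono[OF a(1) vt] \<tau>(3) by simp
        then have 1: "\<phi> t x - \<phi> a x = (LINT s:{a..t}|lborel. net s (\<phi> s) x)" using inc[of a t x] a \<tau> by simp
        have 2: "(LINT s:{0..t}|lborel. net s (\<phi> s) x) = (LINT s:{0..\<tau>}|lborel. net s (\<phi> s) x)
            + ((LINT s:{\<tau>..a}|lborel. net s (\<phi> s) x) + (LINT s:{a..t}|lborel. net s (\<phi> s) x))"
          using LINT_split[of 0 \<tau> t] LINT_split[of \<tau> a t] net_integrable[OF \<phi>] \<tau> a by simp
        have 3: "(LINT s:{0..\<tau>}|lborel. net s (\<phi> s) x) = 0" using zero[OF \<tau>(1)] \<tau>(3) by simp
        have lm: "(lam + 1) * (a - \<tau>) \<le> (lam + 1) * e" by (rule mult_left_mono) (use a lam in auto)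
        have 4: "\<bar>LINT s:{\<tau>..a}|lborel. net s (\<phi> s) x\<bar> \<le> (lam + 1) * e"
          using LINT_net_bound[OF \<phi>, of \<tau> a x] a lm by linarith
        have 5: "\<bar>\<phi> a x - \<phi> \<tau> x\<bar> \<le> (lam + 1) * e"
          using flowsD(2)[OF \<phi>, of a x \<tau>] a(1) lm by simp
        have 6: "\<phi> \<tau> x = 1" "\<phi> 0 x = 1" using one[OF \<tau>(1)] one[of 0] \<tau>(3) x by auto
        have "\<phi> t x - (\<phi> 0 x + (LINT s:{0..t}|lborel. net s (\<phi> s) x)) = (\<phi> a x - \<phi> \<tau> x) - (LINT s:{\<tau>..a}|lborel. net s (\<phi> s) x)"
          using 1 2 3 6 by simp
        moreover have "\<bar>(\<phi> a x - \<phi> \<tau> x) - (LINT s:{\<tau>..a}|lborel. net s (\<phi> s) x)\<bar> \<le> (lam + 1) * e + (lam + 1) * e"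
          by (rule order_trans[OF abs_triangle_ineq4 add_mono[OF 5 4]])
        moreover have "2 * (lam + 1) * e = (lam + 1) * e + (lam + 1) * e" by (simp add: distrib_right)
        ultimately show ?thesis by (simp only:)
      qed
      note bd = this
      have "\<bar>\<phi> t x - (\<phi> 0 x + (LINT s:{0..t}|lborel. net s (\<phi> s) x))\<bar> \<le> 0 + \<epsilon>" if "0 < \<epsilon>" for \<epsilon>
      proof -
        define e where "e = min (t - \<tau>) (\<epsilon> / (2 * (lam + 1)))"
        have "0 < \<epsilon> / (2 * (lam + 1))" using that lam by simp
        then have e: "0 < e" "e \<le> t - \<tau>" "e \<le> \<epsilon> / (2 * (lam + 1))" unfolding e_def using \<tau>(2) by (simp_all only: min_less_iff_conj min.cobounded1 min.cobounded2 diff_gt_0_iff_gt)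
        have "0 < 2 * (lam + 1)" using lam by simp
        then have "e * (2 * (lam + 1)) \<le> \<epsilon>" using e(3) by (simp only: pos_le_divide_eq)
        then have "2 * (lam + 1) * e \<le> \<epsilon>" by (simp only: mult.commute)
        then show ?thesis using bd[OF e(1,2)] by simp
      qed
      then show ?thesis using field_le_epsilon[of "\<bar>\<phi> t x - (\<phi> 0 x + (LINT s:{0..t}|lborel. net s (\<phi> s) x))\<bar>" 0] by simp
    qed
  qed
qed

text \<open>The flow minus its integrated rate has increments of order h^2 in absolute value, by
  \<open>flow_step\<close> and the Lipschitz continuity of the drift along the flow. So it neither
  grows nor falls.\<close>

lemma flow_solution: "solution flow"
proof (rule solutionI[OF flow_flows])
  fix x a b :: real assume a: "0 \<le> a" "a < b" and x: "x < B0 + v * a"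
  note fl = flow_flows
  define P where "P r = flow r x - (LINT s:{a..r}|lborel. net s (flow s) x)" for r
  define K where "K = (2 * lam + 3) * (lam + 1) + (2 * lam + 1) * (lam + 1)"
  have inc: "\<bar>P (r + h) - P r\<bar> \<le> K * h\<^sup>2" if r: "a \<le> r" "0 \<le> h" for r h
  proof -
    have xr: "x < B0 + v * s" if "r \<le> s" for s using x mult_left_mono[of a s v] v r that by simp
    have "(LINT s:{a..r + h}|lborel. net s (flow s) x) = (LINT s:{a..r}|lborel. net s (flow s) x) + (LINT s:{r..r + h}|lborel. net s (flow s) x)"
      using r by (intro LINT_split net_integrable fl) auto
    then have "P (r + h) - P r = (flow (r + h) x - flow r x) - (LINT s:{r..r + h}|lborel. net s (flow s) x)" by (simp add: P_def)
    moreover have "\<bar>(LINT s:{r..r + h}|lborel. net s (flow s) x) - h * drift lam \<mu> (flow r) x\<bar> \<le> (2 * lam + 1) * (lam + 1) * h\<^sup>2"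
    proof -
      have 1: "(LINT s:{r..r + h}|lborel. net s (flow s) x) - h * drift lam \<mu> (flow r) x
         = (LINT s:{r..r + h}|lborel. net s (flow s) x - drift lam \<mu> (flow r) x)"
      proof -
        have "(LINT s:{r..r + h}|lborel. drift lam \<mu> (flow r) x) = (r + h - r) * drift lam \<mu> (flow r) x"
          by (rule LINT_const(1)) (use r in simp)
        then show ?thesis
          by (simp only: set_integral_diff(2)[OF net_integrable[OF fl] LINT_const(2)] add_diff_cancel_left')
      qed
      have 2: "\<bar>LINT s:{r..r + h}|lborel. net s (flow s) x - drift lam \<mu> (flow r) x\<bar> \<le> (LINT s:{r..r + h}|lborel. (2 * lam + 1) * ((lam + 1) * h))"
      proof (rule set_integral_abs_le)
        show "set_integrable lborel {r..r + h} (\<lambda>s. net s (flow s) x - drift lam \<mu> (flow r) x)"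
          by (intro set_integral_diff net_integrable fl LINT_const(2))
        fix s assume s: "s \<in> {r..r + h}"
        have "\<bar>net s (flow s) x - drift lam \<mu> (flow r) x\<bar> \<le> (2 * lam + 1) * ((lam + 1) * \<bar>s - r\<bar>)"
          using drift_lipschitz[OF fl, of s x r] xr[of s] s by (simp add: net_def)
        also have "\<dots> \<le> (2 * lam + 1) * ((lam + 1) * h)" using s lam by (intro mult_left_mono) auto
        finally show "\<bar>net s (flow s) x - drift lam \<mu> (flow r) x\<bar> \<le> (2 * lam + 1) * ((lam + 1) * h)" .
      qed (rule LINT_const(2))
      have 3: "(LINT s:{r..r + h}|lborel. (2 * lam + 1) * ((lam + 1) * h)) = (2 * lam + 1) * (lam + 1) * h\<^sup>2"
      proof -
        have "(LINT s:{r..r + h}|lborel. (2 * lam + 1) * ((lam + 1) * h)) = (r + h - r) * ((2 * lam + 1) * ((lam + 1) * h))"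
          by (rule LINT_const(1)) (use r in simp)
        then show ?thesis by (simp only: power2_eq_square add_diff_cancel_left' mult_ac)
      qed
      show ?thesis unfolding 1 by (rule order_trans[OF 2 eq_refl[OF 3]])
    qed
    moreover have "\<bar>flow (r + h) x - flow r x - h * drift lam \<mu> (flow r) x\<bar> \<le> (2 * lam + 3) * (lam + 1) * h\<^sup>2"
      by (rule flow_step) (use r a xr[of r] in auto)
    moreover have "K * h\<^sup>2 = (2 * lam + 3) * (lam + 1) * h\<^sup>2 + (2 * lam + 1) * (lam + 1) * h\<^sup>2"
      by (simp add: K_def distrib_right)
    ultimately show ?thesis unfolding abs_le_iff by linarith
  qed
  have "P b \<le> P a"
    by (rule quadratic_increments_le[where K = K]) (use a inc in \<open>auto simp: abs_le_iff\<close>)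
  moreover have "- P b \<le> - P a"
    by (rule quadratic_increments_le[where K = K]) (use a inc in \<open>auto simp: abs_le_iff\<close>)
  ultimately have "P b = P a" by simp
  moreover have "(LINT s:{a..a}|lborel. net s (flow s) x) = 0" using LINT_net_bound[OF fl order_refl, of a x] by simp
  ultimately show "flow b x - flow a x = (LINT s:{a..b}|lborel. net s (flow s) x)" by (simp add: P_def)
qed

text \<open>Gronwall by iteration: R is twice the Lipschitz constant of \<open>net\<close>, so one
  pass through the integral equation halves the bound relative to the weight exp (R t).\<close>

lemma solution_unique:
  assumes \<phi>: "solution \<phi>" and \<psi>: "solution \<psi>" and eq: "\<phi> 0 = \<psi> 0" and t: "0 \<le> t"
  shows "\<phi> t x = \<psi> t x"
proof -
  define R where "R = 2 * (2 * lam + 1)"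
  have R: "0 < R" using lam by (simp add: R_def)
  have fl: "\<phi> \<in> flows" "\<psi> \<in> flows" using \<phi> \<psi> by (auto simp: solution_def)
  have "\<bar>\<phi> t x - \<psi> t x\<bar> \<le> (1/2) ^ k * exp (R * t)" if "0 \<le> t" for k t x
    using that
  proof (induction k arbitrary: t x)
    case 0
    have "\<bar>\<phi> t x - \<psi> t x\<bar> \<le> 1"
      using cdfs_bounds[OF flowsD(1)[OF fl(1)], of t x] cdfs_bounds[OF flowsD(1)[OF fl(2)], of t x] by (auto simp: abs_le_iff)
    also have "1 \<le> exp (R * t)" using 0 R by simp
    finally show ?case by simp
  next
    case (Suc k)
    have 1: "\<phi> t x - \<psi> t x = (LINT s:{0..t}|lborel. net s (\<phi> s) x - net s (\<psi> s) x)"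
    proof -
      have "\<phi> t x = \<phi> 0 x + (LINT s:{0..t}|lborel. net s (\<phi> s) x)" "\<psi> t x = \<psi> 0 x + (LINT s:{0..t}|lborel. net s (\<psi> s) x)"
        using \<phi> \<psi> Suc.prems unfolding solution_def by blast+
      moreover have "(LINT s:{0..t}|lborel. net s (\<phi> s) x - net s (\<psi> s) x) = (LINT s:{0..t}|lborel. net s (\<phi> s) x) - (LINT s:{0..t}|lborel. net s (\<psi> s) x)"
        by (rule set_integral_diff(2)[OF net_integrable[OF fl(1)] net_integrable[OF fl(2)]])
      ultimately show ?thesis by (simp only: eq add_diff_cancel_left)
    qed
    have 2: "\<bar>LINT s:{0..t}|lborel. net s (\<phi> s) x - net s (\<psi> s) x\<bar> \<le> (LINT s:{0..t}|lborel. ((2 * lam + 1) * (1/2) ^ k) * exp (R * s))"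
    proof (rule set_integral_abs_le)
      show "set_integrable lborel {0..t} (\<lambda>s. net s (\<phi> s) x - net s (\<psi> s) x)"
        by (intro set_integral_diff net_integrable fl)
      show "set_integrable lborel {0..t} (\<lambda>s. ((2 * lam + 1) * (1/2) ^ k) * exp (R * s))"
        by (rule LINT_exp(2)) (use Suc.prems R in auto)
      fix s assume s: "s \<in> {0..t}"
      have "\<bar>net s (\<phi> s) x - net s (\<psi> s) x\<bar> \<le> (2 * lam + 1) * ((1/2) ^ k * exp (R * s))"
        by (intro net_diff flowsD fl Suc.IH) (use s in auto)
      then show "\<bar>net s (\<phi> s) x - net s (\<psi> s) x\<bar> \<le> ((2 * lam + 1) * (1/2) ^ k) * exp (R * s)" by (simp add: mult.assoc)
    qed
    have 3: "(LINT s:{0..t}|lborel. ((2 * lam + 1) * (1/2) ^ k) * exp (R * s)) = ((2 * lam + 1) * (1/2) ^ k) * (exp (R * t) - 1) / R"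
      by (subst LINT_exp(1)) (use Suc.prems R in simp_all)
    have 4: "((2 * lam + 1) * (1/2) ^ k) * (exp (R * t) - 1) / R = (1/2) ^ Suc k * (exp (R * t) - 1)"
    proof -
      have "((2 * lam + 1) * y) * z / R = (1/2) * y * z" for y z using R by (simp add: R_def field_simps)
      then show ?thesis by (simp only: power_Suc)
    qed
    have 5: "(1/2) ^ Suc k * (exp (R * t) - 1) \<le> (1/2) ^ Suc k * exp (R * t)" by (intro mult_left_mono) auto
    show ?case unfolding 1 using 2 5 unfolding 3 4 by (rule order_trans)
  qed
  note bd = this[OF t]
  have "(\<lambda>k. (1/2) ^ k * exp (R * t)) \<longlonglongrightarrow> 0 * exp (R * t)" by (intro tendsto_intros LIMSEQ_power_zero) simp
  then have lim: "(\<lambda>k. (1/2) ^ k * exp (R * t)) \<longlonglongrightarrow> 0" by simp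
  have "\<bar>\<phi> t x - \<psi> t x\<bar> \<le> 0" by (rule LIMSEQ_le_const[OF lim]) (use bd in blast)
  then show ?thesis by simp
qed

text \<open>The integral over y <= x of 1 - J(x - y) is the mass carried from (-oo, x] beyond x by one jump.\<close>

lemma jump_loss:
  assumes u: "u \<in> cdfs"
  shows "(LINT y:{..x}|interval_measure u. 1 - cdf \<mu> (x - y)) = u x - shift u x"
proof -
  have rd: "real_distribution (interval_measure u)"
    by (rule real_distribution_interval_measure) (use u in \<open>auto simp: cdfs_def mono_def\<close>)
  interpret U: real_distribution "interval_measure u" by (rule rd)
  interpret P: pair_prob_space "interval_measure u" \<mu> ..
  have cu: "cdf (interval_measure u) = u"
    by (rule cdf_interval_measure) (use u in \<open>auto simp: cdfs_def mono_def\<close>)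
  have mu: "measure (interval_measure u) {..y} = u y" for y using fun_cong[OF cu, of y] by (simp add: cdf_def)
  define k where "k = (\<lambda>(y, z). of_bool (y \<le> x \<and> x < y + z) :: real)"
  have km[measurable]: "k \<in> borel_measurable (interval_measure u \<Otimes>\<^sub>M \<mu>)" unfolding k_def by measurable
  have ki: "integrable (interval_measure u \<Otimes>\<^sub>M \<mu>) k"
    by (rule P.integrable_const_bound[where B = 1]) (auto simp: k_def)
  have 1: "(\<integral>z. k (y, z) \<partial>\<mu>) = indicator {..x} y * (1 - cdf \<mu> (x - y))" for y
  proof -
    have sp: "space \<mu> = UNIV" using sets_mu sets_eq_imp_space_eq by fastforce
    have "(\<integral>z. k (y, z) \<partial>\<mu>) = (\<integral>z. indicator {..x} y * indicator {x - y<..} z \<partial>\<mu>)"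
      by (intro Bochner_Integration.integral_cong) (auto simp: k_def indicator_def)
    also have "\<dots> = indicator {..x} y * prob {x - y<..}" by simp
    also have "prob {x - y<..} = 1 - cdf \<mu> (x - y)"
    proof -
      have "{x - y<..} = space \<mu> - {..x - y}" using sp by auto
      then show ?thesis using prob_compl[of "{..x - y}"] by (simp add: cdf_def sets_mu)
    qed
    finally show ?thesis .
  qed
  have 2: "AE z in \<mu>. (\<integral>y. k (y, z) \<partial>interval_measure u) = u x - u (x - z)"
    using pos
  proof eventually_elim
    case (elim z)
    have "(\<integral>y. k (y, z) \<partial>interval_measure u) = (\<integral>y. indicator {..x} y - indicator {..x - z} y \<partial>interval_measure u)"
      using elim by (intro Bochner_Integration.integral_cong) (auto simp: k_def indicator_def)
    also have "\<dots> = U.expectation (indicator {..x}) - U.expectation (indicator {..x - z})"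
      by (rule Bochner_Integration.integral_diff) (auto intro!: integrable_real_indicator simp: less_top[symmetric])
    also have "\<dots> = u x - u (x - z)" by (simp add: mu)
    finally show ?case .
  qed
  have "(LINT y:{..x}|interval_measure u. 1 - cdf \<mu> (x - y)) = (\<integral>y. \<integral>z. k (y, z) \<partial>\<mu> \<partial>interval_measure u)"
    unfolding set_lebesgue_integral_def 1 by simp
  also have "\<dots> = (\<integral>z. \<integral>y. k (y, z) \<partial>interval_measure u \<partial>\<mu>)"
    by (rule P.Fubini_integral[symmetric]) (use ki in simp)
  also have "\<dots> = (\<integral>z. u x - u (x - z) \<partial>\<mu>)"
  proof (rule integral_cong_AE)
    show "(\<lambda>z. \<integral>y. k (y, z) \<partial>interval_measure u) \<in> borel_measurable \<mu>"
      by (rule U.borel_measurable_lebesgue_integral) measurable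
    show "(\<lambda>z. u x - u (x - z)) \<in> borel_measurable \<mu>" using cdfs_measurable[OF u] by measurable
  qed (rule 2)
  also have "\<dots> = u x - shift u x" using shift_integrable_cdf[OF u] by (simp add: shift_def prob_space)
  finally show ?thesis .
qed

lemma loss_drift:
  assumes "u \<in> cdfs"
  shows "- lam * (LINT y:{..x}|interval_measure u. 1 - cdf \<mu> (x - y)) - u x * (1 - u x) = drift lam \<mu> u x"
  unfolding jump_loss[OF assms] drift_def shift_def by (simp add: algebra_simps)

text \<open>\<open>flow_step\<close> expands to the right only. This suffices, for a derivative
  within [0, \<infinity>) is also the limit of the right difference quotients, and it covers the
  time 0.\<close>

lemma flow_model: "mean_field_model lam (cdf \<mu>) v B0 flow"
  unfolding mean_field_model_def
proof (intro conjI allI impI)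
  show "flow t \<in> cdfs_upto (B0 + v * t)" if "0 \<le> t" for t by (rule flowsD(3)[OF flow_flows that])
  show "antimono_on {0..} (\<lambda>t. flow t x)" for x
    by (intro monotone_onI) (use flow_antimono in auto)
  show "(lam + 1)-lipschitz_on {0..} (\<lambda>t. flow t x)" for x
    by (rule lipschitz_onI) (use flowsD(2)[OF flow_flows] lam in \<open>auto simp: dist_real_def\<close>)
  fix x t D
  assume "0 \<le> t \<and> x < B0 + v * t \<and> ((\<lambda>s. flow s x) has_real_derivative D) (at t within {0..})"
  then have t: "0 \<le> t" "x < B0 + v * t" and D: "((\<lambda>s. flow s x) has_real_derivative D) (at t within {0..})" by auto
  have "((\<lambda>s. flow s x) has_real_derivative D) (at_right t)"
    by (rule DERIV_subset[OF D]) (use t in auto)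
  then have 1: "((\<lambda>s. (flow s x - flow t x) / (s - t)) \<longlongrightarrow> D) (at_right t)" by (simp add: has_field_derivative_iff)
  let ?K = "(2 * lam + 3) * (lam + 1)" and ?d = "drift lam \<mu> (flow t) x"
  have 2: "((\<lambda>s. (flow s x - flow t x) / (s - t)) \<longlongrightarrow> ?d) (at_right t)"
  proof (rule tendsto_sandwich)
    have ev: "eventually (\<lambda>s. \<bar>(flow s x - flow t x) / (s - t) - ?d\<bar> \<le> ?K * (s - t)) (at_right t)"
      using eventually_at_right_less[of t]
    proof eventually_elim
      case (elim s)
      have "\<bar>flow s x - flow t x - (s - t) * ?d\<bar> \<le> ?K * (s - t)\<^sup>2"
        using flow_step[OF t(1) _ t(2), of "s - t"] elim by simp
      moreover have "(flow s x - flow t x) / (s - t) - ?d = (flow s x - flow t x - (s - t) * ?d) / (s - t)"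
        using elim by (simp add: diff_divide_distrib)
      ultimately have "\<bar>(flow s x - flow t x) / (s - t) - ?d\<bar> \<le> ?K * (s - t)\<^sup>2 / (s - t)"
        using elim by (simp add: divide_right_mono)
      then show ?case using elim by (simp add: power2_eq_square)
    qed
    show "eventually (\<lambda>s. ?d - ?K * (s - t) \<le> (flow s x - flow t x) / (s - t)) (at_right t)"
      using ev by eventually_elim (simp add: abs_le_iff)
    show "eventually (\<lambda>s. (flow s x - flow t x) / (s - t) \<le> ?d + ?K * (s - t)) (at_right t)"
      using ev by eventually_elim (simp add: abs_le_iff)
    have "((\<lambda>s. ?d - ?K * (s - t)) \<longlongrightarrow> ?d - ?K * (t - t)) (at_right t)" by (intro tendsto_intros)
    then show "((\<lambda>s. ?d - ?K * (s - t)) \<longlongrightarrow> ?d) (at_right t)" by simp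
    have "((\<lambda>s. ?d + ?K * (s - t)) \<longlongrightarrow> ?d + ?K * (t - t)) (at_right t)" by (intro tendsto_intros)
    then show "((\<lambda>s. ?d + ?K * (s - t)) \<longlongrightarrow> ?d) (at_right t)" by simp
  qed
  have "D = ?d" by (rule tendsto_unique[OF _ 1 2]) simp
  then show "D = - lam * (LINT y:{..x}|interval_measure (flow t). 1 - cdf \<mu> (x - y)) - flow t x * (1 - flow t x)"
    using loss_drift[OF flowsD(1)[OF flow_flows], of t x] by simp
qed

text \<open>Freezing the model at negative times makes it an element of \<open>flows\<close>.
  \<open>lipschitz_mono_FTC\<close> turns the derivative condition into the integral equation left
  of the boundary, and \<open>solutionI\<close> extends this to all locations.\<close>

lemma model_unique:
  assumes g: "mean_field_model lam (cdf \<mu>) v B0 g" and g0: "g 0 = f0" and t: "0 \<le> t"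
  shows "g t = flow t"
proof -
  define \<phi> where "\<phi> t = g (max 0 t)" for t
  have lip: "\<bar>g t x - g s x\<bar> \<le> (lam + 1) * \<bar>t - s\<bar>" if "0 \<le> s" "0 \<le> t" for s t x
  proof -
    have "(lam + 1)-lipschitz_on {0..} (\<lambda>t. g t x)" using g by (simp add: mean_field_model_def)
    from lipschitz_onD[OF this, of t s] that show ?thesis by (simp add: dist_real_def)
  qed
  have \<phi>: "\<phi> \<in> flows"
    unfolding flows_def
  proof (intro CollectI conjI allI)
    show "\<phi> t \<in> cdfs_upto (B0 + v * max 0 t)" for t using g by (simp add: \<phi>_def mean_field_model_def)
    show "\<bar>\<phi> t x - \<phi> s x\<bar> \<le> (lam + 1) * \<bar>t - s\<bar>" for s t x
    proof -
      have "\<bar>\<phi> t x - \<phi> s x\<bar> \<le> (lam + 1) * \<bar>max 0 t - max 0 s\<bar>" unfolding \<phi>_def by (rule lip) auto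
      also have "\<dots> \<le> (lam + 1) * \<bar>t - s\<bar>" using lam by (intro mult_left_mono) auto
      finally show ?thesis .
    qed
  qed
  have "solution \<phi>"
  proof (rule solutionI[OF \<phi>])
    fix x a b :: real assume a: "0 \<le> a" "a < b" and x: "x < B0 + v * a"
    \<comment> \<open>The sign is reversed because the fundamental theorem above is for increasing
      functions.\<close>
    define F where "F t = - \<phi> t x" for t
    have "F b - F a = (LINT s:{a..b}|lborel. - net s (\<phi> s) x)"
    proof (rule lipschitz_mono_FTC)
      show "mono F"
      proof (rule monoI)
        fix s t :: real assume "s \<le> t"
        moreover have "antimono_on {0..} (\<lambda>t. g t x)" using g by (simp add: mean_field_model_def)
        ultimately have "g (max 0 t) x \<le> g (max 0 s) x" by (auto simp: monotone_on_def)
        then show "F s \<le> F t" by (simp add: F_def \<phi>_def)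
      qed
      show "\<bar>F t - F s\<bar> \<le> (lam + 1) * \<bar>t - s\<bar>" for s t
        using flowsD(2)[OF \<phi>, of s x t] by (simp add: F_def abs_minus_commute)
      show "a \<le> b" using a by simp
      show "(\<lambda>s. - net s (\<phi> s) x) \<in> borel_measurable borel" using net_measurable[OF \<phi>] by measurable
      fix t D assume t: "a < t" "t < b" and D: "(F has_real_derivative D) (at t)"
      have t0: "0 < t" using t a by simp
      have xt: "x < B0 + v * t" using x mult_left_mono[of a t v] v t by simp
      have "((\<lambda>s. \<phi> s x) has_real_derivative - D) (at t)"
        using DERIV_minus[OF D] by (simp add: F_def)
      then have "((\<lambda>s. g s x) has_real_derivative - D) (at t)"
      proof (rule has_field_derivative_transform_within_open)
        show "open {0 :: real<..}" "t \<in> {0<..}" using t0 by auto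
        show "\<phi> s x = g s x" if "s \<in> {0<..}" for s using that by (simp add: \<phi>_def)
      qed
      then have "((\<lambda>s. g s x) has_real_derivative - D) (at t within {0..})" by (rule DERIV_subset) simp
      then have "- D = - lam * (LINT y:{..x}|interval_measure (g t). 1 - cdf \<mu> (x - y)) - g t x * (1 - g t x)"
        using g t0 xt unfolding mean_field_model_def by fastforce
      also have "\<dots> = drift lam \<mu> (g t) x"
        by (rule loss_drift) (use flowsD(1)[OF \<phi>, of t] t0 in \<open>simp add: \<phi>_def\<close>)
      finally show "D = - net t (\<phi> t) x" using xt t0 by (simp add: net_def \<phi>_def)
    qed
    then show "\<phi> b x - \<phi> a x = (LINT s:{a..b}|lborel. net s (\<phi> s) x)"
      by (simp add: F_def set_lebesgue_integral_def)
  qed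
  moreover have "\<phi> 0 = flow 0" using g0 flow_0 by (simp add: \<phi>_def fun_eq_iff)
  ultimately have "\<phi> t x = flow t x" for x using solution_unique[OF _ flow_solution _ t] by blast
  then show ?thesis using t by (simp add: \<phi>_def fun_eq_iff)
qed

end

section \<open>The weak equation\<close>

lemma iterated_integral:
  fixes k :: "real \<Rightarrow> real \<Rightarrow> real"
  assumes P: "real_distribution P" and Q: "real_distribution Q"
    and [measurable]: "case_prod k \<in> borel_measurable (borel \<Otimes>\<^sub>M borel)" and K: "\<And>a b. \<bar>k a b\<bar> \<le> K"
  shows "integrable Q (k a)" "integrable P (\<lambda>a. \<integral>b. k a b \<partial>Q)" "\<bar>\<integral>a. \<integral>b. k a b \<partial>Q \<partial>P\<bar> \<le> K"
proof -
  interpret P: real_distribution P by (rule P)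
  interpret Q: real_distribution Q by (rule Q)
  note [measurable_cong] = P.events_eq_borel Q.events_eq_borel
  show i: "integrable Q (k a)" for a by (rule Q.integrable_const_bound[where B = K]) (use K in auto)
  have b: "\<bar>\<integral>b. k a b \<partial>Q\<bar> \<le> K" for a by (rule Q.abs_expectation_le) (use K in auto)
  have [measurable]: "(\<lambda>a. \<integral>b. k a b \<partial>Q) \<in> borel_measurable P"
    by (rule Q.borel_measurable_lebesgue_integral) measurable
  show "integrable P (\<lambda>a. \<integral>b. k a b \<partial>Q)" by (rule P.integrable_const_bound[where B = K]) (use b in auto)
  show "\<bar>\<integral>a. \<integral>b. k a b \<partial>Q \<partial>P\<bar> \<le> K" by (rule P.abs_expectation_le) (use b in auto)
qed

lemma iterated_integral_linear:
  fixes k l :: "real \<Rightarrow> real \<Rightarrow> real"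
  assumes P: "real_distribution P" and Q: "real_distribution Q"
    and k: "case_prod k \<in> borel_measurable (borel \<Otimes>\<^sub>M borel)" "\<And>a b. \<bar>k a b\<bar> \<le> K"
    and l: "case_prod l \<in> borel_measurable (borel \<Otimes>\<^sub>M borel)" "\<And>a b. \<bar>l a b\<bar> \<le> L"
  shows "(\<integral>a. \<integral>b. k a b + c * l a b \<partial>Q \<partial>P) = (\<integral>a. \<integral>b. k a b \<partial>Q \<partial>P) + c * (\<integral>a. \<integral>b. l a b \<partial>Q \<partial>P)"
proof -
  note k' = iterated_integral[OF P Q k] and l' = iterated_integral[OF P Q l]
  have "(\<integral>b. k a b + c * l a b \<partial>Q) = (\<integral>b. k a b \<partial>Q) + c * (\<integral>b. l a b \<partial>Q)" for a
    by (subst Bochner_Integration.integral_add) (use k'(1)[of a] l'(1)[of a] in auto)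
  then have "(\<integral>a. \<integral>b. k a b + c * l a b \<partial>Q \<partial>P) = (\<integral>a. (\<integral>b. k a b \<partial>Q) + c * (\<integral>b. l a b \<partial>Q) \<partial>P)" by (simp only:)
  also have "\<dots> = (\<integral>a. \<integral>b. k a b \<partial>Q \<partial>P) + c * (\<integral>a. \<integral>b. l a b \<partial>Q \<partial>P)"
    by (subst Bochner_Integration.integral_add) (use k'(2) l'(2) in auto)
  finally show ?thesis .
qed

definition bounded_borel :: "(real \<Rightarrow> real) \<Rightarrow> real \<Rightarrow> bool" where
  "bounded_borel h K \<longleftrightarrow> h \<in> borel_measurable borel \<and> (\<forall>x. \<bar>h x\<bar> \<le> K)"

text \<open>The domains of the set integrals are moved into the kernels. Both parts of the operator
  then are iterated integrals of bounded measurable functions, with one proof of linearity and of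
  the bound.\<close>

definition jump_kernel :: "real \<Rightarrow> (real \<Rightarrow> real) \<Rightarrow> real \<Rightarrow> real \<Rightarrow> real" where
  "jump_kernel B h z y = of_bool (y < B) * (h (min (y + z) B) - h y)"

definition copy_kernel :: "real \<Rightarrow> (real \<Rightarrow> real) \<Rightarrow> real \<Rightarrow> real \<Rightarrow> real" where
  "copy_kernel B h y \<xi> = of_bool (y < B \<and> y \<le> \<xi> \<and> \<xi> \<le> B) * (h \<xi> - h y)"

lemma kernel_bounds:
  assumes "bounded_borel h K"
  shows "case_prod (jump_kernel B h) \<in> borel_measurable (borel \<Otimes>\<^sub>M borel)" "\<bar>jump_kernel B h z y\<bar> \<le> 2 * K"
    "case_prod (copy_kernel B h) \<in> borel_measurable (borel \<Otimes>\<^sub>M borel)" "\<bar>copy_kernel B h z y\<bar> \<le> 2 * K"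
proof -
  have [measurable]: "h \<in> borel_measurable borel" and K: "\<bar>h x\<bar> \<le> K" for x
    using assms by (auto simp: bounded_borel_def)
  have d: "\<bar>h x - h y\<bar> \<le> 2 * K" for x y using K[of x] K[of y] by linarith
  then have K0: "0 \<le> 2 * K" using order_trans[OF abs_ge_zero] by blast
  show "case_prod (jump_kernel B h) \<in> borel_measurable (borel \<Otimes>\<^sub>M borel)" unfolding jump_kernel_def by measurable
  show "case_prod (copy_kernel B h) \<in> borel_measurable (borel \<Otimes>\<^sub>M borel)" unfolding copy_kernel_def by measurable
  show "\<bar>jump_kernel B h z y\<bar> \<le> 2 * K" using d K0 by (auto simp: jump_kernel_def)
  show "\<bar>copy_kernel B h z y\<bar> \<le> 2 * K" using d K0 by (auto simp: copy_kernel_def)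
qed

lemma boundary_operator_kernels:
  "boundary_operator lam \<mu> B u h = lam * (\<integral>z. \<integral>y. jump_kernel B h z y \<partial>interval_measure u \<partial>\<mu>)
     + (\<integral>y. \<integral>\<xi>. copy_kernel B h y \<xi> \<partial>interval_measure u \<partial>interval_measure u)"
proof -
  have 1: "(\<lambda>y. indicator {..<B} y *\<^sub>R (h (min (y + z) B) - h y)) = jump_kernel B h z" for z
    by (auto simp: jump_kernel_def fun_eq_iff indicator_def)
  have 2: "indicator {..<B} y *\<^sub>R (\<integral>\<xi>. indicator {y..B} \<xi> *\<^sub>R (h \<xi> - h y) \<partial>interval_measure u) = (\<integral>\<xi>. copy_kernel B h y \<xi> \<partial>interval_measure u)" for y
  proof (cases "y < B")
    case True
    then have "(\<lambda>\<xi>. indicator {y..B} \<xi> *\<^sub>R (h \<xi> - h y)) = copy_kernel B h y" by (auto simp: copy_kernel_def fun_eq_iff indicator_def)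
    then show ?thesis using True by simp
  qed (simp add: copy_kernel_def)
  show ?thesis unfolding boundary_operator_def set_lebesgue_integral_def 1 2 by simp
qed

lemma cdfs_distribution:
  assumes "u \<in> cdfs" shows "real_distribution (interval_measure u)" "cdf (interval_measure u) = u"
  by (rule real_distribution_interval_measure cdf_interval_measure; use assms in \<open>auto simp: cdfs_def mono_def\<close>)+

context mean_field_data begin

lemma mu_distribution: "real_distribution \<mu>"
  by (rule real_distribution.intro) (unfold_locales, use sets_mu sets_eq_imp_space_eq in fastforce)+

lemma boundary_operator_bound:
  assumes u: "u \<in> cdfs" and h: "bounded_borel h K"
  shows "\<bar>boundary_operator lam \<mu> B u h\<bar> \<le> (2 * lam + 2) * K"
proof -
  note rd = cdfs_distribution(1)[OF u]
  let ?a = "\<integral>z. \<integral>y. jump_kernel B h z y \<partial>interval_measure u \<partial>\<mu>"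
  let ?b = "\<integral>y. \<integral>\<xi>. copy_kernel B h y \<xi> \<partial>interval_measure u \<partial>interval_measure u"
  have a: "\<bar>?a\<bar> \<le> 2 * K"
    by (rule iterated_integral(3)[OF mu_distribution rd kernel_bounds(1,2)[OF h]])
  have b: "\<bar>?b\<bar> \<le> 2 * K"
    by (rule iterated_integral(3)[OF rd rd kernel_bounds(3,4)[OF h]])
  have "\<bar>lam * ?a\<bar> \<le> lam * (2 * K)" using mult_left_mono[OF a lam] lam by (simp add: abs_mult)
  then have "\<bar>lam * ?a + ?b\<bar> \<le> lam * (2 * K) + 2 * K" using b by (rule order_trans[OF abs_triangle_ineq add_mono])
  then show ?thesis unfolding boundary_operator_kernels by (simp add: algebra_simps)
qed

lemma boundary_operator_linear:
  assumes u: "u \<in> cdfs" and h: "bounded_borel h K" and g: "bounded_borel g L"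
  shows "boundary_operator lam \<mu> B u (\<lambda>x. h x + c * g x) = boundary_operator lam \<mu> B u h + c * boundary_operator lam \<mu> B u g"
proof -
  note rd = cdfs_distribution(1)[OF u]
  have 1: "jump_kernel B (\<lambda>x. h x + c * g x) z y = jump_kernel B h z y + c * jump_kernel B g z y" for z y
    by (simp add: jump_kernel_def algebra_simps)
  have 2: "copy_kernel B (\<lambda>x. h x + c * g x) z y = copy_kernel B h z y + c * copy_kernel B g z y" for z y
    by (simp add: copy_kernel_def algebra_simps)
  show ?thesis
    unfolding boundary_operator_kernels 1 2
      iterated_integral_linear[OF mu_distribution rd kernel_bounds(1,2)[OF h] kernel_bounds(1,2)[OF g]]
      iterated_integral_linear[OF rd rd kernel_bounds(3,4)[OF h] kernel_bounds(3,4)[OF g]]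
    by (simp add: algebra_simps)
qed

lemma boundary_operator_const: "boundary_operator lam \<mu> B u (\<lambda>_. c) = 0"
  by (simp add: boundary_operator_kernels jump_kernel_def[abs_def] copy_kernel_def[abs_def])

text \<open>For x < B a truncated jump ends at or below x just when the untruncated one does, and
  copying loses the mass u x at the rate of choosing one of the mass 1 - u x beyond x. For x \<ge> B
  no move leaves (-\<infinity>, x].\<close>

lemma boundary_operator_indicator:
  assumes u: "u \<in> cdfs_upto B"
  shows "boundary_operator lam \<mu> B u (indicator {..x}) = (if x < B then drift lam \<mu> u x else 0)"
proof -
  have uc: "u \<in> cdfs" and uB: "u B = 1" using u by (auto simp: cdfs_upto_def)
  interpret U: real_distribution "interval_measure u" by (rule cdfs_distribution(1)[OF uc])
  have mu: "U.prob {..y} = u y" for y using fun_cong[OF cdfs_distribution(2)[OF uc], of y] by (simp add: cdf_def)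
  show ?thesis
  proof (cases "x < B")
    case False
    have "jump_kernel B (indicator {..x}) z y = 0" "copy_kernel B (indicator {..x}) y \<xi> = 0" for z y \<xi>
      using False by (auto simp: jump_kernel_def copy_kernel_def indicator_def)
    then show ?thesis using False by (simp add: boundary_operator_kernels)
  next
    case True
    have ind: "U.expectation (indicator A) = U.prob A" "integrable (interval_measure u) (indicator A :: real \<Rightarrow> real)" if "A \<in> sets borel" for A
      using that by (auto intro!: integrable_real_indicator simp: less_top[symmetric])
    have "(\<integral>z. \<integral>y. jump_kernel B (indicator {..x}) z y \<partial>interval_measure u \<partial>\<mu>) = (\<integral>z. u (x - z) - u x \<partial>\<mu>)"
    proof (rule integral_cong_AE)
      show "AE z in \<mu>. U.expectation (jump_kernel B (indicator {..x}) z) = u (x - z) - u x"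
        using pos
      proof eventually_elim
        case (elim z)
        have "jump_kernel B (indicator {..x}) z = (\<lambda>y. indicator {..x - z} y - indicator {..x} y)"
          using elim True by (auto simp: jump_kernel_def fun_eq_iff indicator_def min_def)
        then have "U.expectation (jump_kernel B (indicator {..x}) z) = U.expectation (indicator {..x - z}) - U.expectation (indicator {..x})"
          using ind by (simp add: Bochner_Integration.integral_diff)
        then show ?case by (simp add: mu)
      qed
      have "bounded_borel (indicator {..x}) 1" by (auto simp: bounded_borel_def indicator_def)
      from iterated_integral(2)[OF mu_distribution cdfs_distribution(1)[OF uc] kernel_bounds(1,2)[OF this]]
      show "(\<lambda>z. U.expectation (jump_kernel B (indicator {..x}) z)) \<in> borel_measurable \<mu>" by (rule borel_measurable_integrable)
      show "(\<lambda>z. u (x - z) - u x) \<in> borel_measurable \<mu>" using cdfs_measurable[OF uc] by measurable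
    qed
    also have "\<dots> = (\<integral>s. u (x - s) \<partial>\<mu>) - u x" using shift_integrable_cdf[OF uc] by (simp add: prob_space)
    finally have 1: "(\<integral>z. \<integral>y. jump_kernel B (indicator {..x}) z y \<partial>interval_measure u \<partial>\<mu>) = (\<integral>s. u (x - s) \<partial>\<mu>) - u x" .
    \<comment> \<open>For y \<le> x the difference vanishes at every \<xi> \<le> x, so the
      constraint y \<le> \<xi> disappears, and minus the mass between x and B is left. For y > x it
      vanishes altogether.\<close>
    have "U.expectation (copy_kernel B (indicator {..x}) y) = indicator {..x} y * (- (1 - u x))" for y
    proof -
      have "copy_kernel B (indicator {..x}) y = (\<lambda>\<xi>. indicator {..x} y * (indicator {..x} \<xi> - indicator {..B} \<xi>))"
        using True by (auto simp: copy_kernel_def fun_eq_iff indicator_def)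
      then show ?thesis using ind by (simp add: Bochner_Integration.integral_diff mu uB)
    qed
    then have 2: "(\<integral>y. \<integral>\<xi>. copy_kernel B (indicator {..x}) y \<xi> \<partial>interval_measure u \<partial>interval_measure u) = u x * (- (1 - u x))"
      using ind[of "{..x}"] by (simp add: mu)
    show ?thesis using True unfolding boundary_operator_kernels 1 2 drift_def by (simp add: algebra_simps)
  qed
qed

text \<open>The flow is defined at negative times too; they are sent to 0 to keep the state below the boundary.\<close>

definition operator :: "real \<Rightarrow> (real \<Rightarrow> real) \<Rightarrow> real" where
  "operator s h = boundary_operator lam \<mu> (B0 + v * max 0 s) (flow (max 0 s)) h"

text \<open>The class of functions for which the weak equation holds. Measurability of the operator
  in time belongs to it, because it too is obtained from the indicators by linear combinations and
  limits.\<close>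

definition balanced :: "(real \<Rightarrow> real) \<Rightarrow> bool" where
  "balanced h \<longleftrightarrow> (\<exists>K. bounded_borel h K) \<and> (\<lambda>s. operator s h) \<in> borel_measurable borel \<and>
     (\<forall>t\<ge>0. cdf_integral (flow t) h - cdf_integral (flow 0) h = (LINT s:{0..t}|lborel. operator s h))"

lemma operator_bound: "bounded_borel h K \<Longrightarrow> \<bar>operator s h\<bar> \<le> (2 * lam + 2) * K"
  unfolding operator_def by (rule boundary_operator_bound[OF flowsD(1)[OF flow_flows]])

lemma operator_linear:
  "bounded_borel h K \<Longrightarrow> bounded_borel g L \<Longrightarrow> operator s (\<lambda>x. h x + c * g x) = operator s h + c * operator s g"
  unfolding operator_def by (rule boundary_operator_linear[OF flowsD(1)[OF flow_flows]])

lemma operator_integrable: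
  "bounded_borel h K \<Longrightarrow> (\<lambda>s. operator s h) \<in> borel_measurable borel \<Longrightarrow> set_integrable lborel {0..t} (\<lambda>s. operator s h)"
  by (rule set_integrable_bounded) (use operator_bound in auto)

lemma bounded_borel_linear:
  assumes "bounded_borel h K" "bounded_borel g L" shows "bounded_borel (\<lambda>x. h x + c * g x) (K + \<bar>c\<bar> * L)"
proof -
  have "\<bar>h x + c * g x\<bar> \<le> K + \<bar>c\<bar> * L" for x
    by (rule order_trans[OF abs_triangle_ineq add_mono])
      (use assms in \<open>auto simp: bounded_borel_def abs_mult intro!: mult_left_mono\<close>)
  then show ?thesis using assms by (auto simp: bounded_borel_def)
qed

lemma cdf_integral_linear:
  assumes u: "u \<in> cdfs" and h: "bounded_borel h K" and g: "bounded_borel g L"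
  shows "cdf_integral u (\<lambda>x. h x + c * g x) = cdf_integral u h + c * cdf_integral u g" "\<bar>cdf_integral u h\<bar> \<le> K"
proof -
  interpret U: real_distribution "interval_measure u" by (rule cdfs_distribution(1)[OF u])
  have i: "integrable (interval_measure u) k" if "bounded_borel k C" for k C
    by (rule U.integrable_const_bound[where B = C]) (use that in \<open>auto simp: bounded_borel_def\<close>)
  show "cdf_integral u (\<lambda>x. h x + c * g x) = cdf_integral u h + c * cdf_integral u g"
    unfolding cdf_integral_def by (subst Bochner_Integration.integral_add) (use i[OF h] i[OF g] in auto)
  show "\<bar>cdf_integral u h\<bar> \<le> K"
    unfolding cdf_integral_def by (rule U.abs_expectation_le) (use h in \<open>auto simp: bounded_borel_def\<close>)
qed

lemma balanced_linear:
  assumes h: "balanced h" and g: "balanced g" shows "balanced (\<lambda>x. h x + c * g x)"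
proof -
  obtain K L where K: "bounded_borel h K" and L: "bounded_borel g L" using h g by (auto simp: balanced_def)
  have m: "(\<lambda>s. operator s h) \<in> borel_measurable borel" "(\<lambda>s. operator s g) \<in> borel_measurable borel"
    using h g by (auto simp: balanced_def)
  have "cdf_integral (flow t) (\<lambda>x. h x + c * g x) - cdf_integral (flow 0) (\<lambda>x. h x + c * g x)
      = (LINT s:{0..t}|lborel. operator s h + c * operator s g)" if t: "0 \<le> t" for t
  proof -
    have "(LINT s:{0..t}|lborel. operator s h + c * operator s g) = (LINT s:{0..t}|lborel. operator s h) + c * (LINT s:{0..t}|lborel. operator s g)"
      using operator_integrable[OF K m(1), of t] operator_integrable[OF L m(2), of t] by (simp add: set_integral_add)
    moreover have "(LINT s:{0..t}|lborel. operator s h) = cdf_integral (flow t) h - cdf_integral (flow 0) h"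
      "(LINT s:{0..t}|lborel. operator s g) = cdf_integral (flow t) g - cdf_integral (flow 0) g"
      using h g t unfolding balanced_def by metis+
    ultimately show ?thesis using cdf_integral_linear(1)[OF flowsD(1)[OF flow_flows] K L] by (simp add: algebra_simps)
  qed
  then show ?thesis
    unfolding balanced_def operator_linear[OF K L] using bounded_borel_linear[OF K L] m by (auto intro!: borel_measurable_add borel_measurable_times)
qed

lemma balanced_const: "balanced (\<lambda>_. c)"
proof -
  have "cdf_integral (flow t) (\<lambda>_. c) = c" for t
  proof -
    interpret U: real_distribution "interval_measure (flow t)" by (rule cdfs_distribution(1)[OF flowsD(1)[OF flow_flows]])
    show ?thesis using U.prob_space by (simp add: cdf_integral_def U.space_eq_univ)
  qed
  moreover have "bounded_borel (\<lambda>_. c) \<bar>c\<bar>" by (simp add: bounded_borel_def)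
  ultimately show ?thesis by (auto simp: balanced_def operator_def boundary_operator_const set_lebesgue_integral_def)
qed

lemma balanced_indicator: "balanced (indicator {..x})"
proof -
  have *: "operator s (indicator {..x}) = net (max 0 s) (flow (max 0 s)) x" for s
    unfolding operator_def net_def by (rule boundary_operator_indicator) (rule flowsD(3)[OF flow_flows], simp)
  have "cdf_integral (flow t) (indicator {..x}) = flow t x" for t
  proof -
    have uc: "flow t \<in> cdfs" by (rule flowsD(1)[OF flow_flows])
    interpret U: real_distribution "interval_measure (flow t)" by (rule cdfs_distribution(1)[OF uc])
    show ?thesis using fun_cong[OF cdfs_distribution(2)[OF uc], of x] by (simp add: cdf_integral_def cdf_def)
  qed
  moreover have "flow t x - flow 0 x = (LINT s:{0..t}|lborel. net (max 0 s) (flow (max 0 s)) x)" if "0 \<le> t" for t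
  proof -
    have "(LINT s:{0..t}|lborel. net (max 0 s) (flow (max 0 s)) x) = (LINT s:{0..t}|lborel. net s (flow s) x)"
      by (intro set_lebesgue_integral_cong) auto
    moreover have "flow t x = flow 0 x + (LINT s:{0..t}|lborel. net s (flow s) x)"
      using flow_solution that unfolding solution_def by blast
    ultimately show ?thesis by simp
  qed
  moreover have "(\<lambda>s. net (max 0 s) (flow (max 0 s)) x) \<in> borel_measurable borel"
    by (rule measurable_compose[OF _ net_measurable[OF flow_flows]]) measurable
  moreover have "bounded_borel (indicator {..x}) 1" by (auto simp: bounded_borel_def indicator_def)
  ultimately show ?thesis unfolding balanced_def * by auto
qed

text \<open>Both sides of the equation are linear in \<open>h\<close> and bounded by a constant
  times its supremum norm, uniformly in time up to \<open>t\<close>.\<close>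

lemma balanced_limit:
  assumes h: "bounded_borel h K" and ap: "\<And>e. 0 < e \<Longrightarrow> \<exists>g. balanced g \<and> (\<forall>x. \<bar>g x - h x\<bar> \<le> e)"
  shows "balanced h"
proof -
  have "\<exists>g. balanced g \<and> (\<forall>x. \<bar>g x - h x\<bar> \<le> 1 / (real k + 1))" for k :: nat by (rule ap) simp
  then obtain g where g: "\<And>k. balanced (g k)" "\<And>k x. \<bar>g k x - h x\<bar> \<le> 1 / (real k + 1)" by metis
  define \<epsilon> where "\<epsilon> k = 1 / (real k + 1)" for k :: nat
  have \<epsilon>0: "\<epsilon> \<longlonglongrightarrow> 0" unfolding \<epsilon>_def using LIMSEQ_inverse_real_of_nat by (simp add: inverse_eq_divide add.commute)
  have gb: "\<exists>C. bounded_borel (g k) C" for k using g(1) by (simp add: balanced_def)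
  have d: "bounded_borel (\<lambda>x. g k x + (- 1) * h x) (\<epsilon> k)" for k
    using g(2)[of k] gb[of k] h by (auto simp: bounded_borel_def \<epsilon>_def)
  have od: "\<bar>operator s (g k) - operator s h\<bar> \<le> (2 * lam + 2) * \<epsilon> k" for s k
  proof -
    obtain C where C: "bounded_borel (g k) C" using gb by blast
    show ?thesis using operator_bound[OF d[of k], of s] operator_linear[OF C h, of s "- 1"] by simp
  qed
  have cd: "\<bar>cdf_integral (flow t) (g k) - cdf_integral (flow t) h\<bar> \<le> \<epsilon> k" for t k
  proof -
    obtain C where C: "bounded_borel (g k) C" using gb by blast
    have u: "flow t \<in> cdfs" by (rule flowsD(1)[OF flow_flows])
    show ?thesis using cdf_integral_linear(1)[OF u C h, of "- 1"] cdf_integral_linear(2)[OF u d[of k] h] by simp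
  qed
  have lim0: "(\<lambda>k. a * \<epsilon> k) \<longlonglongrightarrow> 0" for a using tendsto_mult_right_zero[OF \<epsilon>0] .
  have olim: "(\<lambda>k. operator s (g k)) \<longlonglongrightarrow> operator s h" for s
    by (rule LIM_zero_cancel, rule Lim_null_comparison[OF _ lim0[of "2 * lam + 2"]]) (use od in auto)
  have m: "(\<lambda>s. operator s (g k)) \<in> borel_measurable borel" for k using g(1) by (simp add: balanced_def)
  have mh: "(\<lambda>s. operator s h) \<in> borel_measurable borel"
    by (rule borel_measurable_LIMSEQ_real[where u = "\<lambda>k s. operator s (g k)"]) (use olim m in auto)
  have "cdf_integral (flow t) h - cdf_integral (flow 0) h = (LINT s:{0..t}|lborel. operator s h)" if t: "0 \<le> t" for t
  proof -
    have clim: "(\<lambda>k. cdf_integral (flow r) (g k)) \<longlonglongrightarrow> cdf_integral (flow r) h" for r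
      by (rule LIM_zero_cancel, rule Lim_null_comparison[OF _ \<epsilon>0]) (use cd in auto)
    have eq: "(\<lambda>k. LINT s:{0..t}|lborel. operator s (g k)) = (\<lambda>k. cdf_integral (flow t) (g k) - cdf_integral (flow 0) (g k))"
      using g(1) t by (auto simp: balanced_def fun_eq_iff)
    have 1: "(\<lambda>k. LINT s:{0..t}|lborel. operator s (g k)) \<longlonglongrightarrow> cdf_integral (flow t) h - cdf_integral (flow 0) h"
      unfolding eq by (intro tendsto_diff clim)
    have 2: "(\<lambda>k. LINT s:{0..t}|lborel. operator s (g k)) \<longlonglongrightarrow> (LINT s:{0..t}|lborel. operator s h)"
    proof (rule LIM_zero_cancel, rule Lim_null_comparison[OF _ lim0[of "t * (2 * lam + 2)"]], rule always_eventually, rule allI)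
      fix k
      obtain C where C: "bounded_borel (g k) C" using gb by blast
      note i = operator_integrable[OF C m, of t] operator_integrable[OF h mh, of t]
      have "(LINT s:{0..t}|lborel. operator s (g k)) - (LINT s:{0..t}|lborel. operator s h) = (LINT s:{0..t}|lborel. operator s (g k) - operator s h)"
        by (rule set_integral_diff(2)[OF i, symmetric])
      moreover have "\<bar>LINT s:{0..t}|lborel. operator s (g k) - operator s h\<bar> \<le> (LINT s:{0..t}|lborel. (2 * lam + 2) * \<epsilon> k)"
        by (rule set_integral_abs_le[OF set_integral_diff(1)[OF i] LINT_const(2) od])
      moreover have "(LINT s:{0..t}|lborel. (2 * lam + 2) * \<epsilon> k) = t * (2 * lam + 2) * \<epsilon> k"
        using LINT_const(1)[OF t, of "(2 * lam + 2) * \<epsilon> k"] by (simp only: diff_zero mult.assoc)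
      ultimately show "norm ((LINT s:{0..t}|lborel. operator s (g k)) - (LINT s:{0..t}|lborel. operator s h)) \<le> t * (2 * lam + 2) * \<epsilon> k"
        by (simp only: real_norm_def)
    qed
    show ?thesis by (rule LIMSEQ_unique[OF 1 2])
  qed
  then show ?thesis using h mh by (auto simp: balanced_def)
qed

text \<open>Left end points of the partition carry the increments, so that the step function takes the value
  of h at the right end point of each cell.\<close>

lemma step_approximation:
  fixes h :: "real \<Rightarrow> real"
  assumes c: "continuous_on UNIV h" and ab: "a \<le> b" "\<And>x. x \<le> a \<Longrightarrow> h x = h a" "\<And>x. b \<le> x \<Longrightarrow> h x = h b" and e: "0 < e"
  obtains m :: nat and \<xi> :: "nat \<Rightarrow> real"
  where "\<And>x. \<bar>(h b + (\<Sum>i<m. (h (\<xi> i) - h (\<xi> (Suc i))) * indicator {..\<xi> i} x)) - h x\<bar> \<le> e"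
proof -
  have "uniformly_continuous_on {a..b} h"
    by (rule compact_uniformly_continuous) (use c in \<open>auto intro: continuous_on_subset\<close>)
  then obtain d where d: "0 < d" "\<And>x y. x \<in> {a..b} \<Longrightarrow> y \<in> {a..b} \<Longrightarrow> dist y x < d \<Longrightarrow> dist (h y) (h x) < e"
    unfolding uniformly_continuous_on_def using e by metis
  obtain m :: nat where m: "(b - a) / d < real m" using reals_Archimedean2 by blast
  have m0: "0 < m" using m ab(1) d(1) by (cases m) (auto simp: divide_less_0_iff not_less[symmetric])
  define w where "w = (b - a) / real m"
  have w: "0 \<le> w" "w < d" using m m0 ab(1) d(1) by (auto simp: w_def field_simps)
  define \<xi> where "\<xi> i = a + real i * w" for i
  have \<xi>: "\<xi> 0 = a" "\<xi> m = b" using m0 by (auto simp: \<xi>_def w_def)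
  have mono: "\<xi> i \<le> \<xi> j" if "i \<le> j" for i j using that w(1) by (auto simp: \<xi>_def intro!: mult_right_mono)
  have "\<bar>(h b + (\<Sum>i<m. (h (\<xi> i) - h (\<xi> (Suc i))) * indicator {..\<xi> i} x)) - h x\<bar> \<le> e" for x
  proof (cases "b < x")
    case True
    have "x \<notin> {..\<xi> i}" if "i < m" for i using True mono[of i m] that \<xi>(2) by auto
    then have "(\<Sum>i<m. (h (\<xi> i) - h (\<xi> (Suc i))) * indicator {..\<xi> i} x) = 0" by (intro sum.neutral) simp
    then show ?thesis using True ab(3)[of x] e by simp
  next
    case False
    \<comment> \<open>At x only the indicators from number \<open>j\<close> on are active, and their
      coefficients telescope to h (\<xi> j) - h b.\<close>
    define j where "j = (LEAST i. x \<le> \<xi> i)"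
    have ex: "x \<le> \<xi> m" using False \<xi>(2) by simp
    have j: "x \<le> \<xi> j" "j \<le> m" unfolding j_def by (rule LeastI[of _ m], rule ex) (rule Least_le, rule ex)
    have jl: "\<xi> i < x" if "i < j" for i using not_less_Least[OF that[unfolded j_def]] by simp
    have "(\<Sum>i<m. (h (\<xi> i) - h (\<xi> (Suc i))) * indicator {..\<xi> i} x) = (\<Sum>i=j..<m. h (\<xi> i) - h (\<xi> (Suc i)))"
    proof (rule sum.mono_neutral_cong_right)
      show "\<forall>i\<in>{..<m} - {j..<m}. (h (\<xi> i) - h (\<xi> (Suc i))) * indicator {..\<xi> i} x = 0" using jl by (auto simp: indicator_def not_le)
      show "(h (\<xi> i) - h (\<xi> (Suc i))) * indicator {..\<xi> i} x = h (\<xi> i) - h (\<xi> (Suc i))" if "i \<in> {j..<m}" for i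
        using that j(1) mono[of j i] by (auto simp: indicator_def)
    qed auto
    also have "\<dots> = h (\<xi> j) - h b"
      using sum_Suc_diff'[OF j(2), of "\<lambda>i. - h (\<xi> i)"] \<xi>(2) by simp
    finally have *: "h b + (\<Sum>i<m. (h (\<xi> i) - h (\<xi> (Suc i))) * indicator {..\<xi> i} x) - h x = h (\<xi> j) - h x" by simp
    have "\<bar>h (\<xi> j) - h x\<bar> \<le> e"
    proof (cases "x \<le> a")
      case True
      then have "j = 0" unfolding j_def using \<xi>(1) by (intro Least_eq_0) simp
      then show ?thesis using ab(2)[OF True] \<xi>(1) e by simp
    next
      case xa: False
      then have "j \<noteq> 0" using j(1) \<xi>(1) by (intro notI) simp
      then obtain i where i: "j = Suc i" by (cases j) auto
      have "\<xi> i < x" using jl i by simp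
      then have "\<bar>\<xi> j - x\<bar> < d" using j(1) w by (simp add: i \<xi>_def algebra_simps)
      moreover have "\<xi> j \<in> {a..b}" using mono[of 0 j] mono[of j m] j(2) \<xi> by simp
      ultimately have "dist (h (\<xi> j)) (h x) < e" using xa False by (intro d(2)) (auto simp: dist_real_def)
      then show ?thesis by (simp add: dist_real_def)
    qed
    then show ?thesis unfolding * .
  qed
  then show ?thesis by (rule that)
qed

lemma test_function_balanced:
  assumes "h \<in> test_functions" shows "balanced h"
proof -
  obtain a b where c: "continuous_on UNIV h" and ab: "a \<le> b" "\<And>x. x \<le> a \<Longrightarrow> h x = h a" "\<And>x. b \<le> x \<Longrightarrow> h x = h b"
    and bd: "bounded (range h)"
    using assms by (auto simp: test_functions_def)
  obtain K where "\<And>x. \<bar>h x\<bar> \<le> K" using bd by (auto simp: bounded_iff)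
  then have "bounded_borel h K" using c by (auto simp: bounded_borel_def intro: borel_measurable_continuous_onI)
  then show ?thesis
  proof (rule balanced_limit)
    fix e :: real assume "0 < e"
    from step_approximation[OF c ab this] obtain m :: nat and \<xi> where
      ap: "\<And>x. \<bar>(h b + (\<Sum>i<m. (h (\<xi> i) - h (\<xi> (Suc i))) * indicator {..\<xi> i} x)) - h x\<bar> \<le> e" by blast
    have "balanced (\<lambda>x. h b + (\<Sum>i<k. (h (\<xi> i) - h (\<xi> (Suc i))) * indicator {..\<xi> i} x))" for k
    proof (induction k)
      case 0
      show ?case using balanced_const by simp
    next
      case (Suc k)
      from balanced_linear[OF Suc balanced_indicator[of "\<xi> k"], of "h (\<xi> k) - h (\<xi> (Suc k))"]
      show ?case by (simp add: add.assoc)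
    qed
    then show "\<exists>g. balanced g \<and> (\<forall>x. \<bar>g x - h x\<bar> \<le> e)" using ap by blast
  qed
qed

lemma weak_equation:
  assumes h: "h \<in> test_functions" and t: "0 \<le> t"
  shows "set_integrable lborel {0..t} (\<lambda>s. boundary_operator lam \<mu> (B0 + v * s) (flow s) h)"
    "cdf_integral (flow t) h - cdf_integral (flow 0) h - (LINT s:{0..t}|lborel. boundary_operator lam \<mu> (B0 + v * s) (flow s) h) = 0"
proof -
  note b = test_function_balanced[OF h]
  obtain K where K: "bounded_borel h K" using b by (auto simp: balanced_def)
  have op: "operator s h = boundary_operator lam \<mu> (B0 + v * s) (flow s) h" if "s \<in> {0..t}" for s
    using that by (simp add: operator_def max_def)
  have "set_integrable lborel {0..t} (\<lambda>s. operator s h)"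
    by (rule operator_integrable[OF K]) (use b in \<open>simp add: balanced_def\<close>)
  moreover have "set_integrable lborel {0..t} (\<lambda>s. operator s h) = set_integrable lborel {0..t} (\<lambda>s. boundary_operator lam \<mu> (B0 + v * s) (flow s) h)"
    by (rule set_integrable_cong) (use op in auto)
  ultimately show "set_integrable lborel {0..t} (\<lambda>s. boundary_operator lam \<mu> (B0 + v * s) (flow s) h)" by simp
  have "(LINT s:{0..t}|lborel. operator s h) = (LINT s:{0..t}|lborel. boundary_operator lam \<mu> (B0 + v * s) (flow s) h)"
    by (rule set_lebesgue_integral_cong) (use op in auto)
  then show "cdf_integral (flow t) h - cdf_integral (flow 0) h - (LINT s:{0..t}|lborel. boundary_operator lam \<mu> (B0 + v * s) (flow s) h) = 0"
    using b t by (simp add: balanced_def)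
qed

end

section \<open>Convergence in the Skorohod space\<close>

lemma measurable_borel_sets_of:
  assumes "continuous_map X euclideanreal \<Phi>"
  shows "\<Phi> \<in> borel_measurable (borel_sets_of X)"
proof (rule borel_measurableI)
  have sp: "space (borel_sets_of X) = topspace X" by (simp add: borel_sets_of_def space_measure_of_conv)
  fix S :: "real set" assume "open S"
  then have "openin X {x \<in> topspace X. \<Phi> x \<in> S}" using assms by (auto simp: continuous_map_def)
  moreover have "{U. openin X U} \<subseteq> Pow (topspace X)" using openin_subset by auto
  moreover have "\<Phi> -` S \<inter> space (borel_sets_of X) = {x \<in> topspace X. \<Phi> x \<in> S}" using sp by auto
  ultimately show "\<Phi> -` S \<inter> space (borel_sets_of X) \<in> sets (borel_sets_of X)"
    by (simp add: borel_sets_of_def sets_measure_of)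
qed

text \<open>On a J1 neighbourhood of the deterministic path \<open>f\<close> a continuous function
  is close to its value at \<open>f\<close>. Uniform closeness up to \<open>T\<close> puts
  \<open>Y n\<close> into that neighbourhood, with the identity as time change, and the remaining
  event has small probability and a bounded contribution.\<close>

lemma J1_weak_limit:
  fixes M :: "nat \<Rightarrow> 'w measure" and Y :: "nat \<Rightarrow> 'w \<Rightarrow> real \<Rightarrow> 'a"
  assumes f: "f \<in> cadlag_paths m"
    and pr: "\<And>n. N \<le> n \<Longrightarrow> prob_space (M n)"
    and Y: "\<And>n. N \<le> n \<Longrightarrow> Y n \<in> M n \<rightarrow>\<^sub>M borel_sets_of (J1_topology m)"
    and close: "\<And>T e. 0 < T \<Longrightarrow> 0 < e \<Longrightarrow> eventually (\<lambda>n. \<exists>A\<in>sets (M n). 1 - e \<le> measure (M n) A \<and>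
        (\<forall>\<omega>\<in>A. \<forall>t\<in>{0..T}. mdist m (Y n \<omega> t) (f t) < e)) sequentially"
  shows "weakly_converges (J1_topology m) (\<lambda>n. distr (M n) (borel_sets_of (J1_topology m)) (Y n))
     (return (borel_sets_of (J1_topology m)) f)"
  unfolding weakly_converges_def
proof (intro allI impI, elim conjE)
  fix \<Phi> assume c: "continuous_map (J1_topology m) euclideanreal \<Phi>" and bd: "bounded (\<Phi> ` topspace (J1_topology m))"
  let ?B = "borel_sets_of (J1_topology m)"
  have sp: "space ?B = cadlag_paths m" by (simp add: borel_sets_of_def space_measure_of_conv)
  note \<Phi>m = measurable_borel_sets_of[OF c]
  obtain K where K: "\<And>y. y \<in> cadlag_paths m \<Longrightarrow> \<bar>\<Phi> y\<bar> \<le> K" using bd by (auto simp: bounded_iff)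
  have K0: "0 \<le> K" using K[OF f] by linarith
  have lim: "integral\<^sup>L (return ?B f) \<Phi> = \<Phi> f" using f sp by (intro integral_return \<Phi>m) auto
  show "(\<lambda>n. integral\<^sup>L (distr (M n) ?B (Y n)) \<Phi>) \<longlonglongrightarrow> integral\<^sup>L (return ?B f) \<Phi>"
    unfolding lim
  proof (rule tendstoI)
    fix \<epsilon> :: real assume \<epsilon>: "0 < \<epsilon>"
    have "openin (J1_topology m) {y \<in> topspace (J1_topology m). \<Phi> y \<in> ball (\<Phi> f) (\<epsilon> / 2)}"
      by (rule openin_continuous_map_preimage[OF c]) simp
    moreover have "f \<in> {y \<in> topspace (J1_topology m). \<Phi> y \<in> ball (\<Phi> f) (\<epsilon> / 2)}" using f \<epsilon> by simp
    ultimately obtain T e where T: "0 < T" and e: "0 < e"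
      and nhd: "J1_nhd m f T e \<subseteq> {y \<in> topspace (J1_topology m). \<Phi> y \<in> ball (\<Phi> f) (\<epsilon> / 2)}"
      unfolding openin_J1_topology by blast
    \<comment> \<open>Off the good event the difference is at most 2 K, and this choice keeps 2 K e'
      below half of \<epsilon>; the other half is spent inside the neighbourhood.\<close>
    define e' where "e' = min e (\<epsilon> / (8 * (K + 1)))"
    have e': "0 < e'" "e' \<le> e" using e \<epsilon> K0 by (auto simp: e'_def)
    have "2 * K * e' \<le> 2 * K * (\<epsilon> / (8 * (K + 1)))" unfolding e'_def using K0 by (intro mult_left_mono) auto
    also have "\<dots> < \<epsilon> / 2" using K0 \<epsilon> by (simp add: field_simps add_strict_increasing)
    finally have Ke: "2 * K * e' < \<epsilon> / 2" .
    show "eventually (\<lambda>n. dist (integral\<^sup>L (distr (M n) ?B (Y n)) \<Phi>) (\<Phi> f) < \<epsilon>) sequentially"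
      using close[OF T e'(1)] eventually_ge_at_top[of N]
    proof eventually_elim
      case (elim n)
      then obtain A where A: "A \<in> sets (M n)" "1 - e' \<le> measure (M n) A"
        and near: "\<And>\<omega> t. \<omega> \<in> A \<Longrightarrow> t \<in> {0..T} \<Longrightarrow> mdist m (Y n \<omega> t) (f t) < e'" by blast
      interpret prob_space "M n" by (rule pr[OF elim(2)])
      note Yn = Y[OF elim(2)]
      note [measurable] = measurable_compose[OF Yn \<Phi>m] A(1)
      have cad: "Y n \<omega> \<in> cadlag_paths m" if "\<omega> \<in> space (M n)" for \<omega> using measurable_space[OF Yn that] sp by simp
      have i: "integrable (M n) (\<lambda>\<omega>. \<Phi> (Y n \<omega>))"
        by (rule integrable_const_bound[where B = K]) (use K cad in auto)
      have inA: "\<bar>\<Phi> (Y n \<omega>) - \<Phi> f\<bar> \<le> \<epsilon> / 2" if "\<omega> \<in> A" for \<omega>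
      proof -
        have "\<omega> \<in> space (M n)" using sets.sets_into_space[OF A(1)] that by blast
        moreover have "time_change (\<lambda>t. t)" by (simp add: time_change_def strict_mono_on_def)
        moreover have "\<bar>t - t\<bar> < e \<and> mdist m (Y n \<omega> t) (f t) < e" if "t \<in> {0..T}" for t
          using near[OF \<open>\<omega> \<in> A\<close> that] e e'(2) by simp
        ultimately have "Y n \<omega> \<in> J1_nhd m f T e" unfolding J1_nhd_def using cad by blast
        then have "dist (\<Phi> f) (\<Phi> (Y n \<omega>)) < \<epsilon> / 2" using nhd by auto
        then show ?thesis by (simp add: dist_real_def abs_minus_commute)
      qed
      have le: "\<bar>\<Phi> (Y n \<omega>) - \<Phi> f\<bar> \<le> \<epsilon> / 2 + 2 * K * indicator (space (M n) - A) \<omega>" if "\<omega> \<in> space (M n)" for \<omega>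
      proof (cases "\<omega> \<in> A")
        case True
        then show ?thesis using inA[OF True] by simp
      next
        case False
        have "\<bar>\<Phi> (Y n \<omega>) - \<Phi> f\<bar> \<le> 2 * K" using K[OF cad[OF that]] K[OF f] by linarith
        then show ?thesis using False that \<epsilon> by simp
      qed
      have "integral\<^sup>L (distr (M n) ?B (Y n)) \<Phi> = expectation (\<lambda>\<omega>. \<Phi> (Y n \<omega>))" by (rule integral_distr[OF Yn \<Phi>m])
      moreover have "expectation (\<lambda>\<omega>. \<Phi> (Y n \<omega>)) - \<Phi> f = expectation (\<lambda>\<omega>. \<Phi> (Y n \<omega>) - \<Phi> f)"
        using i by (simp add: prob_space)
      moreover have "\<bar>expectation (\<lambda>\<omega>. \<Phi> (Y n \<omega>) - \<Phi> f)\<bar> \<le> expectation (\<lambda>\<omega>. \<bar>\<Phi> (Y n \<omega>) - \<Phi> f\<bar>)" by (rule integral_abs_bound)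
      moreover have "expectation (\<lambda>\<omega>. \<bar>\<Phi> (Y n \<omega>) - \<Phi> f\<bar>) \<le> expectation (\<lambda>\<omega>. \<epsilon> / 2 + 2 * K * indicator (space (M n) - A) \<omega>)"
        by (rule integral_mono) (use i le in \<open>auto intro!: Bochner_Integration.integrable_add integrable_real_indicator simp: less_top[symmetric]\<close>)
      moreover have "expectation (\<lambda>\<omega>. \<epsilon> / 2 + 2 * K * indicator (space (M n) - A) \<omega>) = \<epsilon> / 2 + 2 * K * prob (space (M n) - A)"
        by (subst Bochner_Integration.integral_add) (auto intro!: integrable_real_indicator simp: less_top[symmetric] prob_space)
      moreover have "2 * K * prob (space (M n) - A) \<le> 2 * K * e'"
        using K0 prob_compl[OF A(1)] A(2) by (intro mult_left_mono) auto
      ultimately have "\<bar>integral\<^sup>L (distr (M n) ?B (Y n)) \<Phi> - \<Phi> f\<bar> < \<epsilon>" using Ke by linarith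
      then show ?case by (simp only: dist_real_def)
    qed
  qed
qed

lemma levy_dist_le_sup:
  assumes u: "u \<in> cdfs" and w: "w \<in> cdfs" and D: "\<And>x. \<bar>u x - w x\<bar> \<le> D"
  shows "levy_dist u w \<le> D"
proof (rule field_le_epsilon)
  fix e :: real assume e: "0 < e"
  have D0: "0 \<le> D" using D[of 0] by linarith
  have "u x \<le> u (x + (D + e))" "w x \<le> w (x + (D + e))" for x using u w D0 e by (auto simp: cdfs_def mono_def)
  then have "u x \<le> w (x + (D + e)) + (D + e) \<and> w x \<le> u (x + (D + e)) + (D + e)" for x
  proof -
    have "u x \<le> w x + D" "w x \<le> u x + D" using D[of x] by linarith+
    moreover have "u x \<le> u (x + (D + e))" "w x \<le> w (x + (D + e))" by fact+
    ultimately show ?thesis using e by linarith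
  qed
  then have "levy_close (D + e) u w" unfolding levy_close_def by blast
  then show "levy_dist u w \<le> D + e" using D0 e by (intro levy_dist_le) auto
qed

context mean_field_data begin

text \<open>The Lipschitz bound in time is uniform in the location and hence bounds the Levy
  distance. The filter is left free so that right limits, left limits and continuity all
  follow.\<close>

lemma flow_limitin:
  assumes t: "0 \<le> t" and F: "F \<le> nhds t" "eventually (\<lambda>s. 0 \<le> s) F"
  shows "limitin (mtopology_of levy_metric) (restrict flow {0..}) (restrict flow {0..} t) F"
proof -
  have "eventually (\<lambda>s. restrict flow {0..} s \<in> cdfs \<and> levy_dist (restrict flow {0..} s) (restrict flow {0..} t) < e) F" if e: "0 < e" for e
  proof -
    have "eventually (\<lambda>s. dist s t < e / (lam + 1)) (nhds t)"
      unfolding eventually_nhds_metric by (rule exI[of _ "e / (lam + 1)"]) (use e lam in simp)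
    then have "eventually (\<lambda>s. dist s t < e / (lam + 1)) F" using F(1) unfolding le_filter_def by blast
    then show ?thesis using F(2)
    proof eventually_elim
      case (elim s)
      have "levy_dist (flow s) (flow t) \<le> (lam + 1) * \<bar>s - t\<bar>"
        by (rule levy_dist_le_sup) (use flowsD[OF flow_flows] in auto)
      also have "\<dots> < e" using elim(1) lam by (simp add: dist_real_def field_simps)
      finally show ?case using elim(2) t flowsD(1)[OF flow_flows] by simp
    qed
  qed
  then show ?thesis using t flowsD(1)[OF flow_flows]
    by (simp add: mtopology_of_def Metric_space.limitin_metric[OF Metric_space_levy])
qed

lemma flow_cadlag: "restrict flow {0..} \<in> cadlag_paths levy_metric"
  unfolding cadlag_paths_def
proof (intro CollectI conjI allI impI)
  show "restrict flow {0..} \<in> {0..} \<rightarrow>\<^sub>E mspace levy_metric" using flowsD(1)[OF flow_flows] by auto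
  show "limitin (mtopology_of levy_metric) (restrict flow {0..}) (restrict flow {0..} t) (at_right t)" if "0 \<le> t" for t
    by (rule flow_limitin[OF that]) (use that in \<open>auto simp: at_within_def eventually_inf_principal intro!: always_eventually\<close>)
  show "\<exists>l. limitin (mtopology_of levy_metric) (restrict flow {0..}) l (at_left t)" if "0 < t" for t
    by (rule exI, rule flow_limitin[of t])
      (use that eventually_at_left_real[OF that] in \<open>auto simp: at_within_def elim: eventually_mono\<close>)
qed

lemma flow_continuous: "continuous_map (top_of_set {0..}) (mtopology_of levy_metric) (restrict flow {0..})"
  unfolding continuous_map_atin
proof
  fix t :: real assume "t \<in> topspace (top_of_set {0..})"
  then have t: "0 \<le> t" by simp
  show "limitin (mtopology_of levy_metric) (restrict flow {0..}) (restrict flow {0..} t) (atin (top_of_set {0..}) t)"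
  proof (rule flow_limitin[OF t])
    have eq: "atin (top_of_set {0..}) t = atin_within euclideanreal t {0..}" by (rule atin_subtopology_within) (use t in simp)
    show "atin (top_of_set {0..}) t \<le> nhds t"
      unfolding eq le_filter_def eventually_nhds eventually_atin_within by (intro allI impI disjI2) (metis open_openin)
    show "eventually (\<lambda>s. 0 \<le> s) (atin (top_of_set {0..}) t)"
      unfolding eq eventually_atin_within by (intro disjI2 exI[of _ UNIV]) simp
  qed
qed

end

text \<open>Elements of the path space are \<open>undefined\<close> at negative times, where
  \<open>flow\<close> is frozen instead. This lemma and \<open>mean_flow_cong\<close> carry the
  results over to the restricted path.\<close>

lemma mean_field_model_cong:
  assumes m: "mean_field_model lam J v B0 f" and eq: "\<And>t. 0 \<le> t \<Longrightarrow> g t = f t"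
  shows "mean_field_model lam J v B0 g"
  unfolding mean_field_model_def
proof (intro conjI allI impI)
  show "g t \<in> cdfs_upto (B0 + v * t)" if "0 \<le> t" for t using m that by (simp add: eq mean_field_model_def)
  show "antimono_on {0..} (\<lambda>t. g t x)" for x
    using m eq by (auto simp: mean_field_model_def monotone_on_def)
  show "(lam + 1)-lipschitz_on {0..} (\<lambda>t. g t x)" for x
  proof (rule lipschitz_onI)
    have lip: "(lam + 1)-lipschitz_on {0..} (\<lambda>t. f t x)" using m by (simp add: mean_field_model_def)
    show "dist (g s x) (g t x) \<le> (lam + 1) * dist s t" if "s \<in> {0..}" "t \<in> {0..}" for s t
      using lipschitz_onD[OF lip that] that by (simp add: eq)
    show "0 \<le> lam + 1" by (rule lipschitz_on_nonneg[OF lip])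
  qed
  fix x t D
  assume "0 \<le> t \<and> x < B0 + v * t \<and> ((\<lambda>s. g s x) has_real_derivative D) (at t within {0..})"
  then have t: "0 \<le> t" "x < B0 + v * t" and D: "((\<lambda>s. g s x) has_real_derivative D) (at t within {0..})" by blast+
  have "((\<lambda>s. f s x) has_real_derivative D) (at t within {0..})"
    by (rule has_field_derivative_transform_within[OF D zero_less_one]) (use t eq in \<open>simp_all only: atLeast_iff\<close>)
  then have "D = - lam * (LINT y:{..x}|interval_measure (f t). 1 - J (x - y)) - f t x * (1 - f t x)"
    using m t unfolding mean_field_model_def by blast
  then show "D = - lam * (LINT y:{..x}|interval_measure (g t). 1 - J (x - y)) - g t x * (1 - g t x)"
    by (simp only: eq[OF t(1)])
qed

lemma mean_flow_cong:
  assumes "mean_flow lam \<mu> v B0 f" "\<And>t. 0 \<le> t \<Longrightarrow> g t = f t"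
  shows "mean_flow lam \<mu> v B0 g"
proof -
  have eq: "g t = f t" "g (t + h) = f (t + h)" if "0 \<le> t" "0 \<le> h" for t h using assms(2) that by auto
  show ?thesis
    unfolding mean_flow_def
  proof (intro conjI allI impI; (elim conjE)?)
    show "g t \<in> cdfs_upto (B0 + v * t)" if "0 \<le> t" for t
      using assms(1) that unfolding mean_flow_def assms(2)[OF that] by blast
    show "\<bar>g (t + h) x - g t x\<bar> \<le> (lam + 1) * h" if "0 \<le> t" "0 \<le> h" for x t h
      using assms(1) that unfolding mean_flow_def eq[OF that] by blast
    show "\<bar>g (t + h) x - g t x - h * drift lam \<mu> (g t) x\<bar> \<le> (2 * lam + 3) * (lam + 1) * h\<^sup>2"
      if "0 \<le> t" "0 \<le> h" "x < B0 + v * t" for x t h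
      using assms(1) that unfolding mean_flow_def eq[OF that(1,2)] by blast
  qed
qed

lemma levy_close_empirical:
  assumes "\<And>i. i < n \<Longrightarrow> \<bar>w i - w' i\<bar> < e" "0 < e"
  shows "levy_close e (empirical_cdf n w) (empirical_cdf n w')"
proof -
  have "empirical_cdf n w x \<le> empirical_cdf n w' (x + e)" if "\<And>i. i < n \<Longrightarrow> \<bar>w i - w' i\<bar> < e" for x and w w' :: "nat \<Rightarrow> real"
  proof -
    have "w' i \<le> x + e" if "i < n" "w i \<le> x" for i using \<open>\<And>i. i < n \<Longrightarrow> \<bar>w i - w' i\<bar> < e\<close>[OF that(1)] that(2) by linarith
    then have "card {i. i < n \<and> w i \<le> x} \<le> card {i. i < n \<and> w' i \<le> x + e}" by (intro card_mono) auto
    then show ?thesis unfolding empirical_cdf_def by (intro divide_right_mono) auto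
  qed
  note mono = this
  show ?thesis
    unfolding levy_close_def
  proof (intro allI conjI)
    fix x
    show "empirical_cdf n w x \<le> empirical_cdf n w' (x + e) + e" using mono[of w w' x, OF assms(1)] assms(2) by linarith
    show "empirical_cdf n w' x \<le> empirical_cdf n w (x + e) + e"
      using mono[of w' w x, OF assms(1)[unfolded abs_minus_commute[of "w _"]]] assms(2) by linarith
  qed
qed

section \<open>Measurability and range of the empirical paths\<close>

context moving_boundary_system begin

lemma total_measurable:
  assumes "0 \<le> t" shows "(\<lambda>\<omega>. total \<omega> t) \<in> measurable M (count_space UNIV)"
proof -
  have "(\<lambda>\<omega>. NJ i t \<omega>) \<in> borel_measurable M" "(\<lambda>\<omega>. NC i t \<omega>) \<in> borel_measurable M" if "i < n" for i
  proof -
    have "random_variable (count_space UNIV) (NJ i t)" "random_variable (count_space UNIV) (NC i t)"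
      using jump_process[OF that] choice_process[OF that] assms unfolding poisson_process_def by blast+
    then show "(\<lambda>\<omega>. NJ i t \<omega>) \<in> borel_measurable M" "(\<lambda>\<omega>. NC i t \<omega>) \<in> borel_measurable M"
      by (simp_all add: measurable_cong_sets[OF refl sets_borel_eq_count_space])
  qed
  then have "(\<lambda>\<omega>. total \<omega> t) \<in> borel_measurable M"
    unfolding total_def by (intro borel_measurable_sum borel_measurable_add) auto
  then show ?thesis by (simp add: measurable_cong_sets[OF refl sets_borel_eq_count_space])
qed

text \<open>An instance of \<open>step_paths\<close> with \<open>total\<close> as the clock and
  empirical functions of rational configurations as the dense family. Closeness of all locations to
  the rational ones is a measurable condition and bounds the Levy distance.\<close>

lemma empirical_measurable:
  assumes n: "0 < n" and Y: "\<And>\<omega>. \<omega> \<in> space M \<Longrightarrow> Y \<omega> = (\<lambda>t\<in>{0..}. empirical_cdf n (\<lambda>i. X i t \<omega>))"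
  shows "Y \<in> M \<rightarrow>\<^sub>M borel_sets_of (J1_topology levy_metric)"
proof -
  define d :: "rat list \<Rightarrow> real \<Rightarrow> real" where "d q = empirical_cdf n (\<lambda>i. of_rat (q ! i))" for q
  define near where "near q e t \<omega> \<longleftrightarrow> (\<forall>i\<in>{..<n}. \<bar>X i t \<omega> - of_rat (q ! i)\<bar> < e)" for q :: "rat list" and e t \<omega>
  interpret step_paths M levy_metric total Y d near
  proof
    show "counting (total \<omega>)" if "\<omega> \<in> space M" for \<omega> by (rule counting_total[OF that])
    show "(\<lambda>\<omega>. total \<omega> t) \<in> measurable M (count_space UNIV)" if "0 \<le> t" for t by (rule total_measurable[OF that])
    show "Y \<omega> \<in> {0..} \<rightarrow>\<^sub>E mspace levy_metric" if "\<omega> \<in> space M" for \<omega>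
      using empirical_cdf_cdfs[OF n] by (simp add: Y[OF that])
    show "Y \<omega> t = Y \<omega> s" if "\<omega> \<in> space M" "0 \<le> s" "s \<le> t" "total \<omega> s = total \<omega> t" for \<omega> s t
    proof -
      have "X i t \<omega> = X i s \<omega>" if "i < n" for i by (rule total_const(3)) fact+
      then have "{i. i < n \<and> X i t \<omega> \<le> x} = {i. i < n \<and> X i s \<omega> \<le> x}" for x by auto
      then show ?thesis using that by (simp add: Y empirical_cdf_def)
    qed
    show "d q \<in> mspace levy_metric" for q using empirical_cdf_cdfs[OF n] by (simp add: d_def)
    show "Measurable.pred M (near q e t)" if "0 \<le> t" for q e t
    proof -
      have "Measurable.pred M (\<lambda>\<omega>. \<bar>X i t \<omega> - of_rat (q ! i)\<bar> < e)" if "i < n" for i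
      proof -
        have [measurable]: "random_variable borel (X i t)" by (rule location_measurable) fact+
        show ?thesis by measurable
      qed
      then show ?thesis unfolding near_def[abs_def] by (intro pred_intros_finite) auto
    qed
    show "mdist levy_metric (Y \<omega> t) (d q) \<le> e" if "\<omega> \<in> space M" "0 \<le> t" "0 < e" "near q e t \<omega>" for \<omega> t e q
      using that levy_close_empirical[of n "\<lambda>i. X i t \<omega>" "\<lambda>i. of_rat (q ! i)" e]
      by (auto simp: Y d_def near_def intro!: levy_dist_le)
    show "\<exists>q. near q e t \<omega>" if e: "0 < e" for \<omega> t e
    proof -
      have "\<exists>r. \<bar>X i t \<omega> - of_rat r\<bar> < e" for i
      proof -
        obtain r where "X i t \<omega> - e < of_rat r" "of_rat r < X i t \<omega> + e" using of_rat_dense[of "X i t \<omega> - e" "X i t \<omega> + e"] e by auto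
        then show ?thesis by (intro exI[of _ r]) linarith
      qed
      then obtain r where "\<And>i. \<bar>X i t \<omega> - of_rat (r i)\<bar> < e" by metis
      then have "near (map r [0..<n]) e t \<omega>" by (simp add: near_def)
      then show ?thesis by blast
    qed
  qed
  show ?thesis by (rule measurable_J1)
qed

lemma empirical_values:
  assumes n: "2 \<le> n" and pos: "AE z in \<mu>. 0 < z" and v: "0 \<le> v" and p: "empirical_cdf n p \<in> cdfs_upto B0"
  shows "AE \<omega> in M. \<forall>t\<ge>0. empirical_cdf n (\<lambda>i. X i t \<omega>) \<in> cdfs_upto (B0 + v * t)"
proof -
  have p: "p i \<le> B0" if "i < n" for i using p empirical_cdf_eq_1D[OF _ that] by (simp add: cdfs_upto_def)
  show ?thesis
    using regular_AE[OF n pos] AE_space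
  proof eventually_elim
    case (elim \<omega>)
    show ?case
    proof (intro allI impI)
      fix t :: real assume t: "0 \<le> t"
      have "empirical_cdf n (\<lambda>i. X i t \<omega>) (B0 + v * t) = 1"
        by (rule emp_le_n) (use n location_mono_bounded[OF elim(2,1) v p t] in auto)
      then show "empirical_cdf n (\<lambda>i. X i t \<omega>) \<in> cdfs_upto (B0 + v * t)"
        using empirical_cdf_cdfs n by (simp add: cdfs_upto_def)
    qed
  qed
qed

end

lemma empirical_process_props:
  assumes Y: "empirical_process M n lam \<mu> v B0 g Y" and n: "2 \<le> n" and pos: "AE z in \<mu>. 0 < z" and v: "0 \<le> v" and g: "g \<in> cdfs_upto B0"
  shows "prob_space M" "Y \<in> M \<rightarrow>\<^sub>M borel_sets_of (J1_topology levy_metric)"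
    "AE \<omega> in M. \<forall>t\<ge>0. Y \<omega> t \<in> empirical_cdfs n \<inter> cdfs_upto (B0 + v * t)"
proof -
  obtain p NJ NC S C X where sys: "moving_boundary_system M n lam \<mu> v B0 p NJ NC S C X" and p: "empirical_cdf n p = g"
    and Y: "\<And>\<omega>. \<omega> \<in> space M \<Longrightarrow> Y \<omega> = (\<lambda>t\<in>{0..}. empirical_cdf n (\<lambda>i. X i t \<omega>))"
    using Y unfolding empirical_process_def by blast
  interpret moving_boundary_system M n lam \<mu> v B0 p NJ NC S C X by (rule sys)
  show "prob_space M" by (rule prob_space_axioms)
  show "Y \<in> M \<rightarrow>\<^sub>M borel_sets_of (J1_topology levy_metric)" by (rule empirical_measurable[OF _ Y]) (use n in simp)
  show "AE \<omega> in M. \<forall>t\<ge>0. Y \<omega> t \<in> empirical_cdfs n \<inter> cdfs_upto (B0 + v * t)"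
    using empirical_values[OF n pos v g[folded p]] AE_space
    by eventually_elim (auto simp: Y empirical_cdfs_def)
qed

text \<open>The path is quantified before the particle systems, so one \<open>f\<close> serves all
  approximating sequences and all probability spaces on the given type. This expresses that the
  limit is determined by \<open>f0\<close>.\<close>

theorem theorem4:
  fixes lam v B0 :: real and \<mu> :: "real measure" and f0 :: "real \<Rightarrow> real"
  assumes "0 \<le> lam" and "0 < v"
    and "real_distribution \<mu>" and "AE z in \<mu>. 0 < z"
    and "integrable \<mu> (\<lambda>z. z)" and "(LINT z|\<mu>. z) = 1"
    and "f0 \<in> cdfs_upto B0"
  shows "\<exists>f \<in> cadlag_paths levy_metric.
     f 0 = f0 \<and>
     (\<forall>(fn0 :: nat \<Rightarrow> real \<Rightarrow> real) (M :: nat \<Rightarrow> 'w measure) (Y :: nat \<Rightarrow> 'w \<Rightarrow> real \<Rightarrow> real \<Rightarrow> real).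
        (\<forall>n\<ge>2. fn0 n \<in> empirical_cdfs n \<inter> cdfs_upto B0) \<and>
        weak_conv fn0 f0 \<and>
        (\<forall>n\<ge>2. empirical_process (M n) n lam \<mu> v B0 (fn0 n) (Y n)) \<longrightarrow>
          (\<forall>n\<ge>2. Y n \<in> M n \<rightarrow>\<^sub>M borel_sets_of (J1_topology levy_metric)) \<and>
          weakly_converges (J1_topology levy_metric)
            (\<lambda>n. distr (M n) (borel_sets_of (J1_topology levy_metric)) (Y n))
            (return (borel_sets_of (J1_topology levy_metric)) f) \<and>
          (\<forall>n\<ge>2. AE \<omega> in M n. \<forall>t\<ge>0. Y n \<omega> t \<in> empirical_cdfs n \<inter> cdfs_upto (B0 + v * t))) \<and>
     (\<forall>t\<ge>0. f t \<in> cdfs_upto (B0 + v * t)) \<and>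
     continuous_map (top_of_set {0..}) (mtopology_of levy_metric) f \<and>
     (\<forall>h\<in>test_functions. \<forall>t\<ge>0.
        set_integrable lborel {0..t} (\<lambda>s. boundary_operator lam \<mu> (B0 + v * s) (f s) h) \<and>
        cdf_integral (f t) h - cdf_integral (f 0) h
          - (LINT s:{0..t}|lborel. boundary_operator lam \<mu> (B0 + v * s) (f s) h) = 0) \<and>
     mean_field_model lam (cdf \<mu>) v B0 f \<and>
     (\<forall>g. mean_field_model lam (cdf \<mu>) v B0 g \<and> g 0 = f0 \<longrightarrow> (\<forall>t\<ge>0. g t = f t))"
proof -
  interpret \<mu>: real_distribution \<mu> by fact
  interpret mean_field_data \<mu> lam v B0 f0
    by unfold_locales (use assms in auto)
  \<comment> \<open>Restricted because the path space consists of functions that are extensional on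
    [0, \<infinity>).\<close>
  define f where "f = restrict flow {0..}"
  have f: "f t = flow t" if "0 \<le> t" for t using that by (simp add: f_def)
  have f0: "f 0 = f0" using f[of 0] flow_0 by (simp add: fun_eq_iff)
  have v0: "0 \<le> v" using \<open>0 < v\<close> by simp
  have mf: "mean_flow lam \<mu> v B0 f" by (rule mean_flow_cong[OF flow_mean_flow f])
  have particles: "(\<forall>n\<ge>2. Y n \<in> M n \<rightarrow>\<^sub>M borel_sets_of (J1_topology levy_metric)) \<and>
      weakly_converges (J1_topology levy_metric) (\<lambda>n. distr (M n) (borel_sets_of (J1_topology levy_metric)) (Y n))
        (return (borel_sets_of (J1_topology levy_metric)) f) \<and>
      (\<forall>n\<ge>2. AE \<omega> in M n. \<forall>t\<ge>0. Y n \<omega> t \<in> empirical_cdfs n \<inter> cdfs_upto (B0 + v * t))"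
    if fn0: "\<forall>n\<ge>2. fn0 n \<in> empirical_cdfs n \<inter> cdfs_upto B0" and w: "weak_conv fn0 f0"
      and Y: "\<forall>n\<ge>2. empirical_process (M n) n lam \<mu> v B0 (fn0 n) (Y n)"
    for fn0 :: "nat \<Rightarrow> real \<Rightarrow> real" and M :: "nat \<Rightarrow> 'w measure" and Y :: "nat \<Rightarrow> 'w \<Rightarrow> real \<Rightarrow> real \<Rightarrow> real"
  proof -
    have fn0': "fn0 n \<in> cdfs_upto B0" if "2 \<le> n" for n using fn0 that by blast
    have Y': "empirical_process (M n) n lam \<mu> v B0 (fn0 n) (Y n)" if "2 \<le> n" for n using Y that by blast
    note props = empirical_process_props[OF Y' _ \<open>AE z in \<mu>. 0 < z\<close> v0 fn0']
    have "weakly_converges (J1_topology levy_metric) (\<lambda>n. distr (M n) (borel_sets_of (J1_topology levy_metric)) (Y n))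
        (return (borel_sets_of (J1_topology levy_metric)) f)"
    proof (rule J1_weak_limit[where N = 2])
      show "f \<in> cadlag_paths levy_metric" unfolding f_def by (rule flow_cadlag)
      show "eventually (\<lambda>n. \<exists>A\<in>sets (M n). 1 - e \<le> measure (M n) A \<and>
        (\<forall>\<omega>\<in>A. \<forall>t\<in>{0..T}. mdist levy_metric (Y n \<omega> t) (f t) < e)) sequentially" if "0 < T" "0 < e" for T e
        unfolding mdist_levy_metric
      proof (rule uniform_convergence[OF lam v0 \<open>real_distribution \<mu>\<close> \<open>AE z in \<mu>. 0 < z\<close> mf that])
        show "weak_conv fn0 (f 0)" using w f0 by simp
      qed (fact fn0' Y')+
    qed (use props in blast)+
    then show ?thesis using props by blast
  qed
  have weak: "set_integrable lborel {0..t} (\<lambda>s. boundary_operator lam \<mu> (B0 + v * s) (f s) h) \<and>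
      cdf_integral (f t) h - cdf_integral (f 0) h - (LINT s:{0..t}|lborel. boundary_operator lam \<mu> (B0 + v * s) (f s) h) = 0"
    if h: "h \<in> test_functions" and t: "0 \<le> t" for h t
  proof -
    have "set_integrable lborel {0..t} (\<lambda>s. boundary_operator lam \<mu> (B0 + v * s) (f s) h) =
        set_integrable lborel {0..t} (\<lambda>s. boundary_operator lam \<mu> (B0 + v * s) (flow s) h)"
      by (rule set_integrable_cong) (use f in auto)
    moreover have "(LINT s:{0..t}|lborel. boundary_operator lam \<mu> (B0 + v * s) (f s) h) =
        (LINT s:{0..t}|lborel. boundary_operator lam \<mu> (B0 + v * s) (flow s) h)"
      by (rule set_lebesgue_integral_cong) (use f in auto)
    ultimately show ?thesis using weak_equation[OF h t] f[OF t] f[of 0] by simp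
  qed
  show ?thesis
  proof (intro bexI[of _ f] conjI)
    show "\<forall>t\<ge>0. f t \<in> cdfs_upto (B0 + v * t)" using mf by (simp add: mean_flow_def)
    show "continuous_map (top_of_set {0..}) (mtopology_of levy_metric) f" unfolding f_def by (rule flow_continuous)
    show "mean_field_model lam (cdf \<mu>) v B0 f" by (rule mean_field_model_cong[OF flow_model f])
    show "\<forall>g. mean_field_model lam (cdf \<mu>) v B0 g \<and> g 0 = f0 \<longrightarrow> (\<forall>t\<ge>0. g t = f t)"
      using model_unique f by simp
    show "f \<in> cadlag_paths levy_metric" unfolding f_def by (rule flow_cadlag)
  qed (use f0 particles weak in blast)+
qed

end
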